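(* Let $(\overline Y,\overline Z)$ be a nonnegative solution (that is, $\overline Y\ge 0$), in the singular sense defined in the context, of the BSDE $$\overline Y_t=\xi-\int_{t\wedge\tau}^{\tau}\overline Y_r|\overline Y_r|^q\,dr-\int_{t\wedge\tau}^{\tau}\overline Z_r\,dB_r .$$ Then $\mathbf P$-a.s., for all $t\ge 0$, $$\overline Y_t\ge Y_t .$$
   Context: $(\Omega,\mathcal F,\mathbf P)$ is a probability space carrying a $d$-dimensional Brownian motion $B$ with its standard (augmented) filtration $(\mathcal F_t)_{t\ge 0}$. $q>0$ is fixed. $D\subset\mathbb R^d$ is a bounded open set with boundary of class $C^2$, and $\rho(x)=\operatorname{dist}(x,\partial D)$. The functions $b:\mathbb R^d\to\mathbb R^d$ and $\sigma:\mathbb R^d\to\mathbb R^{d\times d}$ are measurable and, for some $K\ge 0$ and $\alpha>0$: $\|\sigma(x)-\sigma(y)\|\le K|x-y|$ for all $x,y$; $|b(x)|+\|\sigma(x)\|\le K$ for all $x$; $\sigma\sigma^*(x)\ge\alpha\,\mathrm{Id}$ for all $x$. $X^x$ is the unique strong solution of $X^x_t=x+\int_0^t b(X^x_r)dr+\int_0^t\sigma(X^x_r)dB_r$, and $\tau_x=\inf\{t\ge 0: X^x_t\notin\overline D\}$. It is known that $\tau_x<\infty$ a.s. for $x\in\overline D$, that $\tau_x=0$ a.s. for $x\in\partial D$, and that $\sup_{x\in\overline D}\mathbb E e^{\beta\tau_x}<\infty$ for some $\beta>0$. Fix $x\in D$ and write $X=X^x$, $\tau=\tau_x$; for $\eta>0$,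 $\tau_\eta=\inf\{t\ge 0:\rho(X_t)\le\eta\}$. Let $\xi$ be an $\mathcal F_\tau$-measurable random variable with values in $[0,+\infty]$ and $\mathbf P(\xi=+\infty)>0$. Minimal candidate $Y$: for $n\in\mathbb N^*$ let $(Y^n,Z^n)$ be the unique pair of progressively measurable processes with values in $\mathbb R\times\mathbb R^d$ such that a.s. $Y^n_t=\xi\wedge n$, $Z^n_t=0$ on $\{t\ge\tau\}$, $Y^n_{t\wedge\tau}=Y^n_{T\wedge\tau}-\int_{t\wedge\tau}^{T\wedge\tau}Y^n_r|Y^n_r|^qdr-\int_{t\wedge\tau}^{T\wedge\tau}Z^n_rdB_r$ for all $0\le t\le T$, and $\mathbb E\big(\sup_{0\le t\le\tau}e^{\beta t}|Y^n_t|^2+\int_0^\tau e^{\beta t}(|Y^n_t|^2+\|Z^n_t\|^2)dt\big)<\infty$ (existence and uniqueness are known). Then $0\le Y^n_t\le Y^m_t$ for $n\le m$, and $Y_t:=\lim_{n\to\infty}Y^n_t\in[0,+\infty]$. Solution in the singular sense: a pair $(\overline Y,\overline Z)$ of progressively measurable processes such that (D1) for all $\eta>0$ and $T\ge 0$, $\mathbb E\big(\sup_{0\le t\le T}|\overline Y_{t\wedge\tau_\eta}|^2+\int_0^{T\wedge\tau_\eta}\|\overline Z_r\|^2dr\big)<+\infty$; (D2) $\mathbf P$-a.s. for all $0\le t\le T$ and all $\eta>0$, $\overline Y_{t\wedge\tau_\eta}=\overline Y_{T\wedge\tau_\eta}-\int_{t\wedge\tau_\eta}^{T\wedge\tau_\eta}\overline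 Y_r|\overline Y_r|^qdr-\int_{t\wedge\tau_\eta}^{T\wedge\tau_\eta}\overline Z_rdB_r$; (D3) on $\{t\ge\tau\}$, $\overline Y_t=\xi$ and $\overline Z_t=0$, and $\mathbf P$-a.s. $\lim_{t\uparrow\tau,\,t<\tau}\overline Y_t=\xi$. *)

theory Defs
  imports "HOL-Probability.Probability"
begin

text \<open>
  Deterministic times are nonnegative reals, and processes are functions
  \<open>real \<Rightarrow> 'w \<Rightarrow> 'b\<close> of which only the values at times \<open>t \<ge> 0\<close> matter. Stopping times take
  values in \<^typ>\<open>ennreal\<close>, with \<open>\<top>\<close> for a time that never occurs. Filtrations are indexed by
  \<^typ>\<open>ennreal\<close> as well, so that \<open>\<F>\<^sub>\<infinity>\<close> is the value at \<open>\<top>\<close> and the library notions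
  \<^const>\<open>stopping_time\<close> and \<open>filtration.pre_sigma\<close> apply.

  The probability space is not assumed complete. Null sets and probabilities of events that are
  only measurable up to null sets refer to \<^const>\<open>completion\<close>; the null-set quantifier and the
  nonnegative integral of \<open>M\<close> and of its completion agree (\<open>AE_completion_iff\<close>,
  \<open>nn_integral_completion\<close>).
\<close>

subsection \<open>Brownian motion and its augmented filtration\<close>

definition past_events :: "'w measure \<Rightarrow> (real \<Rightarrow> 'w \<Rightarrow> 'b::topological_space) \<Rightarrow> ennreal \<Rightarrow> 'w set set"
  where "past_events M B t = {B r -` A \<inter> space M | r A. 0 \<le> r \<and> ennreal r \<le> t \<and> A \<in> sets borel}"

definition aug_filtration ::
  "'w measure \<Rightarrow> (real \<Rightarrow> 'w \<Rightarrow> 'b::topological_space) \<Rightarrow> ennreal \<Rightarrow> 'w measure"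
  where "aug_filtration M B t = sigma (space M) (past_events M B t \<union> null_sets (completion M))"

definition brownian_motion :: "'w measure \<Rightarrow> (real \<Rightarrow> 'w \<Rightarrow> real ^ 'd) \<Rightarrow> bool" where
  "brownian_motion M B \<longleftrightarrow>
     (\<forall>t\<ge>0. B t \<in> borel_measurable M) \<and>
     (AE w in M. B 0 w = 0) \<and>
     (AE w in M. continuous_on {0..} (\<lambda>t. B t w)) \<and>
     (\<forall>s t. 0 \<le> s \<and> s < t \<longrightarrow>
        distributed M lborel (\<lambda>w. B t w - B s w)
          (\<lambda>y. ennreal (\<Prod>i\<in>UNIV. normal_density 0 (sqrt (t - s)) (y $ i))) \<and>
        prob_space.indep_set M
          (sigma_sets (space M) (past_events M B (ennreal s)))
          {(\<lambda>w. B t w - B s w) -` A \<inter> space M | A. A \<in> sets borel})"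

lemma space_aug_filtration [simp]: "space (aug_filtration M B t) = space M"
proof -
  have "past_events M B t \<union> null_sets (completion M) \<subseteq> Pow (space M)"
    using sets.sets_into_space[of _ "completion M"] by (auto simp: past_events_def null_sets_def)
  then show ?thesis by (simp add: aug_filtration_def space_measure_of)
qed

lemma filtration_aug_filtration: "filtration (space M) (aug_filtration M B)"
proof
  fix s t :: ennreal
  assume "s \<le> t"
  then have "past_events M B s \<subseteq> past_events M B t"
    unfolding past_events_def by (blast intro: order_trans)
  moreover have "past_events M B u \<union> null_sets (completion M) \<subseteq> Pow (space M)" for u
    using sets.sets_into_space[of _ "completion M"] by (auto simp: past_events_def null_sets_def)
  ultimately show "sets (aug_filtration M B s) \<subseteq> sets (aug_filtration M B t)"
    unfolding aug_filtration_def
    by (simp add: sets_measure_of) (intro sigma_sets_mono' Un_mono subset_refl)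
qed simp

definition adapted ::
  "(ennreal \<Rightarrow> 'w measure) \<Rightarrow> (real \<Rightarrow> 'w \<Rightarrow> 'b::topological_space) \<Rightarrow> bool" where
  "adapted F Z \<longleftrightarrow> (\<forall>t\<ge>0. Z t \<in> borel_measurable (F (ennreal t)))"

definition progressively_measurable ::
  "(ennreal \<Rightarrow> 'w measure) \<Rightarrow> (real \<Rightarrow> 'w \<Rightarrow> 'b::topological_space) \<Rightarrow> bool" where
  "progressively_measurable F Z \<longleftrightarrow>
     (\<forall>t\<ge>0. (\<lambda>(r, w). Z r w)
        \<in> borel_measurable (restrict_space borel {0..t} \<Otimes>\<^sub>M F (ennreal t)))"

text \<open>\<open>tmin t s\<close> is \<open>t \<and> s\<close> for a deterministic time \<open>t\<close> and an extended time \<open>s\<close>.\<close>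

definition tmin :: "real \<Rightarrow> ennreal \<Rightarrow> real"
  where "tmin t s = enn2real (min (ennreal t) s)"

definition hitting_time :: "'b set \<Rightarrow> (real \<Rightarrow> 'w \<Rightarrow> 'b) \<Rightarrow> 'w \<Rightarrow> ennreal"
  where "hitting_time S X w = (INF t\<in>{t. 0 \<le> t \<and> X t w \<in> S}. ennreal t)"

subsection \<open>The Ito integral\<close>

definition conv_in_prob_0 :: "'w measure \<Rightarrow> (nat \<Rightarrow> 'w \<Rightarrow> ennreal) \<Rightarrow> bool" where
  "conv_in_prob_0 M f \<longleftrightarrow>
     (\<forall>\<epsilon>::real. \<epsilon> > 0 \<longrightarrow>
        (\<lambda>n. emeasure (completion M) {w \<in> space M. ennreal \<epsilon> \<le> f n w}) \<longlonglongrightarrow> 0)"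

text \<open>
  A simple process \<open>\<Sum>i<m. indicator {s i<..s (i+1)} \<cdot> h i\<close> with bounded \<open>\<F>\<^sub>s\<^sub>i\<close>-measurable
  coefficients \<open>h i\<close>.
\<close>

definition simple_process ::
  "'w measure \<Rightarrow> (real \<Rightarrow> 'w \<Rightarrow> real ^ 'd) \<Rightarrow> nat \<Rightarrow> (nat \<Rightarrow> real) \<Rightarrow> (nat \<Rightarrow> 'w \<Rightarrow> real ^ 'd) \<Rightarrow> bool"
  where "simple_process M B m s h \<longleftrightarrow>
     (\<forall>i<m. 0 \<le> s i \<and> s i \<le> s (Suc i) \<and>
        h i \<in> borel_measurable (aug_filtration M B (ennreal (s i)))) \<and>
     (\<exists>C. \<forall>i<m. \<forall>w\<in>space M. norm (h i w) \<le> C)"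

definition simple_val ::
  "nat \<Rightarrow> (nat \<Rightarrow> real) \<Rightarrow> (nat \<Rightarrow> 'w \<Rightarrow> real ^ 'd) \<Rightarrow> real \<Rightarrow> 'w \<Rightarrow> real ^ 'd"
  where "simple_val m s h r w = (\<Sum>i<m. indicator {s i<..s (Suc i)} r *\<^sub>R h i w)"

definition simple_int ::
  "(real \<Rightarrow> 'w \<Rightarrow> real ^ 'd) \<Rightarrow> nat \<Rightarrow> (nat \<Rightarrow> real) \<Rightarrow> (nat \<Rightarrow> 'w \<Rightarrow> real ^ 'd) \<Rightarrow> real \<Rightarrow> 'w \<Rightarrow> real"
  where "simple_int B m s h t w =
     (\<Sum>i<m. h i w \<bullet> (B (min t (s (Suc i))) w - B (min t (s i)) w))"

text \<open>
  \<open>ito_integral M B Z I\<close> says that \<open>I\<close> is (a version of) the process \<open>t \<mapsto> \<integral>\<^sub>0\<^sup>t Z dB\<close>, for a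
  progressively measurable integrand with paths almost surely locally in \<open>L\<^sup>2\<close>. Such integrands
  are limits of simple processes in the sense below, and the limit of the elementary integrals is
  unique up to indistinguishability, so the relation determines \<open>I\<close> up to a null set.
\<close>

definition ito_integral ::
  "'w measure \<Rightarrow> (real \<Rightarrow> 'w \<Rightarrow> real ^ 'd) \<Rightarrow> (real \<Rightarrow> 'w \<Rightarrow> real ^ 'd) \<Rightarrow> (real \<Rightarrow> 'w \<Rightarrow> real) \<Rightarrow> bool"
  where "ito_integral M B Z I \<longleftrightarrow>
     progressively_measurable (aug_filtration M B) Z \<and>
     (AE w in M. \<forall>T\<ge>0. (\<integral>\<^sup>+ r\<in>{0..T}. ennreal ((norm (Z r w))\<^sup>2) \<partial>lborel) < \<infinity>) \<and>
     adapted (aug_filtration M B) I \<and>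
     (AE w in M. continuous_on {0..} (\<lambda>t. I t w)) \<and>
     (\<exists>m s h. (\<forall>n. simple_process M B (m n) (s n) (h n)) \<and>
        (\<forall>T\<ge>0.
           conv_in_prob_0 M (\<lambda>n w. \<integral>\<^sup>+ r\<in>{0..T}.
              ennreal ((norm (simple_val (m n) (s n) (h n) r w - Z r w))\<^sup>2) \<partial>lborel) \<and>
           conv_in_prob_0 M (\<lambda>n w. SUP t\<in>{0..T}.
              ennreal \<bar>simple_int B (m n) (s n) (h n) t w - I t w\<bar>)))"

text \<open>
  \<open>I\<close>, stopped at \<open>S\<close>, is the integral of \<open>Z\<close> over \<open>[0, t \<and> S]\<close>. Nothing is said about \<open>Z\<close> and
  \<open>I\<close> after \<open>S\<close>.
\<close>

definition stopped_ito_integral ::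
  "'w measure \<Rightarrow> (real \<Rightarrow> 'w \<Rightarrow> real ^ 'd) \<Rightarrow> ('w \<Rightarrow> ennreal) \<Rightarrow>
   (real \<Rightarrow> 'w \<Rightarrow> real ^ 'd) \<Rightarrow> (real \<Rightarrow> 'w \<Rightarrow> real) \<Rightarrow> bool"
  where "stopped_ito_integral M B S Z I \<longleftrightarrow>
     ito_integral M B (\<lambda>r w. if ennreal r \<le> S w then Z r w else 0) (\<lambda>t w. I (tmin t (S w)) w)"

subsection \<open>The forward equation\<close>

text \<open>
  Component \<open>i\<close> of \<open>\<integral> \<sigma>(X) dB\<close> is the integral of the \<open>i\<close>-th row of \<open>\<sigma>(X)\<close> against \<open>B\<close>.
\<close>

definition strong_solution ::
  "'w measure \<Rightarrow> (real \<Rightarrow> 'w \<Rightarrow> real ^ 'd) \<Rightarrow> (real ^ 'd \<Rightarrow> real ^ 'd) \<Rightarrow> (real ^ 'd \<Rightarrow> real ^ 'd ^ 'd) \<Rightarrow>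
   real ^ 'd \<Rightarrow> (real \<Rightarrow> 'w \<Rightarrow> real ^ 'd) \<Rightarrow> bool"
  where "strong_solution M B b \<sigma> x X \<longleftrightarrow>
     progressively_measurable (aug_filtration M B) X \<and>
     (AE w in M. continuous_on {0..} (\<lambda>t. X t w)) \<and>
     (\<exists>J :: real \<Rightarrow> 'w \<Rightarrow> real ^ 'd.
        (\<forall>i. ito_integral M B (\<lambda>r w. \<sigma> (X r w) $ i) (\<lambda>t w. J t w $ i)) \<and>
        (AE w in M. \<forall>t\<ge>0. set_integrable lborel {0..t} (\<lambda>r. b (X r w)) \<and>
           X t w = x + (LINT r:{0..t}|lborel. b (X r w)) + J t w))"

text \<open>
  Near each boundary point \<open>D\<close> is the positivity set of a twice continuously differentiable
  function (gradient \<open>g\<close>, Hessian \<open>H\<close>) with nonvanishing gradient.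
\<close>

definition C2_boundary :: "(real ^ 'd) set \<Rightarrow> bool" where
  "C2_boundary D \<longleftrightarrow>
     (\<forall>z\<in>frontier D. \<exists>U (\<phi> :: real ^ 'd \<Rightarrow> real) (g :: real ^ 'd \<Rightarrow> real ^ 'd)
          (H :: real ^ 'd \<Rightarrow> real ^ 'd ^ 'd).
        open U \<and> z \<in> U \<and>
        (\<forall>y\<in>U. (\<phi> has_derivative (\<lambda>v. g y \<bullet> v)) (at y) \<and>
                (g has_derivative (\<lambda>v. H y *v v)) (at y) \<and> g y \<noteq> 0) \<and>
        continuous_on U H \<and>
        D \<inter> U = {y \<in> U. \<phi> y > 0})"

definition exp_time :: "real \<Rightarrow> ennreal \<Rightarrow> ennreal"
  where "exp_time \<beta> s = (if s = \<top> then \<top> else ennreal (exp (\<beta> * enn2real s)))"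

text \<open>The exit time \<open>\<tau>\<close> from \<open>closure D\<close>, and the time \<open>\<tau>\<^sub>\<eta>\<close> at which \<open>X\<close> comes \<open>\<eta>\<close>-close to
  the boundary.\<close>

definition exit_time :: "(real ^ 'd) set \<Rightarrow> (real \<Rightarrow> 'w \<Rightarrow> real ^ 'd) \<Rightarrow> 'w \<Rightarrow> ennreal"
  where "exit_time D X = hitting_time (- closure D) X"

definition near_time :: "(real ^ 'd) set \<Rightarrow> (real \<Rightarrow> 'w \<Rightarrow> real ^ 'd) \<Rightarrow> real \<Rightarrow> 'w \<Rightarrow> ennreal"
  where "near_time D X \<eta> = hitting_time {y. infdist y (frontier D) \<le> \<eta>} X"

subsection \<open>The backward equation\<close>

text \<open>
  The equation on \<open>[0, S]\<close> along one path: \<open>y\<close> is the path of the solution and \<open>i\<close> the path of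
  the stochastic integral.
\<close>

definition bsde_path :: "real \<Rightarrow> ennreal \<Rightarrow> (real \<Rightarrow> real) \<Rightarrow> (real \<Rightarrow> real) \<Rightarrow> bool" where
  "bsde_path q S y i \<longleftrightarrow>
     (\<forall>t T. 0 \<le> t \<and> t \<le> T \<longrightarrow>
        set_integrable lborel {tmin t S..tmin T S} (\<lambda>r. y r * \<bar>y r\<bar> powr q) \<and>
        y (tmin t S) = y (tmin T S)
          - (LINT r:{tmin t S..tmin T S}|lborel. y r * \<bar>y r\<bar> powr q)
          - (i (tmin T S) - i (tmin t S)))"

definition truncated_solution ::
  "'w measure \<Rightarrow> (real \<Rightarrow> 'w \<Rightarrow> real ^ 'd) \<Rightarrow> real \<Rightarrow> real \<Rightarrow> ('w \<Rightarrow> ennreal) \<Rightarrow> ('w \<Rightarrow> ereal) \<Rightarrow>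
   nat \<Rightarrow> (real \<Rightarrow> 'w \<Rightarrow> real) \<Rightarrow> (real \<Rightarrow> 'w \<Rightarrow> real ^ 'd) \<Rightarrow> bool"
  where "truncated_solution M B q \<beta> \<tau> \<xi> n Y Z \<longleftrightarrow>
     progressively_measurable (aug_filtration M B) Y \<and>
     progressively_measurable (aug_filtration M B) Z \<and>
     (AE w in M. \<forall>t\<ge>0. \<tau> w \<le> ennreal t \<longrightarrow>
        ereal (Y t w) = min (\<xi> w) (ereal (real n)) \<and> Z t w = 0) \<and>
     (\<exists>I. stopped_ito_integral M B \<tau> Z I \<and>
        (AE w in M. bsde_path q (\<tau> w) (\<lambda>t. Y t w) (\<lambda>t. I t w))) \<and>
     (\<integral>\<^sup>+ w. (SUP t\<in>{t. 0 \<le> t \<and> ennreal t \<le> \<tau> w}. ennreal (exp (\<beta> * t) * \<bar>Y t w\<bar>\<^sup>2))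
        + (\<integral>\<^sup>+ t\<in>{t. 0 \<le> t \<and> ennreal t \<le> \<tau> w}.
             ennreal (exp (\<beta> * t) * (\<bar>Y t w\<bar>\<^sup>2 + (norm (Z t w))\<^sup>2)) \<partial>lborel) \<partial>M) < \<infinity>"

definition minimal_candidate :: "(nat \<Rightarrow> real \<Rightarrow> 'w \<Rightarrow> real) \<Rightarrow> real \<Rightarrow> 'w \<Rightarrow> ereal"
  where "minimal_candidate Yn t w = lim (\<lambda>n. ereal (Yn n t w))"

text \<open>
  \<open>Y\<close> is extended real valued because it equals \<open>\<xi>\<close> from \<open>\<tau>\<close> on. Before that the equation is
  one between real numbers; finiteness is stated explicitly since \<^const>\<open>real_of_ereal\<close> sends
  \<open>\<plusminus>\<infinity>\<close> to \<open>0\<close>. The process \<open>I\<close> is the local stochastic integral of \<open>Z\<close> on \<open>[0, \<tau>)\<close>, which is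
  determined by its stopped versions; a single \<open>I\<close> is needed because \<open>\<eta>\<close> ranges over all
  positive reals inside the almost sure statement.
\<close>

definition singular_solution ::
  "'w measure \<Rightarrow> (real \<Rightarrow> 'w \<Rightarrow> real ^ 'd) \<Rightarrow> real \<Rightarrow> (real \<Rightarrow> 'w \<Rightarrow> ennreal) \<Rightarrow> ('w \<Rightarrow> ennreal) \<Rightarrow>
   ('w \<Rightarrow> ereal) \<Rightarrow> (real \<Rightarrow> 'w \<Rightarrow> ereal) \<Rightarrow> (real \<Rightarrow> 'w \<Rightarrow> real ^ 'd) \<Rightarrow> bool"
  where "singular_solution M B q \<tau>' \<tau> \<xi> Y Z \<longleftrightarrow>
     progressively_measurable (aug_filtration M B) Y \<and>
     progressively_measurable (aug_filtration M B) Z \<and>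
     (\<forall>\<eta>>0. \<forall>T\<ge>0.
        (\<integral>\<^sup>+ w. (SUP t\<in>{0..T}. e2ennreal (\<bar>Y (tmin t (\<tau>' \<eta> w)) w\<bar>\<^sup>2))
           + (\<integral>\<^sup>+ r\<in>{0..tmin T (\<tau>' \<eta> w)}. ennreal ((norm (Z r w))\<^sup>2) \<partial>lborel) \<partial>M) < \<infinity>) \<and>
     (\<exists>I. (\<forall>\<eta>>0. stopped_ito_integral M B (\<tau>' \<eta>) Z I) \<and>
        (AE w in M. \<forall>\<eta>>0.
           (\<forall>t\<ge>0. \<bar>Y (tmin t (\<tau>' \<eta> w)) w\<bar> \<noteq> \<infinity>) \<and>
           bsde_path q (\<tau>' \<eta> w) (\<lambda>t. real_of_ereal (Y t w)) (\<lambda>t. I t w))) \<and>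
     (AE w in M. \<forall>t\<ge>0. \<tau> w \<le> ennreal t \<longrightarrow> Y t w = \<xi> w \<and> Z t w = 0) \<and>
     (AE w in M. ((\<lambda>t. Y t w) \<longlongrightarrow> \<xi> w) (at (enn2real (\<tau> w)) within {0..<enn2real (\<tau> w)}))"

end

theory Submission
  imports Defs
begin

text \<open>
  The generator \<open>f(y) = y \<bar>y\<bar>\<^sup>q\<close> is increasing, so two solutions \<open>U\<close>, \<open>V\<close> of the backward equation
  up to a bounded stopping time \<open>s\<close> satisfy \<open>E (U - V)\<^sup>+\<close> at \<open>a \<and> s\<close> \<open>\<le>\<close> \<open>E (U - V)\<^sup>+\<close> at \<open>s\<close>. Take
  \<open>U = Y\<^sup>n\<close>, let \<open>V\<close> be the singular solution, and let \<open>s = s\<^sub>k\<close> be the minimum of \<open>k + 1\<close> and the time at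
  which \<open>X\<close> comes \<open>1 / (k + 1)\<close>-close to the boundary. At \<open>s\<^sub>k\<close> the positive part is at most
  \<open>\<bar>U\<bar>\<close>, which is bounded in \<open>L\<^sup>2\<close>, and it tends to \<open>0\<close> because \<open>U\<close> and \<open>V\<close> tend to \<open>min \<xi> n\<close> and
  \<open>\<xi>\<close>; hence \<open>U \<le> V\<close> before \<open>\<tau>\<close>. The same comparison gives \<open>Y\<^sup>n \<le> Y\<^sup>m\<close> for \<open>n \<le> m\<close>, so that the limit
  defining the minimal candidate exists.

  That \<open>s\<^sub>k\<close> tends to \<open>\<tau>\<close> from below requires that \<open>X\<close> leaves the closed domain as soon as it hits the
  boundary. This follows from ellipticity, which makes the martingale part of a boundary defining
  function oscillate, and is derived from the second moments of the stopped process.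
\<close>

subsection \<open>Stopping times and martingales in a complete filtration\<close>

text \<open>The stochastic integral is given only as a limit in probability of elementary integrals,
  so its martingale property and isometry are derived from simple processes. The comparison is
  arranged to need optional stopping only: a first crossing time takes the place of an Ito formula
  for the positive part.

  (D1) bounds the singular solution separately at each distance from the boundary, with no bound
  common to all \<open>k\<close>, and (D3) controls it only at \<open>\<tau>\<close>. If
  \<open>X\<close> could touch the boundary and return to \<open>D\<close>, the near times would
  accumulate at the first touch, strictly before \<open>\<tau>\<close>, where no terminal value is
  prescribed. This is the reason for the study of the exit time.

  Regularity for starting points on the boundary would have to be carried to the random hitting
  point by the strong Markov property. The estimate is made directly after the hitting time instead:
  the gradient of the defining function is frozen at the point that is hit, and conditioning is
  replaced by optional stopping with weights known at that time. Only first and second moments of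
  increments are then needed.\<close>

lemma affine_mem_Icc:
  fixes a t x :: real
  assumes "a \<le> t" "x \<in> {0..1}" shows "a + (t - a) * x \<in> {a..t}"
  using mult_left_mono[of x 1 "t - a"] mult_nonneg_nonneg[of "t - a" x] assms by auto

section \<open>First hitting times of continuous paths\<close>

text \<open>The point \<open>T\<close> keeps the set nonempty, so the value always lies in
  \<open>{a..T}\<close>. The value \<open>T\<close> leaves open whether the level was reached, hence
  the strict inequality in \<open>first_hit_value\<close>.\<close>

definition first_hit :: "(real \<Rightarrow> real) \<Rightarrow> real \<Rightarrow> real \<Rightarrow> real \<Rightarrow> real" where
  "first_hit g c a T = Inf ({t\<in>{a..T}. g t \<le> c} \<union> {T})"

lemma first_hit_bounds:
  assumes "a \<le> T"
  shows "a \<le> first_hit g c a T" "first_hit g c a T \<le> T"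
proof -
  show "a \<le> first_hit g c a T"
    unfolding first_hit_def using assms by (intro cInf_greatest) auto
  show "first_hit g c a T \<le> T"
    unfolding first_hit_def using assms by (intro cInf_lower bdd_belowI[where m=a]) auto
qed

lemma first_hit_above:
  assumes "a \<le> r" "r < first_hit g c a T" "a \<le> T"
  shows "c < g r"
proof (rule ccontr)
  assume "\<not> c < g r"
  moreover have "r < T" using first_hit_bounds(2)[OF assms(3), of g c] assms(2) by simp
  ultimately have "first_hit g c a T \<le> r"
    unfolding first_hit_def using assms by (intro cInf_lower bdd_belowI[where m=a]) auto
  then show False using assms by simp
qed

lemma first_hit_le:
  assumes "a \<le> r" "r \<le> T" "g r \<le> c"
  shows "first_hit g c a T \<le> r"
  unfolding first_hit_def using assms by (intro cInf_lower bdd_belowI[where m=a]) auto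

lemma first_hit_value:
  assumes cont: "continuous_on {a..T} g" and "a \<le> T" and lt: "first_hit g c a T < T"
  shows "g (first_hit g c a T) \<le> c"
proof -
  let ?K = "{t\<in>{a..T}. g t \<le> c}"
  have "closed ?K"
    using continuous_on_closed_Collect_le[OF cont continuous_on_const, of c] by auto
  moreover have ne: "?K \<noteq> {}"
  proof
    assume "?K = {}"
    then show False using lt unfolding first_hit_def by (metis Un_empty_left cInf_singleton less_irrefl)
  qed
  moreover have "bdd_below ?K" by (intro bdd_belowI[where m=a]) auto
  ultimately have inK: "Inf ?K \<in> ?K" by (intro closed_contains_Inf)
  have "first_hit g c a T = inf (Inf ?K) (Inf {T})"
    unfolding first_hit_def
    by (rule cInf_union_distrib) (use ne in \<open>auto intro!: bdd_belowI[where m=a]\<close>)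
  then have "first_hit g c a T = Inf ?K" using lt by (simp add: inf_min min_def split: if_splits)
  then show ?thesis using inK by auto
qed

text \<open>A continuous path reaches the level by time \<open>t\<close> iff its minimum over
  \<open>{a..t}\<close> is at most \<open>c\<close>, and this can be tested on a countable dense
  set. Rational points of the unit interval, moved affinely to \<open>{a..t}\<close>, remain
  available when \<open>a = t\<close> is irrational. The bound \<open>t < T\<close> excludes the
  artificial value \<open>T\<close>.\<close>

lemma first_hit_le_iff:
  assumes cont: "continuous_on {a..T} g" and "a \<le> t" "t < T"
  shows "first_hit g c a T \<le> t \<longleftrightarrow>
    (\<forall>n::nat. \<exists>x\<in>{0..1}\<inter>\<rat>. g (a + (t - a) * x) < c + 1 / real (Suc n))"
    (is "_ \<longleftrightarrow> ?R")
proof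
  assume h: "first_hit g c a T \<le> t"
  let ?s = "first_hit g c a T"
  have gs: "g ?s \<le> c" and s: "a \<le> ?s"
    using first_hit_value[OF cont] first_hit_bounds(1)[of a T g c] h assms by auto
  show ?R
  proof
    fix n :: nat
    \<comment> \<open>For \<open>t = a\<close> the affine map is constant and any parameter
      serves.\<close>
    define y where "y = (if t = a then 0 else (?s - a) / (t - a))"
    have y: "y \<in> {0..1}" "a + (t - a) * y = ?s"
      using s h assms by (auto simp: y_def field_simps)
    have "continuous_on {0..1} (\<lambda>x. g (a + (t - a) * x))"
    proof (rule continuous_on_compose2[OF cont])
      show "continuous_on {0..1} (\<lambda>x. a + (t - a) * x)" by (intro continuous_intros)
      show "(\<lambda>x. a + (t - a) * x) ` {0..1} \<subseteq> {a..T}"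
      proof safe
        fix x :: real assume "x \<in> {0..1}"
        then have "a + (t - a) * x \<in> {a..t}" using assms by (intro affine_mem_Icc) auto
        then show "a + (t - a) * x \<in> {a..T}" using assms by auto
      qed
    qed
    then have "((\<lambda>x. g (a + (t - a) * x)) \<longlongrightarrow> g (a + (t - a) * y)) (at y within {0..1})"
      using y(1) by (auto simp: continuous_on_def)
    moreover have "g (a + (t - a) * y) < c + 1 / real (Suc n)"
      using gs unfolding y(2) by (rule le_less_trans) simp
    ultimately have "eventually (\<lambda>x. g (a + (t - a) * x) < c + 1 / real (Suc n)) (at y within {0..1})"
      by (rule order_tendstoD)
    then obtain d where d: "d > 0" "\<And>x. x \<in> {0..1} \<Longrightarrow> x \<noteq> y \<Longrightarrow> dist x y < d \<Longrightarrow> g (a + (t - a) * x) < c + 1 / real (Suc n)"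
      unfolding eventually_at by auto
    define l where "l = max 0 (y - d/2)"
    define u where "u = min 1 (y + d/2)"
    have "l < u" using y d by (auto simp: l_def u_def)
    then obtain x where x: "x \<in> \<rat>" "l < x" "x < u" using Rats_dense_in_real by blast
    then have "x \<in> {0..1}" "dist x y < d" using d by (auto simp: l_def u_def dist_real_def)
    then have "g (a + (t - a) * x) < c + 1 / real (Suc n)"
      using d(2)[of x] \<open>g (a + (t - a) * y) < c + 1 / real (Suc n)\<close> by (cases "x = y") auto
    with x \<open>x \<in> {0..1}\<close> show "\<exists>x\<in>{0..1}\<inter>\<rat>. g (a + (t - a) * x) < c + 1 / real (Suc n)" by auto
  qed
next
  assume R: ?R
  have "continuous_on {a..t} g" using cont assms by (elim continuous_on_subset) auto
  then obtain m where m: "m \<in> {a..t}" "\<And>r. r \<in> {a..t} \<Longrightarrow> g m \<le> g r"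
    using continuous_attains_inf[of "{a..t}" g] assms by auto
  have "g m \<le> c"
  proof (rule ccontr)
    assume "\<not> g m \<le> c"
    then obtain n :: nat where n: "1 / real (Suc n) < g m - c"
      using nat_approx_posE[of "g m - c"] by auto
    from R[rule_format, of n] obtain x
      where x: "x \<in> {0..1}" "g (a + (t - a) * x) < c + 1 / real (Suc n)" by blast
    have "a + (t - a) * x \<in> {a..t}" using assms x by (intro affine_mem_Icc) auto
    then have "g m \<le> g (a + (t - a) * x)" using assms by (intro m(2)) auto
    then show False using n x by simp
  qed
  then show "first_hit g c a T \<le> t"
    using m assms first_hit_le[of a m T g c] by auto
qed

section \<open>Stopping times in a filtration that contains all null sets\<close>

text \<open>Every \<open>F t\<close> contains the subsets of null sets, so facts known only almost
  surely, such as continuity of paths, may be used in proofs of adaptedness.\<close>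

locale complete_filtration = prob_space P for P :: "'w measure" +
  fixes F :: "real \<Rightarrow> 'w measure"
  assumes space_F [simp]: "space (F t) = space P"
    and sets_F: "sets (F t) \<subseteq> sets P"
    and F_mono: "s \<le> t \<Longrightarrow> sets (F s) \<subseteq> sets (F t)"
    and null_F: "N \<in> null_sets P \<Longrightarrow> N' \<subseteq> N \<Longrightarrow> N' \<in> sets (F t)"
begin

lemma measurable_F: "f \<in> borel_measurable (F t) \<Longrightarrow> f \<in> borel_measurable P"
  using sets_F[of t] by (auto simp: measurable_def)

lemma measurable_F_mono: "s \<le> t \<Longrightarrow> f \<in> borel_measurable (F s) \<Longrightarrow> f \<in> borel_measurable (F t)"
  using F_mono[of s t] by (auto simp: measurable_def)

lemma sets_F_AE:
  assumes A: "A \<in> sets (F t)" and "C \<subseteq> space P" and ae: "AE w in P. w \<in> A \<longleftrightarrow> w \<in> C"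
  shows "C \<in> sets (F t)"
proof -
  from ae obtain N where N: "{w\<in>space P. \<not> (w \<in> A \<longleftrightarrow> w \<in> C)} \<subseteq> N" "N \<in> null_sets P"
    by (auto simp: eventually_ae_filter)
  have "C = (A - (A - C)) \<union> (C - A)" by auto
  moreover have "A - C \<in> sets (F t)" "C - A \<in> sets (F t)"
    using N sets.sets_into_space[OF A] assms(2) by (auto intro!: null_F[OF N(2)])
  ultimately show ?thesis using A by (metis sets.Diff sets.Un)
qed

lemma measurable_F_AE:
  fixes f g :: "'w \<Rightarrow> 'c::topological_space"
  assumes f: "f \<in> borel_measurable (F t)" and ae: "AE w in P. g w = f w"
  shows "g \<in> borel_measurable (F t)"
proof (rule measurableI)
  fix A :: "'c set" assume "A \<in> sets borel"
  then have "f -` A \<inter> space (F t) \<in> sets (F t)" using f by (rule measurable_sets[rotated])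
  then show "g -` A \<inter> space (F t) \<in> sets (F t)"
    by (rule sets_F_AE) (use ae in auto)
qed auto

lemma measurable_P_AE:
  fixes f g :: "'w \<Rightarrow> 'c::topological_space"
  assumes f: "f \<in> borel_measurable P" and ae: "AE w in P. g w = f w"
  shows "g \<in> borel_measurable P"
proof (rule measurableI)
  fix A :: "'c set" assume "A \<in> sets borel"
  then have A: "f -` A \<inter> space P \<in> sets P" using f by (rule measurable_sets[rotated])
  let ?C = "g -` A \<inter> space P"
  from ae obtain N where N: "{w\<in>space P. g w \<noteq> f w} \<subseteq> N" "N \<in> null_sets P"
    by (auto simp: eventually_ae_filter)
  have "?C = ((f -` A \<inter> space P) - ((f -` A \<inter> space P) - ?C)) \<union> (?C - (f -` A \<inter> space P))" by auto
  moreover have "(f -` A \<inter> space P) - ?C \<in> sets (F 0)" "?C - (f -` A \<inter> space P) \<in> sets (F 0)"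
    using N by (auto intro!: null_F[OF N(2)])
  ultimately have "?C = ((f -` A \<inter> space P) - ((f -` A \<inter> space P) - ?C)) \<union> (?C - (f -` A \<inter> space P))"
    "(f -` A \<inter> space P) - ?C \<in> sets P" "?C - (f -` A \<inter> space P) \<in> sets P"
    using sets_F[of 0] by blast+
  then show "?C \<in> sets P" using A by (subst (1) \<open>?C = _\<close>) (rule sets.Un[OF sets.Diff])
qed auto

text \<open>Times are real valued because those used below are capped at deterministic
  horizons.\<close>

definition stop :: "('w \<Rightarrow> real) \<Rightarrow> bool" where
  "stop s \<longleftrightarrow> (\<forall>w\<in>space P. 0 \<le> s w) \<and> (\<forall>t\<ge>0. {w\<in>space P. s w \<le> t} \<in> sets (F t))"

lemma stopI:
  "(\<And>w. w \<in> space P \<Longrightarrow> 0 \<le> s w) \<Longrightarrow> (\<And>t. 0 \<le> t \<Longrightarrow> {w\<in>space P. s w \<le> t} \<in> sets (F t)) \<Longrightarrow> stop s"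
  by (auto simp: stop_def)

lemma stopD:
  assumes "stop s"
  shows "w \<in> space P \<Longrightarrow> 0 \<le> s w" "0 \<le> t \<Longrightarrow> {w\<in>space P. s w \<le> t} \<in> sets (F t)"
  using assms by (auto simp: stop_def)

lemma stop_const: "0 \<le> t \<Longrightarrow> stop (\<lambda>_. t)"
proof (rule stopI)
  fix r :: real
  have "{w \<in> space P. t \<le> r} = (if t \<le> r then space (F r) else {})" by auto
  then show "{w \<in> space P. t \<le> r} \<in> sets (F r)" using sets.top[of "F r"] by auto
qed auto

lemma stop_min:
  assumes "stop s" "stop s'" shows "stop (\<lambda>w. min (s w) (s' w))"
proof (rule stopI)
  fix t :: real assume "0 \<le> t"
  have "{w \<in> space P. min (s w) (s' w) \<le> t} = {w\<in>space P. s w \<le> t} \<union> {w\<in>space P. s' w \<le> t}" by auto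
  then show "{w \<in> space P. min (s w) (s' w) \<le> t} \<in> sets (F t)"
    using stopD(2)[OF assms(1) \<open>0 \<le> t\<close>] stopD(2)[OF assms(2) \<open>0 \<le> t\<close>] by auto
qed (use stopD(1)[OF assms(1)] stopD(1)[OF assms(2)] in auto)

lemma stop_max:
  assumes "stop s" "stop s'" shows "stop (\<lambda>w. max (s w) (s' w))"
proof (rule stopI)
  fix t :: real assume "0 \<le> t"
  have "{w \<in> space P. max (s w) (s' w) \<le> t} = {w\<in>space P. s w \<le> t} \<inter> {w\<in>space P. s' w \<le> t}" by auto
  then show "{w \<in> space P. max (s w) (s' w) \<le> t} \<in> sets (F t)"
    using stopD(2)[OF assms(1) \<open>0 \<le> t\<close>] stopD(2)[OF assms(2) \<open>0 \<le> t\<close>] by auto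
qed (use stopD(1)[OF assms(1)] stopD(1)[OF assms(2)] in \<open>auto simp: le_max_iff_disj\<close>)

lemma stop_add:
  assumes "stop s" "0 \<le> h" shows "stop (\<lambda>w. s w + h)"
proof (rule stopI)
  fix t :: real assume "0 \<le> t"
  show "{w \<in> space P. s w + h \<le> t} \<in> sets (F t)"
  proof (cases "h \<le> t")
    case True
    have "{w \<in> space P. s w + h \<le> t} = {w \<in> space P. s w \<le> t - h}" by auto
    then show ?thesis using stopD(2)[OF assms(1), of "t - h"] True F_mono[of "t - h" t] assms(2) by auto
  next
    case False
    then have "{w \<in> space P. s w + h \<le> t} = {}" using stopD(1)[OF assms(1)] by fastforce
    then show ?thesis by (simp only: sets.empty_sets)
  qed
qed (use stopD(1)[OF assms(1)] assms(2) in auto)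

lemma stop_lt:
  assumes "stop s" "0 \<le> t" shows "{w\<in>space P. s w < t} \<in> sets (F t)"
proof -
  have "{w\<in>space P. s w < t} = (\<Union>n::nat. {w\<in>space P. s w \<le> t - 1 / real (Suc n)})"
  proof safe
    fix w assume "s w < t"
    then obtain n :: nat where "1 / real (Suc n) < t - s w" using nat_approx_posE[of "t - s w"] by auto
    then show "w \<in> (\<Union>n::nat. {w\<in>space P. s w \<le> t - 1 / real (Suc n)})" if "w \<in> space P"
      using that by (auto intro!: exI[of _ n])
  next
    fix w n assume "s w \<le> t - 1 / real (Suc n)"
    moreover have "0 < 1 / real (Suc n)" by simp
    ultimately show "s w < t" by linarith
  qed
  moreover have "{w\<in>space P. s w \<le> t - 1 / real (Suc n)} \<in> sets (F t)" for n
  proof (cases "0 \<le> t - 1 / real (Suc n)")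
    case True
    then show ?thesis using stopD(2)[OF assms(1)] F_mono[of "t - 1 / real (Suc n)" t] by fastforce
  next
    case False
    then have "{w\<in>space P. s w \<le> t - 1 / real (Suc n)} = {}" using stopD(1)[OF assms(1)] by fastforce
    then show ?thesis by (simp only: sets.empty_sets)
  qed
  ultimately show ?thesis by auto
qed

lemma stop_measurable:
  assumes "stop s" shows "s \<in> borel_measurable P"
proof (rule borel_measurableI_le)
  fix t
  show "{w \<in> space P. s w \<le> t} \<in> sets P"
  proof (cases "0 \<le> t")
    case True
    then show ?thesis using stopD(2)[OF assms] sets_F by blast
  next
    case False
    then have "{w \<in> space P. s w \<le> t} = {}" using stopD(1)[OF assms] by fastforce
    then show ?thesis by (simp only: sets.empty_sets)
  qed
qed

lemma stop_min_measurable: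
  assumes s: "stop s" and "0 \<le> t" shows "(\<lambda>w. min t (s w)) \<in> borel_measurable (F t)"
proof (rule borel_measurableI_le)
  fix r
  show "{w \<in> space (F t). min t (s w) \<le> r} \<in> sets (F t)"
  proof -
    consider "t \<le> r" | "0 \<le> r" "r < t" | "r < 0" using \<open>0 \<le> t\<close> by linarith
    then show ?thesis
    proof cases
      case 1
      then have "{w \<in> space (F t). min t (s w) \<le> r} = space (F t)" by auto
      then show ?thesis by (metis sets.top)
    next
      case 2
      then have "{w \<in> space (F t). min t (s w) \<le> r} = {w\<in>space P. s w \<le> r}" by auto
      then show ?thesis using stopD(2)[OF s 2(1)] F_mono[of r t] 2 by auto
    next
      case 3
      then have "{w \<in> space (F t). min t (s w) \<le> r} = {}" using stopD(1)[OF s] \<open>0 \<le> t\<close> by fastforce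
      then show ?thesis by (simp only: sets.empty_sets)
    qed
  qed
qed

text \<open>By \<open>first_hit_le_iff\<close> countably many strict inequalities describe the
  event, but only on continuous paths; completeness absorbs the remaining null set.\<close>

lemma first_hit_stop:
  fixes G :: "real \<Rightarrow> 'w \<Rightarrow> real"
  assumes "0 \<le> a" "a \<le> T" and G: "\<And>t. a \<le> t \<Longrightarrow> t \<le> T \<Longrightarrow> G t \<in> borel_measurable (F t)"
    and cont: "AE w in P. continuous_on {a..T} (\<lambda>t. G t w)"
  shows "stop (\<lambda>w. first_hit (\<lambda>t. G t w) c a T)"
proof (rule stopI)
  fix w show "0 \<le> first_hit (\<lambda>t. G t w) c a T"
    using first_hit_bounds(1)[OF assms(2)] assms(1) by (rule order_trans[rotated])
next
  fix t :: real assume "0 \<le> t"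
  \<comment> \<open>From \<open>T\<close> on the event is the whole space and before
    \<open>a\<close> it is empty; only in between does the path matter.\<close>
  consider "T \<le> t" | "a \<le> t" "t < T" | "t < a" by linarith
  then show "{w \<in> space P. first_hit (\<lambda>t. G t w) c a T \<le> t} \<in> sets (F t)"
  proof cases
    case 1
    then have "{w \<in> space P. first_hit (\<lambda>t. G t w) c a T \<le> t} = space (F t)"
      using first_hit_bounds(2)[OF assms(2)] by (auto intro: order_trans)
    then show ?thesis by (metis sets.top)
  next
    case 3
    then have "{w \<in> space P. first_hit (\<lambda>t. G t w) c a T \<le> t} = {}"
      using first_hit_bounds(1)[OF assms(2)] by (auto simp: not_le intro: less_le_trans[OF 3])
    then show ?thesis by (simp only: sets.empty_sets)
  next
    case 2
    have m: "{w \<in> space P. G (a + (t - a) * x) w < c + 1 / real (Suc n)} \<in> sets (F t)"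
      if "x \<in> {0..1}" for x n
    proof -
      have "a + (t - a) * x \<in> {a..t}" using that 2 by (intro affine_mem_Icc) auto
      then have "G (a + (t - a) * x) \<in> borel_measurable (F t)"
        using 2 by (intro measurable_F_mono[OF _ G]) auto
      then have "{w \<in> space (F t). G (a + (t - a) * x) w < c + 1 / real (Suc n)} \<in> sets (F t)"
        by measurable
      then show ?thesis by simp
    qed
    have "(\<Union>x\<in>{0..1}\<inter>\<rat>. {w \<in> space P. G (a + (t - a) * x) w < c + 1 / real (Suc n)}) \<in> sets (F t)" for n
    proof (rule sets.countable_UN'')
      show "countable ({0..1} \<inter> \<rat> :: real set)" by (intro countable_Int2 countable_rat)
    qed (auto intro!: m simp del: of_nat_Suc)
    then have "(\<Inter>n::nat. \<Union>x\<in>{0..1}\<inter>\<rat>. {w \<in> space P. G (a + (t - a) * x) w < c + 1 / real (Suc n)}) \<in> sets (F t)"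
      by (intro sets.countable_INT) auto
    then show ?thesis
    proof (rule sets_F_AE)
      show "AE w in P. (w \<in> (\<Inter>n::nat. \<Union>x\<in>{0..1}\<inter>\<rat>. {w \<in> space P. G (a + (t - a) * x) w < c + 1 / real (Suc n)}))
           = (w \<in> {w \<in> space P. first_hit (\<lambda>t. G t w) c a T \<le> t})"
        using cont AE_space
      proof eventually_elim
        case (elim w)
        show ?case using first_hit_le_iff[OF elim(1) 2] elim(2) by auto
      qed
    qed auto
  qed
qed

end

section \<open>Convergence of means under uniform integrability\<close>

text \<open>Vitali's theorem for means: clamping at \<open>R n\<close> costs at most
  \<open>\<rho> n\<close> in mean, uniformly in \<open>k\<close>; Fatou's lemma passes this cost to
  the limit, and the clamped variables converge by dominated convergence.\<close>

lemma (in prob_space) uniformly_integrable_limit: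
  fixes X :: "nat \<Rightarrow> 'a \<Rightarrow> real"
  assumes X: "\<And>k. integrable M (X k)" and Y: "Y \<in> borel_measurable M"
    and lim: "AE w in M. (\<lambda>k. X k w) \<longlonglongrightarrow> Y w"
    and R: "\<And>n::nat. 0 \<le> R n"
    and ui: "\<And>n k. expectation (\<lambda>w. indicator {w. R n < \<bar>X k w\<bar>} w * \<bar>X k w\<bar>) \<le> \<rho> n"
    and \<rho>: "\<rho> \<longlonglongrightarrow> 0"
  shows "integrable M Y" "(\<lambda>k. expectation (X k)) \<longlonglongrightarrow> expectation Y"
proof -
  note [measurable] = borel_measurable_integrable[OF X] Y
  define cl where "cl n x = max (- R n) (min (R n) x)" for n and x :: real
  have cl_bd: "\<bar>cl n x\<bar> \<le> R n" for n x using R[of n] by (auto simp: cl_def)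
  have [measurable]: "cl n \<in> borel_measurable borel" for n unfolding cl_def by measurable
  have cl_cont: "(\<lambda>k. cl n (a k)) \<longlonglongrightarrow> cl n b" if "a \<longlonglongrightarrow> b" for a b n
    unfolding cl_def by (intro tendsto_intros that)
  have cl_err: "\<bar>x - cl n x\<bar> \<le> (if R n < \<bar>x\<bar> then \<bar>x\<bar> else 0)" for n x
    using R[of n] by (auto simp: cl_def)
  have icl: "integrable M (\<lambda>w. cl n (Z w))" if "Z \<in> borel_measurable M" for Z n
    by (rule integrable_const_bound[of _ "R n"]) (use that cl_bd in \<open>auto\<close>)
  have err: "expectation (\<lambda>w. \<bar>X k w - cl n (X k w)\<bar>) \<le> \<rho> n" for n k
  proof (rule order_trans[OF integral_mono ui])
    show "integrable M (\<lambda>w. \<bar>X k w - cl n (X k w)\<bar>)"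
      by (intro integrable_abs Bochner_Integration.integrable_diff X icl) measurable
    show "integrable M (\<lambda>w. indicator {w. R n < \<bar>X k w\<bar>} w * \<bar>X k w\<bar>)"
      by (rule Bochner_Integration.integrable_bound[OF X[of k]]) (auto simp: indicator_def)
    show "\<bar>X k w - cl n (X k w)\<bar> \<le> indicator {w. R n < \<bar>X k w\<bar>} w * \<bar>X k w\<bar>" for w
      using cl_err[of "X k w" n] by (auto simp: indicator_def split: if_splits)
  qed
  have fatou: "(\<integral>\<^sup>+ w. ennreal \<bar>Y w - cl n (Y w)\<bar> \<partial>M) \<le> ennreal (\<rho> n)" for n
  proof -
    have "(\<integral>\<^sup>+ w. ennreal \<bar>Y w - cl n (Y w)\<bar> \<partial>M)
        = (\<integral>\<^sup>+ w. liminf (\<lambda>k. ennreal \<bar>X k w - cl n (X k w)\<bar>) \<partial>M)"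
    proof (rule nn_integral_cong_AE, use lim in eventually_elim)
      fix w assume "(\<lambda>k. X k w) \<longlonglongrightarrow> Y w"
      then have "(\<lambda>k. ennreal \<bar>X k w - cl n (X k w)\<bar>) \<longlonglongrightarrow> ennreal \<bar>Y w - cl n (Y w)\<bar>"
        by (intro tendsto_intros tendsto_ennrealI cl_cont)
      from lim_imp_Liminf[OF _ this]
      show "ennreal \<bar>Y w - cl n (Y w)\<bar> = liminf (\<lambda>k. ennreal \<bar>X k w - cl n (X k w)\<bar>)" by simp
    qed
    also have "\<dots> \<le> liminf (\<lambda>k. \<integral>\<^sup>+ w. ennreal \<bar>X k w - cl n (X k w)\<bar> \<partial>M)"
      by (rule nn_integral_liminf) measurable
    also have "\<dots> \<le> limsup (\<lambda>k. \<integral>\<^sup>+ w. ennreal \<bar>X k w - cl n (X k w)\<bar> \<partial>M)"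
      by (rule Liminf_le_Limsup) simp
    also have "\<dots> \<le> ennreal (\<rho> n)"
    proof (rule Limsup_bounded, rule always_eventually, rule allI)
      fix k
      have "(\<integral>\<^sup>+ w. ennreal \<bar>X k w - cl n (X k w)\<bar> \<partial>M) = ennreal (expectation (\<lambda>w. \<bar>X k w - cl n (X k w)\<bar>))"
        by (rule nn_integral_eq_integral)
          (auto intro!: integrable_abs Bochner_Integration.integrable_diff X icl)
      also have "\<dots> \<le> ennreal (\<rho> n)" using err by (rule ennreal_leI)
      finally show "(\<integral>\<^sup>+ w. ennreal \<bar>X k w - cl n (X k w)\<bar> \<partial>M) \<le> ennreal (\<rho> n)" .
    qed
    finally show ?thesis .
  qed
  have idiff: "integrable M (\<lambda>w. Y w - cl n (Y w))" for n
  proof (rule integrableI_bounded)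
    have "(\<integral>\<^sup>+ w. ennreal (norm (Y w - cl n (Y w))) \<partial>M) \<le> ennreal (\<rho> n)" using fatou[of n] by simp
    also have "\<dots> < \<infinity>" by simp
    finally show "(\<integral>\<^sup>+ w. ennreal (norm (Y w - cl n (Y w))) \<partial>M) < \<infinity>" .
  qed measurable
  have "integrable M (\<lambda>w. (Y w - cl 0 (Y w)) + cl 0 (Y w))"
    by (intro Bochner_Integration.integrable_add idiff icl Y)
  then show iY: "integrable M Y" by simp
  have \<rho>0: "0 \<le> \<rho> n" for n
    using err[of 0 n] by (rule order_trans[rotated]) (auto intro!: integral_nonneg_AE)
  have errY: "expectation (\<lambda>w. \<bar>Y w - cl n (Y w)\<bar>) \<le> \<rho> n" for n
  proof -
    have "ennreal (expectation (\<lambda>w. \<bar>Y w - cl n (Y w)\<bar>)) \<le> ennreal (\<rho> n)"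
      using fatou[of n] by (subst nn_integral_eq_integral[symmetric]) (auto intro: integrable_abs idiff)
    then show ?thesis using \<rho>0 by (simp add: ennreal_le_iff)
  qed
  have clconv: "(\<lambda>k. expectation (\<lambda>w. cl n (X k w))) \<longlonglongrightarrow> expectation (\<lambda>w. cl n (Y w))" for n
  proof (rule integral_dominated_convergence[where w="\<lambda>_. R n"])
    show "AE w in M. (\<lambda>k. cl n (X k w)) \<longlonglongrightarrow> cl n (Y w)"
      using lim by eventually_elim (rule cl_cont)
  qed (use cl_bd in auto)
  show "(\<lambda>k. expectation (X k)) \<longlonglongrightarrow> expectation Y"
  proof (rule LIMSEQ_I)
    fix r :: real assume "0 < r"
    then have "eventually (\<lambda>n. \<rho> n < r/3) sequentially"
      using \<rho> by (intro order_tendstoD(2)) auto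
    then obtain n where n: "\<rho> n < r/3" by (auto simp: eventually_sequentially)
    from LIMSEQ_D[OF clconv[of n], of "r/3"] \<open>0 < r\<close> obtain k0 where
      k0: "\<And>k. k \<ge> k0 \<Longrightarrow> \<bar>expectation (\<lambda>w. cl n (X k w)) - expectation (\<lambda>w. cl n (Y w))\<bar> < r/3"
      by auto
    have "\<bar>expectation (X k) - expectation Y\<bar> < r" if "k \<ge> k0" for k
    proof -
      have "\<bar>expectation (X k) - expectation (\<lambda>w. cl n (X k w))\<bar> = \<bar>expectation (\<lambda>w. X k w - cl n (X k w))\<bar>"
        by (subst Bochner_Integration.integral_diff[OF X icl]) auto
      also have "\<dots> \<le> \<rho> n" using err[of k n] integral_abs_bound[of M] by (rule order_trans[rotated])
      finally have 1: "\<bar>expectation (X k) - expectation (\<lambda>w. cl n (X k w))\<bar> \<le> \<rho> n" .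
      have "\<bar>expectation Y - expectation (\<lambda>w. cl n (Y w))\<bar> = \<bar>expectation (\<lambda>w. Y w - cl n (Y w))\<bar>"
        by (subst Bochner_Integration.integral_diff[OF iY icl]) auto
      also have "\<dots> \<le> \<rho> n" using errY[of n] integral_abs_bound[of M] by (rule order_trans[rotated])
      finally have 2: "\<bar>expectation Y - expectation (\<lambda>w. cl n (Y w))\<bar> \<le> \<rho> n" .
      show ?thesis using 1 2 n k0[OF that] by linarith
    qed
    then show "\<exists>no. \<forall>k\<ge>no. norm (expectation (X k) - expectation Y) < r" by auto
  qed
qed

section \<open>Dyadic approximation of stopping times from above\<close>

text \<open>Rounding up, not down, keeps the rounded time a stopping time: whether it equals
  \<open>j / 2 ^ k\<close> is decided by that time.\<close>

definition dyadic_index :: "nat \<Rightarrow> real \<Rightarrow> nat" where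
  "dyadic_index k x = nat \<lceil>x * 2 ^ k\<rceil>"

lemma dyadic_index_eq_iff:
  assumes "0 \<le> x"
  shows "dyadic_index k x = j \<longleftrightarrow> x \<le> real j / 2 ^ k \<and> (j = 0 \<or> (real j - 1) / 2 ^ k < x)"
proof -
  have "dyadic_index k x = j \<longleftrightarrow> \<lceil>x * 2 ^ k\<rceil> = int j"
    unfolding dyadic_index_def using assms by (metis ceiling_mono ceiling_zero int_nat_eq mult_nonneg_nonneg nat_int of_nat_eq_iff zero_le_numeral zero_le_power)
  also have "\<dots> \<longleftrightarrow> real j - 1 < x * 2 ^ k \<and> x * 2 ^ k \<le> real j"
    by (simp add: ceiling_eq_iff)
  also have "\<dots> \<longleftrightarrow> x \<le> real j / 2 ^ k \<and> (j = 0 \<or> (real j - 1) / 2 ^ k < x)"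
  proof (cases "j = 0")
    case True
    have "- 1 < x * 2 ^ k" using assms by (smt (verit) mult_nonneg_nonneg zero_le_power)
    moreover have "\<not> (2::real) ^ k \<le> 0" by (simp add: not_le)
    ultimately show ?thesis using True by (auto simp: mult_le_0_iff)
  qed (auto simp: field_simps)
  finally show ?thesis .
qed

lemma dyadic_index_LIMSEQ:
  assumes "0 \<le> x" shows "(\<lambda>k. real (dyadic_index k x) / 2 ^ k) \<longlonglongrightarrow> x"
proof (rule tendsto_sandwich[where f="\<lambda>_. x" and h="\<lambda>k. x + (1/2) ^ k"])
  have "x \<le> real (dyadic_index k x) / 2 ^ k \<and> real (dyadic_index k x) / 2 ^ k \<le> x + (1/2) ^ k" for k
    using dyadic_index_eq_iff[OF assms, of k "dyadic_index k x"] assms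
    by (auto simp: field_simps power_divide)
  then show "\<forall>\<^sub>F k in sequentially. x \<le> real (dyadic_index k x) / 2 ^ k"
    "\<forall>\<^sub>F k in sequentially. real (dyadic_index k x) / 2 ^ k \<le> x + (1/2) ^ k" by auto
  show "(\<lambda>k. x + (1/2) ^ k) \<longlonglongrightarrow> x"
    using tendsto_add[OF tendsto_const LIMSEQ_power_zero[of "1/2::real"], of x] by simp
qed simp

context complete_filtration
begin

text \<open>Rounding up may overshoot \<open>T\<close>, so the time is capped there. The event stays
  measurable at the capped time because \<open>s w \<le> b\<close> always holds once
  \<open>b \<ge> T\<close>.\<close>

lemma dyadic_index_sets:
  assumes s: "stop s" and "0 \<le> T" and bd: "\<And>w. w \<in> space P \<Longrightarrow> s w \<le> T"
  shows "{w\<in>space P. dyadic_index k (s w) = j} \<in> sets (F (min T (real j / 2 ^ k)))"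
proof -
  have le: "{w\<in>space P. s w \<le> b} \<in> sets (F (min T c))" if "0 \<le> b" "b \<le> c" for b c
  proof (cases "T \<le> b")
    case True
    then have "{w\<in>space P. s w \<le> b} = space (F (min T c))" using bd by (auto intro: order_trans)
    then show ?thesis by (metis sets.top)
  next
    case False
    then show ?thesis using stopD(2)[OF s that(1)] F_mono[of b "min T c"] that by auto
  qed
  show ?thesis
  proof (cases "j = 0")
    case True
    have "{w\<in>space P. dyadic_index k (s w) = j} = {w\<in>space P. s w \<le> 0}"
      using dyadic_index_eq_iff[OF stopD(1)[OF s]] True by auto
    then show ?thesis using le[of 0 0] True by simp
  next
    case False
    then have "{w\<in>space P. dyadic_index k (s w) = j}
        = {w\<in>space P. s w \<le> real j / 2 ^ k} - {w\<in>space P. s w \<le> (real j - 1) / 2 ^ k}"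
    proof (intro set_eqI)
      fix w
      show "w \<in> {w\<in>space P. dyadic_index k (s w) = j} \<longleftrightarrow>
          w \<in> {w\<in>space P. s w \<le> real j / 2 ^ k} - {w\<in>space P. s w \<le> (real j - 1) / 2 ^ k}"
        using dyadic_index_eq_iff[OF stopD(1)[OF s], of w k j] False by auto
    qed
    moreover have "(real j - 1) / 2 ^ k \<le> real j / 2 ^ k" by (intro divide_right_mono) auto
    ultimately show ?thesis using le[of "real j / 2 ^ k" "real j / 2 ^ k"] le[of "(real j - 1) / 2 ^ k" "real j / 2 ^ k"] False
      by auto
  qed
qed

text \<open>Sampling along rounded times capped at \<open>t\<close> uses countably many of the
  variables \<open>N r\<close> with \<open>r \<le> t\<close>; path continuity gives the
  limit.\<close>

lemma stopped_measurable:
  fixes N :: "real \<Rightarrow> 'w \<Rightarrow> 'c::metric_space"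
  assumes s: "stop s" and t: "0 \<le> t"
    and N: "\<And>r. 0 \<le> r \<Longrightarrow> r \<le> t \<Longrightarrow> N r \<in> borel_measurable (F r)"
    and cont: "AE w in P. continuous_on {0..t} (\<lambda>r. N r w)"
  shows "(\<lambda>w. N (min t (s w)) w) \<in> borel_measurable (F t)"
proof -
  define u where "u w = min t (s w)" for w
  have u: "stop u" unfolding u_def[abs_def] by (intro stop_min stop_const s t)
  have ub: "u w \<le> t" for w by (simp add: u_def)
  define J where "J k w = dyadic_index k (u w)" for k w
  from cont obtain Z where Z: "Z \<in> null_sets P" "{w\<in>space P. \<not> continuous_on {0..t} (\<lambda>r. N r w)} \<subseteq> Z"
    by (auto simp: eventually_ae_filter)
  define G where "G = space P - Z"
  have Gs [measurable]: "G \<in> sets (F t)"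
    unfolding G_def using null_F[OF Z(1), of Z t] sets.compl_sets[of Z "F t"] by simp
  \<comment> \<open>Off the continuous paths a fixed value is used, so that the limit exists at
    every point; completeness corrects this afterwards.\<close>
  define X where "X k w = (if w \<in> G then N (min t (real (J k w) / 2 ^ k)) w else undefined)" for k w
  have Jm [measurable]: "J k \<in> measurable (F t) (count_space UNIV)" for k
  proof (subst measurable_count_space_eq2_countable, safe)
    fix j
    have "J k -` {j} \<inter> space (F t) = {w\<in>space P. dyadic_index k (u w) = j}" by (auto simp: J_def)
    then show "J k -` {j} \<inter> space (F t) \<in> sets (F t)"
      using dyadic_index_sets[OF u t ub, of k j] F_mono[of "min t (real j / 2 ^ k)" t] by auto
  qed auto
  have Xm: "X k \<in> borel_measurable (F t)" for k
  proof -
    have "N (min t (real j / 2 ^ k)) \<in> borel_measurable (F t)" for j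
      using t by (intro measurable_F_mono[OF _ N]) auto
    then have "(\<lambda>w. N (min t (real (J k w) / 2 ^ k)) w) \<in> borel_measurable (F t)"
      by (rule measurable_compose_countable[OF _ Jm, where f="\<lambda>j. N (min t (real j / 2 ^ k))"])
    then show ?thesis unfolding X_def[abs_def] by measurable
  qed
  define Y where "Y w = (if w \<in> G then N (u w) w else undefined)" for w
  have "Y \<in> borel_measurable (F t)"
  proof (rule borel_measurable_LIMSEQ_metric[OF Xm])
    fix w assume w: "w \<in> space (F t)"
    show "(\<lambda>k. X k w) \<longlonglongrightarrow> Y w"
    proof (cases "w \<in> G")
      case True
      then have c: "continuous_on {0..t} (\<lambda>r. N r w)" using Z by (auto simp: G_def)
      have "0 \<le> u w" using stopD(1)[OF u] w by simp
      then have "(\<lambda>k. min t (real (J k w) / 2 ^ k)) \<longlonglongrightarrow> min t (u w)"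
        unfolding J_def by (intro tendsto_intros dyadic_index_LIMSEQ)
      then have "(\<lambda>k. min t (real (J k w) / 2 ^ k)) \<longlonglongrightarrow> u w" using ub[of w] by (simp add: min_absorb2)
      then have "(\<lambda>k. N (min t (real (J k w) / 2 ^ k)) w) \<longlonglongrightarrow> N (u w) w"
        using \<open>0 \<le> u w\<close> ub[of w] t by (intro continuous_on_tendsto_compose[OF c]) auto
      then show ?thesis using True by (simp add: X_def Y_def)
    qed (simp add: X_def Y_def)
  qed
  moreover have "AE w in P. N (u w) w = Y w"
    using AE_not_in[OF Z(1)] AE_space by eventually_elim (simp add: Y_def G_def)
  ultimately show ?thesis unfolding u_def by (rule measurable_F_AE)
qed

section \<open>Martingales on a bounded interval and optional stopping\<close>

text \<open>The martingale property is tested against the final value only: \<open>N t\<close> is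
  the conditional expectation of \<open>N T\<close>, which is the form that optional stopping
  uses.\<close>

definition mart :: "real \<Rightarrow> (real \<Rightarrow> 'w \<Rightarrow> real) \<Rightarrow> bool" where
  "mart T N \<longleftrightarrow>
     (\<forall>t. 0 \<le> t \<and> t \<le> T \<longrightarrow> N t \<in> borel_measurable (F t) \<and> integrable P (N t) \<and>
        (\<forall>A\<in>sets (F t). expectation (\<lambda>w. indicator A w * N t w) = expectation (\<lambda>w. indicator A w * N T w))) \<and>
     (AE w in P. continuous_on {0..T} (\<lambda>t. N t w))"

lemma martD:
  assumes "mart T N" "0 \<le> t" "t \<le> T"
  shows "N t \<in> borel_measurable (F t)" "integrable P (N t)"
    "A \<in> sets (F t) \<Longrightarrow> expectation (\<lambda>w. indicator A w * N t w) = expectation (\<lambda>w. indicator A w * N T w)"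
    "AE w in P. continuous_on {0..T} (\<lambda>t. N t w)"
  using assms by (auto simp: mart_def)

lemma integrable_indicator_mult:
  fixes f :: "'w \<Rightarrow> real"
  assumes "A \<in> sets P" "integrable P f" shows "integrable P (\<lambda>w. indicator A w * f w)"
  using integrable_mult_indicator[OF assms] by simp

lemma mart_diff:
  assumes N: "mart T N" and N': "mart T N'"
  shows "mart T (\<lambda>t w. N t w - N' t w)"
  unfolding mart_def
proof (intro conjI allI impI ballI)
  show "AE w in P. continuous_on {0..T} (\<lambda>t. N t w - N' t w)"
    using N N' unfolding mart_def by (auto elim!: eventually_elim2 intro: continuous_on_diff)
  fix t assume t: "0 \<le> t \<and> t \<le> T"
  note m = martD[OF N, of t] martD[OF N', of t]
  note mT = martD[OF N, of T] martD[OF N', of T]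
  show "(\<lambda>w. N t w - N' t w) \<in> borel_measurable (F t)" "integrable P (\<lambda>w. N t w - N' t w)"
    using m t by (auto intro: borel_measurable_diff)
  fix A assume A: "A \<in> sets (F t)"
  then have AP: "A \<in> sets P" using sets_F by auto
  have "expectation (\<lambda>w. indicator A w * (N r w - N' r w))
      = expectation (\<lambda>w. indicator A w * N r w) - expectation (\<lambda>w. indicator A w * N' r w)"
    if "0 \<le> r" "r \<le> T" for r
    unfolding right_diff_distrib
    by (intro Bochner_Integration.integral_diff integrable_indicator_mult AP martD(2)[OF N that] martD(2)[OF N' that])
  then show "expectation (\<lambda>w. indicator A w * (N t w - N' t w)) = expectation (\<lambda>w. indicator A w * (N T w - N' T w))"
    using m(3)[OF _ _ A] m(7)[OF _ _ A] t by auto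
qed

text \<open>Jensen's inequality for the absolute value, by splitting \<open>A\<close> according to
  the sign of \<open>N t\<close>.\<close>

lemma mart_abs_le:
  assumes N: "mart T N" and t: "0 \<le> t" "t \<le> T" and A: "A \<in> sets (F t)"
  shows "expectation (\<lambda>w. indicator A w * \<bar>N t w\<bar>) \<le> expectation (\<lambda>w. indicator A w * \<bar>N T w\<bar>)"
proof -
  note [measurable] = martD(1)[OF N t]
  let ?A = "{w\<in>space (F t). 0 \<le> N t w} \<inter> A" and ?C = "{w\<in>space (F t). N t w < 0} \<inter> A"
  have m: "?A \<in> sets (F t)" "?C \<in> sets (F t)" using A by measurable
  have mP: "?A \<in> sets P" "?C \<in> sets P" "A \<in> sets P" using m A sets_F by blast+
  have T: "0 \<le> T" "T \<le> T" using t by auto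
  note i = integrable_indicator_mult[OF mP(1) martD(2)[OF N t]] integrable_indicator_mult[OF mP(2) martD(2)[OF N t]]
    integrable_indicator_mult[OF mP(1) martD(2)[OF N T]] integrable_indicator_mult[OF mP(2) martD(2)[OF N T]]
  have "expectation (\<lambda>w. indicator A w * \<bar>N t w\<bar>)
      = expectation (\<lambda>w. indicator ?A w * N t w - indicator ?C w * N t w)"
    by (rule Bochner_Integration.integral_cong) (auto simp: indicator_def)
  also have "\<dots> = expectation (\<lambda>w. indicator ?A w * N T w - indicator ?C w * N T w)"
    using martD(3)[OF N t m(1)] martD(3)[OF N t m(2)]
    by (subst (1 2) Bochner_Integration.integral_diff) (use i in auto)
  also have "\<dots> \<le> expectation (\<lambda>w. indicator A w * \<bar>N T w\<bar>)"
    by (rule integral_mono[OF Bochner_Integration.integrable_diff[OF i(3,4)]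
          integrable_indicator_mult[OF mP(3) integrable_abs[OF martD(2)[OF N T]]]]) (auto simp: indicator_def)
  finally show ?thesis .
qed

text \<open>At rounded times the claim is a finite sum of martingale identities. The passage to the
  limit needs uniform integrability, which holds because each sampled value is dominated in
  conditional mean by the absolute value of \<open>N T\<close>.\<close>

lemma optional_stopping:
  assumes N: "mart T N" and T: "0 \<le> T" and s: "stop s" and bd: "\<And>w. w \<in> space P \<Longrightarrow> s w \<le> T"
  shows "integrable P (\<lambda>w. N (s w) w)" "expectation (\<lambda>w. N (s w) w) = expectation (N T)"
proof -
  have TT: "0 \<le> T" "T \<le> T" using T by auto
  define J where "J k w = dyadic_index k (s w)" for k w
  define tt where "tt k j = min T (real j / 2 ^ k)" for k j
  have tt: "0 \<le> tt k j" "tt k j \<le> T" for k j using T by (auto simp: tt_def)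
  define A where "A k j = {w\<in>space P. J k w = j}" for k j
  have A: "A k j \<in> sets (F (tt k j))" for k j
    unfolding A_def J_def tt_def by (rule dyadic_index_sets[OF s T bd])
  have AP: "A k j \<in> sets P" for k j using A sets_F by blast
  \<comment> \<open>The largest index that occurs, since \<open>s \<le> T\<close>; it makes the sums
    finite.\<close>
  define m where "m k = dyadic_index k T" for k
  have Jm: "J k w \<le> m k" if "w \<in> space P" for k w
    unfolding J_def m_def dyadic_index_def using bd[OF that] by (intro nat_mono ceiling_mono mult_right_mono) auto
  define X where "X k w = N (tt k (J k w)) w" for k w
  have Xsum: "\<And>k w g. w \<in> space P \<Longrightarrow> (g (X k w) :: real) = (\<Sum>j\<le>m k. indicator (A k j) w * g (N (tt k j) w))"
  proof -
    fix k w and g :: "real \<Rightarrow> real" assume that: "w \<in> space P"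
    have "(\<Sum>j\<le>m k. indicator (A k j) w * g (N (tt k j) w)) = (\<Sum>j\<le>m k. if j = J k w then g (N (tt k j) w) else 0)"
      using that by (intro sum.cong) (auto simp: A_def indicator_def)
    also have "\<dots> = g (X k w)" using Jm[OF that, of k] by (simp add: X_def)
    finally show "g (X k w) = (\<Sum>j\<le>m k. indicator (A k j) w * g (N (tt k j) w))" by simp
  qed
  note i1 = integrable_indicator_mult[OF AP martD(2)[OF N tt]]
  have Xi: "integrable P (X k)" for k
  proof -
    have "integrable P (\<lambda>w. \<Sum>j\<le>m k. indicator (A k j) w * N (tt k j) w)" by (intro Bochner_Integration.integrable_sum i1)
    then show ?thesis
      by (rule Bochner_Integration.integrable_cong[THEN iffD1, rotated 2])
        (use Xsum[of _ "\<lambda>x. x"] in auto)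
  qed
  have EX: "expectation (X k) = expectation (N T)" for k
  proof -
    have "expectation (X k) = expectation (\<lambda>w. \<Sum>j\<le>m k. indicator (A k j) w * N (tt k j) w)"
      by (rule Bochner_Integration.integral_cong) (use Xsum[of _ "\<lambda>x. x"] in auto)
    also have "\<dots> = (\<Sum>j\<le>m k. expectation (\<lambda>w. indicator (A k j) w * N (tt k j) w))"
      by (rule Bochner_Integration.integral_sum) (rule i1)
    also have "\<dots> = (\<Sum>j\<le>m k. expectation (\<lambda>w. indicator (A k j) w * N T w))"
      by (intro sum.cong refl martD(3)[OF N tt A])
    also have "\<dots> = expectation (\<lambda>w. \<Sum>j\<le>m k. indicator (A k j) w * N T w)"
      by (rule Bochner_Integration.integral_sum[symmetric])
        (intro integrable_indicator_mult AP martD(2)[OF N TT])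
    also have "\<dots> = expectation (N T)"
    proof (rule Bochner_Integration.integral_cong)
      fix w assume w: "w \<in> space P"
      have "(\<Sum>j\<le>m k. indicator (A k j) w * N T w) = (\<Sum>j\<le>m k. if j = J k w then N T w else 0)"
        using w by (intro sum.cong) (auto simp: A_def indicator_def)
      then show "(\<Sum>j\<le>m k. indicator (A k j) w * N T w) = N T w" using Jm[OF w, of k] by simp
    qed simp
    finally show ?thesis .
  qed
  \<comment> \<open>The event is determined at the sampled time, so \<open>mart_abs_le\<close>
    applies on each piece \<open>A k j\<close>.\<close>
  have Xabs: "expectation (\<lambda>w. indicator {w. c < \<bar>X k w\<bar>} w * \<bar>X k w\<bar>)
      \<le> expectation (\<lambda>w. indicator {w. c < \<bar>X k w\<bar>} w * \<bar>N T w\<bar>)" for k c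
  proof -
    define C where "C j = {w\<in>space (F (tt k j)). c < \<bar>N (tt k j) w\<bar>} \<inter> A k j" for j
    have C: "C j \<in> sets (F (tt k j))" for j
    proof -
      note [measurable] = martD(1)[OF N tt]
      show ?thesis unfolding C_def using A by measurable
    qed
    have CP: "C j \<in> sets P" for j using C sets_F by blast
    have iN: "integrable P (\<lambda>w. indicator (C j) w * \<bar>N (tt k j) w\<bar>)" "integrable P (\<lambda>w. indicator (C j) w * \<bar>N T w\<bar>)" for j
      by (intro integrable_indicator_mult CP integrable_abs martD(2)[OF N tt] martD(2)[OF N TT])+
    have "expectation (\<lambda>w. indicator {w. c < \<bar>X k w\<bar>} w * \<bar>X k w\<bar>)
       = expectation (\<lambda>w. \<Sum>j\<le>m k. indicator (C j) w * \<bar>N (tt k j) w\<bar>)"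
    proof (rule Bochner_Integration.integral_cong)
      fix w assume w: "w \<in> space P"
      have "indicator {w. c < \<bar>X k w\<bar>} w * \<bar>X k w\<bar> = (if c < \<bar>X k w\<bar> then \<bar>X k w\<bar> else 0)" by (auto simp: indicator_def)
      also have "\<dots> = (\<Sum>j\<le>m k. indicator (A k j) w * (if c < \<bar>N (tt k j) w\<bar> then \<bar>N (tt k j) w\<bar> else 0))"
        by (rule Xsum[OF w, of "\<lambda>x. if c < \<bar>x\<bar> then \<bar>x\<bar> else 0" k])
      also have "\<dots> = (\<Sum>j\<le>m k. indicator (C j) w * \<bar>N (tt k j) w\<bar>)"
        using w by (intro sum.cong) (auto simp: C_def indicator_def)
      finally show "indicator {w. c < \<bar>X k w\<bar>} w * \<bar>X k w\<bar> = (\<Sum>j\<le>m k. indicator (C j) w * \<bar>N (tt k j) w\<bar>)" .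
    qed simp
    also have "\<dots> = (\<Sum>j\<le>m k. expectation (\<lambda>w. indicator (C j) w * \<bar>N (tt k j) w\<bar>))"
      by (rule Bochner_Integration.integral_sum) (rule iN)
    also have "\<dots> \<le> (\<Sum>j\<le>m k. expectation (\<lambda>w. indicator (C j) w * \<bar>N T w\<bar>))"
      by (intro sum_mono mart_abs_le[OF N tt C])
    also have "\<dots> = expectation (\<lambda>w. \<Sum>j\<le>m k. indicator (C j) w * \<bar>N T w\<bar>)"
      by (rule Bochner_Integration.integral_sum[symmetric]) (rule iN)
    also have "\<dots> = expectation (\<lambda>w. indicator {w. c < \<bar>X k w\<bar>} w * \<bar>N T w\<bar>)"
    proof (rule Bochner_Integration.integral_cong)
      fix w assume w: "w \<in> space P"
      have "(\<Sum>j\<le>m k. indicator (C j) w * \<bar>N T w\<bar>) = (\<Sum>j\<le>m k. if j = J k w then indicator {w. c < \<bar>X k w\<bar>} w * \<bar>N T w\<bar> else 0)"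
        using w by (intro sum.cong) (auto simp: C_def A_def X_def indicator_def)
      then show "(\<Sum>j\<le>m k. indicator (C j) w * \<bar>N T w\<bar>) = indicator {w. c < \<bar>X k w\<bar>} w * \<bar>N T w\<bar>" using Jm[OF w, of k] by simp
    qed simp
    finally show ?thesis .
  qed
  note [measurable] = borel_measurable_integrable[OF Xi] borel_measurable_integrable[OF martD(2)[OF N TT]]
  define \<rho> where "\<rho> n = expectation (\<lambda>w. indicator {w. real n < \<bar>N T w\<bar>} w * \<bar>N T w\<bar>) + expectation (\<lambda>w. \<bar>N T w\<bar>) / real n" for n
  have tail: "integrable P (\<lambda>w. indicator {w. c < \<bar>N T w\<bar>} w * \<bar>N T w\<bar>)" for c
    by (rule Bochner_Integration.integrable_bound[OF martD(2)[OF N TT]]) (auto simp: indicator_def)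
  have iab: "integrable P (\<lambda>w. \<bar>N T w\<bar>)" by (intro integrable_abs martD(2)[OF N TT])
  \<comment> \<open>The level \<open>-1\<close> makes the indicator identically one.\<close>
  have EXabs: "expectation (\<lambda>w. \<bar>X k w\<bar>) \<le> expectation (\<lambda>w. \<bar>N T w\<bar>)" for k
    using Xabs[of "-1" k] by (simp add: less_le_trans[of "-1" 0])
  \<comment> \<open>Where a sample exceeds \<open>c\<^sup>2\<close>, either
    \<open>\<bar>N T w\<bar>\<close> exceeds \<open>c\<close>, or it is at most \<open>c\<close> and
    hence at most the sample divided by \<open>c\<close>. This explains the squared level and the
    two terms of \<open>\<rho>\<close>.\<close>
  have ui: "expectation (\<lambda>w. indicator {w. (real (Suc n))\<^sup>2 < \<bar>X k w\<bar>} w * \<bar>X k w\<bar>) \<le> \<rho> (Suc n)" for n k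
  proof -
    define c where "c = real (Suc n)"
    have c: "0 < c" by (simp add: c_def)
    have "expectation (\<lambda>w. indicator {w. c\<^sup>2 < \<bar>X k w\<bar>} w * \<bar>X k w\<bar>) \<le> expectation (\<lambda>w. indicator {w. c\<^sup>2 < \<bar>X k w\<bar>} w * \<bar>N T w\<bar>)"
      by (rule Xabs)
    also have "\<dots> \<le> expectation (\<lambda>w. indicator {w. c < \<bar>N T w\<bar>} w * \<bar>N T w\<bar> + \<bar>X k w\<bar> / c)"
    proof (rule integral_mono)
      show "integrable P (\<lambda>w. indicator {w. c\<^sup>2 < \<bar>X k w\<bar>} w * \<bar>N T w\<bar>)"
        by (rule Bochner_Integration.integrable_bound[OF martD(2)[OF N TT]]) (auto simp: indicator_def)
      show "integrable P (\<lambda>w. indicator {w. c < \<bar>N T w\<bar>} w * \<bar>N T w\<bar> + \<bar>X k w\<bar> / c)"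
        by (intro Bochner_Integration.integrable_add tail integrable_divide_zero integrable_abs Xi)
      fix w
      show "indicator {w. c\<^sup>2 < \<bar>X k w\<bar>} w * \<bar>N T w\<bar> \<le> indicator {w. c < \<bar>N T w\<bar>} w * \<bar>N T w\<bar> + \<bar>X k w\<bar> / c"
      proof (cases "c\<^sup>2 < \<bar>X k w\<bar> \<and> \<not> c < \<bar>N T w\<bar>")
        case True
        have "c * c \<le> \<bar>X k w\<bar>" using True by (simp add: power2_eq_square)
        then have "c \<le> \<bar>X k w\<bar> / c" using c by (simp add: pos_le_divide_eq)
        then show ?thesis using True by (auto simp: indicator_def)
      next
        case False
        have "0 \<le> \<bar>X k w\<bar> / c" using c by simp
        then show ?thesis using False by (auto simp: indicator_def)
      qed
    qed
    also have "\<dots> = expectation (\<lambda>w. indicator {w. c < \<bar>N T w\<bar>} w * \<bar>N T w\<bar>) + expectation (\<lambda>w. \<bar>X k w\<bar>) / c"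
      by (subst Bochner_Integration.integral_add[OF tail]) (auto intro!: integrable_abs Xi)
    also have "\<dots> \<le> \<rho> (Suc n)" unfolding \<rho>_def c_def using EXabs by (intro add_left_mono divide_right_mono) auto
    finally show ?thesis by (simp add: c_def)
  qed
  have "(\<lambda>n. expectation (\<lambda>w. indicator {w. real n < \<bar>N T w\<bar>} w * \<bar>N T w\<bar>)) \<longlonglongrightarrow> expectation (\<lambda>w. 0)"
  proof (rule integral_dominated_convergence[OF _ _ iab])
    show "AE w in P. (\<lambda>n. indicator {w. real n < \<bar>N T w\<bar>} w * \<bar>N T w\<bar>) \<longlonglongrightarrow> 0"
    proof (rule AE_I2)
      fix w
      obtain n0 :: nat where n0: "\<bar>N T w\<bar> \<le> real n0" using real_arch_simple by blast
      have "eventually (\<lambda>n. indicator {w. real n < \<bar>N T w\<bar>} w * \<bar>N T w\<bar> = 0) sequentially"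
        unfolding eventually_sequentially using n0 by (intro exI[of _ n0]) (auto simp: indicator_def)
      then show "(\<lambda>n. indicator {w. real n < \<bar>N T w\<bar>} w * \<bar>N T w\<bar>) \<longlonglongrightarrow> 0" by (rule tendsto_eventually)
    qed
  qed (auto simp: indicator_def)
  then have "\<rho> \<longlonglongrightarrow> 0 + 0"
    unfolding \<rho>_def by (intro tendsto_add lim_const_over_n) auto
  then have \<rho>0: "(\<lambda>n. \<rho> (Suc n)) \<longlonglongrightarrow> 0" using LIMSEQ_Suc[of \<rho> 0] by simp
  have lim: "AE w in P. (\<lambda>k. X k w) \<longlonglongrightarrow> N (s w) w"
    using martD(4)[OF N TT] AE_space
  proof eventually_elim
    case (elim w)
    have "0 \<le> s w" using stopD(1)[OF s elim(2)] .
    then have "(\<lambda>k. tt k (J k w)) \<longlonglongrightarrow> min T (s w)"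
      unfolding J_def tt_def by (intro tendsto_intros dyadic_index_LIMSEQ)
    then have "(\<lambda>k. tt k (J k w)) \<longlonglongrightarrow> s w" using bd[OF elim(2)] by (simp add: min_absorb2)
    then show ?case unfolding X_def
      by (rule continuous_on_tendsto_compose[OF elim(1)])
        (use \<open>0 \<le> s w\<close> bd[OF elim(2)] tt in auto)
  qed
  have Ym: "(\<lambda>w. N (s w) w) \<in> borel_measurable P"
  proof -
    have "(\<lambda>w. N (min T (s w)) w) \<in> borel_measurable (F T)"
      by (rule stopped_measurable[OF s T martD(1)[OF N] martD(4)[OF N TT]])
    then have "(\<lambda>w. N (min T (s w)) w) \<in> borel_measurable P" by (rule measurable_F)
    then show ?thesis by (rule measurable_cong[THEN iffD1, rotated]) (use bd in \<open>simp add: min_absorb2\<close>)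
  qed
  note ul = uniformly_integrable_limit[where X=X and R="\<lambda>n. (real (Suc n))\<^sup>2", OF Xi Ym lim _ ui \<rho>0]
  show "integrable P (\<lambda>w. N (s w) w)" using ul(1) by simp
  have "(\<lambda>k. expectation (X k)) \<longlonglongrightarrow> expectation (\<lambda>w. N (s w) w)" using ul(2) by simp
  then show "expectation (\<lambda>w. N (s w) w) = expectation (N T)"
    unfolding EX using LIMSEQ_unique tendsto_const by blast
qed

section \<open>Events known at a stopping time\<close>

definition pre :: "('w \<Rightarrow> real) \<Rightarrow> 'w set \<Rightarrow> bool" where
  "pre s A \<longleftrightarrow> A \<subseteq> space P \<and> (\<forall>t\<ge>0. A \<inter> {w\<in>space P. s w \<le> t} \<in> sets (F t))"

lemma pre_sets:
  assumes "pre s A" "0 \<le> T" "\<And>w. w \<in> space P \<Longrightarrow> s w \<le> T" shows "A \<in> sets (F T)" "A \<in> sets P"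
proof -
  have "A \<inter> {w\<in>space P. s w \<le> T} = A" using assms by (auto simp: pre_def)
  then show "A \<in> sets (F T)" using assms by (metis pre_def)
  then show "A \<in> sets P" using sets_F by blast
qed

lemma pre_mono:
  assumes A: "pre s A" and s': "stop s'" and le: "\<And>w. w \<in> space P \<Longrightarrow> s w \<le> s' w"
  shows "pre s' A"
  unfolding pre_def
proof (intro conjI allI impI)
  fix t :: real assume t: "0 \<le> t"
  have "A \<inter> {w\<in>space P. s' w \<le> t} = (A \<inter> {w\<in>space P. s w \<le> t}) \<inter> {w\<in>space P. s' w \<le> t}"
    using le by (auto intro: order_trans)
  then show "A \<inter> {w\<in>space P. s' w \<le> t} \<in> sets (F t)"
    using A t stopD(2)[OF s' t] by (auto simp: pre_def)
qed (use A in \<open>auto simp: pre_def\<close>)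

text \<open>The time equal to \<open>s\<close> on \<open>A\<close> and to \<open>T\<close> elsewhere
  is again a stopping time; optional stopping for it localises the identity to \<open>A\<close>,
  since the contributions off \<open>A\<close> cancel.\<close>

lemma optional_stopping_pre:
  assumes N: "mart T N" and T: "0 \<le> T" and s: "stop s" and bd: "\<And>w. w \<in> space P \<Longrightarrow> s w \<le> T"
    and A: "pre s A"
  shows "integrable P (\<lambda>w. indicator A w * N (s w) w)"
    "expectation (\<lambda>w. indicator A w * N (s w) w) = expectation (\<lambda>w. indicator A w * N T w)"
proof -
  have TT: "0 \<le> T" "T \<le> T" using T by auto
  have AP: "A \<in> sets P" by (rule pre_sets[OF A T bd])
  show i: "integrable P (\<lambda>w. indicator A w * N (s w) w)"
    by (intro integrable_indicator_mult AP optional_stopping(1)[OF N T s bd])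
  define u where "u w = (if w \<in> A then s w else T)" for w
  have u: "stop u"
  proof (rule stopI)
    fix t :: real assume t: "0 \<le> t"
    show "{w \<in> space P. u w \<le> t} \<in> sets (F t)"
    proof (cases "T \<le> t")
      case True
      then have "{w \<in> space P. u w \<le> t} = space (F t)" using bd by (auto simp: u_def intro: order_trans)
      then show ?thesis by (metis sets.top)
    next
      case False
      then have "{w \<in> space P. u w \<le> t} = A \<inter> {w\<in>space P. s w \<le> t}" using A by (auto simp: u_def pre_def)
      then show ?thesis using A t by (simp add: pre_def)
    qed
  qed (use stopD(1)[OF s] T in \<open>auto simp: u_def\<close>)
  have ubd: "u w \<le> T" if "w \<in> space P" for w using bd[OF that] by (auto simp: u_def)
  have c: "space P - A \<in> sets P" using AP by auto
  have "expectation (\<lambda>w. indicator A w * N (s w) w) + expectation (\<lambda>w. indicator (space P - A) w * N T w)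
      = expectation (\<lambda>w. indicator A w * N (s w) w + indicator (space P - A) w * N T w)"
    by (rule Bochner_Integration.integral_add[symmetric, OF i integrable_indicator_mult[OF c martD(2)[OF N TT]]])
  also have "\<dots> = expectation (\<lambda>w. N (u w) w)"
    by (rule Bochner_Integration.integral_cong) (auto simp: indicator_def u_def)
  also have "\<dots> = expectation (N T)" by (rule optional_stopping(2)[OF N T u ubd])
  also have "\<dots> = expectation (\<lambda>w. indicator A w * N T w + indicator (space P - A) w * N T w)"
    by (rule Bochner_Integration.integral_cong) (auto simp: indicator_def)
  also have "\<dots> = expectation (\<lambda>w. indicator A w * N T w) + expectation (\<lambda>w. indicator (space P - A) w * N T w)"
    by (rule Bochner_Integration.integral_add[OF integrable_indicator_mult[OF AP martD(2)[OF N TT]] integrable_indicator_mult[OF c martD(2)[OF N TT]]])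
  finally show "expectation (\<lambda>w. indicator A w * N (s w) w) = expectation (\<lambda>w. indicator A w * N T w)" by simp
qed

lemma optional_stopping_increment:
  assumes N: "mart T N" and T: "0 \<le> T" and s: "stop s" and s': "stop s'"
    and le: "\<And>w. w \<in> space P \<Longrightarrow> s w \<le> s' w" and bd: "\<And>w. w \<in> space P \<Longrightarrow> s' w \<le> T"
    and A: "pre s A"
  shows "integrable P (\<lambda>w. indicator A w * (N (s' w) w - N (s w) w))"
    "expectation (\<lambda>w. indicator A w * (N (s' w) w - N (s w) w)) = 0"
proof -
  have bds: "s w \<le> T" if "w \<in> space P" for w using le[OF that] bd[OF that] by simp
  note a = optional_stopping_pre[OF N T s bds A] optional_stopping_pre[OF N T s' bd pre_mono[OF A s' le]]
  show "integrable P (\<lambda>w. indicator A w * (N (s' w) w - N (s w) w))"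
    using a unfolding right_diff_distrib by (intro Bochner_Integration.integrable_diff) auto
  show "expectation (\<lambda>w. indicator A w * (N (s' w) w - N (s w) w)) = 0"
    unfolding right_diff_distrib by (subst Bochner_Integration.integral_diff) (use a in auto)
qed

end

subsection \<open>Comparison of solutions of backward equations\<close>

lemma continuous_on_set_lebesgue_integral:
  fixes f :: "real \<Rightarrow> real"
  assumes "set_integrable lborel {a..b} f"
  shows "continuous_on {a..b} (\<lambda>t. LINT r:{a..t}|lborel. f r)"
proof (rule continuous_on_eq)
  have eq: "(LINT r:{a..t}|lborel. f r) = integral {a..t} f" if "t \<in> {a..b}" for t
  proof (rule set_borel_integral_eq_integral(2))
    show "set_integrable lborel {a..t} f" by (rule set_integrable_subset[OF assms]) (use that in auto)
  qed
  show "continuous_on {a..b} (\<lambda>t. integral {a..t} f)"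
    by (rule indefinite_integral_continuous_1[OF set_borel_integral_eq_integral(1)[OF assms]])
  show "integral {a..t} f = (LINT r:{a..t}|lborel. f r)" if "t \<in> {a..b}" for t
    using eq[OF that] by simp
qed

text \<open>Here \<open>n\<close> is the path of the martingale part. With an abstract generator and
  an abstract noise path, one comparison serves truncated and singular solutions alike.\<close>

definition backward_path :: "(real \<Rightarrow> real) \<Rightarrow> real \<Rightarrow> (real \<Rightarrow> real) \<Rightarrow> (real \<Rightarrow> real) \<Rightarrow> bool" where
  "backward_path f S y n \<longleftrightarrow> (\<forall>u v. 0 \<le> u \<and> u \<le> v \<and> v \<le> S \<longrightarrow>
     set_integrable lborel {u..v} (\<lambda>r. f (y r)) \<and>
     y u = y v - (LINT r:{u..v}|lborel. f (y r)) - (n v - n u))"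

lemma backward_path_continuous:
  assumes p: "backward_path f S y n" and n: "continuous_on {0..S} n"
  shows "continuous_on {0..S} y"
proof (cases "0 \<le> S")
  case True
  show ?thesis
  proof (rule continuous_on_eq)
    show "continuous_on {0..S} (\<lambda>t. y 0 + (LINT r:{0..t}|lborel. f (y r)) + (n t - n 0))"
      by (intro continuous_intros continuous_on_set_lebesgue_integral n)
        (use p True in \<open>auto simp: backward_path_def\<close>)
    show "y 0 + (LINT r:{0..t}|lborel. f (y r)) + (n t - n 0) = y t" if "t \<in> {0..S}" for t
    proof -
      have "y 0 = y t - (LINT r:{0..t}|lborel. f (y r)) - (n t - n 0)"
        using p that unfolding backward_path_def by auto
      then show ?thesis by simp
    qed
  qed
qed simp

context complete_filtration
begin

text \<open>
  Stop at the first time after \<open>a\<close> at which \<open>U \<le> V\<close>. Until then \<open>f(U) - f(V) \<ge> 0\<close>, so that on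
  \<open>{U\<^sub>a > V\<^sub>a}\<close> the difference at \<open>a\<close> is at most its value at the stopping time minus a martingale
  increment, and that value is at most \<open>(U\<^sub>T - V\<^sub>T)\<^sup>+\<close>.
\<close>

lemma comparison_step:
  fixes U V NU NV :: "real \<Rightarrow> 'w \<Rightarrow> real"
  assumes a: "0 \<le> a" "a \<le> T" and s: "stop s" and bd: "\<And>w. w \<in> space P \<Longrightarrow> s w \<le> T"
    and f: "mono f"
    and NU: "mart T NU" and NV: "mart T NV"
    and mU: "\<And>t. 0 \<le> t \<Longrightarrow> t \<le> T \<Longrightarrow> (\<lambda>w. U (min t (s w)) w) \<in> borel_measurable (F t)"
    and mV: "\<And>t. 0 \<le> t \<Longrightarrow> t \<le> T \<Longrightarrow> (\<lambda>w. V (min t (s w)) w) \<in> borel_measurable (F t)"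
    and iU: "\<And>t. 0 \<le> t \<Longrightarrow> t \<le> T \<Longrightarrow> integrable P (\<lambda>w. U (min t (s w)) w)"
    and iV: "\<And>t. 0 \<le> t \<Longrightarrow> t \<le> T \<Longrightarrow> integrable P (\<lambda>w. V (min t (s w)) w)"
    and pU: "AE w in P. backward_path f (s w) (\<lambda>t. U t w) (\<lambda>t. NU t w)"
    and pV: "AE w in P. backward_path f (s w) (\<lambda>t. V t w) (\<lambda>t. NV t w)"
  shows "expectation (\<lambda>w. max 0 (U (min a (s w)) w - V (min a (s w)) w))
      \<le> expectation (\<lambda>w. max 0 (U (min T (s w)) w - V (min T (s w)) w))"
proof -
  have T: "0 \<le> T" using a by simp
  \<comment> \<open>Both processes are stopped at \<open>s\<close>, so \<open>D\<close> is constant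
    after \<open>s\<close> and the search for its first nonpositive value may run up to the
    deterministic time \<open>T\<close>.\<close>
  define D where "D t w = U (min t (s w)) w - V (min t (s w)) w" for t w
  define N where "N t w = NU t w - NV t w" for t w
  have N: "mart T N" unfolding N_def[abs_def] by (rule mart_diff[OF NU NV])
  have Dm: "D t \<in> borel_measurable (F t)" if "0 \<le> t" "t \<le> T" for t
    unfolding D_def[abs_def] using mU[OF that] mV[OF that] by measurable
  have Di: "integrable P (D t)" if "0 \<le> t" "t \<le> T" for t
    unfolding D_def[abs_def] by (intro Bochner_Integration.integrable_diff iU iV that)
  have good: "AE w in P. w \<in> space P \<and> 0 \<le> s w \<and> s w \<le> T \<and> continuous_on {0..T} (\<lambda>t. D t w) \<and>
      backward_path f (s w) (\<lambda>t. U t w) (\<lambda>t. NU t w) \<and> backward_path f (s w) (\<lambda>t. V t w) (\<lambda>t. NV t w)"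
    using pU pV martD(4)[OF NU T order_refl] martD(4)[OF NV T order_refl] AE_space
  proof eventually_elim
    case (elim w)
    have sw: "0 \<le> s w" "s w \<le> T" using stopD(1)[OF s] bd elim by auto
    have "continuous_on {0..s w} (\<lambda>t. NU t w)" "continuous_on {0..s w} (\<lambda>t. NV t w)"
      using sw by (auto intro!: continuous_on_subset[OF elim(3)] continuous_on_subset[OF elim(4)])
    then have "continuous_on {0..s w} (\<lambda>t. U t w - V t w)"
      by (intro continuous_on_diff backward_path_continuous[OF elim(1)] backward_path_continuous[OF elim(2)])
    then have "continuous_on {0..T} (\<lambda>t. D t w)" unfolding D_def
      by (rule continuous_on_compose2[where f="\<lambda>t. min t (s w)"]) (use sw in \<open>auto intro!: continuous_intros\<close>)
    then show ?case using elim sw by auto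
  qed
  define \<sigma> where "\<sigma> w = first_hit (\<lambda>t. D t w) 0 a T" for w
  have \<sigma>: "stop \<sigma>" unfolding \<sigma>_def[abs_def]
  proof (rule first_hit_stop[OF a Dm])
    show "AE w in P. continuous_on {a..T} (\<lambda>t. D t w)"
      using good by eventually_elim (rule continuous_on_subset[of "{0..T}"], use a in auto)
  qed (use a in auto)
  have \<sigma>b: "a \<le> \<sigma> w" "\<sigma> w \<le> T" for w unfolding \<sigma>_def using first_hit_bounds[OF a(2)] by auto
  define A where "A = {w\<in>space P. 0 < D a w}"
  define u where "u w = min a (s w)" for w
  define v where "v w = min (\<sigma> w) (s w)" for w
  have u: "stop u" unfolding u_def[abs_def] by (intro stop_min stop_const s a)
  have v: "stop v" unfolding v_def[abs_def] by (intro stop_min \<sigma> s)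
  have posm: "{w\<in>space P. 0 < D t w} \<in> sets (F t)" if "0 \<le> t" "t \<le> T" for t
  proof -
    have "{w\<in>space (F t). 0 < D t w} \<in> sets (F t)" using Dm[OF that] by measurable
    then show ?thesis by simp
  qed
  \<comment> \<open>If \<open>s w \<le> t < a\<close>, the stopped difference has the same value at
    \<open>t\<close> and at \<open>a\<close>, so its sign at \<open>a\<close> is already known at
    time \<open>t\<close>.\<close>
  have A: "pre u A" unfolding pre_def
  proof (intro conjI allI impI)
    fix t :: real assume t: "0 \<le> t"
    show "A \<inter> {w \<in> space P. u w \<le> t} \<in> sets (F t)"
    proof (cases "a \<le> t")
      case True
      then have "A \<inter> {w \<in> space P. u w \<le> t} = A" by (auto simp: A_def u_def)
      then show ?thesis using posm[OF a] F_mono[OF True] by (auto simp: A_def)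
    next
      case False
      then have "A \<inter> {w \<in> space P. u w \<le> t} = {w\<in>space P. 0 < D t w} \<inter> {w\<in>space P. s w \<le> t}"
        by (auto simp: A_def u_def D_def min_def split: if_splits)
      then show ?thesis using posm[of t] stopD(2)[OF s t] t a False by auto
    qed
  qed (auto simp: A_def)
  have incr: "integrable P (\<lambda>w. indicator A w * (N (v w) w - N (u w) w))"
    "expectation (\<lambda>w. indicator A w * (N (v w) w - N (u w) w)) = 0"
  proof -
    have "u w \<le> v w" "v w \<le> T" if "w \<in> space P" for w
      using \<sigma>b[of w] bd[OF that] by (auto simp: u_def v_def)
    from optional_stopping_increment[OF N T u v this A]
    show "integrable P (\<lambda>w. indicator A w * (N (v w) w - N (u w) w))"
      "expectation (\<lambda>w. indicator A w * (N (v w) w - N (u w) w)) = 0" by auto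
  qed
  \<comment> \<open>The pathwise form of the claim; taking means removes the martingale increment,
    as its weight \<open>A\<close> is known at \<open>u\<close>.\<close>
  have key: "AE w in P. max 0 (D a w) \<le> max 0 (D T w) - indicator A w * (N (v w) w - N (u w) w)"
    using good
  proof eventually_elim
    case (elim w)
    then have sw: "0 \<le> s w" "s w \<le> T" and w: "w \<in> space P"
      and cD: "continuous_on {0..T} (\<lambda>t. D t w)" by blast+
    have cDa: "continuous_on {a..T} (\<lambda>t. D t w)" by (rule continuous_on_subset[OF cD]) (use a in simp)
    show ?case
    proof (cases "0 < D a w")
      case False
      then show ?thesis by (auto simp: A_def)
    next
      case True
      have uv: "0 \<le> u w" "u w \<le> v w" "v w \<le> s w" using a sw \<sigma>b[of w] by (auto simp: u_def v_def)
      have eU: "set_integrable lborel {u w..v w} (\<lambda>r. f (U r w))"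
         "U (u w) w = U (v w) w - (LINT r:{u w..v w}|lborel. f (U r w)) - (NU (v w) w - NU (u w) w)"
        and eV: "set_integrable lborel {u w..v w} (\<lambda>r. f (V r w))"
         "V (u w) w = V (v w) w - (LINT r:{u w..v w}|lborel. f (V r w)) - (NV (v w) w - NV (u w) w)"
        using elim uv unfolding backward_path_def by blast+
      have "(LINT r:{u w..v w}|lborel. f (V r w)) \<le> (LINT r:{u w..v w}|lborel. f (U r w))"
      proof (rule set_integral_mono_AE[OF eV(1) eU(1)])
        \<comment> \<open>The sign of the difference is known strictly before
          \<open>\<sigma>\<close> only; the right endpoint is a null set.\<close>
        show "AE r\<in>{u w..v w} in lborel. f (V r w) \<le> f (U r w)"
          using AE_lborel_singleton[of "v w"]
        proof eventually_elim
          case (elim r)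
          show ?case
          proof
            assume r: "r \<in> {u w..v w}"
            then have "r < v w" using elim by auto
            then have "a \<le> r" "r < \<sigma> w" "r \<le> s w" using r unfolding u_def v_def by (auto simp: min_less_iff_conj min_le_iff_disj)
            then have "0 < D r w"
              using first_hit_above[of a r "\<lambda>t. D t w" 0 T] a(2) unfolding \<sigma>_def by blast
            then have "V r w \<le> U r w" using \<open>r \<le> s w\<close> by (simp add: D_def min_absorb1)
            then show "f (V r w) \<le> f (U r w)" using f by (auto simp: mono_def)
          qed
        qed
      qed
      then have "D a w \<le> D (\<sigma> w) w - (N (v w) w - N (u w) w)"
        using eU(2) eV(2) unfolding D_def N_def u_def v_def by linarith
      \<comment> \<open>Either the difference is nonpositive at \<open>\<sigma>\<close>, or the
        search ended at \<open>T\<close>.\<close>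
      moreover have "D (\<sigma> w) w \<le> max 0 (D T w)"
      proof (cases "\<sigma> w < T")
        case True
        have "D (\<sigma> w) w \<le> 0"
          using first_hit_value[OF cDa a(2)] True unfolding \<sigma>_def by blast
        then show ?thesis by simp
      next
        case False
        then have "\<sigma> w = T" using \<sigma>b(2)[of w] by linarith
        then show ?thesis by (simp only: max.cobounded2)
      qed
      moreover have "indicator A w = (1::real)" "max 0 (D a w) = D a w" using True w by (simp_all add: A_def)
      ultimately show ?thesis by (simp only: mult_1_left)
    qed
  qed
  have imax: "integrable P (\<lambda>w. max 0 (D t w))" if "0 \<le> t" "t \<le> T" for t
    using Di[OF that] by (intro Bochner_Integration.integrable_max) auto
  have "expectation (\<lambda>w. max 0 (D a w)) \<le> expectation (\<lambda>w. max 0 (D T w) - indicator A w * (N (v w) w - N (u w) w))"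
    by (rule integral_mono_AE[OF imax[OF a] Bochner_Integration.integrable_diff[OF imax[OF T order_refl] incr(1)] key])
  also have "\<dots> = expectation (\<lambda>w. max 0 (D T w))"
    unfolding Bochner_Integration.integral_diff[OF imax[OF T order_refl] incr(1)] incr(2) by (rule diff_zero)
  finally show ?thesis unfolding D_def .
qed

end

subsection \<open>Increments of Brownian motion\<close>

text \<open>Lebesgue measure on vectors is the image of a product measure indexed by basis vectors;
  identifying these with coordinates through \<open>axis\<close> turns coordinate products into
  products of integrals.\<close>

lemma vec_prod_lborel:
  fixes g :: "'d::finite \<Rightarrow> real \<Rightarrow> real"
  assumes g: "\<And>i. integrable lborel (g i)"
  shows "integrable lborel (\<lambda>y :: real ^ 'd. \<Prod>i\<in>UNIV. g i (y $ i))"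
    and "(\<integral>y. (\<Prod>i\<in>UNIV. g i (y $ i)) \<partial>(lborel :: (real ^ 'd) measure)) = (\<Prod>i\<in>UNIV. integral\<^sup>L lborel (g i))"
proof -
  interpret product_sigma_finite "\<lambda>_ :: real ^ 'd. lborel :: real measure" by standard
  define e where "e i = (axis i 1 :: real ^ 'd)" for i
  have e_inj: "inj e" by (auto simp: inj_on_def e_def axis_eq_axis)
  have e_B: "Basis = range e" by (auto simp: Basis_vec_def e_def)
  define G where "G b = g (inv e b)" for b
  have Gi: "integrable lborel (G b)" for b using g by (simp add: G_def)
  have [measurable]: "g i \<in> borel_measurable borel" for i using borel_measurable_integrable[OF g] by simp
  define \<Phi> where "\<Phi> f = (\<Sum>b\<in>Basis. f b *\<^sub>R b)" for f :: "real ^ 'd \<Rightarrow> real"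
  have \<Phi>[measurable]: "\<Phi> \<in> measurable (\<Pi>\<^sub>M b\<in>Basis. lborel) borel" unfolding \<Phi>_def[abs_def] by measurable
  have comp: "\<Phi> f $ i = f (e i)" for f i
  proof -
    have "\<Phi> f $ i = \<Phi> f \<bullet> e i" by (simp add: e_def inner_axis)
    also have "\<dots> = f (e i)" unfolding \<Phi>_def by (rule inner_sum_left_Basis) (auto simp: e_B)
    finally show ?thesis .
  qed
  have pr: "(\<Prod>i\<in>UNIV. g i (\<Phi> f $ i)) = (\<Prod>b\<in>Basis. G b (f b))" for f
    unfolding e_B by (subst prod.reindex[OF e_inj]) (simp add: comp G_def e_inj)
  have lb: "(lborel :: (real ^ 'd) measure) = distr (\<Pi>\<^sub>M b\<in>Basis. lborel) borel \<Phi>"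
    unfolding \<Phi>_def[abs_def] by (rule lborel_eq)
  have m: "(\<lambda>y :: real ^ 'd. \<Prod>i\<in>UNIV. g i (y $ i)) \<in> borel_measurable borel" by measurable
  have "integrable (\<Pi>\<^sub>M b\<in>Basis. lborel) (\<lambda>f. \<Prod>b\<in>Basis. G b (f b))"
    by (rule product_integrable_prod) (auto intro: Gi)
  then show "integrable lborel (\<lambda>y :: real ^ 'd. \<Prod>i\<in>UNIV. g i (y $ i))"
    unfolding lb by (subst integrable_distr_eq[OF \<Phi> m]) (simp add: pr)
  have "(\<integral>y. (\<Prod>i\<in>UNIV. g i (y $ i)) \<partial>(lborel :: (real ^ 'd) measure)) = (\<integral>f. (\<Prod>b\<in>Basis. G b (f b)) \<partial>(\<Pi>\<^sub>M b\<in>Basis. lborel))"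
    unfolding lb by (subst integral_distr[OF \<Phi> m]) (simp add: pr)
  also have "\<dots> = (\<Prod>b\<in>Basis. integral\<^sup>L lborel (G b))"
    by (rule product_integral_prod) (auto intro: Gi)
  also have "\<dots> = (\<Prod>i\<in>UNIV. integral\<^sup>L lborel (g i))"
    unfolding e_B by (subst prod.reindex[OF e_inj]) (simp add: G_def e_inj)
  finally show "(\<integral>y. (\<Prod>i\<in>UNIV. g i (y $ i)) \<partial>(lborel :: (real ^ 'd) measure)) = (\<Prod>i\<in>UNIV. integral\<^sup>L lborel (g i))" .
qed

text \<open>The coordinate factors are absorbed into the one-dimensional densities, so the moments
  become products of one-dimensional ones; off the diagonal a vanishing first moment occurs as a
  factor.\<close>

lemma gaussian_vec_moments:
  fixes k l :: "'d::finite" and s :: real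
  assumes s: "s > 0"
  shows "integrable lborel (\<lambda>y :: real ^ 'd. (\<Prod>i\<in>UNIV. normal_density 0 s (y $ i)) * y $ k)"
    and "(\<integral>y. (\<Prod>i\<in>UNIV. normal_density 0 s (y $ i)) * y $ k \<partial>(lborel :: (real ^ 'd) measure)) = 0"
    and "integrable lborel (\<lambda>y :: real ^ 'd. (\<Prod>i\<in>UNIV. normal_density 0 s (y $ i)) * (y $ k * y $ l))"
    and "(\<integral>y. (\<Prod>i\<in>UNIV. normal_density 0 s (y $ i)) * (y $ k * y $ l) \<partial>(lborel :: (real ^ 'd) measure)) = (if k = l then s\<^sup>2 else 0)"
proof -
  let ?n = "normal_density 0 s"
  have i0: "integrable lborel ?n" "integral\<^sup>L lborel ?n = 1" using s by (auto simp: integral_normal_density)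
  have i1: "integrable lborel (\<lambda>u. ?n u * u)" "(\<integral>u. ?n u * u \<partial>lborel) = 0"
    using integrable_normal_moment_nz_1[OF s, of 0] integral_normal_moment_nz_1[OF s, of 0] by auto
  have i2: "integrable lborel (\<lambda>u. ?n u * (u * u))" "(\<integral>u. ?n u * (u * u) \<partial>lborel) = s\<^sup>2"
    using integrable_normal_moment[OF s, of 0 2] integral_normal_moment_even[OF s, of 0 1]
    by (auto simp: power2_eq_square fact_numeral)
  define g1 where "g1 i u = ?n u * (if i = k then u else 1)" for i u
  define g2 where "g2 i u = ?n u * ((if i = k then u else 1) * (if i = l then u else 1))" for i u
  have G1: "integrable lborel (g1 i)" "integral\<^sup>L lborel (g1 i) = (if i = k then 0 else 1)" for i
    using i0 i1 by (cases "i = k"; simp add: g1_def[abs_def])+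
  have G2: "integrable lborel (g2 i)"
     "integral\<^sup>L lborel (g2 i) = (if i = k then if i = l then s\<^sup>2 else 0 else if i = l then 0 else 1)" for i
    using i0 i1 i2 by (cases "i = k"; cases "i = l"; simp add: g2_def[abs_def])+
  have p1: "(\<Prod>i\<in>UNIV. g1 i (y $ i)) = (\<Prod>i\<in>UNIV. ?n (y $ i)) * y $ k" for y :: "real ^ 'd"
    unfolding g1_def prod.distrib by (simp add: prod.If_cases prod.delta)
  have p2: "(\<Prod>i\<in>UNIV. g2 i (y $ i)) = (\<Prod>i\<in>UNIV. ?n (y $ i)) * (y $ k * y $ l)" for y :: "real ^ 'd"
    unfolding g2_def prod.distrib by (simp add: prod.If_cases prod.delta)
  show "integrable lborel (\<lambda>y :: real ^ 'd. (\<Prod>i\<in>UNIV. ?n (y $ i)) * y $ k)"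
    using vec_prod_lborel(1)[of g1, OF G1(1)] by (simp only: p1)
  show "(\<integral>y. (\<Prod>i\<in>UNIV. ?n (y $ i)) * y $ k \<partial>(lborel :: (real ^ 'd) measure)) = 0"
    using vec_prod_lborel(2)[of g1, OF G1(1)] by (simp add: p1 G1(2))
  show "integrable lborel (\<lambda>y :: real ^ 'd. (\<Prod>i\<in>UNIV. ?n (y $ i)) * (y $ k * y $ l))"
    using vec_prod_lborel(1)[of g2, OF G2(1)] by (simp only: p2)
  have "(\<Prod>i\<in>UNIV. integral\<^sup>L lborel (g2 i)) = (if k = l then s\<^sup>2 else 0)"
  proof (cases "k = l")
    case True
    then have "(\<Prod>i\<in>UNIV. integral\<^sup>L lborel (g2 i)) = (\<Prod>i\<in>UNIV. if i = k then s\<^sup>2 else 1)"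
      by (intro prod.cong) (auto simp: G2(2))
    then show ?thesis using True by (simp add: prod.delta)
  next
    case False
    then have "integral\<^sup>L lborel (g2 k) = 0" by (simp add: G2(2))
    then show ?thesis using False by (auto intro!: prod_zero)
  qed
  then show "(\<integral>y. (\<Prod>i\<in>UNIV. ?n (y $ i)) * (y $ k * y $ l) \<partial>(lborel :: (real ^ 'd) measure)) = (if k = l then s\<^sup>2 else 0)"
    using vec_prod_lborel(2)[of g2, OF G2(1)] by (simp only: p2)
qed

lemma prob_space_completion:
  assumes "prob_space M" shows "prob_space (completion M)"
proof
  interpret prob_space M by fact
  show "emeasure (completion M) (space (completion M)) = 1"
    by (simp add: emeasure_space_1)
qed

lemma sets_aug_filtration:
  "sets (aug_filtration M B t) = sigma_sets (space M) (past_events M B t \<union> null_sets (completion M))"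
proof -
  have "past_events M B t \<union> null_sets (completion M) \<subseteq> Pow (space M)"
    using sets.sets_into_space[of _ "completion M"] by (auto simp: past_events_def null_sets_def)
  then show ?thesis by (simp add: aug_filtration_def)
qed

section \<open>Brownian motion relative to its augmented filtration\<close>

locale brownian =
  fixes M :: "'w measure" and B :: "real \<Rightarrow> 'w \<Rightarrow> real ^ 'd"
  assumes prob_M: "prob_space M" and brownian: "brownian_motion M B"
begin

abbreviation "P \<equiv> completion M"
abbreviation "Ft \<equiv> (\<lambda>t. aug_filtration M B (ennreal t))"

lemma B_measurable [measurable]: "0 \<le> t \<Longrightarrow> B t \<in> borel_measurable M"
  using brownian by (simp add: brownian_motion_def)

lemma past_events_sets: "past_events M B t \<subseteq> sets M"
  by (auto simp: past_events_def intro!: measurable_sets[OF B_measurable])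

sublocale complete_filtration P Ft
proof -
  interpret P: prob_space P by (rule prob_space_completion[OF prob_M])
  show "complete_filtration P Ft"
  proof
    fix s t :: real and N N' :: "'w set"
    show "space (Ft t) = space P" by simp
    have "past_events M B (ennreal t) \<union> null_sets P \<subseteq> sets P"
      using past_events_sets[of "ennreal t"] by (auto simp: null_sets_def)
    then show "sets (Ft t) \<subseteq> sets P"
      using sets.sigma_sets_subset[of _ P] by (simp add: sets_aug_filtration)
    show "sets (Ft s) \<subseteq> sets (Ft t)" if "s \<le> t"
      using filtration.sets_F_mono[OF filtration_aug_filtration, of "ennreal s" "ennreal t" M B] that
      by (simp add: ennreal_leI)
    show "N' \<in> sets (Ft t)" if "N \<in> null_sets P" "N' \<subseteq> N"
      using null_sets_completion_subset[OF that(2,1)]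
      by (auto simp: sets_aug_filtration intro: sigma_sets.Basic)
  qed
qed

lemma B_adapted: "0 \<le> t \<Longrightarrow> B t \<in> borel_measurable (Ft t)"
proof (rule measurableI)
  fix A :: "(real ^ 'd) set" assume "0 \<le> t" "A \<in> sets borel"
  then have "B t -` A \<inter> space M \<in> past_events M B (ennreal t)" by (auto simp: past_events_def)
  then show "B t -` A \<inter> space (Ft t) \<in> sets (Ft t)"
    by (auto simp: sets_aug_filtration intro: sigma_sets.Basic)
qed auto

text \<open>Independence of increments is given for the raw past. Since augmentation changes events
  by null sets only, this lemma carries it over to the augmented filtration.\<close>

lemma aug_sets_approx:
  assumes "A \<in> sets (Ft s)"
  shows "\<exists>A'\<in>sigma_sets (space M) (past_events M B (ennreal s)). AE w in P. w \<in> A \<longleftrightarrow> w \<in> A'"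
  using assms unfolding sets_aug_filtration
proof (induction rule: sigma_sets.induct)
  case (Basic a)
  then show ?case
  proof
    assume "a \<in> null_sets P"
    then show ?thesis using AE_not_in[of a P] by (auto intro!: bexI[of _ "{}"] sigma_sets.Empty)
  qed (auto intro!: bexI[of _ a])
next
  case Empty
  then show ?case by (auto intro!: bexI[of _ "{}"] sigma_sets.Empty)
next
  case (Compl a)
  then obtain a' where a': "a' \<in> sigma_sets (space M) (past_events M B (ennreal s))" "AE w in P. w \<in> a \<longleftrightarrow> w \<in> a'" by blast
  have "AE w in P. w \<in> space M - a \<longleftrightarrow> w \<in> space M - a'" using a'(2) by eventually_elim auto
  with a'(1) show ?case by (blast intro: sigma_sets.Compl)
next
  case (Union a)
  then obtain a' where a': "\<And>i::nat. a' i \<in> sigma_sets (space M) (past_events M B (ennreal s))"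
    "\<And>i. AE w in P. w \<in> a i \<longleftrightarrow> w \<in> a' i" by metis
  have "AE w in P. \<forall>i. w \<in> a i \<longleftrightarrow> w \<in> a' i" using a'(2) by (simp add: AE_all_countable)
  then have "AE w in P. w \<in> (\<Union>i. a i) \<longleftrightarrow> w \<in> (\<Union>i. a' i)" by eventually_elim auto
  with a'(1) show ?case by (blast intro: sigma_sets.Union)
qed

lemma increment_indep_prob:
  assumes st: "0 \<le> s" "s < t" and A: "A \<in> sets (Ft s)" and C: "C \<in> sets borel"
  shows "prob (A \<inter> ((\<lambda>w. B t w - B s w) -` C \<inter> space M)) = prob A * prob ((\<lambda>w. B t w - B s w) -` C \<inter> space M)"
proof -
  interpret M: prob_space M by (rule prob_M)
  let ?C = "(\<lambda>w. B t w - B s w) -` C \<inter> space M"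
  have [measurable]: "B t \<in> borel_measurable M" "B s \<in> borel_measurable M" using st by auto
  have Cm: "?C \<in> sets M" using C by measurable
  obtain A' where A': "A' \<in> sigma_sets (space M) (past_events M B (ennreal s))" "AE w in P. w \<in> A \<longleftrightarrow> w \<in> A'"
    using aug_sets_approx[OF A] by blast
  have A'm: "A' \<in> sets M" using A'(1) sets.sigma_sets_subset[OF past_events_sets] by blast
  have AP: "A \<in> sets P" using A sets_F by blast
  have "M.indep_set (sigma_sets (space M) (past_events M B (ennreal s))) {(\<lambda>w. B t w - B s w) -` A \<inter> space M | A. A \<in> sets borel}"
    using brownian st by (simp add: brownian_motion_def)
  then have ind: "measure M (A' \<inter> ?C) = measure M A' * measure M ?C"
    by (rule M.indep_setD) (use A' C in auto)
  have "prob (A \<inter> ?C) = prob (A' \<inter> ?C)"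
    by (rule finite_measure_eq_AE) (use A'(2) AP A'm Cm in \<open>auto elim!: eventually_mono\<close>)
  moreover have "prob A = prob A'"
    by (rule finite_measure_eq_AE) (use A'(2) AP A'm in \<open>auto elim!: eventually_mono\<close>)
  ultimately show ?thesis using ind A'm Cm by (simp add: sets.Int)
qed

lemma increment_indep_var:
  fixes g :: "real ^ 'd \<Rightarrow> real" and W :: "'w \<Rightarrow> real"
  assumes st: "0 \<le> s" "s < t" and W: "W \<in> borel_measurable (Ft s)" and g: "g \<in> borel_measurable borel"
  shows "indep_var borel W borel (\<lambda>w. g (B t w - B s w))"
proof -
  have [measurable]: "B t \<in> borel_measurable M" "B s \<in> borel_measurable M" using st by auto
  let ?D = "\<lambda>w. B t w - B s w"
  have D: "?D \<in> borel_measurable P" by (intro measurable_completion) measurable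
  have "indep_set (sets (Ft s)) {?D -` A \<inter> space M | A. A \<in> sets borel}"
  proof (rule indep_setI)
    show "sets (Ft s) \<subseteq> events" by (rule sets_F)
    show "{?D -` A \<inter> space M | A. A \<in> sets borel} \<subseteq> events"
      using measurable_sets[OF D] by auto
  qed (use increment_indep_prob[OF st] in auto)
  then have i: "indep_set (sigma_sets (space P) (sets (Ft s))) (sigma_sets (space P) {?D -` A \<inter> space M | A. A \<in> sets borel})"
  proof (rule indep_set_sigma_sets)
    show "Int_stable (sets (Ft s))" by (auto simp: Int_stable_def)
    show "Int_stable {?D -` A \<inter> space M | A. A \<in> sets borel}"
    proof (clarsimp simp: Int_stable_def)
      fix A A' :: "(real ^ 'd) set" assume "A \<in> sets borel" "A' \<in> sets borel"
      then show "\<exists>Aa. ?D -` A \<inter> space M \<inter> (?D -` A' \<inter> space M) = ?D -` Aa \<inter> space M \<and> Aa \<in> sets borel"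
        by (intro exI[of _ "A \<inter> A'"]) auto
    qed
  qed
  have 1: "sigma_sets (space P) {W -` A \<inter> space P |A. A \<in> sets borel} \<subseteq> sigma_sets (space P) (sets (Ft s))"
    using measurable_sets[OF W] by (intro sigma_sets_mono') auto
  have 2: "sigma_sets (space P) {(\<lambda>w. g (?D w)) -` A \<inter> space P |A. A \<in> sets borel}
      \<subseteq> sigma_sets (space P) {?D -` A \<inter> space M | A. A \<in> sets borel}"
  proof (rule sigma_sets_mono', clarsimp)
    fix A :: "real set" assume "A \<in> sets borel"
    then show "\<exists>Aa. (\<lambda>w. g (?D w)) -` A \<inter> space M = ?D -` Aa \<inter> space M \<and> Aa \<in> sets borel"
      using measurable_sets[OF g, of A] by (intro exI[of _ "g -` A"]) auto
  qed
  show ?thesis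
    unfolding indep_var_eq indep_sets2_eq
  proof (intro conjI)
    show "random_variable borel W" using W by (rule measurable_F)
    show "random_variable borel (\<lambda>w. g (?D w))" using measurable_compose[OF D g] .
  qed (use i 1 2 in \<open>simp_all only: indep_sets2_eq, blast+\<close>)
qed

lemma increment_moments:
  assumes st: "0 \<le> s" "s < t"
  shows "integrable P (\<lambda>w. (B t w - B s w) $ k)" "expectation (\<lambda>w. (B t w - B s w) $ k) = 0"
    "integrable P (\<lambda>w. (B t w - B s w) $ k * (B t w - B s w) $ l)"
    "expectation (\<lambda>w. (B t w - B s w) $ k * (B t w - B s w) $ l) = (if k = l then t - s else 0)"
proof -
  have [measurable]: "B t \<in> borel_measurable M" "B s \<in> borel_measurable M" using st by auto
  let ?f = "\<lambda>y :: real ^ 'd. \<Prod>i\<in>UNIV. normal_density 0 (sqrt (t - s)) (y $ i)"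
  have d: "distributed M lborel (\<lambda>w. B t w - B s w) ?f"
    using brownian st by (simp add: brownian_motion_def)
  have s: "sqrt (t - s) > 0" using st by simp
  have nn: "0 \<le> ?f y" for y by (intro prod_nonneg) auto
  have int: "integrable P (\<lambda>w. g (B t w - B s w))" "expectation (\<lambda>w. g (B t w - B s w)) = (\<integral>y. ?f y * g y \<partial>lborel)"
    if "integrable lborel (\<lambda>y. ?f y * g y)" and [measurable]: "g \<in> borel_measurable borel" for g :: "real ^ 'd \<Rightarrow> real"
    using distributed_integrable[OF d, of g] distributed_integral[OF d, of g] that nn
    by (simp_all add: integrable_completion integral_completion)
  note m = gaussian_vec_moments[OF s]
  show "integrable P (\<lambda>w. (B t w - B s w) $ k)" "expectation (\<lambda>w. (B t w - B s w) $ k) = 0"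
    using int[OF m(1)] m(2) by simp_all
  show "integrable P (\<lambda>w. (B t w - B s w) $ k * (B t w - B s w) $ l)"
    "expectation (\<lambda>w. (B t w - B s w) $ k * (B t w - B s w) $ l) = (if k = l then t - s else 0)"
    using int[OF m(3)[of k l]] m(4)[of k l] st by (simp_all only: real_sqrt_pow2 diff_ge_0_iff_ge less_imp_le borel_measurable_const) measurable
qed

text \<open>The case \<open>s = t\<close> is included because clamping a time grid to an interval
  produces such empty steps.\<close>

lemma increment_mult_mean:
  assumes st: "0 \<le> s" "s \<le> t" and W: "W \<in> borel_measurable (Ft s)" "integrable P W"
  shows "integrable P (\<lambda>w. W w * (B t w - B s w) $ k)" "expectation (\<lambda>w. W w * (B t w - B s w) $ k) = 0"
proof -
  have "integrable P (\<lambda>w. W w * (B t w - B s w) $ k) \<and> expectation (\<lambda>w. W w * (B t w - B s w) $ k) = 0"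
  proof (cases "s < t")
    case True
    note i = increment_indep_var[OF st(1) True W(1), of "\<lambda>y. y $ k"]
    show ?thesis
      using indep_var_integrable[OF i W(2)] indep_var_lebesgue_integral[OF i W(2)] increment_moments[OF st(1) True, of k] by simp
  qed (use st in simp)
  then show "integrable P (\<lambda>w. W w * (B t w - B s w) $ k)" "expectation (\<lambda>w. W w * (B t w - B s w) $ k) = 0" by auto
qed

lemma increment_mult_cov:
  assumes st: "0 \<le> s" "s \<le> t" and W: "W \<in> borel_measurable (Ft s)" "integrable P W"
  shows "integrable P (\<lambda>w. W w * ((B t w - B s w) $ k * (B t w - B s w) $ l))"
    "expectation (\<lambda>w. W w * ((B t w - B s w) $ k * (B t w - B s w) $ l)) = (if k = l then (t - s) * expectation W else 0)"
proof -
  have "integrable P (\<lambda>w. W w * ((B t w - B s w) $ k * (B t w - B s w) $ l)) \<and>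
    expectation (\<lambda>w. W w * ((B t w - B s w) $ k * (B t w - B s w) $ l)) = (if k = l then (t - s) * expectation W else 0)"
  proof (cases "s < t")
    case True
    note i = increment_indep_var[OF st(1) True W(1), of "\<lambda>y. y $ k * y $ l"]
    show ?thesis
      using indep_var_integrable[OF i W(2)] indep_var_lebesgue_integral[OF i W(2)] increment_moments(3,4)[OF st(1) True, of k l] by simp
  qed (use st in simp)
  then show "integrable P (\<lambda>w. W w * ((B t w - B s w) $ k * (B t w - B s w) $ l))"
    "expectation (\<lambda>w. W w * ((B t w - B s w) $ k * (B t w - B s w) $ l)) = (if k = l then (t - s) * expectation W else 0)" by auto
qed

lemma increment_adapted:
  assumes "0 \<le> a" "0 \<le> b" "a \<le> c" "b \<le> c"
  shows "(\<lambda>w. (B b w - B a w) $ k) \<in> borel_measurable (Ft c)"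
proof -
  have [measurable]: "B a \<in> borel_measurable (Ft c)" "B b \<in> borel_measurable (Ft c)"
    using measurable_F_mono[OF _ B_adapted] assms by auto
  have "(\<lambda>w. B b w - B a w) \<in> borel_measurable (Ft c)" by measurable
  moreover have "(\<lambda>y :: real ^ 'd. y $ k) \<in> borel_measurable borel" by measurable
  ultimately show ?thesis by (rule measurable_compose)
qed

lemma bounded_integrable:
  fixes W :: "'w \<Rightarrow> real"
  assumes "W \<in> borel_measurable (Ft s)" "\<And>w. w \<in> space M \<Longrightarrow> \<bar>W w\<bar> \<le> C"
  shows "integrable P W"
  by (rule integrable_const_bound[of _ C]) (use assms measurable_F in auto)

text \<open>Only the common part of the two intervals contributes. With the starting points ordered,
  the product \<open>h w * h' w\<close> is known at \<open>c\<close>.\<close>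

lemma increment_pair_ordered:
  assumes ab: "0 \<le> a" "a \<le> b" and cd: "c \<le> d" and ac: "a \<le> c"
    and h: "h \<in> borel_measurable (Ft a)" and h': "h' \<in> borel_measurable (Ft c)"
    and hb: "\<And>w. w \<in> space M \<Longrightarrow> \<bar>h w\<bar> \<le> C" and hb': "\<And>w. w \<in> space M \<Longrightarrow> \<bar>h' w\<bar> \<le> C'"
  shows "integrable P (\<lambda>w. (h w * (B b w - B a w) $ k) * (h' w * (B d w - B c w) $ l)) \<and>
    expectation (\<lambda>w. (h w * (B b w - B a w) $ k) * (h' w * (B d w - B c w) $ l))
      = (if k = l then max 0 (min b d - max a c) * expectation (\<lambda>w. h w * h' w) else 0)"
proof -
  have c: "0 \<le> c" using ab ac by simp
  define W where "W w = h w * h' w" for w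
  have Wc: "W \<in> borel_measurable (Ft c)"
    using measurable_F_mono[OF ac h] h' unfolding W_def[abs_def] by measurable
  have Wb: "\<bar>W w\<bar> \<le> C * C'" if "w \<in> space M" for w
    unfolding W_def abs_mult using hb[OF that] hb'[OF that] by (intro mult_mono) auto
  have Wi: "integrable P W" by (rule bounded_integrable[OF Wc Wb])
  define x where "x p q j w = (B q w - B p w) $ j" for p q j w
  \<comment> \<open>Of two successive increments the first belongs to the past of the second, so
    their weighted product has mean zero.\<close>
  have xW: "integrable P (\<lambda>w. W w * x p q j w * x r t i w) \<and> expectation (\<lambda>w. W w * x p q j w * x r t i w) = 0"
    if "0 \<le> p" "p \<le> q" "q \<le> r" "r \<le> t" "c \<le> r" for p q r t i j
  proof -
    have m: "(\<lambda>w. W w * x p q j w) \<in> borel_measurable (Ft r)"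
      unfolding x_def using measurable_F_mono[OF that(5) Wc] increment_adapted[of p q r j] that
      by (intro borel_measurable_times) auto
    have "integrable P (x p q j)"
    proof -
      have "integrable P (\<lambda>w. 1 * (B q w - B p w) $ j)" by (rule increment_mult_mean(1)) (use that in auto)
      then show ?thesis by (simp only: mult_1_left x_def[abs_def])
    qed
    then have "integrable P (\<lambda>w. W w * x p q j w)"
    proof (rule Bochner_Integration.integrable_bound[OF integrable_mult_right[of "C * C'"]])
      show "(\<lambda>w. W w * x p q j w) \<in> borel_measurable P" by (rule measurable_F[OF m])
      show "AE w in P. norm (W w * x p q j w) \<le> norm (C * C' * x p q j w)"
      proof (rule AE_I2)
        fix w assume "w \<in> space P"
        then have "\<bar>W w\<bar> \<le> \<bar>C * C'\<bar>" using Wb[of w] by simp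
        then show "norm (W w * x p q j w) \<le> norm (C * C' * x p q j w)"
          unfolding real_norm_def abs_mult[of _ "x p q j w"] by (rule mult_right_mono) simp
      qed
    qed
    from increment_mult_mean[OF _ that(4) m this, of i] that show ?thesis by (auto simp: x_def mult.assoc)
  qed
  show ?thesis
  proof (cases "b \<le> c")
    case True
    have "(\<lambda>w. (h w * (B b w - B a w) $ k) * (h' w * (B d w - B c w) $ l)) = (\<lambda>w. W w * x a b k w * x c d l w)"
      by (auto simp: W_def x_def)
    moreover have "max 0 (min b d - max a c) = 0" using True by auto
    ultimately show ?thesis using xW[of a b c d k l] ab cd True by auto
  next
    case False
    \<comment> \<open>The end of the overlap \<open>{c..e}\<close>. Cutting both increments at
      \<open>c\<close> and \<open>e\<close> leaves a product over the overlap and products over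
      disjoint intervals.\<close>
    define e where "e = min b d"
    have e: "c \<le> e" "e \<le> b" "e \<le> d" using False cd by (auto simp: e_def)
    have eq: "(\<lambda>w. (h w * (B b w - B a w) $ k) * (h' w * (B d w - B c w) $ l))
       = (\<lambda>w. W w * x a c k w * x c d l w + W w * (x c e k w * x c e l w)
            + W w * x c e k w * x e d l w + W w * x c e l w * x e b k w)"
    proof
      fix w
      \<comment> \<open>At most one of the two intervals extends beyond \<open>e\<close>.\<close>
      have z: "x e b k w * x e d l w = 0" unfolding e_def x_def by (cases "b \<le> d") auto
      have s: "x a b k w = x a c k w + x c e k w + x e b k w" "x c d l w = x c e l w + x e d l w"
        by (simp_all add: x_def)
      have "(h w * x a b k w) * (h' w * x c d l w) = W w * x a c k w * x c d l w + W w * (x c e k w * x c e l w)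
            + W w * x c e k w * x e d l w + W w * x c e l w * x e b k w + W w * (x e b k w * x e d l w)"
        unfolding s W_def by (simp add: algebra_simps)
      then show "(h w * (B b w - B a w) $ k) * (h' w * (B d w - B c w) $ l)
         = W w * x a c k w * x c d l w + W w * (x c e k w * x c e l w)
            + W w * x c e k w * x e d l w + W w * x c e l w * x e b k w"
        unfolding z by (simp add: x_def)
    qed
    have 2: "integrable P (\<lambda>w. W w * (x c e k w * x c e l w))"
        "expectation (\<lambda>w. W w * (x c e k w * x c e l w)) = (if k = l then (e - c) * expectation W else 0)"
      unfolding x_def by (rule increment_mult_cov[OF c e(1) Wc Wi])+
    note 1 = xW[of a c c d k l] and 3 = xW[of c e e d k l] and 4 = xW[of c e e b l k]
    have i: "integrable P (\<lambda>w. W w * x a c k w * x c d l w)" "integrable P (\<lambda>w. W w * (x c e k w * x c e l w))"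
      "integrable P (\<lambda>w. W w * x c e k w * x e d l w)" "integrable P (\<lambda>w. W w * x c e l w * x e b k w)"
      using 1 2 3 4 ab cd ac c e by auto
    have "max 0 (min b d - max a c) = e - c" using e ac by (auto simp: e_def)
    then show ?thesis unfolding eq
      using i 1 2 3 4 ab cd ac c e by (simp add: W_def[symmetric])
  qed
qed

lemma increment_pair:
  assumes ab: "0 \<le> a" "a \<le> b" and cd: "0 \<le> c" "c \<le> d"
    and h: "h \<in> borel_measurable (Ft a)" and h': "h' \<in> borel_measurable (Ft c)"
    and hb: "\<And>w. w \<in> space M \<Longrightarrow> \<bar>h w\<bar> \<le> C" and hb': "\<And>w. w \<in> space M \<Longrightarrow> \<bar>h' w\<bar> \<le> C'"
  shows "integrable P (\<lambda>w. (h w * (B b w - B a w) $ k) * (h' w * (B d w - B c w) $ l)) \<and>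
    expectation (\<lambda>w. (h w * (B b w - B a w) $ k) * (h' w * (B d w - B c w) $ l))
      = (if k = l then max 0 (min b d - max a c) * expectation (\<lambda>w. h w * h' w) else 0)"
proof -
  show ?thesis
  proof (cases "a \<le> c")
    case True
    show ?thesis by (rule increment_pair_ordered[OF ab cd(2) True h h' hb hb'])
  next
    case False
    then have "c \<le> a" by simp
    from increment_pair_ordered[OF cd ab(2) this h' h hb' hb, of l k]
    show ?thesis by (cases "k = l") (simp_all add: mult.commute min.commute max.commute)
  qed
qed

end

subsection \<open>The Ito integral of a square integrable integrand\<close>

abbreviation clamp :: "real \<Rightarrow> real \<Rightarrow> real \<Rightarrow> real" where
  "clamp u t x \<equiv> max u (min t x)"

lemma measure_Icc_Int_Ioc:
  fixes u t x y :: real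
  assumes "u \<le> t"
  shows "measure lborel ({u..t} \<inter> {x<..y}) = max 0 (clamp u t y - clamp u t x)"
proof (cases "x < u")
  case True
  then have "{u..t} \<inter> {x<..y} = {u..min t y}" by auto
  then show ?thesis using assms True by (auto simp: max_def min_def)
next
  case False
  then have "{u..t} \<inter> {x<..y} = {x<..min t y}" by auto
  then show ?thesis using assms False by (auto simp: max_def min_def)
qed

text \<open>Lebesgue measure on the interval as a finite measure with its own space, ready for
  products with the probability space and Fubini's theorem.\<close>

definition time_measure :: "real \<Rightarrow> real measure" where
  "time_measure T = restrict_space lborel {0..T}"

lemma space_time_measure [simp]: "space (time_measure T) = {0..T}"
  by (simp add: time_measure_def space_restrict_space)

lemma sets_time_measure [measurable_cong]: "sets (time_measure T) = sets (restrict_space borel {0..T})"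
  by (simp add: time_measure_def sets_restrict_space)

lemma finite_time_measure: "finite_measure (time_measure T)"
proof (rule finite_measureI)
  have "emeasure lborel {0..T} \<noteq> \<infinity>" by (cases "0 \<le> T") auto
  then show "emeasure (time_measure T) (space (time_measure T)) \<noteq> \<infinity>"
    by (simp add: time_measure_def emeasure_restrict_space space_restrict_space)
qed

lemma borel_measurable_time_measure: "f \<in> borel_measurable borel \<Longrightarrow> f \<in> borel_measurable (time_measure T)"
  by (simp add: time_measure_def measurable_restrict_space1)

lemma nn_integral_time_measure:
  "(\<integral>\<^sup>+ r. f r \<partial>time_measure T) = (\<integral>\<^sup>+ r\<in>{0..T}. f r \<partial>lborel)"
  unfolding time_measure_def by (subst nn_integral_restrict_space) (auto simp: mult.commute)

lemma simple_processD:
  assumes "simple_process M B m s h" "i < m"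
  shows "0 \<le> s i" "s i \<le> s (Suc i)" "h i \<in> borel_measurable (aug_filtration M B (ennreal (s i)))"
  using assms by (auto simp: simple_process_def)

lemma simple_process_mono:
  assumes "simple_process M B m s h" "i \<le> j" "j \<le> m" shows "s i \<le> s j"
  using assms(2,3)
proof (induction j rule: dec_induct)
  case (step j)
  then show ?case using simple_processD(2)[OF assms(1), of j] by simp
qed simp

section \<open>Mean and isometry of simple integrals\<close>

context brownian
begin

sublocale TP: pair_sigma_finite "time_measure T" P for T
proof -
  interpret a: finite_measure "time_measure T" by (rule finite_time_measure)
  show "pair_sigma_finite (time_measure T) P" by standard
qed

abbreviation "Q T \<equiv> time_measure T \<Otimes>\<^sub>M P"

lemma product_integral_mult:
  fixes f :: "real \<Rightarrow> real" and g :: "'w \<Rightarrow> real"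
  assumes f: "integrable (time_measure T) f" and g: "integrable P g"
  shows "integrable (Q T) (\<lambda>(r, w). f r * g w)"
    "(\<integral>(r, w). f r * g w \<partial>Q T) = integral\<^sup>L (time_measure T) f * expectation g"
proof -
  show i: "integrable (Q T) (\<lambda>(r, w). f r * g w)"
  proof (rule TP.Fubini_integrable)
    have [measurable]: "f \<in> borel_measurable (time_measure T)" "g \<in> borel_measurable P" using f g by auto
    show "(\<lambda>(r, w). f r * g w) \<in> borel_measurable (Q T)" by measurable
    show "AE x in time_measure T. integrable P (\<lambda>y. case (x, y) of (r, w) \<Rightarrow> f r * g w)" using g by auto
    show "integrable (time_measure T) (\<lambda>x. \<integral> y. norm (case (x, y) of (r, w) \<Rightarrow> f r * g w) \<partial>P)"
      using f g by (simp add: abs_mult)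
  qed
  show "(\<integral>(r, w). f r * g w \<partial>Q T) = integral\<^sup>L (time_measure T) f * expectation g"
    using TP.integral_fst[OF i] by simp
qed

lemma simple_process_bound:
  assumes "simple_process M B m s h"
  obtains C where "\<And>i w. i < m \<Longrightarrow> w \<in> space M \<Longrightarrow> norm (h i w) \<le> C"
  using assms by (auto simp: simple_process_def)

text \<open>An increment over \<open>{u..t}\<close> sees only the grid clamped to this interval. The
  factor \<open>of_bool (s i \<le> t)\<close> discards coefficients of steps that start after
  \<open>t\<close>: their clamped increments vanish, but they are not known at the clamped
  time.\<close>

lemma simple_int_increment:
  assumes sp: "simple_process M B m s h" and "0 \<le> u" "u \<le> t"
  shows "indicator A w * (simple_int B m s h t w - simple_int B m s h u w)
    = (\<Sum>(i, k)\<in>{..<m} \<times> UNIV. (indicator A w * of_bool (s i \<le> t) * h i w $ k)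
        * (B (clamp u t (s (Suc i))) w - B (clamp u t (s i)) w) $ k)"
proof -
  \<comment> \<open>Wherever \<open>x\<close> lies, \<open>B (min t x) w - B (min u x) w\<close> is
    the increment from \<open>u\<close> to the clamped point.\<close>
  have cl: "(B (min t y) w - B (min t x) w) - (B (min u y) w - B (min u x) w) = B (clamp u t y) w - B (clamp u t x) w" for x y
  proof -
    have "B (min t x) w - B (min u x) w = B (clamp u t x) w - B u w" for x
      using assms by (auto simp: min_def max_def)
    note c = this
    have "(B (min t y) w - B (min t x) w) - (B (min u y) w - B (min u x) w)
        = (B (min t y) w - B (min u y) w) - (B (min t x) w - B (min u x) w)" by (simp add: algebra_simps)
    then show ?thesis unfolding c by simp
  qed
  have "simple_int B m s h t w - simple_int B m s h u w
      = (\<Sum>i<m. h i w \<bullet> (B (clamp u t (s (Suc i))) w - B (clamp u t (s i)) w))"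
    unfolding simple_int_def sum_subtractf[symmetric] inner_diff_right[symmetric] cl ..
  also have "\<dots> = (\<Sum>i<m. \<Sum>k\<in>UNIV. of_bool (s i \<le> t) * h i w $ k * (B (clamp u t (s (Suc i))) w - B (clamp u t (s i)) w) $ k)"
  proof (rule sum.cong[OF refl])
    fix i assume "i \<in> {..<m}"
    then have "s i \<le> s (Suc i)" using simple_processD(2)[OF sp] by auto
    then show "h i w \<bullet> (B (clamp u t (s (Suc i))) w - B (clamp u t (s i)) w)
        = (\<Sum>k\<in>UNIV. of_bool (s i \<le> t) * h i w $ k * (B (clamp u t (s (Suc i))) w - B (clamp u t (s i)) w) $ k)"
      by (cases "s i \<le> t") (auto simp: inner_vec_def min_def)
  qed
  finally show ?thesis
    by (simp only: sum_distrib_left sum.cartesian_product mult.assoc case_prod_beta')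
qed

lemma simple_int_coeff:
  assumes sp: "simple_process M B m s h" and u: "0 \<le> u" "u \<le> t" and A: "A \<in> sets (Ft u)" and i: "i < m"
  shows "(\<lambda>w. indicator A w * of_bool (s i \<le> t) * h i w $ k) \<in> borel_measurable (Ft (clamp u t (s i)))"
proof (cases "s i \<le> t")
  case True
  have h: "h i \<in> borel_measurable (Ft (clamp u t (s i)))"
    using True by (intro measurable_F_mono[OF _ simple_processD(3)[OF sp i]]) auto
  have "A \<in> sets (Ft (clamp u t (s i)))" using A F_mono[of u "clamp u t (s i)"] by auto
  moreover have "(\<lambda>w. h i w $ k) \<in> borel_measurable (Ft (clamp u t (s i)))"
    by (rule measurable_compose[OF h]) measurable
  ultimately show ?thesis by measurable
qed simp

lemma simple_int_coeff_bound:
  assumes "w \<in> space M" and C: "norm (h i w) \<le> C"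
  shows "\<bar>indicator A w * of_bool (s i \<le> t) * h i w $ k\<bar> \<le> C"
  using order_trans[OF component_le_norm_cart C, of k] order_trans[OF norm_ge_zero C]
  by (auto simp: indicator_def)

lemma simple_int_mean:
  assumes sp: "simple_process M B m s h" and u: "0 \<le> u" "u \<le> t" and A: "A \<in> sets (Ft u)"
  shows "integrable P (\<lambda>w. indicator A w * (simple_int B m s h t w - simple_int B m s h u w))"
    "expectation (\<lambda>w. indicator A w * (simple_int B m s h t w - simple_int B m s h u w)) = 0"
proof -
  obtain C where C: "\<And>i w. i < m \<Longrightarrow> w \<in> space M \<Longrightarrow> norm (h i w) \<le> C" using simple_process_bound[OF sp] by blast
  have 1: "integrable P (\<lambda>w. (indicator A w * of_bool (s i \<le> t) * h i w $ k) * (B (clamp u t (s (Suc i))) w - B (clamp u t (s i)) w) $ k)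
    \<and> expectation (\<lambda>w. (indicator A w * of_bool (s i \<le> t) * h i w $ k) * (B (clamp u t (s (Suc i))) w - B (clamp u t (s i)) w) $ k) = 0"
    if "i < m" for i k
  proof -
    note m = simple_int_coeff[OF sp u A that]
    have "integrable P (\<lambda>w. indicator A w * of_bool (s i \<le> t) * h i w $ k)"
    proof (rule bounded_integrable[OF m, where C=C])
      fix w assume w: "w \<in> space M"
      show "\<bar>indicator A w * of_bool (s i \<le> t) * h i w $ k\<bar> \<le> C"
        by (rule simple_int_coeff_bound[of w h i C A s t k, OF w C[OF that w]])
    qed
    moreover have "0 \<le> clamp u t (s i)" "clamp u t (s i) \<le> clamp u t (s (Suc i))"
      using u simple_processD(2)[OF sp that] by auto
    ultimately show ?thesis using increment_mult_mean[OF _ _ m] by blast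
  qed
  show "integrable P (\<lambda>w. indicator A w * (simple_int B m s h t w - simple_int B m s h u w))"
    unfolding simple_int_increment[OF sp u] by (intro Bochner_Integration.integrable_sum) (use 1 in auto)
  show "expectation (\<lambda>w. indicator A w * (simple_int B m s h t w - simple_int B m s h u w)) = 0"
    unfolding simple_int_increment[OF sp u]
    by (subst Bochner_Integration.integral_sum) (use 1 in \<open>auto intro!: sum.neutral\<close>)
qed

text \<open>Two different grids are allowed because approximations of one integral must be compared
  with each other; an event of the past is allowed for the sake of the martingale property of
  products. Both sides expand into the same sum over pairs of steps and coordinates, weighted by
  overlap lengths.\<close>

lemma simple_int_isometry:
  assumes sp: "simple_process M B m s h" and sp': "simple_process M B m' s' h'"
    and u: "0 \<le> u" "u \<le> t" "t \<le> T" and A: "A \<in> sets (Ft u)"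
  shows "integrable P (\<lambda>w. indicator A w * ((simple_int B m s h t w - simple_int B m s h u w) * (simple_int B m' s' h' t w - simple_int B m' s' h' u w)))"
    "integrable (Q T) (\<lambda>(r, w). indicator {u..t} r * indicator A w * (simple_val m s h r w \<bullet> simple_val m' s' h' r w))"
    "expectation (\<lambda>w. indicator A w * ((simple_int B m s h t w - simple_int B m s h u w) * (simple_int B m' s' h' t w - simple_int B m' s' h' u w)))
     = (\<integral>(r, w). indicator {u..t} r * indicator A w * (simple_val m s h r w \<bullet> simple_val m' s' h' r w) \<partial>Q T)"
proof -
  obtain C where C: "\<And>i w. i < m \<Longrightarrow> w \<in> space M \<Longrightarrow> norm (h i w) \<le> C" using simple_process_bound[OF sp] by blast
  obtain C' where C': "\<And>i w. i < m' \<Longrightarrow> w \<in> space M \<Longrightarrow> norm (h' i w) \<le> C'" using simple_process_bound[OF sp'] by blast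
  define I where "I = {..<m} \<times> (UNIV :: 'd set)"
  define I' where "I' = {..<m'} \<times> (UNIV :: 'd set)"
  define c where "c p w = indicator A w * of_bool (s (fst p) \<le> t) * h (fst p) w $ snd p" for p :: "nat \<times> 'd" and w
  define c' where "c' p w = indicator A w * of_bool (s' (fst p) \<le> t) * h' (fst p) w $ snd p" for p :: "nat \<times> 'd" and w
  define a where "a i = clamp u t (s i)" for i
  define a' where "a' i = clamp u t (s' i)" for i
  \<comment> \<open>The length of the overlap of two clamped steps; \<open>\<phi>\<close> below
    integrates to it.\<close>
  define l where "l i j = max 0 (min (a (Suc i)) (a' (Suc j)) - max (a i) (a' j))" for i j
  define X where "X p w = c p w * (B (a (Suc (fst p))) w - B (a (fst p)) w) $ snd p" for p :: "nat \<times> 'd" and w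
  define X' where "X' p w = c' p w * (B (a' (Suc (fst p))) w - B (a' (fst p)) w) $ snd p" for p :: "nat \<times> 'd" and w
  have cm: "c p \<in> borel_measurable (Ft (a (fst p)))" "\<And>w. w \<in> space M \<Longrightarrow> \<bar>c p w\<bar> \<le> C" if "p \<in> I" for p
    using simple_int_coeff[OF sp u(1,2) A, of "fst p" "snd p"]
      simple_int_coeff_bound[of _ h "fst p" C A s t "snd p"] C[of "fst p"] that
    unfolding c_def[abs_def] a_def I_def by auto
  have cm': "c' p \<in> borel_measurable (Ft (a' (fst p)))" "\<And>w. w \<in> space M \<Longrightarrow> \<bar>c' p w\<bar> \<le> C'" if "p \<in> I'" for p
    using simple_int_coeff[OF sp' u(1,2) A, of "fst p" "snd p"]
      simple_int_coeff_bound[of _ h' "fst p" C' A s' t "snd p"] C'[of "fst p"] that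
    unfolding c'_def[abs_def] a'_def I'_def by auto
  have ab: "0 \<le> a (fst p)" "a (fst p) \<le> a (Suc (fst p))" if "p \<in> I" for p
    using u simple_processD(2)[OF sp, of "fst p"] that by (auto simp: a_def I_def)
  have ab': "0 \<le> a' (fst p)" "a' (fst p) \<le> a' (Suc (fst p))" if "p \<in> I'" for p
    using u simple_processD(2)[OF sp', of "fst p"] that by (auto simp: a'_def I'_def)
  have XX: "integrable P (\<lambda>w. X p w * X' p' w) \<and> expectation (\<lambda>w. X p w * X' p' w)
      = (if snd p = snd p' then l (fst p) (fst p') * expectation (\<lambda>w. c p w * c' p' w) else 0)"
    if p: "p \<in> I" "p' \<in> I'" for p p'
    unfolding X_def X'_def l_def by (rule increment_pair[OF ab[OF p(1)] ab'[OF p(2)] cm(1)[OF p(1)] cm'(1)[OF p(2)] cm(2)[OF p(1)] cm'(2)[OF p(2)]])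
  \<comment> \<open>The indicator is idempotent, so each factor receives its own copy, as in
    \<open>simple_int_increment\<close>.\<close>
  have prod: "indicator A w * ((simple_int B m s h t w - simple_int B m s h u w) * (simple_int B m' s' h' t w - simple_int B m' s' h' u w))
      = (\<Sum>p\<in>I. \<Sum>p'\<in>I'. X p w * X' p' w)" for w
  proof -
    have "indicator A w * ((simple_int B m s h t w - simple_int B m s h u w) * (simple_int B m' s' h' t w - simple_int B m' s' h' u w))
      = (indicator A w * (simple_int B m s h t w - simple_int B m s h u w)) * (indicator A w * (simple_int B m' s' h' t w - simple_int B m' s' h' u w))"
      by (auto simp: indicator_def)
    also have "\<dots> = (\<Sum>p\<in>I. X p w) * (\<Sum>p'\<in>I'. X' p' w)"
      unfolding simple_int_increment[OF sp u(1,2)] simple_int_increment[OF sp' u(1,2)] I_def I'_def X_def X'_def c_def c'_def a_def a'_def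
      by (simp add: case_prod_beta')
    finally show ?thesis by (simp only: sum_product)
  qed
  define \<phi> where "\<phi> i j r = (indicator {u..t} r * indicator {s i<..s (Suc i)} r * indicator {s' j<..s' (Suc j)} r :: real)" for i j r
  have [measurable]: "\<phi> i j \<in> borel_measurable borel" for i j unfolding \<phi>_def[abs_def] by measurable
  have \<phi>i: "integrable (time_measure T) (\<phi> i j)" for i j
  proof -
    interpret finite_measure "time_measure T" by (rule finite_time_measure)
    show ?thesis
      by (rule integrable_const_bound[of _ 1]) (auto simp: \<phi>_def indicator_def intro: borel_measurable_time_measure)
  qed
  have \<phi>l: "integral\<^sup>L (time_measure T) (\<phi> i j) = l i j" for i j
  proof -
    have "integral\<^sup>L (time_measure T) (\<phi> i j) = (\<integral>r. indicator ({u..t} \<inter> {max (s i) (s' j)<..min (s (Suc i)) (s' (Suc j))}) r \<partial>lborel)"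
    proof -
      have "indicator {0..T} r *\<^sub>R \<phi> i j r = indicator ({u..t} \<inter> {max (s i) (s' j)<..min (s (Suc i)) (s' (Suc j))}) r" for r
        using u by (auto simp: \<phi>_def indicator_def)
      then show ?thesis unfolding time_measure_def by (subst integral_restrict_space) simp_all
    qed
    also have "\<dots> = measure lborel ({u..t} \<inter> {max (s i) (s' j)<..min (s (Suc i)) (s' (Suc j))})" by simp
    also have "\<dots> = l i j"
    proof -
      \<comment> \<open>Clamping commutes with \<open>min\<close> and \<open>max\<close>, so it may
        be applied before or after intersecting the steps.\<close>
      have "clamp u t (min x y) = min (clamp u t x) (clamp u t y)" "clamp u t (max x y) = max (clamp u t x) (clamp u t y)" for x y
        by (auto simp: max_def min_def)
      then show ?thesis unfolding measure_Icc_Int_Ioc[OF u(2)] l_def a_def a'_def by simp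
    qed
    finally show ?thesis .
  qed
  have ci: "integrable P (\<lambda>w. c p w * c' p' w)" if p: "p \<in> I" "p' \<in> I'" for p p'
  proof (rule integrable_const_bound[of _ "C * C'"])
    show "AE w in P. norm (c p w * c' p' w) \<le> C * C'"
    proof (rule AE_I2)
      fix w assume "w \<in> space P"
      then have "\<bar>c p w\<bar> \<le> C" "\<bar>c' p' w\<bar> \<le> C'" using cm(2)[OF p(1)] cm'(2)[OF p(2)] by auto
      then show "norm (c p w * c' p' w) \<le> C * C'" unfolding real_norm_def abs_mult by (intro mult_mono) auto
    qed
    show "(\<lambda>w. c p w * c' p' w) \<in> borel_measurable P"
      using measurable_F[OF cm(1)[OF p(1)]] measurable_F[OF cm'(1)[OF p(2)]] by measurable
  qed
  define Y where "Y p p' = (\<lambda>(r, w). if snd p = snd p' then \<phi> (fst p) (fst p') r * (c p w * c' p' w) else 0)" for p p'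
  have Y: "integrable (Q T) (Y p p')" "integral\<^sup>L (Q T) (Y p p') = (if snd p = snd p' then l (fst p) (fst p') * expectation (\<lambda>w. c p w * c' p' w) else 0)"
    if p: "p \<in> I" "p' \<in> I'" for p p'
  proof -
    have "integrable (Q T) (Y p p') \<and> integral\<^sup>L (Q T) (Y p p') = (if snd p = snd p' then l (fst p) (fst p') * expectation (\<lambda>w. c p w * c' p' w) else 0)"
    proof (cases "snd p = snd p'")
      case True
      then have "Y p p' = (\<lambda>(r, w). \<phi> (fst p) (fst p') r * (c p w * c' p' w))" by (simp add: Y_def)
      then show ?thesis
        using True product_integral_mult[OF \<phi>i ci[OF p], of "fst p" "fst p'"] by (simp only: \<phi>l if_True simp_thms)
    next
      case False
      then have "Y p p' = (\<lambda>_. 0)" by (auto simp only: Y_def if_False)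
      then show ?thesis using False by simp
    qed
    then show "integrable (Q T) (Y p p')" "integral\<^sup>L (Q T) (Y p p') = (if snd p = snd p' then l (fst p) (fst p') * expectation (\<lambda>w. c p w * c' p' w) else 0)"
      by blast+
  qed
  have prodQ: "(case x of (r, w) \<Rightarrow> indicator {u..t} r * indicator A w * (simple_val m s h r w \<bullet> simple_val m' s' h' r w))
      = (\<Sum>p\<in>I. \<Sum>p'\<in>I'. Y p p' x)" for x
  proof -
    obtain r w where x: "x = (r, w)" by (cases x)
    let ?f = "\<lambda>i k. indicator {s i<..s (Suc i)} r * h i w $ k" and ?g = "\<lambda>i k. indicator {s' i<..s' (Suc i)} r * h' i w $ k"
    have "(\<Sum>p\<in>I. \<Sum>p'\<in>I'. Y p p' x) = (\<Sum>i<m. \<Sum>k\<in>UNIV. \<Sum>j<m'. \<Sum>l\<in>UNIV. if k = l then \<phi> i j r * (c (i, k) w * c' (j, l) w) else 0)"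
      unfolding I_def I'_def sum.cartesian_product' by (simp add: Y_def x)
    also have "\<dots> = (\<Sum>i<m. \<Sum>k\<in>UNIV. \<Sum>j<m'. \<phi> i j r * (c (i, k) w * c' (j, k) w))" by simp
    also have "\<dots> = (\<Sum>i<m. \<Sum>k\<in>UNIV. \<Sum>j<m'. indicator {u..t} r * indicator A w * (?f i k * ?g j k))"
      by (intro sum.cong refl) (auto simp: \<phi>_def c_def c'_def indicator_def)
    also have "\<dots> = (\<Sum>k\<in>UNIV. \<Sum>i<m. \<Sum>j<m'. indicator {u..t} r * indicator A w * (?f i k * ?g j k))"
      by (rule sum.swap)
    also have "\<dots> = indicator {u..t} r * indicator A w * (\<Sum>k\<in>UNIV. (\<Sum>i<m. ?f i k) * (\<Sum>j<m'. ?g j k))"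
    proof -
      have "(\<Sum>i<m. \<Sum>j<m'. indicator {u..t} r * indicator A w * (?f i k * ?g j k))
          = indicator {u..t} r * indicator A w * ((\<Sum>i<m. ?f i k) * (\<Sum>j<m'. ?g j k))" for k
        by (subst sum_product) (simp only: sum_distrib_left)
      then show ?thesis unfolding sum_distrib_left[of _ "\<lambda>k. (\<Sum>i<m. ?f i k) * (\<Sum>j<m'. ?g j k)"] by (rule sum.cong[OF refl])
    qed
    also have "\<dots> = indicator {u..t} r * indicator A w * (simple_val m s h r w \<bullet> simple_val m' s' h' r w)"
      by (simp add: inner_vec_def simple_val_def)
    finally show ?thesis by (simp add: x)
  qed
  show "integrable P (\<lambda>w. indicator A w * ((simple_int B m s h t w - simple_int B m s h u w) * (simple_int B m' s' h' t w - simple_int B m' s' h' u w)))"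
    unfolding prod by (intro Bochner_Integration.integrable_sum) (use XX in auto)
  show "integrable (Q T) (\<lambda>(r, w). indicator {u..t} r * indicator A w * (simple_val m s h r w \<bullet> simple_val m' s' h' r w))"
    unfolding prodQ by (intro Bochner_Integration.integrable_sum Y)
  have "expectation (\<lambda>w. \<Sum>p\<in>I. \<Sum>p'\<in>I'. X p w * X' p' w) = (\<Sum>p\<in>I. \<Sum>p'\<in>I'. expectation (\<lambda>w. X p w * X' p' w))"
  proof -
    have i: "integrable P (\<lambda>w. X p w * X' p' w)" if "p \<in> I" "p' \<in> I'" for p p' using XX[OF that] by blast
    show ?thesis
      by (simp only: Bochner_Integration.integral_sum Bochner_Integration.integrable_sum i cong: sum.cong)
  qed
  also have "\<dots> = (\<Sum>p\<in>I. \<Sum>p'\<in>I'. integral\<^sup>L (Q T) (Y p p'))"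
  proof (intro sum.cong refl)
    fix p p' assume p: "p \<in> I" "p' \<in> I'"
    show "expectation (\<lambda>w. X p w * X' p' w) = integral\<^sup>L (Q T) (Y p p')"
      by (rule trans[OF conjunct2[OF XX[OF p]] Y(2)[OF p, symmetric]])
  qed
  also have "\<dots> = (\<integral>x. (\<Sum>p\<in>I. \<Sum>p'\<in>I'. Y p p' x) \<partial>Q T)"
    by (simp only: Bochner_Integration.integral_sum Bochner_Integration.integrable_sum Y(1) cong: sum.cong)
  finally show "expectation (\<lambda>w. indicator A w * ((simple_int B m s h t w - simple_int B m s h u w) * (simple_int B m' s' h' t w - simple_int B m' s' h' u w)))
     = (\<integral>(r, w). indicator {u..t} r * indicator A w * (simple_val m s h r w \<bullet> simple_val m' s' h' r w) \<partial>Q T)"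
    unfolding prod prodQ .
qed

end

lemma nn_integral_norm_diff_sq:
  fixes f g :: "'a \<Rightarrow> 'b::{euclidean_space}"
  assumes [measurable]: "f \<in> borel_measurable N" "g \<in> borel_measurable N"
  shows "(\<integral>\<^sup>+ x. ennreal ((norm (f x - g x))\<^sup>2) \<partial>N)
     \<le> 2 * (\<integral>\<^sup>+ x. ennreal ((norm (f x))\<^sup>2) \<partial>N) + 2 * (\<integral>\<^sup>+ x. ennreal ((norm (g x))\<^sup>2) \<partial>N)"
proof -
  have "(norm (f x - g x))\<^sup>2 \<le> 2 * (norm (f x))\<^sup>2 + 2 * (norm (g x))\<^sup>2" for x
  proof -
    have "(norm (f x - g x))\<^sup>2 \<le> (norm (f x) + norm (g x))\<^sup>2" by (intro power_mono norm_triangle_ineq4) auto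
    also have "\<dots> \<le> 2 * (norm (f x))\<^sup>2 + 2 * (norm (g x))\<^sup>2"
      using zero_le_power2[of "norm (f x) - norm (g x)"] by (simp add: power2_eq_square algebra_simps)
    finally show ?thesis .
  qed
  then have "(\<integral>\<^sup>+ x. ennreal ((norm (f x - g x))\<^sup>2) \<partial>N)
      \<le> (\<integral>\<^sup>+ x. 2 * ennreal ((norm (f x))\<^sup>2) + 2 * ennreal ((norm (g x))\<^sup>2) \<partial>N)"
  proof (intro nn_integral_mono)
    fix x
    have "ennreal ((norm (f x - g x))\<^sup>2) \<le> ennreal (2 * (norm (f x))\<^sup>2 + 2 * (norm (g x))\<^sup>2)"
      by (rule ennreal_leI) fact
    then show "ennreal ((norm (f x - g x))\<^sup>2) \<le> 2 * ennreal ((norm (f x))\<^sup>2) + 2 * ennreal ((norm (g x))\<^sup>2)"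
      by (simp add: ennreal_plus ennreal_mult')
  qed
  also have "\<dots> = 2 * (\<integral>\<^sup>+ x. ennreal ((norm (f x))\<^sup>2) \<partial>N) + 2 * (\<integral>\<^sup>+ x. ennreal ((norm (g x))\<^sup>2) \<partial>N)"
    by (subst nn_integral_add) (auto simp: nn_integral_cmult)
  finally show ?thesis .
qed

text \<open>At any time at most one step of the grid is active. The coefficients \<open>h'\<close>
  are free, so that the formula also serves after truncation on the same grid.\<close>

lemma simple_val_norm_sq:
  assumes sp: "simple_process M B m s h"
  shows "(norm (simple_val m s h' r w))\<^sup>2 = (\<Sum>i<m. indicator {s i<..s (Suc i)} r * (norm (h' i w))\<^sup>2)"
proof (cases "\<exists>i0<m. r \<in> {s i0<..s (Suc i0)}")
  case True
  then obtain i0 where i0: "i0 < m" "r \<in> {s i0<..s (Suc i0)}" by auto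
  have uniq: "indicator {s i<..s (Suc i)} r = (if i = i0 then 1 else 0 :: real)" if "i < m" for i
  proof -
    have False if "i < i0" "r \<le> s (Suc i)"
      using simple_process_mono[OF sp, of "Suc i" i0] i0 that by auto
    moreover have False if "i0 < i" "s i < r"
      using simple_process_mono[OF sp, of "Suc i0" i] i0 that \<open>i < m\<close> by auto
    ultimately show ?thesis using i0 by (cases i i0 rule: linorder_cases) (auto simp: indicator_def)
  qed
  have "simple_val m s h' r w = (\<Sum>i<m. if i = i0 then h' i w else 0)"
    unfolding simple_val_def by (rule sum.cong) (auto simp: uniq)
  moreover have "(\<Sum>i<m. indicator {s i<..s (Suc i)} r * (norm (h' i w))\<^sup>2) = (\<Sum>i<m. if i = i0 then (norm (h' i w))\<^sup>2 else 0)"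
    by (rule sum.cong) (auto simp: uniq)
  ultimately show ?thesis using i0 by simp
next
  case False
  then have "indicator {s i<..s (Suc i)} r = (0::real)" if "i < m" for i using that by (auto simp: indicator_def)
  then show ?thesis by (simp add: simple_val_def)
qed

section \<open>Truncation of simple processes at an energy level\<close>

text \<open>The time integral up to \<open>T\<close> of the squared norm over the first
  \<open>n\<close> steps, which is a finite sum because the process is constant on each
  step.\<close>

definition energy :: "(nat \<Rightarrow> real) \<Rightarrow> (nat \<Rightarrow> 'w \<Rightarrow> real ^ 'd) \<Rightarrow> real \<Rightarrow> nat \<Rightarrow> 'w \<Rightarrow> real" where
  "energy s h T n w = (\<Sum>i<n. (norm (h i w))\<^sup>2 * (min T (s (Suc i)) - min T (s i)))"

lemma simple_val_energy:
  assumes sp: "simple_process M B m s h" and T: "0 \<le> T"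
  shows "(\<integral>\<^sup>+ r. ennreal ((norm (simple_val m s h' r w))\<^sup>2) \<partial>time_measure T) = ennreal (energy s h' T m w)"
proof -
  have "(\<integral>\<^sup>+ r. ennreal ((norm (simple_val m s h' r w))\<^sup>2) \<partial>time_measure T)
      = (\<integral>\<^sup>+ r. (\<Sum>i<m. ennreal ((norm (h' i w))\<^sup>2) * indicator ({0..T} \<inter> {s i<..s (Suc i)}) r) \<partial>lborel)"
    unfolding nn_integral_time_measure simple_val_norm_sq[OF sp]
  proof (rule nn_integral_cong)
    fix r
    have "ennreal (\<Sum>i<m. indicator {s i<..s (Suc i)} r * (norm (h' i w))\<^sup>2) * indicator {0..T} r
        = (\<Sum>i<m. ennreal (indicator {s i<..s (Suc i)} r * (norm (h' i w))\<^sup>2) * indicator {0..T} r)"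
      by (subst sum_ennreal[symmetric]) (simp, simp only: sum_distrib_right)
    also have "\<dots> = (\<Sum>i<m. ennreal ((norm (h' i w))\<^sup>2) * indicator ({0..T} \<inter> {s i<..s (Suc i)}) r)"
      by (rule sum.cong) (auto simp: indicator_def)
    finally show "ennreal (\<Sum>i<m. indicator {s i<..s (Suc i)} r * (norm (h' i w))\<^sup>2) * indicator {0..T} r
        = (\<Sum>i<m. ennreal ((norm (h' i w))\<^sup>2) * indicator ({0..T} \<inter> {s i<..s (Suc i)}) r)" .
  qed
  also have "\<dots> = (\<Sum>i<m. \<integral>\<^sup>+ r. ennreal ((norm (h' i w))\<^sup>2) * indicator ({0..T} \<inter> {s i<..s (Suc i)}) r \<partial>lborel)"
    by (rule nn_integral_sum) auto
  also have "\<dots> = (\<Sum>i<m. ennreal ((norm (h' i w))\<^sup>2 * (min T (s (Suc i)) - min T (s i))))"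
  proof (rule sum.cong[OF refl])
    fix i assume "i \<in> {..<m}"
    then have s: "0 \<le> s i" "s i \<le> s (Suc i)" using simple_processD[OF sp] by auto
    have "emeasure lborel ({0..T} \<inter> {s i<..s (Suc i)}) = ennreal (min T (s (Suc i)) - min T (s i))"
    proof (cases "s i \<le> T")
      case True
      then have "{0..T} \<inter> {s i<..s (Suc i)} = {s i<..min T (s (Suc i))}" using s by auto
      then show ?thesis using True s by simp
    next
      case False
      then have "{0..T} \<inter> {s i<..s (Suc i)} = {}" by auto
      then show ?thesis using False s by simp
    qed
    then show "(\<integral>\<^sup>+ r. ennreal ((norm (h' i w))\<^sup>2) * indicator ({0..T} \<inter> {s i<..s (Suc i)}) r \<partial>lborel)
        = ennreal ((norm (h' i w))\<^sup>2 * (min T (s (Suc i)) - min T (s i)))"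
      using s by (subst nn_integral_cmult_indicator) (auto simp: ennreal_mult')
  qed
  also have "\<dots> = ennreal (energy s h' T m w)"
    unfolding energy_def
  proof (rule sum_ennreal)
    fix i assume "i \<in> {..<m}"
    then have "s i \<le> s (Suc i)" using simple_processD(2)[OF sp] by auto
    then show "0 \<le> (norm (h' i w))\<^sup>2 * (min T (s (Suc i)) - min T (s i))" by (auto simp: min_def)
  qed
  finally show ?thesis .
qed

definition truncate_coeff :: "(nat \<Rightarrow> real) \<Rightarrow> (nat \<Rightarrow> 'w \<Rightarrow> real ^ 'd) \<Rightarrow> real \<Rightarrow> real \<Rightarrow> nat \<Rightarrow> 'w \<Rightarrow> real ^ 'd" where
  "truncate_coeff s h T R i w = (if energy s h T (Suc i) w \<le> R then h i w else 0)"

context brownian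
begin

lemma energy_mono:
  assumes sp: "simple_process M B m s h" and "i \<le> j" "j \<le> m"
  shows "energy s h' T i w \<le> energy s h' T j w"
  unfolding energy_def
proof (rule sum_mono2)
  fix b assume "b \<in> {..<j} - {..<i}"
  then have "s b \<le> s (Suc b)" using simple_processD(2)[OF sp, of b] assms by auto
  then show "0 \<le> (norm (h' b w))\<^sup>2 * (min T (s (Suc b)) - min T (s b))" by (auto intro!: mult_nonneg_nonneg simp: min_def)
qed (use assms in auto)

lemma truncate_simple:
  assumes sp: "simple_process M B m s h"
  shows "simple_process M B m s (truncate_coeff s h T R)"
proof -
  obtain C where C: "\<And>i w. i < m \<Longrightarrow> w \<in> space M \<Longrightarrow> norm (h i w) \<le> C" using simple_process_bound[OF sp] by blast
  have "norm (truncate_coeff s h T R i w) \<le> max C 0" if "i < m" "w \<in> space M" for i w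
    using C[OF that] by (auto simp: truncate_coeff_def)
  moreover have "truncate_coeff s h T R i \<in> borel_measurable (Ft (s i))" if "i < m" for i
  proof -
    have [measurable]: "h j \<in> borel_measurable (Ft (s i))" if "j \<le> i" for j
      using simple_processD(3)[OF sp, of j] simple_process_mono[OF sp, of j i] that \<open>i < m\<close>
      by (intro measurable_F_mono[of "s j" "s i"]) auto
    have [measurable]: "energy s h T (Suc i) \<in> borel_measurable (Ft (s i))"
      unfolding energy_def[abs_def] by (intro borel_measurable_sum borel_measurable_times borel_measurable_power borel_measurable_norm) auto
    have [measurable]: "h i \<in> borel_measurable (Ft (s i))" by measurable
    show ?thesis unfolding truncate_coeff_def[abs_def] by measurable
  qed
  ultimately show ?thesis using sp unfolding simple_process_def by blast
qed

lemma truncate_energy: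
  assumes sp: "simple_process M B m s h" and R: "0 \<le> R"
  shows "energy s (truncate_coeff s h T R) T m w \<le> R"
proof -
  define J where "J = {i. i < m \<and> energy s h T (Suc i) w \<le> R}"
  have len: "0 \<le> (norm (h i w))\<^sup>2 * (min T (s (Suc i)) - min T (s i))" if "i < m" for i
    using simple_processD(2)[OF sp that] by (auto intro!: mult_nonneg_nonneg simp: min_def)
  have "energy s (truncate_coeff s h T R) T m w = (\<Sum>i\<in>J. (norm (h i w))\<^sup>2 * (min T (s (Suc i)) - min T (s i)))"
    unfolding energy_def[of s "truncate_coeff s h T R"]
    by (rule sum.mono_neutral_cong_right) (auto simp: J_def truncate_coeff_def)
  also have "\<dots> \<le> R"
  proof (cases "J = {}")
    case False
    have fin: "finite J" by (auto simp: J_def)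
    define k where "k = Max J"
    have k: "k \<in> J" and le: "\<And>i. i \<in> J \<Longrightarrow> i \<le> k" using Max_in[OF fin False] Max_ge[OF fin] by (auto simp: k_def)
    have "(\<Sum>i\<in>J. (norm (h i w))\<^sup>2 * (min T (s (Suc i)) - min T (s i))) \<le> energy s h T (Suc k) w"
      unfolding energy_def by (rule sum_mono2) (use le k in \<open>auto simp: J_def intro!: len intro: le_imp_less_Suc\<close>)
    also have "\<dots> \<le> R" using k by (simp add: J_def)
    finally show ?thesis .
  qed (use R in auto)
  finally show ?thesis .
qed

lemma truncate_id:
  assumes sp: "simple_process M B m s h" and "energy s h T m w \<le> R" "i < m"
  shows "truncate_coeff s h T R i w = h i w"
  using energy_mono[OF sp, of "Suc i" m h T w] assms by (auto simp: truncate_coeff_def)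

section \<open>Measurability on the product of time and probability\<close>

lemma simple_val_measurable:
  assumes sp: "simple_process M B m s h"
  shows "(\<lambda>(r, w). simple_val m s h r w) \<in> borel_measurable (Q T)"
proof -
  have h: "(\<lambda>x. h i (snd x)) \<in> borel_measurable (Q T)" if "i < m" for i
    by (rule measurable_compose[OF measurable_snd measurable_F[OF simple_processD(3)[OF sp that]]])
  have "(\<lambda>x. indicator {s i<..s (Suc i)} (fst x) :: real) \<in> borel_measurable (Q T)" for i
    by (rule measurable_compose[OF measurable_fst borel_measurable_time_measure]) measurable
  then have "(\<lambda>x. \<Sum>i<m. indicator {s i<..s (Suc i)} (fst x) *\<^sub>R h i (snd x)) \<in> borel_measurable (Q T)"
    by (intro borel_measurable_sum borel_measurable_scaleR h) auto
  then show ?thesis by (simp add: simple_val_def case_prod_beta')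
qed

lemma progressive_measurable_product:
  fixes Z :: "real \<Rightarrow> 'w \<Rightarrow> 'c::topological_space"
  assumes Z: "progressively_measurable (aug_filtration M B) Z" and T: "0 \<le> T"
  shows "(\<lambda>(r, w). Z r w) \<in> borel_measurable (Q T)"
proof -
  have Z': "(\<lambda>(r, w). Z r w) \<in> borel_measurable (restrict_space borel {0..T} \<Otimes>\<^sub>M Ft T)"
    using Z T by (simp add: progressively_measurable_def)
  have "(\<lambda>a. a) \<in> measurable P (Ft T)" using sets_F[of T] by (auto simp: measurable_def)
  then have "(\<lambda>x. (fst x, snd x)) \<in> measurable (Q T) (restrict_space borel {0..T} \<Otimes>\<^sub>M Ft T)"
    by (intro measurable_Pair measurable_compose[OF measurable_snd])
      (auto simp: measurable_cong_sets[OF refl sets_time_measure[symmetric]])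
  from measurable_compose[OF this Z'] show ?thesis by (simp add: case_prod_beta')
qed

lemma section_measurable:
  assumes "f \<in> borel_measurable (Q T)" "w \<in> space M"
  shows "(\<lambda>r. f (r, w)) \<in> borel_measurable (time_measure T)"
  by (rule measurable_compose[OF measurable_Pair2' assms(1)]) (use assms(2) in simp)

lemma nn_section_measurable:
  fixes f :: "real \<times> 'w \<Rightarrow> ennreal"
  assumes "f \<in> borel_measurable (Q T)"
  shows "(\<lambda>w. \<integral>\<^sup>+ r. f (r, w) \<partial>time_measure T) \<in> borel_measurable P"
proof -
  have "(\<lambda>(w, r). f (r, w)) \<in> borel_measurable (P \<Otimes>\<^sub>M time_measure T)"
    using measurable_compose[OF measurable_pair_swap' assms] by (simp add: case_prod_beta')
  then show ?thesis by (rule TP.M1.borel_measurable_nn_integral[of "\<lambda>w r. f (r, w)" P, simplified])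
qed

text \<open>Continuity reduces the supremum to countably many times, which makes it measurable in
  \<open>SUP_measurable\<close>.\<close>

lemma SUP_countable:
  fixes g :: "real \<Rightarrow> real"
  assumes g: "continuous_on {0..T} g" and T: "0 \<le> T"
  shows "(SUP t\<in>{0..T}. ennreal \<bar>g t\<bar>) = (SUP p\<in>(UNIV :: (nat \<times> nat) set). ennreal \<bar>g (min T (real (fst p) / 2 ^ snd p))\<bar>)"
proof (rule antisym)
  show "(SUP t\<in>{0..T}. ennreal \<bar>g t\<bar>) \<le> (SUP p\<in>(UNIV :: (nat \<times> nat) set). ennreal \<bar>g (min T (real (fst p) / 2 ^ snd p))\<bar>)"
  proof (rule SUP_least)
    fix t assume t: "t \<in> {0..T}"
    have "(\<lambda>k. min T (real (dyadic_index k t) / 2 ^ k)) \<longlonglongrightarrow> min T t"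
      by (intro tendsto_intros dyadic_index_LIMSEQ) (use t in auto)
    then have "(\<lambda>k. g (min T (real (dyadic_index k t) / 2 ^ k))) \<longlonglongrightarrow> g (min T t)"
      by (rule continuous_on_tendsto_compose[OF g]) (use t T in auto)
    then have "(\<lambda>k. ennreal \<bar>g (min T (real (dyadic_index k t) / 2 ^ k))\<bar>) \<longlonglongrightarrow> ennreal \<bar>g (min T t)\<bar>"
      by (intro tendsto_ennrealI tendsto_intros)
    then have "ennreal \<bar>g (min T t)\<bar> \<le> (SUP p\<in>(UNIV :: (nat \<times> nat) set). ennreal \<bar>g (min T (real (fst p) / 2 ^ snd p))\<bar>)"
      by (rule LIMSEQ_le_const2)
        (auto intro!: exI[of _ 0] SUP_upper2[where i="(dyadic_index k t, k)" for k])
    then show "ennreal \<bar>g t\<bar> \<le> (SUP p\<in>(UNIV :: (nat \<times> nat) set). ennreal \<bar>g (min T (real (fst p) / 2 ^ snd p))\<bar>)"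
      using t by (simp add: min_absorb2)
  qed
  show "(SUP p\<in>(UNIV :: (nat \<times> nat) set). ennreal \<bar>g (min T (real (fst p) / 2 ^ snd p))\<bar>) \<le> (SUP t\<in>{0..T}. ennreal \<bar>g t\<bar>)"
    by (rule SUP_least, rule SUP_upper) (use T in auto)
qed

lemma SUP_measurable:
  fixes N :: "real \<Rightarrow> 'w \<Rightarrow> real"
  assumes N: "\<And>t. 0 \<le> t \<Longrightarrow> N t \<in> borel_measurable P" and T: "0 \<le> T"
    and c: "AE w in P. continuous_on {0..T} (\<lambda>t. N t w)"
  shows "(\<lambda>w. SUP t\<in>{0..T}. ennreal \<bar>N t w\<bar>) \<in> borel_measurable P"
proof (rule measurable_P_AE)
  have "(\<lambda>w. ennreal \<bar>N (min T (real (fst p) / 2 ^ snd p)) w\<bar>) \<in> borel_measurable P" for p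
  proof -
    have "N (min T (real (fst p) / 2 ^ snd p)) \<in> borel_measurable P" using T by (intro N) auto
    then show ?thesis by measurable
  qed
  then show "(\<lambda>w. SUP p\<in>(UNIV :: (nat \<times> nat) set). ennreal \<bar>N (min T (real (fst p) / 2 ^ snd p)) w\<bar>) \<in> borel_measurable P"
    by (intro borel_measurable_SUP) auto
  show "AE w in P. (SUP t\<in>{0..T}. ennreal \<bar>N t w\<bar>) = (SUP p\<in>(UNIV :: (nat \<times> nat) set). ennreal \<bar>N (min T (real (fst p) / 2 ^ snd p)) w\<bar>)"
    using c by eventually_elim (rule SUP_countable[OF _ T])
qed

lemma B_continuous: "AE w in P. continuous_on {0..} (\<lambda>t. B t w)"
  using brownian by (auto simp: brownian_motion_def AE_completion_iff)

lemma simple_int_continuous: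
  assumes sp: "simple_process M B m s h" and c: "continuous_on {0..} (\<lambda>t. B t w)"
  shows "continuous_on {0..} (\<lambda>t. simple_int B m s h t w)"
  unfolding simple_int_def
proof (rule continuous_on_sum)
  fix i assume "i \<in> {..<m}"
  then have s: "0 \<le> s i" "0 \<le> s (Suc i)" using simple_processD[OF sp, of i] by auto
  have "continuous_on {0..} (\<lambda>t. B (min t x) w)" if "0 \<le> x" for x
    by (rule continuous_on_compose2[OF c, where f="\<lambda>t. min t x"]) (use that in \<open>auto intro!: continuous_intros\<close>)
  then show "continuous_on {0..} (\<lambda>t. h i w \<bullet> (B (min t (s (Suc i))) w - B (min t (s i)) w))"
    using s by (intro continuous_intros) auto
qed

lemma simple_int_measurable:
  assumes sp: "simple_process M B m s h" and t: "0 \<le> t"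
  shows "simple_int B m s h t \<in> borel_measurable P"
proof -
  have "B (min t x) \<in> borel_measurable P" if "0 \<le> x" for x
    using B_measurable[of "min t x"] that t by (intro measurable_completion) auto
  then have "B (min t (s i)) \<in> borel_measurable P" "B (min t (s (Suc i))) \<in> borel_measurable P" if "i < m" for i
    using simple_processD(1,2)[OF sp that] by auto
  then show ?thesis unfolding simple_int_def[abs_def]
    by (intro borel_measurable_sum borel_measurable_inner borel_measurable_diff measurable_F[OF simple_processD(3)[OF sp]]) auto
qed

text \<open>
  The approximating simple processes of an Ito integral are truncated once their energy exceeds
  \<open>R\<close>. As the energy over \<open>(s\<^sub>i, s\<^sub>i\<^sub>+\<^sub>1]\<close> is known at time \<open>s\<^sub>i\<close>, this gives again simple processes, and
  for large \<open>R\<close> it changes them on a small event only.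
\<close>

lemma ito_integral_approx:
  fixes Z :: "real \<Rightarrow> 'w \<Rightarrow> real ^ 'd"
  assumes ito: "ito_integral M B Z I" and T: "0 \<le> T"
    and Z2: "(\<integral>\<^sup>+ w. (\<integral>\<^sup>+ r. ennreal ((norm (Z r w))\<^sup>2) \<partial>time_measure T) \<partial>P) < \<infinity>"
    and \<epsilon>: "0 < \<epsilon>" "\<epsilon> \<le> 1"
  obtains m s h where "simple_process M B m s h"
    "(\<integral>\<^sup>+ x. ennreal ((norm (simple_val m s h (fst x) (snd x) - Z (fst x) (snd x)))\<^sup>2) \<partial>Q T) \<le> ennreal (3 * \<epsilon>)"
    "\<And>t. 0 \<le> t \<Longrightarrow> t \<le> T \<Longrightarrow> emeasure P {w\<in>space P. \<epsilon> \<le> \<bar>simple_int B m s h t w - I t w\<bar>} \<le> ennreal (3 * \<epsilon>)"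
proof -
  have prog: "progressively_measurable (aug_filtration M B) Z"
    and ad: "adapted (aug_filtration M B) I" and Ic: "AE w in P. continuous_on {0..} (\<lambda>t. I t w)"
    using ito by (auto simp: ito_integral_def AE_completion_iff)
  obtain m s h where sp: "\<And>n. simple_process M B (m n) (s n) (h n)"
    and cD0: "conv_in_prob_0 M (\<lambda>n w. \<integral>\<^sup>+ r\<in>{0..T}. ennreal ((norm (simple_val (m n) (s n) (h n) r w - Z r w))\<^sup>2) \<partial>lborel)"
    and cS0: "conv_in_prob_0 M (\<lambda>n w. SUP t\<in>{0..T}. ennreal \<bar>simple_int B (m n) (s n) (h n) t w - I t w\<bar>)"
    using ito T unfolding ito_integral_def by blast
  define D where "D n w = (\<integral>\<^sup>+ r. ennreal ((norm (simple_val (m n) (s n) (h n) r w - Z r w))\<^sup>2) \<partial>time_measure T)" for n w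
  define S where "S n w = (SUP t\<in>{0..T}. ennreal \<bar>simple_int B (m n) (s n) (h n) t w - I t w\<bar>)" for n w
  define \<zeta> where "\<zeta> w = (\<integral>\<^sup>+ r. ennreal ((norm (Z r w))\<^sup>2) \<partial>time_measure T)" for w
  have Zm: "(\<lambda>x. Z (fst x) (snd x)) \<in> borel_measurable (Q T)"
    using progressive_measurable_product[OF prog T] by (simp add: case_prod_beta')
  have Hm: "(\<lambda>x. simple_val m s h (fst x) (snd x)) \<in> borel_measurable (Q T)" if "simple_process M B m s h" for m s h
    using simple_val_measurable[OF that] by (simp add: case_prod_beta')
  have \<zeta>m [measurable]: "\<zeta> \<in> borel_measurable P"
    using nn_section_measurable[of "\<lambda>x. ennreal ((norm (Z (fst x) (snd x)))\<^sup>2)" T] Zm unfolding \<zeta>_def[abs_def] by simp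
  have Dm [measurable]: "D n \<in> borel_measurable P" for n
    using nn_section_measurable[of "\<lambda>x. ennreal ((norm (simple_val (m n) (s n) (h n) (fst x) (snd x) - Z (fst x) (snd x)))\<^sup>2)" T] Zm Hm[OF sp[of n]]
    unfolding D_def[abs_def] by simp
  have Ia: "I t \<in> borel_measurable P" if "0 \<le> t" for t
    using ad that measurable_F unfolding adapted_def by blast
  have Sm [measurable]: "S n \<in> borel_measurable P" for n
    unfolding S_def[abs_def]
  proof (rule SUP_measurable[OF _ T])
    show "(\<lambda>w. simple_int B (m n) (s n) (h n) t w - I t w) \<in> borel_measurable P" if "0 \<le> t" for t
      by (intro borel_measurable_diff simple_int_measurable[OF sp that] Ia that)
    show "AE w in P. continuous_on {0..T} (\<lambda>t. simple_int B (m n) (s n) (h n) t w - I t w)"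
      using B_continuous Ic
    proof eventually_elim
      case (elim w)
      show ?case
        by (rule continuous_on_subset[OF continuous_on_diff[OF simple_int_continuous[OF sp elim(1)] elim(2)]]) auto
    qed
  qed
  have cD: "(\<lambda>n. emeasure P {w\<in>space P. ennreal \<epsilon> \<le> D n w}) \<longlonglongrightarrow> 0"
    using cD0 \<epsilon>(1) unfolding conv_in_prob_0_def D_def nn_integral_time_measure by simp
  have cS: "(\<lambda>n. emeasure P {w\<in>space P. ennreal \<epsilon> \<le> S n w}) \<longlonglongrightarrow> 0"
    using cS0 \<epsilon>(1) unfolding conv_in_prob_0_def S_def by simp
  have \<zeta>int: "(\<integral>\<^sup>+ w. \<zeta> w \<partial>P) < \<infinity>" using Z2 by (simp add: \<zeta>_def)
  \<comment> \<open>Error allowed where the truncation may act. There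
    \<open>R < 2 * \<zeta> w + 2\<close>, so the crude bound \<open>2 * R + 2 * \<zeta> w\<close> of
    the squared distance is below \<open>8 * \<zeta> w + 4\<close>; as this is integrable, the mean
    of \<open>g R\<close> vanishes for large \<open>R\<close>.\<close>
  define g where "g R w = (8 * \<zeta> w + 4) * indicator {w. ennreal R < 2 * \<zeta> w + 2} w" for R :: real and w
  have gm [measurable]: "g R \<in> borel_measurable P" for R unfolding g_def[abs_def] by measurable
  have g0: "(\<lambda>n. \<integral>\<^sup>+ w. g (real n) w \<partial>P) \<longlonglongrightarrow> (\<integral>\<^sup>+ w. 0 \<partial>P)"
  proof (rule nn_integral_dominated_convergence[where w="\<lambda>w. 8 * \<zeta> w + 4"])
    have "(\<integral>\<^sup>+ w. 8 * \<zeta> w + 4 \<partial>P) = 8 * (\<integral>\<^sup>+ w. \<zeta> w \<partial>P) + 4"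
      using emeasure_space_1 by (subst nn_integral_add) (auto simp: nn_integral_cmult)
    also have "\<dots> < \<infinity>" using \<zeta>int by (simp add: ennreal_mult_less_top)
    finally show "(\<integral>\<^sup>+ w. 8 * \<zeta> w + 4 \<partial>P) < \<infinity>" .
    have "AE w in P. \<zeta> w \<noteq> \<infinity>" using \<zeta>int by (intro nn_integral_PInf_AE) auto
    then show "AE w in P. (\<lambda>n. g (real n) w) \<longlonglongrightarrow> 0"
    proof eventually_elim
      case (elim w)
      then have "2 * \<zeta> w + 2 \<noteq> \<infinity>" by (simp add: ennreal_mult_eq_top_iff)
      then obtain n0 :: nat where "2 * \<zeta> w + 2 < of_nat n0"
        using ennreal_Ex_less_of_nat[of "2 * \<zeta> w + 2"] by (auto simp: less_top)
      then have n0: "2 * \<zeta> w + 2 \<le> of_nat n0" by (rule less_imp_le)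
      have "eventually (\<lambda>n. g (real n) w = 0) sequentially"
        unfolding eventually_sequentially
      proof (intro exI[of _ n0] allI impI)
        fix n assume "n0 \<le> n"
        then have "2 * \<zeta> w + 2 \<le> ennreal (real n)"
          using n0 by (auto intro: order_trans simp: ennreal_of_nat_eq_real_of_nat)
        then show "g (real n) w = 0" by (auto simp: g_def indicator_def not_less[symmetric])
      qed
      then show ?case by (rule tendsto_eventually)
    qed
  qed (auto simp: g_def indicator_def)
  have "eventually (\<lambda>n. (\<integral>\<^sup>+ w. g (real n) w \<partial>P) < ennreal \<epsilon>) sequentially"
    using g0 \<epsilon>(1) by (intro order_tendstoD(2)) auto
  then obtain k0 where k0: "\<And>n. n \<ge> k0 \<Longrightarrow> (\<integral>\<^sup>+ w. g (real n) w \<partial>P) < ennreal \<epsilon>"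
    by (auto simp: eventually_sequentially)
  \<comment> \<open>The maximum with 1 keeps \<open>R\<close> positive for the division by
    \<open>4 * R\<close>.\<close>
  define R where "R = real (max k0 1)"
  have R: "1 \<le> R" "(\<integral>\<^sup>+ w. g R w \<partial>P) \<le> ennreal \<epsilon>"
    using k0[of "max k0 1"] by (auto simp: R_def)
  \<comment> \<open>\<open>R\<close> is fixed before \<open>n\<close>: the event of a large
    deviation must be small relative to \<open>4 * R\<close>, which bounds the squared distance
    there unless the error is covered by \<open>g\<close>.\<close>
  have "eventually (\<lambda>n. emeasure P {w\<in>space P. ennreal \<epsilon> \<le> D n w} < ennreal (\<epsilon> / (4 * R))
      \<and> emeasure P {w\<in>space P. ennreal \<epsilon> \<le> S n w} < ennreal \<epsilon>) sequentially"
    using cD cS \<epsilon>(1) R(1) by (intro eventually_conj order_tendstoD(2)) auto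
  then obtain n where n: "emeasure P {w\<in>space P. ennreal \<epsilon> \<le> D n w} < ennreal (\<epsilon> / (4 * R))"
      "emeasure P {w\<in>space P. ennreal \<epsilon> \<le> S n w} < ennreal \<epsilon>" by (auto simp: eventually_sequentially)
  define h' where "h' = truncate_coeff (s n) (h n) T R"
  have sp': "simple_process M B (m n) (s n) h'" unfolding h'_def by (rule truncate_simple[OF sp])
  define D' where "D' w = (\<integral>\<^sup>+ r. ennreal ((norm (simple_val (m n) (s n) h' r w - Z r w))\<^sup>2) \<partial>time_measure T)" for w
  have sec: "(\<lambda>r. Z r w) \<in> borel_measurable (time_measure T)"
     "(\<lambda>r. simple_val (m n) (s n) h' r w) \<in> borel_measurable (time_measure T)"
     "(\<lambda>r. simple_val (m n) (s n) (h n) r w) \<in> borel_measurable (time_measure T)"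
    if "w \<in> space P" for w
    using section_measurable[OF Zm] section_measurable[OF Hm[OF sp']] section_measurable[OF Hm[OF sp[of n]]] that by auto
  \<comment> \<open>Where \<open>D n w < \<epsilon> \<le> 1\<close> and
    \<open>2 * \<zeta> w + 2 \<le> R\<close>, the energy is at most
    \<open>2 * D n w + 2 * \<zeta> w \<le> R\<close>, so the truncation changes nothing.\<close>
  have same: "simple_val (m n) (s n) h' r w = simple_val (m n) (s n) (h n) r w"
      "simple_int B (m n) (s n) h' r w = simple_int B (m n) (s n) (h n) r w"
    if w: "w \<in> space P" and "D n w < ennreal \<epsilon>" "2 * \<zeta> w + 2 \<le> ennreal R" for r w
  proof -
    have "(\<integral>\<^sup>+ r. ennreal ((norm (simple_val (m n) (s n) (h n) r w - Z r w - - Z r w))\<^sup>2) \<partial>time_measure T)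
        \<le> 2 * D n w + 2 * (\<integral>\<^sup>+ r. ennreal ((norm (- Z r w))\<^sup>2) \<partial>time_measure T)"
      unfolding D_def by (rule nn_integral_norm_diff_sq) (use sec[OF w] in auto)
    then have "ennreal (energy (s n) (h n) T (m n) w) \<le> 2 * D n w + 2 * \<zeta> w"
      by (simp add: simple_val_energy[OF sp T] \<zeta>_def)
    also have "\<dots> \<le> 2 * 1 + 2 * \<zeta> w"
    proof (intro add_mono mult_left_mono)
      have "D n w \<le> ennreal \<epsilon>" using that(2) by (rule less_imp_le)
      also have "\<dots> \<le> ennreal 1" using \<epsilon> by (intro ennreal_leI)
      finally show "D n w \<le> 1" by simp
    qed auto
    also have "\<dots> \<le> ennreal R" using that(3) by (simp add: add.commute)
    finally have "energy (s n) (h n) T (m n) w \<le> R" using R(1) by (simp add: ennreal_le_iff)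
    then have "h' i w = h n i w" if "i < m n" for i
      unfolding h'_def by (rule truncate_id[OF sp _ that])
    then show "simple_val (m n) (s n) h' r w = simple_val (m n) (s n) (h n) r w"
      "simple_int B (m n) (s n) h' r w = simple_int B (m n) (s n) (h n) r w"
      by (auto simp: simple_val_def simple_int_def)
  qed
  have D'le: "D' w \<le> ennreal \<epsilon> + ennreal (4 * R) * indicator {w\<in>space P. ennreal \<epsilon> \<le> D n w} w + g R w"
    if w: "w \<in> space P" for w
  proof -
    have "D' w \<le> 2 * ennreal (energy (s n) h' T (m n) w) + 2 * \<zeta> w"
      using nn_integral_norm_diff_sq[OF sec(2)[OF w] sec(1)[OF w]]
      by (simp add: D'_def \<zeta>_def simple_val_energy[OF sp T])
    also have "\<dots> \<le> 2 * ennreal R + 2 * \<zeta> w"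
      unfolding h'_def using truncate_energy[OF sp, of R n T w] R(1) by (intro add_mono mult_left_mono ennreal_leI) auto
    finally have b: "D' w \<le> 2 * ennreal R + 2 * \<zeta> w" .
    consider "ennreal R < 2 * \<zeta> w + 2" | "2 * \<zeta> w + 2 \<le> ennreal R" "ennreal \<epsilon> \<le> D n w"
      | "2 * \<zeta> w + 2 \<le> ennreal R" "D n w < ennreal \<epsilon>" by (meson not_le)
    then show ?thesis
    proof cases
      case 1
      have "D' w \<le> 2 * ennreal R + 2 * \<zeta> w" by (rule b)
      also have "\<dots> \<le> 2 * (2 * \<zeta> w + 2) + 2 * \<zeta> w" using 1 by (intro add_mono mult_left_mono) auto
      also have "\<dots> = 6 * \<zeta> w + 4"
      proof (cases "\<zeta> w")
        case (real x)
        then show ?thesis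
          by (simp flip: ennreal_plus ennreal_mult' ennreal_numeral)
      qed (simp add: ennreal_mult_top)
      also have "\<dots> \<le> 8 * \<zeta> w + 4" by (intro add_mono mult_right_mono) auto
      also have "\<dots> = g R w" using 1 by (simp add: g_def)
      finally show ?thesis by (rule order_trans) simp
    next
      case 2
      have "2 * \<zeta> w \<le> 2 * \<zeta> w + 2" by simp
      then have "D' w \<le> 2 * ennreal R + ennreal R" using b 2(1) by (meson add_left_mono order_trans)
      also have "\<dots> = ennreal (3 * R)" using R(1) by (simp flip: ennreal_plus ennreal_mult' ennreal_numeral)
      also have "\<dots> \<le> ennreal (4 * R)" using R(1) by (intro ennreal_leI) auto
      also have "\<dots> = ennreal (4 * R) * indicator {w\<in>space P. ennreal \<epsilon> \<le> D n w} w" using 2 w by simp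
      finally show ?thesis by (rule order_trans) (simp add: add_increasing add_increasing2)
    next
      case 3
      have "D' w = D n w" unfolding D'_def D_def by (simp only: same(1)[OF w 3(2,1)])
      then have "D' w \<le> ennreal \<epsilon>" using 3 by simp
      then show ?thesis by (rule order_trans) (simp add: add_increasing2)
    qed
  qed
  have "(\<integral>\<^sup>+ x. ennreal ((norm (simple_val (m n) (s n) h' (fst x) (snd x) - Z (fst x) (snd x)))\<^sup>2) \<partial>Q T) = (\<integral>\<^sup>+ w. D' w \<partial>P)"
    unfolding D'_def using Zm Hm[OF sp'] by (subst TP.nn_integral_snd[symmetric]) auto
  also have "\<dots> \<le> (\<integral>\<^sup>+ w. ennreal \<epsilon> + ennreal (4 * R) * indicator {w\<in>space P. ennreal \<epsilon> \<le> D n w} w + g R w \<partial>P)"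
    by (rule nn_integral_mono) (rule D'le)
  also have "\<dots> = ennreal \<epsilon> + ennreal (4 * R) * emeasure P {w\<in>space P. ennreal \<epsilon> \<le> D n w} + (\<integral>\<^sup>+ w. g R w \<partial>P)"
  proof -
    have s: "{w\<in>space P. ennreal \<epsilon> \<le> D n w} \<in> sets P" by measurable
    have m: "(\<lambda>w. ennreal (4 * R) * indicator {w\<in>space P. ennreal \<epsilon> \<le> D n w} w) \<in> borel_measurable P"
      using s by measurable
    have "(\<integral>\<^sup>+ w. ennreal \<epsilon> \<partial>P) = ennreal \<epsilon>" using emeasure_space_1 by simp
    then show ?thesis
      by (subst nn_integral_add[OF _ gm], use m in measurable)
        (subst nn_integral_add[OF _ m], simp, simp only: nn_integral_cmult_indicator[OF s])
  qed
  also have "\<dots> \<le> ennreal \<epsilon> + ennreal (4 * R) * ennreal (\<epsilon> / (4 * R)) + ennreal \<epsilon>"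
    using n(1) R(2) by (intro add_mono mult_left_mono) auto
  also have "\<dots> = ennreal (3 * \<epsilon>)" using R(1) \<epsilon>(1) by (simp flip: ennreal_plus ennreal_mult')
  finally have 1: "(\<integral>\<^sup>+ x. ennreal ((norm (simple_val (m n) (s n) h' (fst x) (snd x) - Z (fst x) (snd x)))\<^sup>2) \<partial>Q T) \<le> ennreal (3 * \<epsilon>)" .
  have 2: "emeasure P {w\<in>space P. \<epsilon> \<le> \<bar>simple_int B (m n) (s n) h' t w - I t w\<bar>} \<le> ennreal (3 * \<epsilon>)"
    if t: "0 \<le> t" "t \<le> T" for t
  proof -
    let ?D = "{w\<in>space P. ennreal \<epsilon> \<le> D n w}" and ?S = "{w\<in>space P. ennreal \<epsilon> \<le> S n w}" and ?G = "{w\<in>space P. ennreal R < 2 * \<zeta> w + 2}"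
    have sets: "?D \<in> sets P" "?S \<in> sets P" "?G \<in> sets P" by measurable
    have "{w\<in>space P. \<epsilon> \<le> \<bar>simple_int B (m n) (s n) h' t w - I t w\<bar>} \<subseteq> (?D \<union> ?S) \<union> ?G"
    proof safe
      fix w assume w: "w \<in> space P" and e: "\<epsilon> \<le> \<bar>simple_int B (m n) (s n) h' t w - I t w\<bar>"
        and nG: "\<not> ennreal R < 2 * \<zeta> w + 2" and nS: "\<not> ennreal \<epsilon> \<le> S n w"
      show "ennreal \<epsilon> \<le> D n w"
      proof (rule ccontr)
        assume "\<not> ennreal \<epsilon> \<le> D n w"
        then have "simple_int B (m n) (s n) h' t w = simple_int B (m n) (s n) (h n) t w"
          using nG w by (intro same(2)) auto
        then have "ennreal \<epsilon> \<le> ennreal \<bar>simple_int B (m n) (s n) (h n) t w - I t w\<bar>" using e by (intro ennreal_leI) simp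
        also have "\<dots> \<le> S n w" unfolding S_def by (rule SUP_upper) (use t in auto)
        finally show False using nS by simp
      qed
    qed
    then have "emeasure P {w\<in>space P. \<epsilon> \<le> \<bar>simple_int B (m n) (s n) h' t w - I t w\<bar>} \<le> emeasure P ((?D \<union> ?S) \<union> ?G)"
      by (rule emeasure_mono) (use sets in auto)
    also have "\<dots> \<le> (emeasure P ?D + emeasure P ?S) + emeasure P ?G"
      using sets by (intro order_trans[OF emeasure_subadditive] add_mono emeasure_subadditive order_refl) auto
    also have "\<dots> \<le> (ennreal \<epsilon> + ennreal \<epsilon>) + ennreal \<epsilon>"
    proof (intro add_mono)
      have "\<epsilon> / (4 * R) \<le> \<epsilon>" using R(1) \<epsilon>(1) by (simp add: divide_le_eq)
      then show "emeasure P ?D \<le> ennreal \<epsilon>" using n(1) by (meson ennreal_leI less_imp_le order_trans)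
      show "emeasure P ?S \<le> ennreal \<epsilon>" using n(2) by (rule less_imp_le)
      have "emeasure P ?G = (\<integral>\<^sup>+ w. indicator ?G w \<partial>P)" using sets by (intro nn_integral_indicator[symmetric])
      also have "\<dots> \<le> (\<integral>\<^sup>+ w. g R w \<partial>P)"
      proof (rule nn_integral_mono)
        fix w
        have "(1::ennreal) \<le> 8 * \<zeta> w + 4" by (rule order_trans[of _ 4]) auto
        then show "indicator ?G w \<le> g R w" by (auto simp: g_def indicator_def)
      qed
      finally show "emeasure P ?G \<le> ennreal \<epsilon>" using R(2) by simp
    qed
    also have "\<dots> = ennreal (3 * \<epsilon>)" using \<epsilon>(1) by (simp flip: ennreal_plus)
    finally show ?thesis .
  qed
  show ?thesis by (rule that[OF sp' 1 2])
qed

end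

section \<open>Limits of products in mean square\<close>

lemma nn_sq_integrable:
  fixes f :: "'a \<Rightarrow> real"
  assumes f: "f \<in> borel_measurable N" and le: "(\<integral>\<^sup>+ x. ennreal ((f x)\<^sup>2) \<partial>N) \<le> ennreal c" and c: "0 \<le> c"
  shows "integrable N (\<lambda>x. (f x)\<^sup>2)" "(\<integral>x. (f x)\<^sup>2 \<partial>N) \<le> c"
proof -
  show i: "integrable N (\<lambda>x. (f x)\<^sup>2)"
  proof (rule integrableI_bounded)
    have "(\<integral>\<^sup>+ x. ennreal (norm ((f x)\<^sup>2)) \<partial>N) \<le> ennreal c" using le by simp
    also have "\<dots> < \<infinity>" by simp
    finally show "(\<integral>\<^sup>+ x. ennreal (norm ((f x)\<^sup>2)) \<partial>N) < \<infinity>" .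
  qed (use f in measurable)
  have "ennreal (\<integral>x. (f x)\<^sup>2 \<partial>N) \<le> ennreal c" using le nn_integral_eq_integral[OF i] by simp
  then show "(\<integral>x. (f x)\<^sup>2 \<partial>N) \<le> c" using c by (simp add: ennreal_le_iff)
qed

lemma integrable_mult_sq:
  fixes f g b :: "'a \<Rightarrow> real"
  assumes [measurable]: "f \<in> borel_measurable N" "g \<in> borel_measurable N" "b \<in> borel_measurable N"
    and i: "integrable N (\<lambda>x. (f x)\<^sup>2)" "integrable N (\<lambda>x. (g x)\<^sup>2)" and b: "\<And>x. \<bar>b x\<bar> \<le> 1"
  shows "integrable N (\<lambda>x. b x * (f x * g x))"
proof (rule Bochner_Integration.integrable_bound[OF Bochner_Integration.integrable_add[OF i]])
  have "\<bar>b x * (f x * g x)\<bar> \<le> (f x)\<^sup>2 + (g x)\<^sup>2" for x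
  proof -
    have "\<bar>b x * (f x * g x)\<bar> \<le> 1 * \<bar>f x * g x\<bar>" unfolding abs_mult[of "b x"] by (intro mult_right_mono b) auto
    also have "\<dots> \<le> (f x)\<^sup>2 + (g x)\<^sup>2"
    proof -
      have "2 * \<bar>f x\<bar> * \<bar>g x\<bar> \<le> \<bar>f x\<bar>\<^sup>2 + \<bar>g x\<bar>\<^sup>2" by (rule sum_squares_bound)
      moreover have "0 \<le> \<bar>f x\<bar> * \<bar>g x\<bar>" by simp
      ultimately show ?thesis by (simp only: abs_mult power2_abs mult_1_left)
    qed
    finally show ?thesis .
  qed
  then show "AE x in N. norm (b x * (f x * g x)) \<le> norm ((f x)\<^sup>2 + (g x)\<^sup>2)" by (simp add: abs_of_nonneg)
qed measurable

text \<open>Mean-square convergence of both factors yields convergence of weighted products. The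
  pointwise bound is Young's inequality with a free parameter \<open>\<delta>\<close>, chosen small
  to absorb the fixed norms of the limits.\<close>

lemma L2_limit:
  fixes f g b :: "'a \<Rightarrow> real" and fn gn :: "nat \<Rightarrow> 'a \<Rightarrow> real"
  assumes fm [measurable]: "f \<in> borel_measurable N" "g \<in> borel_measurable N" "b \<in> borel_measurable N"
      "\<And>n. fn n \<in> borel_measurable N" "\<And>n. gn n \<in> borel_measurable N"
    and f: "integrable N (\<lambda>x. (f x)\<^sup>2)" and g: "integrable N (\<lambda>x. (g x)\<^sup>2)"
    and fa: "\<And>n. (\<integral>\<^sup>+ x. ennreal ((fn n x - f x)\<^sup>2) \<partial>N) \<le> ennreal (a n)"
    and ga: "\<And>n. (\<integral>\<^sup>+ x. ennreal ((gn n x - g x)\<^sup>2) \<partial>N) \<le> ennreal (a n)"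
    and a0: "\<And>n. 0 \<le> a n" and a: "a \<longlonglongrightarrow> 0" and b: "\<And>x. \<bar>b x\<bar> \<le> 1"
  shows "integrable N (\<lambda>x. b x * (f x * g x))"
    "(\<lambda>n. \<integral>x. b x * (fn n x * gn n x) \<partial>N) \<longlonglongrightarrow> (\<integral>x. b x * (f x * g x) \<partial>N)"
proof -
  show ifg: "integrable N (\<lambda>x. b x * (f x * g x))" by (rule integrable_mult_sq) (use f g b in auto)
  have fd: "integrable N (\<lambda>x. (fn n x - f x)\<^sup>2)" "(\<integral>x. (fn n x - f x)\<^sup>2 \<partial>N) \<le> a n" for n
    using nn_sq_integrable[OF _ fa a0] by auto
  have gd: "integrable N (\<lambda>x. (gn n x - g x)\<^sup>2)" "(\<integral>x. (gn n x - g x)\<^sup>2 \<partial>N) \<le> a n" for n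
    using nn_sq_integrable[OF _ ga a0] by auto
  define C where "C = (\<integral>x. (f x)\<^sup>2 \<partial>N) + (\<integral>x. (g x)\<^sup>2 \<partial>N) + 1"
  have C: "0 < C" unfolding C_def by (intro add_nonneg_pos add_nonneg_nonneg integral_nonneg_AE) auto
  have am: "x * y \<le> x\<^sup>2 / (2 * \<delta>) + \<delta> * y\<^sup>2 / 2" if "0 < \<delta>" for x y \<delta> :: real
  proof -
    have "0 \<le> (x - \<delta> * y)\<^sup>2 / (2 * \<delta>)" using that by simp
    also have "\<dots> = x\<^sup>2 / (2 * \<delta>) + \<delta> * y\<^sup>2 / 2 - x * y" using that by (simp add: power2_eq_square field_simps)
    finally show ?thesis by simp
  qed
  have pt: "\<bar>b x * (fn n x * gn n x) - b x * (f x * g x)\<bar>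
      \<le> (1/2 + 1 / (2 * \<delta>)) * (fn n x - f x)\<^sup>2 + (1/2 + 1 / (2 * \<delta>)) * (gn n x - g x)\<^sup>2 + (\<delta> / 2) * ((f x)\<^sup>2 + (g x)\<^sup>2)"
    if "0 < \<delta>" for x n \<delta>
  proof -
    have "\<bar>b x * (fn n x * gn n x) - b x * (f x * g x)\<bar> = \<bar>b x\<bar> * \<bar>fn n x * gn n x - f x * g x\<bar>"
      by (simp only: right_diff_distrib[symmetric] abs_mult)
    also have "\<dots> \<le> 1 * \<bar>fn n x * gn n x - f x * g x\<bar>" by (intro mult_right_mono b) auto
    also have "\<dots> = \<bar>(fn n x - f x) * (gn n x - g x) + (fn n x - f x) * g x + (gn n x - g x) * f x\<bar>"
      by (simp add: algebra_simps)
    also have "\<dots> \<le> \<bar>fn n x - f x\<bar> * \<bar>gn n x - g x\<bar> + \<bar>fn n x - f x\<bar> * \<bar>g x\<bar> + \<bar>gn n x - g x\<bar> * \<bar>f x\<bar>"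
      unfolding abs_mult[symmetric] by (intro order_trans[OF abs_triangle_ineq] add_mono order_refl)
    also have "\<dots> \<le> (1/2 + 1 / (2 * \<delta>)) * (fn n x - f x)\<^sup>2 + (1/2 + 1 / (2 * \<delta>)) * (gn n x - g x)\<^sup>2 + (\<delta> / 2) * ((f x)\<^sup>2 + (g x)\<^sup>2)"
      using am[of 1 "\<bar>fn n x - f x\<bar>" "\<bar>gn n x - g x\<bar>"] am[OF that, of "\<bar>fn n x - f x\<bar>" "\<bar>g x\<bar>"]
        am[OF that, of "\<bar>gn n x - g x\<bar>" "\<bar>f x\<bar>"]
      by (simp add: algebra_simps)
    finally show ?thesis .
  qed
  have bound: "\<bar>(\<integral>x. b x * (fn n x * gn n x) \<partial>N) - (\<integral>x. b x * (f x * g x) \<partial>N)\<bar> \<le> (1 + 1 / \<delta>) * a n + \<delta> / 2 * C"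
    if \<delta>: "0 < \<delta>" for n \<delta>
  proof -
    let ?R = "\<lambda>x. (1/2 + 1 / (2 * \<delta>)) * (fn n x - f x)\<^sup>2 + (1/2 + 1 / (2 * \<delta>)) * (gn n x - g x)\<^sup>2 + (\<delta> / 2) * ((f x)\<^sup>2 + (g x)\<^sup>2)"
    have iR: "integrable N ?R" by (intro Bochner_Integration.integrable_add integrable_mult_right fd gd f g)
    have id: "integrable N (\<lambda>x. b x * (fn n x * gn n x) - b x * (f x * g x))"
      by (rule Bochner_Integration.integrable_bound[OF iR]) (use order_trans[OF pt[OF \<delta>] abs_ge_self] in \<open>simp_all add: real_norm_def del: abs_le_iff\<close>)
    then have "integrable N (\<lambda>x. (b x * (fn n x * gn n x) - b x * (f x * g x)) + b x * (f x * g x))"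
      by (rule Bochner_Integration.integrable_add[OF _ ifg])
    then have "integrable N (\<lambda>x. b x * (fn n x * gn n x))" by simp
    then have "(\<integral>x. b x * (fn n x * gn n x) \<partial>N) - (\<integral>x. b x * (f x * g x) \<partial>N) = (\<integral>x. b x * (fn n x * gn n x) - b x * (f x * g x) \<partial>N)"
      by (rule Bochner_Integration.integral_diff[symmetric, OF _ ifg])
    also have "\<bar>\<dots>\<bar> \<le> (\<integral>x. \<bar>b x * (fn n x * gn n x) - b x * (f x * g x)\<bar> \<partial>N)" by (rule integral_abs_bound)
    also have "\<dots> \<le> integral\<^sup>L N ?R" by (rule integral_mono[OF integrable_abs[OF id] iR]) (rule pt[OF \<delta>])
    also have "\<dots> = (1/2 + 1 / (2 * \<delta>)) * (\<integral>x. (fn n x - f x)\<^sup>2 \<partial>N) + (1/2 + 1 / (2 * \<delta>)) * (\<integral>x. (gn n x - g x)\<^sup>2 \<partial>N)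
        + (\<delta> / 2) * ((\<integral>x. (f x)\<^sup>2 \<partial>N) + (\<integral>x. (g x)\<^sup>2 \<partial>N))"
      using fd(1)[of n] gd(1)[of n] f g by simp
    also have "\<dots> \<le> (1/2 + 1 / (2 * \<delta>)) * a n + (1/2 + 1 / (2 * \<delta>)) * a n + (\<delta> / 2) * C"
      using \<delta> fd(2)[of n] gd(2)[of n] by (intro add_mono mult_left_mono) (auto simp: C_def)
    also have "\<dots> = (1 + 1 / \<delta>) * a n + \<delta> / 2 * C" by (simp add: field_simps)
    finally show ?thesis .
  qed
  show "(\<lambda>n. \<integral>x. b x * (fn n x * gn n x) \<partial>N) \<longlonglongrightarrow> (\<integral>x. b x * (f x * g x) \<partial>N)"
  proof (rule LIMSEQ_I)
    fix r :: real assume r: "0 < r"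
    \<comment> \<open>\<open>C\<close> dominates the squared norms of the limits, so the part that
      does not depend on \<open>n\<close> is exactly \<open>r / 2\<close>.\<close>
    define \<delta> where "\<delta> = r / C"
    have \<delta>: "0 < \<delta>" using r C by (simp add: \<delta>_def)
    have "(\<lambda>n. (1 + 1 / \<delta>) * a n) \<longlonglongrightarrow> (1 + 1 / \<delta>) * 0" by (intro tendsto_intros a)
    then have "eventually (\<lambda>n. (1 + 1 / \<delta>) * a n < r / 2) sequentially"
      using r by (intro order_tendstoD(2)) auto
    then obtain n0 where n0: "\<And>n. n \<ge> n0 \<Longrightarrow> (1 + 1 / \<delta>) * a n < r / 2" by (auto simp: eventually_sequentially)
    have "\<delta> / 2 * C = r / 2" using C by (simp add: \<delta>_def)
    then have "norm ((\<integral>x. b x * (fn n x * gn n x) \<partial>N) - (\<integral>x. b x * (f x * g x) \<partial>N)) < r" if "n \<ge> n0" for n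
      using bound[OF \<delta>, of n] n0[OF that] unfolding real_norm_def by linarith
    then show "\<exists>no. \<forall>n\<ge>no. norm ((\<integral>x. b x * (fn n x * gn n x) \<partial>N) - (\<integral>x. b x * (f x * g x) \<partial>N)) < r" by auto
  qed
qed

context brownian
begin

lemma simple_int_0: "simple_process M B m s h \<Longrightarrow> simple_int B m s h 0 w = 0"
  unfolding simple_int_def
proof (rule sum.neutral, rule ballI)
  fix i assume sp: "simple_process M B m s h" and "i \<in> {..<m}"
  then have "0 \<le> s i" "0 \<le> s (Suc i)" using simple_processD[OF sp, of i] by auto
  then show "h i w \<bullet> (B (min 0 (s (Suc i))) w - B (min 0 (s i)) w) = 0" by simp
qed

text \<open>The isometry on \<open>{0..t}\<close> and the whole space, where the integrals start at
  zero.\<close>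

lemma simple_int_sq_integrable:
  assumes sp: "simple_process M B m s h" and sp': "simple_process M B m' s' h'" and t: "0 \<le> t" "t \<le> T"
  shows "integrable P (\<lambda>w. simple_int B m s h t w * simple_int B m' s' h' t w)"
    "integrable (Q T) (\<lambda>(r, w). indicator {0..t} r * indicator (space P) w * (simple_val m s h r w \<bullet> simple_val m' s' h' r w))"
    "expectation (\<lambda>w. simple_int B m s h t w * simple_int B m' s' h' t w)
      = (\<integral>(r, w). indicator {0..t} r * indicator (space P) w * (simple_val m s h r w \<bullet> simple_val m' s' h' r w) \<partial>Q T)"
proof -
  have A: "space P \<in> sets (Ft 0)" using sets.top[of "Ft 0"] by simp
  note i = simple_int_isometry[OF sp sp' order_refl t A]
  have e: "indicator (space P) w * ((simple_int B m s h t w - simple_int B m s h 0 w) * (simple_int B m' s' h' t w - simple_int B m' s' h' 0 w))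
     = simple_int B m s h t w * simple_int B m' s' h' t w" if "w \<in> space P" for w
    using that by (simp add: simple_int_0[OF sp] simple_int_0[OF sp'])
  show "integrable P (\<lambda>w. simple_int B m s h t w * simple_int B m' s' h' t w)"
    using i(1) by (rule Bochner_Integration.integrable_cong[THEN iffD1, rotated 2]) (simp_all only: e)
  show "integrable (Q T) (\<lambda>(r, w). indicator {0..t} r * indicator (space P) w * (simple_val m s h r w \<bullet> simple_val m' s' h' r w))"
    by (rule i(2))
  show "expectation (\<lambda>w. simple_int B m s h t w * simple_int B m' s' h' t w)
      = (\<integral>(r, w). indicator {0..t} r * indicator (space P) w * (simple_val m s h r w \<bullet> simple_val m' s' h' r w) \<partial>Q T)"
    unfolding i(3)[symmetric] by (rule Bochner_Integration.integral_cong) (simp_all only: e)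
qed

lemma simple_int_diff_sq:
  assumes sp: "simple_process M B m s h" and sp': "simple_process M B m' s' h'" and t: "0 \<le> t" "t \<le> T"
  shows "(\<integral>\<^sup>+ w. ennreal ((simple_int B m s h t w - simple_int B m' s' h' t w)\<^sup>2) \<partial>P)
    \<le> (\<integral>\<^sup>+ x. ennreal ((norm (simple_val m s h (fst x) (snd x) - simple_val m' s' h' (fst x) (snd x)))\<^sup>2) \<partial>Q T)"
proof -
  let ?S = "simple_int B m s h t" and ?S' = "simple_int B m' s' h' t"
  let ?q = "\<lambda>x. indicator {0..t} (fst x) * indicator (space P) (snd x) :: real"
  let ?H = "\<lambda>x. simple_val m s h (fst x) (snd x)" and ?H' = "\<lambda>x. simple_val m' s' h' (fst x) (snd x)"
  note a = simple_int_sq_integrable[OF sp sp t, unfolded case_prod_beta']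
   and b = simple_int_sq_integrable[OF sp sp' t, unfolded case_prod_beta']
   and c = simple_int_sq_integrable[OF sp' sp' t, unfolded case_prod_beta']
  have e1: "(\<lambda>w. (?S w - ?S' w)\<^sup>2) = (\<lambda>w. ?S w * ?S w - 2 * (?S w * ?S' w) + ?S' w * ?S' w)"
    by (auto simp: power2_eq_square algebra_simps)
  have e2: "(\<lambda>x. ?q x * (norm (?H x - ?H' x))\<^sup>2) = (\<lambda>x. ?q x * (?H x \<bullet> ?H x) - 2 * (?q x * (?H x \<bullet> ?H' x)) + ?q x * (?H' x \<bullet> ?H' x))"
    by (auto simp: power2_norm_eq_inner inner_diff_left inner_diff_right inner_commute algebra_simps)
  have i1: "integrable P (\<lambda>w. (?S w - ?S' w)\<^sup>2)" unfolding e1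
    by (intro Bochner_Integration.integrable_add Bochner_Integration.integrable_diff integrable_mult_right a b c)
  have i2: "integrable (Q T) (\<lambda>x. ?q x * (norm (?H x - ?H' x))\<^sup>2)" unfolding e2
    by (intro Bochner_Integration.integrable_add Bochner_Integration.integrable_diff integrable_mult_right a b c)
  have "expectation (\<lambda>w. (?S w - ?S' w)\<^sup>2) = (\<integral>x. ?q x * (norm (?H x - ?H' x))\<^sup>2 \<partial>Q T)"
    unfolding e1 e2
    by (simp only: Bochner_Integration.integral_add Bochner_Integration.integral_diff Bochner_Integration.integrable_diff
        integral_mult_right_zero integrable_mult_right a b c)
  then have "(\<integral>\<^sup>+ w. ennreal ((?S w - ?S' w)\<^sup>2) \<partial>P) = (\<integral>\<^sup>+ x. ennreal (?q x * (norm (?H x - ?H' x))\<^sup>2) \<partial>Q T)"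
    by (subst (1 2) nn_integral_eq_integral) (use i1 i2 in auto)
  also have "\<dots> \<le> (\<integral>\<^sup>+ x. ennreal ((norm (?H x - ?H' x))\<^sup>2) \<partial>Q T)"
    by (intro nn_integral_mono ennreal_leI) (auto simp: indicator_def)
  finally show ?thesis .
qed

lemma ito_integral_adapted:
  assumes "ito_integral M B Z I" "0 \<le> t" shows "I t \<in> borel_measurable (Ft t)"
  using assms by (auto simp: ito_integral_def adapted_def)

text \<open>Convergence in probability at a geometric rate is almost sure by Borel-Cantelli. The
  isometry bounds the mean-square distances between the simple integrals, and Fatou's lemma
  transfers the bound to the limit \<open>I t\<close>.\<close>

lemma ito_integral_L2_approx:
  fixes Z :: "real \<Rightarrow> 'w \<Rightarrow> real ^ 'd"
  assumes ito: "ito_integral M B Z I" and T: "0 \<le> T"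
    and Z2: "(\<integral>\<^sup>+ w. (\<integral>\<^sup>+ r. ennreal ((norm (Z r w))\<^sup>2) \<partial>time_measure T) \<partial>P) < \<infinity>"
  obtains m s h where "\<And>n :: nat. simple_process M B (m n) (s n) (h n)"
    "\<And>n. (\<integral>\<^sup>+ x. ennreal ((norm (simple_val (m n) (s n) (h n) (fst x) (snd x) - Z (fst x) (snd x)))\<^sup>2) \<partial>Q T) \<le> ennreal ((1/2) ^ n)"
    "\<And>n t. 0 \<le> t \<Longrightarrow> t \<le> T \<Longrightarrow> (\<integral>\<^sup>+ w. ennreal ((simple_int B (m n) (s n) (h n) t w - I t w)\<^sup>2) \<partial>P) \<le> ennreal (2 * (1/2) ^ n)"
proof -
  \<comment> \<open>The division by 3 cancels the factor in
    \<open>ito_integral_approx\<close>.\<close>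
  define \<Phi> where "\<Phi> n m s h \<longleftrightarrow> simple_process M B m s h \<and>
    (\<integral>\<^sup>+ x. ennreal ((norm (simple_val m s h (fst x) (snd x) - Z (fst x) (snd x)))\<^sup>2) \<partial>Q T) \<le> ennreal ((1/2) ^ n) \<and>
    (\<forall>t. 0 \<le> t \<and> t \<le> T \<longrightarrow> emeasure P {w\<in>space P. (1/2) ^ n / 3 \<le> \<bar>simple_int B m s h t w - I t w\<bar>} \<le> ennreal ((1/2) ^ n))"
    for n :: nat and m s h
  have "\<exists>m s h. \<Phi> n m s h" for n :: nat
  proof -
    have "(0::real) < (1/2) ^ n / 3" "(1/2) ^ n / 3 \<le> (1::real)" using power_le_one[of "1/2::real" n] by auto
    then obtain m s h where "simple_process M B m s h"
      "(\<integral>\<^sup>+ x. ennreal ((norm (simple_val m s h (fst x) (snd x) - Z (fst x) (snd x)))\<^sup>2) \<partial>Q T) \<le> ennreal (3 * ((1/2) ^ n / 3))"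
      "\<And>t. 0 \<le> t \<Longrightarrow> t \<le> T \<Longrightarrow> emeasure P {w\<in>space P. (1/2) ^ n / 3 \<le> \<bar>simple_int B m s h t w - I t w\<bar>} \<le> ennreal (3 * ((1/2) ^ n / 3))"
      by (rule ito_integral_approx[OF ito T Z2]) blast
    note msh = this
    have e: "3 * ((1/2) ^ n / 3) = ((1/2) ^ n :: real)" by simp
    show ?thesis using msh unfolding e \<Phi>_def by blast
  qed
  then obtain m s h where msh: "\<And>n. \<Phi> n (m n) (s n) (h n)" by metis
  then have sp: "\<And>n :: nat. simple_process M B (m n) (s n) (h n)"
    and \<delta>: "\<And>n. (\<integral>\<^sup>+ x. ennreal ((norm (simple_val (m n) (s n) (h n) (fst x) (snd x) - Z (fst x) (snd x)))\<^sup>2) \<partial>Q T) \<le> ennreal ((1/2) ^ n)"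
    and pr: "\<And>n t. 0 \<le> t \<and> t \<le> T \<Longrightarrow> emeasure P {w\<in>space P. (1/2) ^ n / 3 \<le> \<bar>simple_int B (m n) (s n) (h n) t w - I t w\<bar>} \<le> ennreal ((1/2) ^ n)"
    unfolding \<Phi>_def by blast+
  have Zm: "(\<lambda>x. Z (fst x) (snd x)) \<in> borel_measurable (Q T)"
  proof -
    have "progressively_measurable (aug_filtration M B) Z" using ito by (simp add: ito_integral_def)
    from progressive_measurable_product[OF this T] show ?thesis by (simp add: case_prod_beta')
  qed
  have Hm: "(\<lambda>x. simple_val (m n) (s n) (h n) (fst x) (snd x)) \<in> borel_measurable (Q T)" for n
    using simple_val_measurable[OF sp] by (simp add: case_prod_beta')
  have conv: "(\<integral>\<^sup>+ w. ennreal ((simple_int B (m n) (s n) (h n) t w - I t w)\<^sup>2) \<partial>P) \<le> ennreal (2 * (1/2) ^ n)"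
    if t: "0 \<le> t" "t \<le> T" for n t
  proof -
    define S where "S n = simple_int B (m n) (s n) (h n) t" for n
    have Sm [measurable]: "S n \<in> borel_measurable P" for n unfolding S_def by (rule simple_int_measurable[OF sp t(1)])
    have Im [measurable]: "I t \<in> borel_measurable P" by (rule measurable_F[OF ito_integral_adapted[OF ito t(1)]])
    define E where "E n = {w\<in>space P. (1/2) ^ n / 3 \<le> \<bar>S n w - I t w\<bar>}" for n :: nat
    have Es: "E n \<in> sets P" for n unfolding E_def by measurable
    have "measure P (E n) \<le> (1/2) ^ n" for n
      using pr[of t n] t unfolding E_def S_def emeasure_eq_measure by (simp add: ennreal_le_iff)
    then have "summable (\<lambda>n. measure P (E n))"
      by (intro summable_comparison_test[OF _ summable_geometric[of "1/2::real"]]) (auto intro!: exI[of _ 0])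
    then have "AE w in P. eventually (\<lambda>n. w \<in> space P - E n) sequentially"
      by (intro borel_cantelli_AE1 Es) (simp_all add: emeasure_eq_measure less_top[symmetric] del: emeasure_completion)
    then have lim: "AE w in P. (\<lambda>n. S n w) \<longlonglongrightarrow> I t w"
    proof eventually_elim
      case (elim w)
      have "(\<lambda>n. S n w - I t w) \<longlonglongrightarrow> 0"
      proof (rule Lim_null_comparison)
        show "eventually (\<lambda>n. norm (S n w - I t w) \<le> (1/2) ^ n / 3) sequentially"
          using elim by eventually_elim (auto simp: E_def)
        show "(\<lambda>n. (1/2::real) ^ n / 3) \<longlonglongrightarrow> 0"
          using tendsto_divide[OF LIMSEQ_power_zero[of "1/2::real"] tendsto_const[of 3]] by simp
      qed
      then show ?case by (simp add: LIM_zero_iff)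
    qed
    have pair: "(\<integral>\<^sup>+ w. ennreal ((S n w - S k w)\<^sup>2) \<partial>P) \<le> ennreal (2 * (1/2) ^ n + 2 * (1/2) ^ k)" for k
    proof -
      let ?f = "\<lambda>n x. simple_val (m n) (s n) (h n) (fst x) (snd x) - Z (fst x) (snd x)"
      have "(\<integral>\<^sup>+ w. ennreal ((S n w - S k w)\<^sup>2) \<partial>P)
          \<le> (\<integral>\<^sup>+ x. ennreal ((norm (simple_val (m n) (s n) (h n) (fst x) (snd x) - simple_val (m k) (s k) (h k) (fst x) (snd x)))\<^sup>2) \<partial>Q T)"
        unfolding S_def by (rule simple_int_diff_sq[OF sp sp t])
      also have "\<dots> = (\<integral>\<^sup>+ x. ennreal ((norm (?f n x - ?f k x))\<^sup>2) \<partial>Q T)" by simp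
      also have "\<dots> \<le> 2 * (\<integral>\<^sup>+ x. ennreal ((norm (?f n x))\<^sup>2) \<partial>Q T) + 2 * (\<integral>\<^sup>+ x. ennreal ((norm (?f k x))\<^sup>2) \<partial>Q T)"
        by (intro nn_integral_norm_diff_sq borel_measurable_diff Hm Zm)
      also have "\<dots> \<le> 2 * ennreal ((1/2) ^ n) + 2 * ennreal ((1/2) ^ k)" by (intro add_mono mult_left_mono \<delta>) auto
      also have "\<dots> = ennreal (2 * (1/2) ^ n + 2 * (1/2) ^ k)" by (simp add: ennreal_plus ennreal_mult')
      finally show ?thesis .
    qed
    have "(\<integral>\<^sup>+ w. ennreal ((S n w - I t w)\<^sup>2) \<partial>P) = (\<integral>\<^sup>+ w. liminf (\<lambda>k. ennreal ((S n w - S k w)\<^sup>2)) \<partial>P)"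
    proof (rule nn_integral_cong_AE, use lim in eventually_elim)
      fix w assume "(\<lambda>k. S k w) \<longlonglongrightarrow> I t w"
      then have "(\<lambda>k. ennreal ((S n w - S k w)\<^sup>2)) \<longlonglongrightarrow> ennreal ((S n w - I t w)\<^sup>2)"
        by (intro tendsto_intros tendsto_ennrealI)
      from lim_imp_Liminf[OF _ this]
      show "ennreal ((S n w - I t w)\<^sup>2) = liminf (\<lambda>k. ennreal ((S n w - S k w)\<^sup>2))" by simp
    qed
    also have "\<dots> \<le> liminf (\<lambda>k. \<integral>\<^sup>+ w. ennreal ((S n w - S k w)\<^sup>2) \<partial>P)"
      by (rule nn_integral_liminf) measurable
    also have "\<dots> \<le> liminf (\<lambda>k. ennreal (2 * (1/2) ^ n + 2 * (1/2) ^ k))"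
      by (rule Liminf_mono) (use pair in auto)
    also have "\<dots> = ennreal (2 * (1/2) ^ n)"
    proof (rule lim_imp_Liminf)
      have "(\<lambda>k. 2 * (1/2) ^ n + 2 * (1/2) ^ k :: real) \<longlonglongrightarrow> 2 * (1/2) ^ n + 2 * 0"
        by (intro tendsto_intros LIMSEQ_power_zero) auto
      then show "(\<lambda>k. ennreal (2 * (1/2) ^ n + 2 * (1/2) ^ k)) \<longlonglongrightarrow> ennreal (2 * (1/2) ^ n)"
        by (intro tendsto_ennrealI) simp
    qed simp
    finally show ?thesis by (simp add: S_def)
  qed
  show ?thesis by (rule that[OF sp \<delta> conv])
qed

end

lemma integrable_diff_sq:
  fixes f g :: "'a \<Rightarrow> real"
  assumes m: "f \<in> borel_measurable N" "g \<in> borel_measurable N"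
    and i: "integrable N (\<lambda>x. (f x)\<^sup>2)" "integrable N (\<lambda>x. (g x)\<^sup>2)"
  shows "integrable N (\<lambda>x. (f x - g x)\<^sup>2)"
proof -
  have "integrable N (\<lambda>x. 1 * (f x * g x))" by (rule integrable_mult_sq) (use m i in auto)
  then have fg: "integrable N (\<lambda>x. f x * g x)" by simp
  have "integrable N (\<lambda>x. (f x)\<^sup>2 - 2 * (f x * g x) + (g x)\<^sup>2)"
    by (rule Bochner_Integration.integrable_add[OF Bochner_Integration.integrable_diff[OF i(1) integrable_mult_right[OF fg]] i(2)])
  moreover have "(f x)\<^sup>2 - 2 * (f x * g x) + (g x)\<^sup>2 = (f x - g x)\<^sup>2" for x
    by (simp add: power2_eq_square algebra_simps)
  ultimately show ?thesis by simp
qed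

text \<open>The hypothesis on indicators says that the conditional expectation of \<open>N\<close>
  given \<open>G\<close> vanishes; measurable factors such as \<open>W\<close> can then be pulled
  out.\<close>

lemma (in complete_filtration) mean_zero_mult:
  fixes N W :: "'w \<Rightarrow> real"
  assumes sub: "subalgebra P G" and N: "integrable P N" and z: "\<And>A. A \<in> sets G \<Longrightarrow> expectation (\<lambda>w. indicator A w * N w) = 0"
    and W: "W \<in> borel_measurable G" and i: "integrable P (\<lambda>w. W w * N w)"
  shows "expectation (\<lambda>w. W w * N w) = 0"
proof -
  interpret finite_measure_subalgebra P G by unfold_locales (rule sub)
  have ae: "AE x in P. real_cond_exp P G N x = 0"
  proof (rule real_cond_exp_charact)
    show "set_lebesgue_integral P A N = set_lebesgue_integral P A (\<lambda>_. 0)" if "A \<in> sets G" for A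
      using z[OF that] by (simp add: set_lebesgue_integral_def)
  qed (use N in auto)
  moreover have "expectation (\<lambda>w. W w * real_cond_exp P G N w) = expectation (\<lambda>w. W w * N w)"
    by (rule real_cond_exp_intg(2)[OF i W]) (use N in auto)
  moreover have "expectation (\<lambda>w. W w * real_cond_exp P G N w) = 0"
    by (rule integral_eq_zero_AE) (use ae in \<open>auto elim: eventually_mono\<close>)
  ultimately show ?thesis by simp
qed

section \<open>Martingale property and isometry of the Ito integral\<close>

context brownian
begin

abbreviation "sq_integrable_integrand T Z \<equiv>
  (\<integral>\<^sup>+ w. (\<integral>\<^sup>+ r. ennreal ((norm (Z r w))\<^sup>2) \<partial>time_measure T) \<partial>P) < \<infinity>"

lemma nn_sq_diff_le:
  fixes f g :: "'a \<Rightarrow> real"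
  assumes "f \<in> borel_measurable N" "g \<in> borel_measurable N"
  shows "(\<integral>\<^sup>+ x. ennreal ((f x - g x)\<^sup>2) \<partial>N) \<le> 2 * (\<integral>\<^sup>+ x. ennreal ((f x)\<^sup>2) \<partial>N) + 2 * (\<integral>\<^sup>+ x. ennreal ((g x)\<^sup>2) \<partial>N)"
  using nn_integral_norm_diff_sq[OF assms] by simp

text \<open>A single approximating simple integral is square integrable and at finite mean-square
  distance.\<close>

lemma ito_integral_sq_integrable:
  fixes Z :: "real \<Rightarrow> 'w \<Rightarrow> real ^ 'd"
  assumes ito: "ito_integral M B Z I" and T: "0 \<le> T" and Z2: "sq_integrable_integrand T Z"
    and t: "0 \<le> t" "t \<le> T"
  shows "integrable P (\<lambda>w. (I t w)\<^sup>2)"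
proof -
  obtain m s h where sp: "\<And>n :: nat. simple_process M B (m n) (s n) (h n)"
    and q: "\<And>n. (\<integral>\<^sup>+ x. ennreal ((norm (simple_val (m n) (s n) (h n) (fst x) (snd x) - Z (fst x) (snd x)))\<^sup>2) \<partial>Q T) \<le> ennreal ((1/2) ^ n)"
    and c: "\<And>n t. 0 \<le> t \<Longrightarrow> t \<le> T \<Longrightarrow> (\<integral>\<^sup>+ w. ennreal ((simple_int B (m n) (s n) (h n) t w - I t w)\<^sup>2) \<partial>P) \<le> ennreal (2 * (1/2) ^ n)"
    by (rule ito_integral_L2_approx[OF ito T Z2]) blast
  let ?S = "simple_int B (m 0) (s 0) (h 0) t"
  have Sm: "?S \<in> borel_measurable P" by (rule simple_int_measurable[OF sp t(1)])
  have Im: "I t \<in> borel_measurable P" by (rule measurable_F[OF ito_integral_adapted[OF ito t(1)]])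
  have Si: "integrable P (\<lambda>w. (?S w)\<^sup>2)"
    using simple_int_sq_integrable(1)[OF sp sp t] by (simp add: power2_eq_square)
  have "(\<integral>\<^sup>+ w. ennreal ((?S w - (?S w - I t w))\<^sup>2) \<partial>P)
      \<le> 2 * (\<integral>\<^sup>+ w. ennreal ((?S w)\<^sup>2) \<partial>P) + 2 * (\<integral>\<^sup>+ w. ennreal ((?S w - I t w)\<^sup>2) \<partial>P)"
    by (rule nn_sq_diff_le) (use Sm Im in measurable)
  also have "\<dots> \<le> 2 * ennreal (expectation (\<lambda>w. (?S w)\<^sup>2)) + 2 * ennreal (2 * (1/2) ^ 0)"
    by (intro add_mono mult_left_mono c t) (use nn_integral_eq_integral[OF Si] in auto)
  also have "\<dots> < \<infinity>" by (simp add: ennreal_mult_less_top)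
  finally have "(\<integral>\<^sup>+ w. ennreal ((I t w)\<^sup>2) \<partial>P) < \<infinity>" by simp
  then show ?thesis by (intro integrableI_bounded) (use Im in auto)
qed

lemma sq_integrable_imp_integrable:
  fixes f :: "'w \<Rightarrow> real"
  assumes "f \<in> borel_measurable P" "integrable P (\<lambda>w. (f w)\<^sup>2)" shows "integrable P f"
proof -
  have "integrable P (\<lambda>w. 1 * (f w * 1))" by (rule integrable_mult_sq) (use assms in auto)
  then show ?thesis by simp
qed

lemma increment_approx:
  fixes S :: "nat \<Rightarrow> real \<Rightarrow> 'w \<Rightarrow> real"
  assumes m: "\<And>n. S n u \<in> borel_measurable P" "\<And>n. S n t \<in> borel_measurable P" "I u \<in> borel_measurable P" "I t \<in> borel_measurable P"
    and c: "\<And>n. (\<integral>\<^sup>+ w. ennreal ((S n u w - I u w)\<^sup>2) \<partial>P) \<le> ennreal (2 * (1/2) ^ n)"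
      "\<And>n. (\<integral>\<^sup>+ w. ennreal ((S n t w - I t w)\<^sup>2) \<partial>P) \<le> ennreal (2 * (1/2) ^ n)"
  shows "(\<integral>\<^sup>+ w. ennreal (((S n t w - S n u w) - (I t w - I u w))\<^sup>2) \<partial>P) \<le> ennreal (8 * (1/2) ^ n)"
proof -
  have "(\<integral>\<^sup>+ w. ennreal (((S n t w - S n u w) - (I t w - I u w))\<^sup>2) \<partial>P)
      = (\<integral>\<^sup>+ w. ennreal (((S n t w - I t w) - (S n u w - I u w))\<^sup>2) \<partial>P)"
    by (simp add: algebra_simps)
  also have "\<dots> \<le> 2 * (\<integral>\<^sup>+ w. ennreal ((S n t w - I t w)\<^sup>2) \<partial>P) + 2 * (\<integral>\<^sup>+ w. ennreal ((S n u w - I u w)\<^sup>2) \<partial>P)"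
    by (rule nn_sq_diff_le) (use m in measurable)
  also have "\<dots> \<le> 2 * ennreal (2 * (1/2) ^ n) + 2 * ennreal (2 * (1/2) ^ n)" by (intro add_mono mult_left_mono c) auto
  also have "\<dots> = ennreal (8 * (1/2) ^ n)"
    by (simp flip: ennreal_plus ennreal_mult' ennreal_numeral)
  finally show ?thesis .
qed

lemma geometric_null: "(\<lambda>n. c * (1/2) ^ n :: real) \<longlonglongrightarrow> 0"
  using tendsto_mult[OF tendsto_const[of c] LIMSEQ_power_zero[of "1/2::real"]] by simp

text \<open>The identity for simple integrals passes to the limit by \<open>L2_limit\<close> with
  the constant 1 as second factor.\<close>

lemma ito_integral_increment_mean:
  fixes Z :: "real \<Rightarrow> 'w \<Rightarrow> real ^ 'd"
  assumes ito: "ito_integral M B Z I" and Z2: "sq_integrable_integrand T Z"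
    and u: "0 \<le> u" "u \<le> t" "t \<le> T" and A: "A \<in> sets (Ft u)"
  shows "expectation (\<lambda>w. indicator A w * (I t w - I u w)) = 0"
proof -
  have T: "0 \<le> T" using u by simp
  have ut: "u \<le> T" "0 \<le> t" using u by auto
  obtain m s h where sp: "\<And>n :: nat. simple_process M B (m n) (s n) (h n)"
    and q: "\<And>n. (\<integral>\<^sup>+ x. ennreal ((norm (simple_val (m n) (s n) (h n) (fst x) (snd x) - Z (fst x) (snd x)))\<^sup>2) \<partial>Q T) \<le> ennreal ((1/2) ^ n)"
    and c: "\<And>n t. 0 \<le> t \<Longrightarrow> t \<le> T \<Longrightarrow> (\<integral>\<^sup>+ w. ennreal ((simple_int B (m n) (s n) (h n) t w - I t w)\<^sup>2) \<partial>P) \<le> ennreal (2 * (1/2) ^ n)"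
    by (rule ito_integral_L2_approx[OF ito T Z2]) blast
  define S where "S n = simple_int B (m n) (s n) (h n)" for n
  have Sm: "S n r \<in> borel_measurable P" if "0 \<le> r" for n r unfolding S_def by (rule simple_int_measurable[OF sp that])
  have Im: "I r \<in> borel_measurable P" if "0 \<le> r" for r by (rule measurable_F[OF ito_integral_adapted[OF ito that]])
  have AP: "A \<in> sets P" using A sets_F by blast
  have "(\<lambda>n. expectation (\<lambda>w. indicator A w * ((S n t w - S n u w) * 1))) \<longlonglongrightarrow> expectation (\<lambda>w. indicator A w * ((I t w - I u w) * 1))"
  proof (rule L2_limit(2)[where a="\<lambda>n. 8 * (1/2) ^ n"])
    show "integrable P (\<lambda>w. (I t w - I u w)\<^sup>2)"
      by (intro integrable_diff_sq Im u ut ito_integral_sq_integrable[OF ito T Z2])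
    show "(\<integral>\<^sup>+ w. ennreal (((S n t w - S n u w) - (I t w - I u w))\<^sup>2) \<partial>P) \<le> ennreal (8 * (1/2) ^ n)" for n
      by (rule increment_approx) (use Sm Im u ut c in \<open>auto simp: S_def\<close>)
  qed (use Sm Im AP u ut geometric_null in \<open>auto simp: indicator_def\<close>)
  moreover have "expectation (\<lambda>w. indicator A w * ((S n t w - S n u w) * 1)) = 0" for n
    using simple_int_mean(2)[OF sp u(1,2) A] by (simp add: S_def)
  ultimately show ?thesis by (simp add: LIMSEQ_const_iff)
qed

lemma ito_integral_mart:
  fixes Z :: "real \<Rightarrow> 'w \<Rightarrow> real ^ 'd"
  assumes ito: "ito_integral M B Z I" and T: "0 \<le> T" and Z2: "sq_integrable_integrand T Z"
  shows "mart T I"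
  unfolding mart_def
proof (intro conjI allI impI ballI)
  show "AE w in P. continuous_on {0..T} (\<lambda>t. I t w)"
  proof -
    have "AE w in P. continuous_on {0..} (\<lambda>t. I t w)" using ito by (simp add: ito_integral_def AE_completion_iff)
    then show ?thesis by eventually_elim (rule continuous_on_subset, auto)
  qed
  fix t assume t: "0 \<le> t \<and> t \<le> T"
  have i: "integrable P (I r)" if "0 \<le> r" "r \<le> T" for r
    by (rule sq_integrable_imp_integrable[OF measurable_F[OF ito_integral_adapted[OF ito that(1)]] ito_integral_sq_integrable[OF ito T Z2 that]])
  show "I t \<in> borel_measurable (Ft t)" using ito_integral_adapted[OF ito] t by blast
  show "integrable P (I t)" using i t by blast
  fix A assume A: "A \<in> sets (Ft t)"
  then have AP: "A \<in> sets P" using sets_F by blast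
  have "expectation (\<lambda>w. indicator A w * (I T w - I t w)) = 0"
    using t by (intro ito_integral_increment_mean[OF ito Z2 _ _ order_refl A]) auto
  then show "expectation (\<lambda>w. indicator A w * I t w) = expectation (\<lambda>w. indicator A w * I T w)"
    unfolding right_diff_distrib
    by (subst (asm) Bochner_Integration.integral_diff) (auto intro!: integrable_indicator_mult[OF AP] i simp: t T)
qed

text \<open>Inner products are treated coordinate by coordinate, so that the scalar
  \<open>L2_limit\<close> applies both on the probability space and on its product with
  time.\<close>

lemma ito_integral_isometry:
  fixes Z Z' :: "real \<Rightarrow> 'w \<Rightarrow> real ^ 'd"
  assumes ito: "ito_integral M B Z I" and Z2: "sq_integrable_integrand T Z"
    and ito': "ito_integral M B Z' I'" and Z2': "sq_integrable_integrand T Z'"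
    and u: "0 \<le> u" "u \<le> t" "t \<le> T" and A: "A \<in> sets (Ft u)"
  shows "integrable P (\<lambda>w. indicator A w * ((I t w - I u w) * (I' t w - I' u w)))"
    "integrable (Q T) (\<lambda>x. indicator {u..t} (fst x) * indicator A (snd x) * (Z (fst x) (snd x) \<bullet> Z' (fst x) (snd x)))"
    "expectation (\<lambda>w. indicator A w * ((I t w - I u w) * (I' t w - I' u w)))
      = (\<integral>x. indicator {u..t} (fst x) * indicator A (snd x) * (Z (fst x) (snd x) \<bullet> Z' (fst x) (snd x)) \<partial>Q T)"
proof -
  have T: "0 \<le> T" using u by simp
  have ut: "u \<le> T" "0 \<le> t" using u by auto
  have AP [measurable]: "A \<in> sets P" using A sets_F by blast
  obtain m s h where sp: "\<And>n :: nat. simple_process M B (m n) (s n) (h n)"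
    and q: "\<And>n. (\<integral>\<^sup>+ x. ennreal ((norm (simple_val (m n) (s n) (h n) (fst x) (snd x) - Z (fst x) (snd x)))\<^sup>2) \<partial>Q T) \<le> ennreal ((1/2) ^ n)"
    and c: "\<And>n t. 0 \<le> t \<Longrightarrow> t \<le> T \<Longrightarrow> (\<integral>\<^sup>+ w. ennreal ((simple_int B (m n) (s n) (h n) t w - I t w)\<^sup>2) \<partial>P) \<le> ennreal (2 * (1/2) ^ n)"
    by (rule ito_integral_L2_approx[OF ito T Z2]) blast
  obtain m' s' h' where sp': "\<And>n :: nat. simple_process M B (m' n) (s' n) (h' n)"
    and q': "\<And>n. (\<integral>\<^sup>+ x. ennreal ((norm (simple_val (m' n) (s' n) (h' n) (fst x) (snd x) - Z' (fst x) (snd x)))\<^sup>2) \<partial>Q T) \<le> ennreal ((1/2) ^ n)"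
    and c': "\<And>n t. 0 \<le> t \<Longrightarrow> t \<le> T \<Longrightarrow> (\<integral>\<^sup>+ w. ennreal ((simple_int B (m' n) (s' n) (h' n) t w - I' t w)\<^sup>2) \<partial>P) \<le> ennreal (2 * (1/2) ^ n)"
    by (rule ito_integral_L2_approx[OF ito' T Z2']) blast
  define S where "S n = simple_int B (m n) (s n) (h n)" for n
  define S' where "S' n = simple_int B (m' n) (s' n) (h' n)" for n
  define H where "H n x = simple_val (m n) (s n) (h n) (fst x) (snd x)" for n x
  define H' where "H' n x = simple_val (m' n) (s' n) (h' n) (fst x) (snd x)" for n x
  define z where "z x = Z (fst x) (snd x)" for x
  define z' where "z' x = Z' (fst x) (snd x)" for x
  define bb where "bb x = indicator {u..t} (fst x) * (indicator A (snd x) :: real)" for x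
  have Sm: "S n r \<in> borel_measurable P" "S' n r \<in> borel_measurable P" if "0 \<le> r" for n r
    unfolding S_def S'_def by (rule simple_int_measurable[OF sp that] simple_int_measurable[OF sp' that])+
  have Im: "I r \<in> borel_measurable P" "I' r \<in> borel_measurable P" if "0 \<le> r" for r
    by (rule measurable_F[OF ito_integral_adapted[OF ito that]] measurable_F[OF ito_integral_adapted[OF ito' that]])+
  have Hm: "H n \<in> borel_measurable (Q T)" "H' n \<in> borel_measurable (Q T)" for n
    using simple_val_measurable[OF sp] simple_val_measurable[OF sp'] by (simp_all add: H_def[abs_def] H'_def[abs_def] case_prod_beta')
  have zm: "z \<in> borel_measurable (Q T)" "z' \<in> borel_measurable (Q T)"
  proof -
    have "progressively_measurable (aug_filtration M B) Z" "progressively_measurable (aug_filtration M B) Z'"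
      using ito ito' by (simp_all add: ito_integral_def)
    from this[THEN progressive_measurable_product, OF T] show "z \<in> borel_measurable (Q T)" "z' \<in> borel_measurable (Q T)"
      by (simp_all add: z_def[abs_def] z'_def[abs_def] case_prod_beta')
  qed
  have bm: "bb \<in> borel_measurable (Q T)"
  proof -
    have "(\<lambda>x. indicator {u..t} (fst x) :: real) \<in> borel_measurable (Q T)"
      by (rule measurable_compose[OF measurable_fst borel_measurable_time_measure]) measurable
    moreover have "(\<lambda>x. indicator A (snd x) :: real) \<in> borel_measurable (Q T)"
      by (rule measurable_compose[OF measurable_snd]) measurable
    ultimately show ?thesis unfolding bb_def[abs_def] by measurable
  qed
  have iI: "integrable P (\<lambda>w. (J t w - J u w)\<^sup>2)" if "ito_integral M B Y J" "sq_integrable_integrand T Y" for Y J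
  proof -
    have Jm: "J r \<in> borel_measurable P" if "0 \<le> r" for r by (rule measurable_F[OF ito_integral_adapted[OF \<open>ito_integral M B Y J\<close> that]])
    note sq = ito_integral_sq_integrable[OF that(1) T that(2)]
    show ?thesis by (intro integrable_diff_sq Jm u ut sq)
  qed
  have zk: "integrable (Q T) (\<lambda>x. (Y (fst x) (snd x) $ k)\<^sup>2)"
    if Ym: "(\<lambda>x. Y (fst x) (snd x)) \<in> borel_measurable (Q T)" and Y: "sq_integrable_integrand T Y"
    for Y :: "real \<Rightarrow> 'w \<Rightarrow> real ^ 'd" and k
  proof (rule integrableI_bounded)
    have "(\<integral>\<^sup>+ x. ennreal (norm ((Y (fst x) (snd x) $ k)\<^sup>2)) \<partial>Q T) \<le> (\<integral>\<^sup>+ x. ennreal ((norm (Y (fst x) (snd x)))\<^sup>2) \<partial>Q T)"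
    proof (intro nn_integral_mono ennreal_leI)
      fix x
      have "\<bar>Y (fst x) (snd x) $ k\<bar>\<^sup>2 \<le> (norm (Y (fst x) (snd x)))\<^sup>2" by (intro power_mono component_le_norm_cart) auto
      then show "norm ((Y (fst x) (snd x) $ k)\<^sup>2) \<le> (norm (Y (fst x) (snd x)))\<^sup>2" by simp
    qed
    also have "\<dots> = (\<integral>\<^sup>+ w. (\<integral>\<^sup>+ r. ennreal ((norm (Y r w))\<^sup>2) \<partial>time_measure T) \<partial>P)"
      using Ym by (subst TP.nn_integral_snd[symmetric]) auto
    also have "\<dots> < \<infinity>" by (rule Y)
    finally show "(\<integral>\<^sup>+ x. ennreal (norm ((Y (fst x) (snd x) $ k)\<^sup>2)) \<partial>Q T) < \<infinity>" .
    have "(\<lambda>x. Y (fst x) (snd x) $ k) \<in> borel_measurable (Q T)" by (rule measurable_compose[OF Ym]) measurable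
    then show "(\<lambda>x. (Y (fst x) (snd x) $ k)\<^sup>2) \<in> borel_measurable (Q T)" by measurable
  qed
  have comp: "(\<integral>\<^sup>+ x. ennreal ((f x $ k - g x $ k)\<^sup>2) \<partial>Q T) \<le> (\<integral>\<^sup>+ x. ennreal ((norm (f x - g x))\<^sup>2) \<partial>Q T)" for f g :: "real \<times> 'w \<Rightarrow> real ^ 'd" and k
  proof (intro nn_integral_mono ennreal_leI)
    fix x
    have "\<bar>(f x - g x) $ k\<bar>\<^sup>2 \<le> (norm (f x - g x))\<^sup>2" by (intro power_mono component_le_norm_cart) auto
    then show "(f x $ k - g x $ k)\<^sup>2 \<le> (norm (f x - g x))\<^sup>2" by simp
  qed
  have nth: "(\<lambda>x. f x $ k) \<in> borel_measurable (Q T)" if "f \<in> borel_measurable (Q T)" for f :: "real \<times> 'w \<Rightarrow> real ^ 'd" and k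
    by (rule measurable_compose[OF that]) measurable
  have L: "(\<lambda>n. expectation (\<lambda>w. indicator A w * ((S n t w - S n u w) * (S' n t w - S' n u w))))
      \<longlonglongrightarrow> expectation (\<lambda>w. indicator A w * ((I t w - I u w) * (I' t w - I' u w)))"
    and Li: "integrable P (\<lambda>w. indicator A w * ((I t w - I u w) * (I' t w - I' u w)))"
  proof -
    have p1: "(\<integral>\<^sup>+ w. ennreal (((S n t w - S n u w) - (I t w - I u w))\<^sup>2) \<partial>P) \<le> ennreal (8 * (1/2) ^ n)"
     "(\<integral>\<^sup>+ w. ennreal (((S' n t w - S' n u w) - (I' t w - I' u w))\<^sup>2) \<partial>P) \<le> ennreal (8 * (1/2) ^ n)" for n
      by (rule increment_approx, use Sm Im u ut c c' in \<open>auto simp: S_def S'_def\<close>)+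
    note l = L2_limit[of "\<lambda>w. I t w - I u w" P "\<lambda>w. I' t w - I' u w" "indicator A" "\<lambda>n w. S n t w - S n u w" "\<lambda>n w. S' n t w - S' n u w" "\<lambda>n. 8 * (1/2) ^ n",
        OF _ _ _ _ _ iI[OF ito Z2] iI[OF ito' Z2'] p1]
    show "(\<lambda>n. expectation (\<lambda>w. indicator A w * ((S n t w - S n u w) * (S' n t w - S' n u w))))
      \<longlonglongrightarrow> expectation (\<lambda>w. indicator A w * ((I t w - I u w) * (I' t w - I' u w)))"
      by (rule l(2)) (use Sm Im u ut geometric_null in \<open>auto simp: indicator_def\<close>)
    show "integrable P (\<lambda>w. indicator A w * ((I t w - I u w) * (I' t w - I' u w)))"
      by (rule l(1)) (use Sm Im u ut geometric_null in \<open>auto simp: indicator_def\<close>)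
  qed
  have Rk: "integrable (Q T) (\<lambda>x. bb x * (z x $ k * z' x $ k))"
     "(\<lambda>n. \<integral>x. bb x * (H n x $ k * H' n x $ k) \<partial>Q T) \<longlonglongrightarrow> (\<integral>x. bb x * (z x $ k * z' x $ k) \<partial>Q T)" for k
  proof -
    have p1: "(\<integral>\<^sup>+ x. ennreal ((H n x $ k - z x $ k)\<^sup>2) \<partial>Q T) \<le> ennreal (1 * (1/2) ^ n)"
      "(\<integral>\<^sup>+ x. ennreal ((H' n x $ k - z' x $ k)\<^sup>2) \<partial>Q T) \<le> ennreal (1 * (1/2) ^ n)" for n
      using order_trans[OF comp q[of n, folded H_def z_def]] order_trans[OF comp q'[of n, folded H'_def z'_def]] by auto
    have zz: "integrable (Q T) (\<lambda>x. (z x $ k)\<^sup>2)" "integrable (Q T) (\<lambda>x. (z' x $ k)\<^sup>2)"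
      using zk[OF _ Z2] zk[OF _ Z2'] zm by (auto simp: z_def[abs_def] z'_def[abs_def])
    note l = L2_limit[of "\<lambda>x. z x $ k" "Q T" "\<lambda>x. z' x $ k" bb "\<lambda>n x. H n x $ k" "\<lambda>n x. H' n x $ k" "\<lambda>n. 1 * (1/2) ^ n",
        OF nth[OF zm(1)] nth[OF zm(2)] bm nth[OF Hm(1)] nth[OF Hm(2)] zz p1 _ geometric_null]
    show "integrable (Q T) (\<lambda>x. bb x * (z x $ k * z' x $ k))" by (rule l(1)) (auto simp: bb_def indicator_def)
    show "(\<lambda>n. \<integral>x. bb x * (H n x $ k * H' n x $ k) \<partial>Q T) \<longlonglongrightarrow> (\<integral>x. bb x * (z x $ k * z' x $ k) \<partial>Q T)"
      by (rule l(2)) (auto simp: bb_def indicator_def)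
  qed
  have ins: "bb x * (f x \<bullet> g x) = (\<Sum>k\<in>UNIV. bb x * (f x $ k * g x $ k))" for x and f g :: "real \<times> 'w \<Rightarrow> real ^ 'd"
    by (simp add: inner_vec_def sum_distrib_left)
  \<comment> \<open>Each simple process is square integrable because its distance to the integrand
    and the integrand itself are.\<close>
  have Hk: "integrable (Q T) (\<lambda>x. bb x * (H n x $ k * H' n x $ k))" for n k
  proof (rule integrable_mult_sq[OF nth[OF Hm(1)] nth[OF Hm(2)] bm])
    have "integrable (Q T) (\<lambda>x. (Y x $ k)\<^sup>2)" if Ym: "Y \<in> borel_measurable (Q T)" "y \<in> borel_measurable (Q T)"
       and le: "(\<integral>\<^sup>+ x. ennreal ((norm (Y x - y x))\<^sup>2) \<partial>Q T) \<le> ennreal ((1/2) ^ n)" and yi: "integrable (Q T) (\<lambda>x. (y x $ k)\<^sup>2)"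
      for Y y :: "real \<times> 'w \<Rightarrow> real ^ 'd"
    proof -
      have d: "integrable (Q T) (\<lambda>x. (Y x $ k - y x $ k)\<^sup>2)"
        by (rule nn_sq_integrable(1)[OF _ order_trans[OF comp le]]) (use nth Ym in auto)
      have "integrable (Q T) (\<lambda>x. ((Y x $ k - y x $ k) - (- y x $ k))\<^sup>2)"
        by (rule integrable_diff_sq) (use d yi nth Ym in auto)
      then show ?thesis by simp
    qed note r = this
    show "integrable (Q T) (\<lambda>x. (H n x $ k)\<^sup>2)"
      using zk[OF _ Z2] zm by (intro r[OF Hm(1) zm(1) q[of n, folded H_def z_def]]) (auto simp: z_def[abs_def])
    show "integrable (Q T) (\<lambda>x. (H' n x $ k)\<^sup>2)"
      using zk[OF _ Z2'] zm by (intro r[OF Hm(2) zm(2) q'[of n, folded H'_def z'_def]]) (auto simp: z'_def[abs_def])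
  qed (auto simp: bb_def indicator_def)
  have R: "(\<lambda>n. \<integral>x. bb x * (H n x \<bullet> H' n x) \<partial>Q T) \<longlonglongrightarrow> (\<integral>x. bb x * (z x \<bullet> z' x) \<partial>Q T)"
    unfolding ins by (simp only: Bochner_Integration.integral_sum Rk(1) Hk) (intro tendsto_sum Rk(2))
  have eq: "expectation (\<lambda>w. indicator A w * ((S n t w - S n u w) * (S' n t w - S' n u w))) = (\<integral>x. bb x * (H n x \<bullet> H' n x) \<partial>Q T)" for n
    using simple_int_isometry(3)[OF sp sp' u A, of n n] unfolding S_def S'_def H_def H'_def bb_def case_prod_beta' .
  show "integrable P (\<lambda>w. indicator A w * ((I t w - I u w) * (I' t w - I' u w)))" by (rule Li)
  have "integrable (Q T) (\<lambda>x. bb x * (z x \<bullet> z' x))" unfolding ins by (intro Bochner_Integration.integrable_sum Rk(1))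
  then show "integrable (Q T) (\<lambda>x. indicator {u..t} (fst x) * indicator A (snd x) * (Z (fst x) (snd x) \<bullet> Z' (fst x) (snd x)))"
    by (simp add: bb_def z_def z'_def)
  have "expectation (\<lambda>w. indicator A w * ((I t w - I u w) * (I' t w - I' u w))) = (\<integral>x. bb x * (z x \<bullet> z' x) \<partial>Q T)"
    by (rule LIMSEQ_unique[OF L[unfolded eq] R])
  then show "expectation (\<lambda>w. indicator A w * ((I t w - I u w) * (I' t w - I' u w)))
      = (\<integral>x. indicator {u..t} (fst x) * indicator A (snd x) * (Z (fst x) (snd x) \<bullet> Z' (fst x) (snd x)) \<partial>Q T)"
    by (simp add: bb_def z_def z'_def)
qed

end

lemma time_integral_eq:
  fixes f :: "real \<Rightarrow> real"
  shows "(\<integral>r. f r \<partial>time_measure t) = (LINT r:{0..t}|lborel. f r)"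
    "integrable (time_measure t) f \<longleftrightarrow> set_integrable lborel {0..t} f"
  unfolding time_measure_def set_lebesgue_integral_def set_integrable_def
  by (simp_all add: integral_restrict_space integrable_restrict_space)

lemma time_integrable_bounded:
  fixes f :: "real \<Rightarrow> real"
  assumes "f \<in> borel_measurable (time_measure T)" "\<And>r. \<bar>f r\<bar> \<le> C"
  shows "integrable (time_measure T) f"
proof -
  interpret finite_measure "time_measure T" by (rule finite_time_measure)
  show ?thesis by (rule integrable_const_bound[of _ C]) (use assms in auto)
qed

lemma time_integral_diff:
  fixes f :: "real \<Rightarrow> real"
  assumes f: "integrable (time_measure T) f" and st: "0 \<le> s" "s \<le> t" "t \<le> T"
  shows "(\<integral>r. f r \<partial>time_measure t) - (\<integral>r. f r \<partial>time_measure s) = (\<integral>r. indicator {s<..t} r * f r \<partial>time_measure T)"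
    "integrable (time_measure T) (\<lambda>r. indicator {s<..t} r * f r)"
proof -
  have [measurable]: "f \<in> borel_measurable (time_measure T)" using f by simp
  have ind: "(\<lambda>r. indicator E r :: real) \<in> borel_measurable (time_measure T)" if "E \<in> sets borel" for E
    using that by (intro borel_measurable_time_measure borel_measurable_indicator) simp
  have i: "integrable (time_measure T) (\<lambda>r. indicator E r * f r)" if E: "E \<in> sets borel" for E
    by (rule Bochner_Integration.integrable_bound[OF f]) (use ind[OF E] in \<open>auto simp: indicator_def\<close>)
  have eq: "(\<integral>r. f r \<partial>time_measure u) = (\<integral>r. indicator {0..u} r * f r \<partial>time_measure T)" if "u \<le> T" for u
  proof -
    have "(\<integral>r. indicator {0..u} r * f r \<partial>time_measure T) = (\<integral>r. indicator {0..T} r *\<^sub>R (indicator {0..u} r * f r) \<partial>lborel)"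
      unfolding time_measure_def by (rule integral_restrict_space) simp
    also have "\<dots> = (\<integral>r. indicator {0..u} r *\<^sub>R f r \<partial>lborel)"
      by (rule Bochner_Integration.integral_cong) (use that in \<open>auto simp: indicator_def\<close>)
    also have "\<dots> = (\<integral>r. f r \<partial>time_measure u)"
      unfolding time_measure_def by (rule integral_restrict_space[symmetric]) simp
    finally show ?thesis by simp
  qed
  show "integrable (time_measure T) (\<lambda>r. indicator {s<..t} r * f r)" by (rule i) simp
  have "(\<integral>r. f r \<partial>time_measure t) - (\<integral>r. f r \<partial>time_measure s)
      = (\<integral>r. indicator {0..t} r * f r - indicator {0..s} r * f r \<partial>time_measure T)"
    using st by (simp add: eq i Bochner_Integration.integral_diff)
  also have "\<dots> = (\<integral>r. indicator {s<..t} r * f r \<partial>time_measure T)"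
    by (rule Bochner_Integration.integral_cong) (use st in \<open>auto simp: indicator_def\<close>)
  finally show "(\<integral>r. f r \<partial>time_measure t) - (\<integral>r. f r \<partial>time_measure s) = (\<integral>r. indicator {s<..t} r * f r \<partial>time_measure T)" .
qed

lemma time_integral_Ioc:
  assumes "0 \<le> s" "s \<le> t" "t \<le> T"
  shows "(\<integral>r. indicator {s<..t} r * c \<partial>time_measure T) = c * (t - s)"
proof -
  have "(\<integral>r. indicator {s<..t} r * c \<partial>time_measure T) = (\<integral>r. indicator {0..T} r *\<^sub>R (indicator {s<..t} r * c) \<partial>lborel)"
    unfolding time_measure_def by (rule integral_restrict_space) simp
  also have "\<dots> = (\<integral>r. indicator {s<..t} r * c \<partial>lborel)"
    by (rule Bochner_Integration.integral_cong) (use assms in \<open>auto simp: indicator_def\<close>)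
  also have "\<dots> = c * (t - s)" using assms by (simp add: mult.commute)
  finally show ?thesis .
qed

section \<open>The sigma-algebra of a stopping time\<close>

context complete_filtration
begin

text \<open>The generating family is already a sigma-algebra, as \<open>sets_stopped_algebra\<close>
  shows; \<open>sigma\<close> only turns it into a measure.\<close>

definition stopped_algebra :: "('w \<Rightarrow> real) \<Rightarrow> 'w measure" where
  "stopped_algebra s = sigma (space P) {A. pre s A}"

lemma sets_stopped_algebra:
  assumes s: "stop s" shows "sets (stopped_algebra s) = {A. pre s A}" "space (stopped_algebra s) = space P"
proof -
  have "sigma_algebra (space P) {A. pre s A}"
    unfolding sigma_algebra_iff2
  proof (intro conjI ballI allI impI)
    show "{A. pre s A} \<subseteq> Pow (space P)" "{} \<in> {A. pre s A}" by (auto simp: pre_def)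
    fix A assume "A \<in> {A. pre s A}"
    then have A: "pre s A" by simp
    show "space P - A \<in> {A. pre s A}"
      unfolding mem_Collect_eq pre_def
    proof (intro conjI allI impI)
      fix t :: real assume t: "0 \<le> t"
      have "(space P - A) \<inter> {w \<in> space P. s w \<le> t} = {w \<in> space P. s w \<le> t} - (A \<inter> {w \<in> space P. s w \<le> t})" by auto
      then show "(space P - A) \<inter> {w \<in> space P. s w \<le> t} \<in> sets (F t)"
        using stopD(2)[OF s t] A t by (simp add: pre_def sets.Diff)
    qed auto
  next
    fix A :: "nat \<Rightarrow> 'w set" assume "range A \<subseteq> {A. pre s A}"
    then have A: "pre s (A n)" for n by auto
    show "(\<Union>n. A n) \<in> {A. pre s A}"
      unfolding mem_Collect_eq pre_def
    proof (intro conjI allI impI)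
      fix t :: real assume t: "0 \<le> t"
      have "(\<Union>n. A n) \<inter> {w \<in> space P. s w \<le> t} = (\<Union>n. A n \<inter> {w \<in> space P. s w \<le> t})" by auto
      moreover have "\<dots> \<in> sets (F t)"
        by (rule sets.countable_UN) (use A t in \<open>auto simp: pre_def\<close>)
      ultimately show "(\<Union>n. A n) \<inter> {w \<in> space P. s w \<le> t} \<in> sets (F t)" by simp
    qed (use A in \<open>auto simp: pre_def\<close>)
  qed
  then show "sets (stopped_algebra s) = {A. pre s A}" "space (stopped_algebra s) = space P"
    unfolding stopped_algebra_def
    by (auto simp: sigma_algebra.sets_measure_of_eq space_measure_of_conv)
qed

lemma stopped_algebra_le:
  assumes "stop s" "0 \<le> T" "\<And>w. w \<in> space P \<Longrightarrow> s w \<le> T"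
  shows "sets (stopped_algebra s) \<subseteq> sets P"
  using pre_sets(2)[OF _ assms(2,3)] sets_stopped_algebra[OF assms(1)] by auto

lemma stopped_algebra_measurable:
  fixes N :: "real \<Rightarrow> 'w \<Rightarrow> 'c::metric_space"
  assumes s: "stop s" and T: "0 \<le> T" and bd: "\<And>w. w \<in> space P \<Longrightarrow> s w \<le> T"
    and N: "\<And>r. 0 \<le> r \<Longrightarrow> N r \<in> borel_measurable (F r)"
    and cont: "AE w in P. continuous_on {0..} (\<lambda>r. N r w)"
  shows "(\<lambda>w. N (s w) w) \<in> borel_measurable (stopped_algebra s)"
proof (rule measurableI)
  fix C :: "'c set" assume C: "C \<in> sets borel"
  let ?A = "(\<lambda>w. N (s w) w) -` C \<inter> space (stopped_algebra s)"
  have "pre s ?A" unfolding pre_def sets_stopped_algebra(2)[OF s]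
  proof (intro conjI allI impI)
    fix t :: real assume t: "0 \<le> t"
    have "(\<lambda>w. N (min t (s w)) w) \<in> borel_measurable (F t)"
      by (rule stopped_measurable[OF s t N]) (use cont in \<open>auto elim!: eventually_mono intro: continuous_on_subset[of "{0..}"]\<close>)
    then have "(\<lambda>w. N (min t (s w)) w) -` C \<inter> space (F t) \<in> sets (F t)" using C by (rule measurable_sets)
    moreover have "((\<lambda>w. N (s w) w) -` C \<inter> space P) \<inter> {w \<in> space P. s w \<le> t}
      = ((\<lambda>w. N (min t (s w)) w) -` C \<inter> space (F t)) \<inter> {w \<in> space P. s w \<le> t}" by (auto simp: min_absorb2)
    ultimately show "((\<lambda>w. N (s w) w) -` C \<inter> space P) \<inter> {w \<in> space P. s w \<le> t} \<in> sets (F t)"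
      using stopD(2)[OF s t] by (simp only: sets.Int)
  qed auto
  then show "?A \<in> sets (stopped_algebra s)" using sets_stopped_algebra(1)[OF s] by simp
qed auto

text \<open>Increments after \<open>s\<close> are orthogonal to the past of \<open>s\<close>, here
  with bounded weights in place of indicators. This serves instead of conditioning at a stopping
  time.\<close>

lemma weighted_optional_stopping:
  fixes W :: "'w \<Rightarrow> real"
  assumes N: "mart T N" and T: "0 \<le> T" and s: "stop s" and s': "stop s'"
    and le: "\<And>w. w \<in> space P \<Longrightarrow> s w \<le> s' w" and bd: "\<And>w. w \<in> space P \<Longrightarrow> s' w \<le> T"
    and W: "W \<in> borel_measurable (stopped_algebra s)" and Wb: "\<And>w. w \<in> space P \<Longrightarrow> \<bar>W w\<bar> \<le> C"
  shows "integrable P (\<lambda>w. W w * (N (s' w) w - N (s w) w))" "expectation (\<lambda>w. W w * (N (s' w) w - N (s w) w)) = 0"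
proof -
  have bds: "s w \<le> T" if "w \<in> space P" for w using le[OF that] bd[OF that] by simp
  have sub: "subalgebra P (stopped_algebra s)"
    using stopped_algebra_le[OF s T bds] sets_stopped_algebra(2)[OF s] by (auto simp: subalgebra_def)
  have i: "integrable P (\<lambda>w. N (s' w) w - N (s w) w)"
    by (intro Bochner_Integration.integrable_diff optional_stopping(1)[OF N T] s s' bds bd)
  have Wm: "W \<in> borel_measurable P" by (rule measurable_from_subalg[OF sub W])
  show iW: "integrable P (\<lambda>w. W w * (N (s' w) w - N (s w) w))"
  proof (rule Bochner_Integration.integrable_bound[OF integrable_mult_right[of C, OF i]])
    show "(\<lambda>w. W w * (N (s' w) w - N (s w) w)) \<in> borel_measurable P" using Wm i by measurable
    show "AE w in P. norm (W w * (N (s' w) w - N (s w) w)) \<le> norm (C * (N (s' w) w - N (s w) w))"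
    proof (rule AE_I2)
      fix w assume "w \<in> space P"
      then have "\<bar>W w\<bar> \<le> \<bar>C\<bar>" using Wb[of w] by simp
      then show "norm (W w * (N (s' w) w - N (s w) w)) \<le> norm (C * (N (s' w) w - N (s w) w))"
        unfolding real_norm_def abs_mult by (rule mult_right_mono) simp
    qed
  qed
  show "expectation (\<lambda>w. W w * (N (s' w) w - N (s w) w)) = 0"
  proof (rule mean_zero_mult[OF sub i _ W iW])
    fix A assume "A \<in> sets (stopped_algebra s)"
    then have "pre s A" using sets_stopped_algebra(1)[OF s] by simp
    then show "expectation (\<lambda>w. indicator A w * (N (s' w) w - N (s w) w)) = 0"
      by (intro optional_stopping_increment(2)[OF N T s s'] le bd)
  qed
qed

end

section \<open>The covariation of two integrals\<close>

context brownian
begin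

lemma time_integral_adapted:
  fixes f :: "real \<Rightarrow> 'w \<Rightarrow> real"
  assumes f: "progressively_measurable (aug_filtration M B) f" and t: "0 \<le> t"
  shows "(\<lambda>w. \<integral>r. f r w \<partial>time_measure t) \<in> borel_measurable (Ft t)"
proof -
  have 1: "(\<lambda>(r, w). f r w) \<in> borel_measurable (restrict_space borel {0..t} \<Otimes>\<^sub>M Ft t)"
    using f t by (simp add: progressively_measurable_def)
  have "(\<lambda>x. (snd x, fst x)) \<in> measurable (Ft t \<Otimes>\<^sub>M time_measure t) (restrict_space borel {0..t} \<Otimes>\<^sub>M Ft t)"
    by (intro measurable_Pair) (auto simp: measurable_cong_sets[OF refl sets_time_measure[symmetric]])
  from measurable_compose[OF this 1]
  have "(\<lambda>(w, r). f r w) \<in> borel_measurable (Ft t \<Otimes>\<^sub>M time_measure t)" by (simp add: case_prod_beta')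
  then show ?thesis by (rule TP.M1.borel_measurable_lebesgue_integral)
qed

lemma progressive_section:
  fixes f :: "real \<Rightarrow> 'w \<Rightarrow> real"
  assumes f: "progressively_measurable (aug_filtration M B) f" and T: "0 \<le> T" and w: "w \<in> space M"
  shows "(\<lambda>r. f r w) \<in> borel_measurable (time_measure T)"
  using section_measurable[OF progressive_measurable_product[OF f T] w] by simp

lemma progressive_adapted:
  fixes Z :: "real \<Rightarrow> 'w \<Rightarrow> 'c::topological_space"
  assumes Z: "progressively_measurable (aug_filtration M B) Z" and t: "0 \<le> t"
  shows "Z t \<in> borel_measurable (Ft t)"
proof -
  have Z': "(\<lambda>(r, w). Z r w) \<in> borel_measurable (restrict_space borel {0..t} \<Otimes>\<^sub>M Ft t)"
    using Z t by (simp add: progressively_measurable_def)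
  have "(\<lambda>w. (t, w)) \<in> measurable (Ft t) (restrict_space borel {0..t} \<Otimes>\<^sub>M Ft t)"
    by (rule measurable_Pair1') (use t in \<open>simp add: space_restrict_space\<close>)
  from measurable_compose[OF this Z'] show ?thesis by simp
qed

lemma progressive_stopped:
  fixes Z :: "real \<Rightarrow> 'w \<Rightarrow> 'c::topological_space"
  assumes Z: "progressively_measurable (aug_filtration M B) Z" and s: "stop s" and t: "0 \<le> t"
  shows "(\<lambda>w. Z (min t (s w)) w) \<in> borel_measurable (Ft t)"
proof -
  have Z': "(\<lambda>(r, w). Z r w) \<in> borel_measurable (restrict_space borel {0..t} \<Otimes>\<^sub>M Ft t)"
    using Z t by (simp add: progressively_measurable_def)
  have "(\<lambda>w. min t (s w)) \<in> measurable (Ft t) (restrict_space borel {0..t})"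
    by (rule measurable_restrict_space2) (use stopD(1)[OF s] t stop_min_measurable[OF s t] in auto)
  then have "(\<lambda>w. (min t (s w), w)) \<in> measurable (Ft t) (restrict_space borel {0..t} \<Otimes>\<^sub>M Ft t)"
    by (intro measurable_Pair) auto
  from measurable_compose[OF this Z'] show ?thesis by simp
qed

lemma progressive_inner:
  fixes Z Z' :: "real \<Rightarrow> 'w \<Rightarrow> real ^ 'd"
  assumes "progressively_measurable (aug_filtration M B) Z" "progressively_measurable (aug_filtration M B) Z'"
  shows "progressively_measurable (aug_filtration M B) (\<lambda>r w. Z r w \<bullet> Z' r w)"
  using assms unfolding progressively_measurable_def case_prod_beta'
  by (auto intro!: borel_measurable_inner)

lemma bounded_sq_integrable_integrand:
  fixes Z :: "real \<Rightarrow> 'w \<Rightarrow> real ^ 'd"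
  assumes K: "\<And>r w. norm (Z r w) \<le> K"
  shows "sq_integrable_integrand T Z"
proof -
  interpret a: finite_measure "time_measure T" by (rule finite_time_measure)
  have "(\<integral>\<^sup>+ r. ennreal ((norm (Z r w))\<^sup>2) \<partial>time_measure T) \<le> ennreal (K\<^sup>2) * emeasure (time_measure T) (space (time_measure T))" for w
  proof -
    have "(\<integral>\<^sup>+ r. ennreal ((norm (Z r w))\<^sup>2) \<partial>time_measure T) \<le> (\<integral>\<^sup>+ r. ennreal (K\<^sup>2) \<partial>time_measure T)"
      by (intro nn_integral_mono ennreal_leI power_mono K) auto
    then show ?thesis by simp
  qed
  then have "(\<integral>\<^sup>+ w. (\<integral>\<^sup>+ r. ennreal ((norm (Z r w))\<^sup>2) \<partial>time_measure T) \<partial>P)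
      \<le> (\<integral>\<^sup>+ w. ennreal (K\<^sup>2) * emeasure (time_measure T) (space (time_measure T)) \<partial>P)"
    by (intro nn_integral_mono)
  also have "\<dots> = ennreal (K\<^sup>2) * emeasure (time_measure T) (space (time_measure T))" using emeasure_space_1 by simp
  also have "\<dots> < \<infinity>"
  proof -
    have "emeasure (time_measure T) (space (time_measure T)) < \<top>"
      using a.emeasure_finite[of "space (time_measure T)"] by (simp only: less_top infinity_ennreal_def)
    then show ?thesis by (simp add: ennreal_mult_less_top)
  qed
  finally show ?thesis .
qed

text \<open>The bracket process of the integrals of \<open>Z\<close> and \<open>Z'\<close> against
  \<open>B\<close>.\<close>

definition covariation :: "(real \<Rightarrow> 'w \<Rightarrow> real ^ 'd) \<Rightarrow> (real \<Rightarrow> 'w \<Rightarrow> real ^ 'd) \<Rightarrow> real \<Rightarrow> 'w \<Rightarrow> real" where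
  "covariation Z Z' t w = (\<integral>r. Z r w \<bullet> Z' r w \<partial>time_measure t)"

lemma covariation_increment:
  fixes Z Z' :: "real \<Rightarrow> 'w \<Rightarrow> real ^ 'd"
  assumes Z: "progressively_measurable (aug_filtration M B) Z" "progressively_measurable (aug_filtration M B) Z'"
    and K: "\<And>r w. norm (Z r w) \<le> K" "\<And>r w. norm (Z' r w) \<le> K"
    and w: "w \<in> space M" and st: "0 \<le> s" "s \<le> t" "t \<le> T"
  shows "covariation Z Z' t w - covariation Z Z' s w = (\<integral>r. indicator {s<..t} r * (Z r w \<bullet> Z' r w) \<partial>time_measure T)"
    "integrable (time_measure T) (\<lambda>r. indicator {s<..t} r * (Z r w \<bullet> Z' r w))"
    "integrable (time_measure T) (\<lambda>r. Z r w \<bullet> Z' r w)"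
    "\<bar>Z r w \<bullet> Z' r w\<bar> \<le> K\<^sup>2"
proof -
  show b: "\<bar>Z r w \<bullet> Z' r w\<bar> \<le> K\<^sup>2" for r
  proof -
    have "\<bar>Z r w \<bullet> Z' r w\<bar> \<le> norm (Z r w) * norm (Z' r w)" by (rule Cauchy_Schwarz_ineq2)
    also have "\<dots> \<le> K * K" using K[of r w] by (intro mult_mono) (auto intro: order_trans[OF norm_ge_zero])
    finally show ?thesis by (simp add: power2_eq_square)
  qed
  have T: "0 \<le> T" using st by simp
  show i: "integrable (time_measure T) (\<lambda>r. Z r w \<bullet> Z' r w)"
    by (rule time_integrable_bounded[OF progressive_section[OF progressive_inner[OF Z] T w] b])
  show "covariation Z Z' t w - covariation Z Z' s w = (\<integral>r. indicator {s<..t} r * (Z r w \<bullet> Z' r w) \<partial>time_measure T)"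
    "integrable (time_measure T) (\<lambda>r. indicator {s<..t} r * (Z r w \<bullet> Z' r w))"
    unfolding covariation_def using time_integral_diff[OF i st] by auto
qed

lemma covariation_continuous:
  fixes Z Z' :: "real \<Rightarrow> 'w \<Rightarrow> real ^ 'd"
  assumes Z: "progressively_measurable (aug_filtration M B) Z" "progressively_measurable (aug_filtration M B) Z'"
    and K: "\<And>r w. norm (Z r w) \<le> K" "\<And>r w. norm (Z' r w) \<le> K"
    and w: "w \<in> space M" and T: "0 \<le> T"
  shows "continuous_on {0..T} (\<lambda>t. covariation Z Z' t w)"
  using continuous_on_set_lebesgue_integral[of 0 T "\<lambda>r. Z r w \<bullet> Z' r w"]
    covariation_increment(3)[OF Z K w order_refl T order_refl]
  unfolding covariation_def time_integral_eq by blast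

lemma covariation_adapted:
  fixes Z Z' :: "real \<Rightarrow> 'w \<Rightarrow> real ^ 'd"
  assumes Z: "progressively_measurable (aug_filtration M B) Z" "progressively_measurable (aug_filtration M B) Z'"
    and t: "0 \<le> t"
  shows "covariation Z Z' t \<in> borel_measurable (Ft t)"
  unfolding covariation_def[abs_def] by (rule time_integral_adapted[OF progressive_inner[OF Z] t])

text \<open>The increment of the product is the product of the increments plus two cross terms. The
  cross terms have mean zero, and the isometry on events of the past turns the mean of the first
  into that of the covariation increment.\<close>

lemma ito_product_mart:
  fixes Z Z' :: "real \<Rightarrow> 'w \<Rightarrow> real ^ 'd"
  assumes ito: "ito_integral M B Z I" and ito': "ito_integral M B Z' I'"
    and K: "\<And>r w. norm (Z r w) \<le> K" "\<And>r w. norm (Z' r w) \<le> K" and T: "0 \<le> T"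
  shows "mart T (\<lambda>t w. I t w * I' t w - covariation Z Z' t w)"
proof -
  have Zp: "progressively_measurable (aug_filtration M B) Z" "progressively_measurable (aug_filtration M B) Z'"
    using ito ito' by (simp_all add: ito_integral_def)
  note Z2 = bounded_sq_integrable_integrand[OF K(1), of T] bounded_sq_integrable_integrand[OF K(2), of T]
  note mI = ito_integral_mart[OF ito T Z2(1)] and mI' = ito_integral_mart[OF ito' T Z2(2)]
  have sq: "integrable P (\<lambda>w. (I t w)\<^sup>2)" "integrable P (\<lambda>w. (I' t w)\<^sup>2)" if "0 \<le> t" "t \<le> T" for t
    by (rule ito_integral_sq_integrable[OF ito T Z2(1) that] ito_integral_sq_integrable[OF ito' T Z2(2) that])+
  have ad: "I t \<in> borel_measurable (Ft t)" "I' t \<in> borel_measurable (Ft t)" "covariation Z Z' t \<in> borel_measurable (Ft t)" if "0 \<le> t" for t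
    by (rule ito_integral_adapted[OF ito that] ito_integral_adapted[OF ito' that] covariation_adapted[OF Zp that])+
  have mP: "I t \<in> borel_measurable P" "I' t \<in> borel_measurable P" "covariation Z Z' t \<in> borel_measurable P" if "0 \<le> t" for t
    using ad[OF that] measurable_F by blast+
  have prod: "integrable P (\<lambda>w. f w * g w)" if "f \<in> borel_measurable P" "g \<in> borel_measurable P"
    "integrable P (\<lambda>w. (f w)\<^sup>2)" "integrable P (\<lambda>w. (g w)\<^sup>2)" for f g :: "'w \<Rightarrow> real"
  proof -
    have "integrable P (\<lambda>w. 1 * (f w * g w))" by (rule integrable_mult_sq) (use that in auto)
    then show ?thesis by simp
  qed
  have cb: "\<bar>covariation Z Z' t w\<bar> \<le> K\<^sup>2 * T" if "w \<in> space M" "0 \<le> t" "t \<le> T" for t w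
  proof -
    note ci = covariation_increment[OF Zp K that(1) order_refl that(2,3)]
    have "covariation Z Z' 0 w = 0"
    proof -
      have "(\<integral>r. f r \<partial>time_measure 0) = 0" for f :: "real \<Rightarrow> real"
        unfolding time_integral_eq set_lebesgue_integral_def
      proof (rule integral_eq_zero_AE)
        show "AE r in lborel. indicator {0..0} r *\<^sub>R f r = 0"
          using AE_lborel_singleton[of "0::real"] by eventually_elim (auto simp: indicator_def)
      qed
      then show ?thesis by (simp add: covariation_def)
    qed
    then have "\<bar>covariation Z Z' t w\<bar> = \<bar>\<integral>r. indicator {0<..t} r * (Z r w \<bullet> Z' r w) \<partial>time_measure T\<bar>" using ci(1) by simp
    also have "\<dots> \<le> (\<integral>r. \<bar>indicator {0<..t} r * (Z r w \<bullet> Z' r w)\<bar> \<partial>time_measure T)" by (rule integral_abs_bound)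
    also have "\<dots> \<le> (\<integral>r. indicator {0<..t} r * K\<^sup>2 \<partial>time_measure T)"
    proof (rule integral_mono[OF integrable_abs[OF ci(2)]])
      show "integrable (time_measure T) (\<lambda>r. indicator {0<..t} r * K\<^sup>2)"
        by (rule time_integrable_bounded[of _ _ "K\<^sup>2"]) (auto intro!: borel_measurable_time_measure simp: indicator_def)
      show "\<bar>indicator {0<..t} r * (Z r w \<bullet> Z' r w)\<bar> \<le> indicator {0<..t} r * K\<^sup>2" for r
        using covariation_increment(4)[OF Zp K that(1) order_refl that(2,3), of r] by (auto simp: indicator_def)
    qed
    also have "\<dots> = K\<^sup>2 * t" using time_integral_Ioc[OF order_refl that(2,3), of "K\<^sup>2"] by simp
    also have "\<dots> \<le> K\<^sup>2 * T" using that by (intro mult_left_mono) auto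
    finally show ?thesis .
  qed
  have ic: "integrable P (covariation Z Z' t)" if "0 \<le> t" "t \<le> T" for t
    by (rule integrable_const_bound[of _ "K\<^sup>2 * T"]) (use cb that mP in auto)
  have iN: "integrable P (\<lambda>w. I t w * I' t w - covariation Z Z' t w)" if "0 \<le> t" "t \<le> T" for t
    by (intro Bochner_Integration.integrable_diff prod mP sq ic that)
  show ?thesis unfolding mart_def
  proof (intro conjI allI impI ballI)
    show "AE w in P. continuous_on {0..T} (\<lambda>t. I t w * I' t w - covariation Z Z' t w)"
      using martD(4)[OF mI T order_refl] martD(4)[OF mI' T order_refl] AE_space
      by eventually_elim (intro continuous_intros covariation_continuous[OF Zp K _ T], auto)
    fix t assume t': "0 \<le> t \<and> t \<le> T"
    then have t: "0 \<le> t" "t \<le> T" by auto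
    show "(\<lambda>w. I t w * I' t w - covariation Z Z' t w) \<in> borel_measurable (Ft t)" using ad[OF t(1)] by measurable
    show "integrable P (\<lambda>w. I t w * I' t w - covariation Z Z' t w)" by (rule iN[OF t])
    fix A assume A: "A \<in> sets (Ft t)"
    then have AP [measurable]: "A \<in> sets P" using sets_F by blast
    define a where "a w = (indicator A w :: real)" for w
    have am: "a \<in> borel_measurable (Ft t)" unfolding a_def[abs_def] using A by measurable
    have z1: "integrable P (\<lambda>w. (a w * I t w) * (I' T w - I' t w))" "expectation (\<lambda>w. (a w * I t w) * (I' T w - I' t w)) = 0"
      and z2: "integrable P (\<lambda>w. (a w * I' t w) * (I T w - I t w))" "expectation (\<lambda>w. (a w * I' t w) * (I T w - I t w)) = 0"
    proof -
      \<comment> \<open>One argument for both cross terms: \<open>G\<close> is known at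
        \<open>t\<close> and square integrable, and \<open>N\<close> is a martingale.\<close>
      have g: "integrable P (\<lambda>w. (a w * G w) * (N T w - N t w)) \<and> expectation (\<lambda>w. (a w * G w) * (N T w - N t w)) = 0"
        if Gm: "G \<in> borel_measurable (Ft t)" and Gs: "integrable P (\<lambda>w. (G w)\<^sup>2)" and ito: "ito_integral M B Y N" and Y: "\<And>r w. norm (Y r w) \<le> K"
        for G N Y
      proof -
        note Y2 = bounded_sq_integrable_integrand[OF Y, of T]
        note mN = ito_integral_mart[OF ito T Y2]
        have Nm: "N r \<in> borel_measurable P" if "0 \<le> r" for r by (rule measurable_F[OF ito_integral_adapted[OF ito that]])
        have dsq: "integrable P (\<lambda>w. (N T w - N t w)\<^sup>2)"
          by (intro integrable_diff_sq Nm ito_integral_sq_integrable[OF ito T Y2] t T order_refl)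
        have i: "integrable P (\<lambda>w. a w * (G w * (N T w - N t w)))"
          by (rule integrable_mult_sq[OF measurable_F[OF Gm] _ measurable_F[OF am] Gs dsq])
            (use Nm t T in \<open>auto simp: a_def indicator_def\<close>)
        then have i': "integrable P (\<lambda>w. (a w * G w) * (N T w - N t w))" by (simp add: mult.assoc)
        have "expectation (\<lambda>w. (a w * G w) * (N T w - N t w)) = 0"
        proof (rule mean_zero_mult[OF _ _ _ _ i'])
          show "subalgebra P (Ft t)" using sets_F by (auto simp: subalgebra_def)
          show "integrable P (\<lambda>w. N T w - N t w)" using martD(2)[OF mN] t T by auto
          show "expectation (\<lambda>w. indicator C w * (N T w - N t w)) = 0" if "C \<in> sets (Ft t)" for C
            by (rule ito_integral_increment_mean[OF ito Y2 t(1,2) order_refl that])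
          show "(\<lambda>w. a w * G w) \<in> borel_measurable (Ft t)" using am Gm by measurable
        qed
        then show ?thesis using i' by simp
      qed
      show "integrable P (\<lambda>w. (a w * I t w) * (I' T w - I' t w))" "expectation (\<lambda>w. (a w * I t w) * (I' T w - I' t w)) = 0"
        using g[OF ad(1)[OF t(1)] sq(1)[OF t] ito' K(2)] by auto
      show "integrable P (\<lambda>w. (a w * I' t w) * (I T w - I t w))" "expectation (\<lambda>w. (a w * I' t w) * (I T w - I t w)) = 0"
        using g[OF ad(2)[OF t(1)] sq(2)[OF t] ito K(1)] by auto
    qed
    note iso = ito_integral_isometry[OF ito Z2(1) ito' Z2(2) t order_refl A]
    have cov: "(\<integral>x. indicator {t..T} (fst x) * indicator A (snd x) * (Z (fst x) (snd x) \<bullet> Z' (fst x) (snd x)) \<partial>Q T)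
        = expectation (\<lambda>w. a w * (covariation Z Z' T w - covariation Z Z' t w))"
    proof -
      have "(\<integral>x. indicator {t..T} (fst x) * indicator A (snd x) * (Z (fst x) (snd x) \<bullet> Z' (fst x) (snd x)) \<partial>Q T)
         = (\<integral>w. (\<integral>r. indicator {t..T} r * indicator A w * (Z r w \<bullet> Z' r w) \<partial>time_measure T) \<partial>P)"
        using TP.integral_snd[of T "\<lambda>r w. indicator {t..T} r * indicator A w * (Z r w \<bullet> Z' r w)"] iso(2) by (simp add: case_prod_beta')
      also have "\<dots> = expectation (\<lambda>w. a w * (covariation Z Z' T w - covariation Z Z' t w))"
      proof (rule Bochner_Integration.integral_cong[OF refl])
        fix w assume "w \<in> space P"
        then have w: "w \<in> space M" by simp
        note ci = covariation_increment[OF Zp K w t order_refl]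
        have "(\<integral>r. indicator {t..T} r * indicator A w * (Z r w \<bullet> Z' r w) \<partial>time_measure T)
            = a w * (\<integral>r. indicator {t..T} r * (Z r w \<bullet> Z' r w) \<partial>time_measure T)"
          by (subst integral_mult_right_zero[symmetric]) (simp add: a_def mult_ac)
        \<comment> \<open>The isometry has a closed interval and the covariation increment a
          half-open one; they differ by a null set.\<close>
        also have "(\<integral>r. indicator {t..T} r * (Z r w \<bullet> Z' r w) \<partial>time_measure T) = (\<integral>r. indicator {t<..T} r * (Z r w \<bullet> Z' r w) \<partial>time_measure T)"
        proof (rule integral_cong_AE)
          have zm: "(\<lambda>r. Z r w \<bullet> Z' r w) \<in> borel_measurable (time_measure T)" using ci(3) by simp
          have im: "(\<lambda>r. indicator E r :: real) \<in> borel_measurable (time_measure T)" if "E \<in> sets borel" for E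
            using that by (intro borel_measurable_time_measure borel_measurable_indicator) simp
          show "(\<lambda>r. indicator {t..T} r * (Z r w \<bullet> Z' r w)) \<in> borel_measurable (time_measure T)"
            "(\<lambda>r. indicator {t<..T} r * (Z r w \<bullet> Z' r w)) \<in> borel_measurable (time_measure T)"
            by (intro borel_measurable_times zm im; simp)+
          have "AE r in time_measure T. r \<noteq> t"
            unfolding time_measure_def using AE_lborel_singleton[of t] by (subst AE_restrict_space_iff) (auto elim!: eventually_mono)
          then show "AE r in time_measure T. indicator {t..T} r * (Z r w \<bullet> Z' r w) = indicator {t<..T} r * (Z r w \<bullet> Z' r w)"
            by eventually_elim (auto simp: indicator_def)
        qed
        finally show "(\<integral>r. indicator {t..T} r * indicator A w * (Z r w \<bullet> Z' r w) \<partial>time_measure T)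
            = a w * (covariation Z Z' T w - covariation Z Z' t w)" unfolding ci(1) .
      qed
      finally show ?thesis .
    qed
    have ica: "integrable P (\<lambda>w. a w * (covariation Z Z' T w - covariation Z Z' t w))"
      unfolding a_def using ic[OF T order_refl] ic[OF t] by (intro integrable_indicator_mult AP Bochner_Integration.integrable_diff)
    have "expectation (\<lambda>w. indicator A w * (I T w * I' T w - covariation Z Z' T w)) - expectation (\<lambda>w. indicator A w * (I t w * I' t w - covariation Z Z' t w))
       = expectation (\<lambda>w. indicator A w * (I T w * I' T w - covariation Z Z' T w) - indicator A w * (I t w * I' t w - covariation Z Z' t w))"
      by (intro Bochner_Integration.integral_diff[symmetric] integrable_indicator_mult AP iN t T order_refl)
    also have "\<dots> = expectation (\<lambda>w. a w * ((I T w - I t w) * (I' T w - I' t w)) + (a w * I t w) * (I' T w - I' t w)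
        + (a w * I' t w) * (I T w - I t w) - a w * (covariation Z Z' T w - covariation Z Z' t w))"
      by (rule Bochner_Integration.integral_cong) (simp_all add: a_def algebra_simps)
    also have "\<dots> = expectation (\<lambda>w. a w * ((I T w - I t w) * (I' T w - I' t w))) + 0 + 0 - expectation (\<lambda>w. a w * (covariation Z Z' T w - covariation Z Z' t w))"
      using iso(1)[folded a_def] z1 z2 ica by simp
    also have "\<dots> = 0" using iso(3)[folded a_def] cov[unfolded a_def, folded a_def] by (simp add: a_def)
    finally show "expectation (\<lambda>w. indicator A w * (I t w * I' t w - covariation Z Z' t w)) = expectation (\<lambda>w. indicator A w * (I T w * I' T w - covariation Z Z' T w))"
      by simp
  qed
qed

end

subsection \<open>The exit time of the diffusion\<close>

lemma norm_matrix_vector_le: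
  fixes A :: "real ^ 'n ^ 'm"
  shows "norm (A *v x) \<le> real CARD('m) * norm A * norm x"
proof -
  have "norm (A *v x) \<le> (\<Sum>k\<in>UNIV. \<bar>(A *v x) $ k\<bar>)" by (rule norm_le_l1_cart)
  also have "\<dots> \<le> (\<Sum>k\<in>(UNIV :: 'm set). norm A * norm x)"
  proof (rule sum_mono)
    fix k
    have "\<bar>(A *v x) $ k\<bar> \<le> norm (A $ k) * norm x"
      unfolding matrix_vector_mul_component by (rule Cauchy_Schwarz_ineq2)
    also have "\<dots> \<le> norm A * norm x" by (intro mult_right_mono Finite_Cartesian_Product.norm_nth_le) auto
    finally show "\<bar>(A *v x) $ k\<bar> \<le> norm A * norm x" .
  qed
  finally show ?thesis by simp
qed

text \<open>A local defining function with the constants of the exit estimate: two-sided bounds of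
  the gradient, a quadratic Taylor error and a Lipschitz bound. Compactness of the closed ball makes
  them uniform.\<close>

lemma C2_boundary_local:
  fixes D :: "(real ^ 'd) set"
  assumes C2: "C2_boundary D" and D: "open D" and z: "z \<in> frontier D"
  obtains r C G m \<phi> g where "0 < r" "0 < C" "0 < G" "0 < m"
    "continuous_on (cball z r) g"
    "\<And>y. y \<in> cball z r \<Longrightarrow> norm (g y) \<le> G \<and> m \<le> norm (g y)"
    "\<And>y y'. y \<in> cball z r \<Longrightarrow> y' \<in> cball z r \<Longrightarrow> \<bar>\<phi> y' - \<phi> y - g y \<bullet> (y' - y)\<bar> \<le> C * (norm (y' - y))\<^sup>2"
    "\<And>y y'. y \<in> cball z r \<Longrightarrow> y' \<in> cball z r \<Longrightarrow> \<bar>\<phi> y' - \<phi> y\<bar> \<le> G * norm (y' - y)"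
    "\<And>y. y \<in> cball z r \<Longrightarrow> y \<in> closure D \<Longrightarrow> 0 \<le> \<phi> y"
    "\<And>y. y \<in> cball z r \<Longrightarrow> y \<in> frontier D \<Longrightarrow> (\<phi> y :: real) = 0"
proof -
  obtain U \<phi> g H where U: "open U" "z \<in> U"
    and d1: "\<And>y. y \<in> U \<Longrightarrow> (\<phi> has_derivative (\<lambda>v. g y \<bullet> v)) (at y)"
    and d2: "\<And>y. y \<in> U \<Longrightarrow> (g has_derivative (\<lambda>v. H y *v v)) (at y)"
    and gnz: "\<And>y. y \<in> U \<Longrightarrow> g y \<noteq> 0"
    and H: "continuous_on U H" and DU: "D \<inter> U = {y \<in> U. (\<phi> :: real ^ 'd \<Rightarrow> real) y > 0}"
    using C2[unfolded C2_boundary_def, rule_format, OF z] by blast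
  obtain r1 where r1: "0 < r1" "cball z r1 \<subseteq> U" using U open_contains_cball by blast
  have gz: "0 < norm (g z)" using gnz U by simp
  have "isCont g z" using d2[OF U(2)] has_derivative_continuous by blast
  have "\<exists>e>0. \<forall>y. dist y z < e \<longrightarrow> dist (g y) (g z) < norm (g z) / 2"
  proof -
    have "0 < norm (g z) / 2" using gz by simp
    from \<open>isCont g z\<close>[unfolded continuous_at_eps_delta, rule_format, OF this] show ?thesis .
  qed
  then obtain e where e: "0 < e" "\<And>y. dist y z < e \<Longrightarrow> dist (g y) (g z) < norm (g z) / 2" by blast
  \<comment> \<open>Small enough for the ball to lie in \<open>U\<close> and for the gradient to
    keep half of its length at \<open>z\<close>.\<close>
  define r where "r = min r1 (e/2)"
  have r: "0 < r" "cball z r \<subseteq> U" using r1 e by (auto simp: r_def)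
  have cg: "continuous_on (cball z r) g"
    by (rule has_derivative_continuous_on[OF has_derivative_at_withinI[OF d2]]) (use r in auto)
  have gb: "norm (g z) / 2 \<le> norm (g y)" if "y \<in> cball z r" for y
  proof -
    have "dist (g y) (g z) < norm (g z) / 2" using that e(1) by (intro e(2)) (auto simp: r_def dist_commute)
    then show ?thesis using norm_triangle_ineq2[of "g z" "g z - g y"] by (simp add: dist_norm norm_minus_commute)
  qed
  have "compact (g ` cball z r)" by (intro compact_continuous_image cg compact_cball)
  then have "bounded (g ` cball z r)" by (rule compact_imp_bounded)
  then obtain G where G: "0 < G" "\<And>y. y \<in> cball z r \<Longrightarrow> norm (g y) \<le> G"
    unfolding bounded_pos by blast
  have "compact (H ` cball z r)" by (intro compact_continuous_image continuous_on_subset[OF H r(2)] compact_cball)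
  then have "bounded (H ` cball z r)" by (rule compact_imp_bounded)
  then obtain B0 where B0: "0 < B0" "\<And>y. y \<in> cball z r \<Longrightarrow> norm (H y) \<le> B0"
    unfolding bounded_pos by blast
  define C where "C = real CARD('d) * B0"
  have C: "0 < C" using B0 by (simp add: C_def)
  have lip: "norm (g y' - g y) \<le> C * norm (y' - y)" if "y \<in> cball z r" "y' \<in> cball z r" for y y'
  proof (rule differentiable_bound[OF convex_cball _ _ that(2,1)])
    fix u assume u: "u \<in> cball z r"
    show "(g has_derivative (\<lambda>v. H u *v v)) (at u within cball z r)"
      by (rule has_derivative_at_withinI[OF d2]) (use u r in auto)
    show "onorm (\<lambda>v. H u *v v) \<le> C"
    proof (rule onorm_bound)
      fix v
      have "norm (H u *v v) \<le> real CARD('d) * norm (H u) * norm v" by (rule norm_matrix_vector_le)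
      also have "\<dots> \<le> C * norm v" unfolding C_def using B0(2)[OF u] by (intro mult_right_mono mult_left_mono) auto
      finally show "norm (H u *v v) \<le> C * norm v" .
    qed (use C in simp)
  qed
  have taylor: "\<bar>\<phi> y' - \<phi> y - g y \<bullet> (y' - y)\<bar> \<le> C * (norm (y' - y))\<^sup>2" if y: "y \<in> cball z r" and y': "y' \<in> cball z r" for y y'
  proof -
    have seg: "closed_segment y y' \<subseteq> cball z r" using y y' by (simp add: closed_segment_subset)
    \<comment> \<open>The mean value inequality for \<open>\<phi>\<close> minus its linear part at
      \<open>y\<close>, whose derivative along the segment is at most
      \<open>C * norm (y' - y)\<close>.\<close>
    have "norm ((\<phi> y' - g y \<bullet> y') - (\<phi> y - g y \<bullet> y)) \<le> (C * norm (y' - y)) * norm (y' - y)"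
    proof (rule differentiable_bound[of "closed_segment y y'" "\<lambda>u. \<phi> u - g y \<bullet> u"])
      fix u assume u: "u \<in> closed_segment y y'"
      have uU: "u \<in> U" using u seg r by auto
      show "((\<lambda>u. \<phi> u - g y \<bullet> u) has_derivative (\<lambda>v. g u \<bullet> v - g y \<bullet> v)) (at u within closed_segment y y')"
        by (rule has_derivative_diff[OF has_derivative_at_withinI[OF d1[OF uU]]
              has_derivative_inner_right[OF has_derivative_ident]])
      show "onorm (\<lambda>v. g u \<bullet> v - g y \<bullet> v) \<le> C * norm (y' - y)"
      proof (rule onorm_bound)
        fix v
        have "norm (g u \<bullet> v - g y \<bullet> v) = \<bar>(g u - g y) \<bullet> v\<bar>" by (simp add: inner_diff_left)
        also have "\<dots> \<le> norm (g u - g y) * norm v" by (rule Cauchy_Schwarz_ineq2)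
        also have "\<dots> \<le> (C * norm (y' - y)) * norm v"
        proof (rule mult_right_mono)
          have "norm (g u - g y) \<le> C * norm (u - y)" by (rule lip) (use y u seg in auto)
          also have "\<dots> \<le> C * norm (y' - y)"
            using segment_bound1[OF u] C by (intro mult_left_mono) auto
          finally show "norm (g u - g y) \<le> C * norm (y' - y)" .
        qed simp
        finally show "norm (g u \<bullet> v - g y \<bullet> v) \<le> (C * norm (y' - y)) * norm v" .
      qed (use C in simp)
    qed auto
    then show ?thesis by (simp add: inner_diff_right power2_eq_square algebra_simps)
  qed
  have philip: "\<bar>\<phi> y' - \<phi> y\<bar> \<le> G * norm (y' - y)" if "y \<in> cball z r" "y' \<in> cball z r" for y y'
  proof -
    have "norm (\<phi> y' - \<phi> y) \<le> G * norm (y' - y)"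
    proof (rule differentiable_bound[OF convex_cball _ _ that(2,1)])
      fix u assume u: "u \<in> cball z r"
      show "(\<phi> has_derivative (\<lambda>v. g u \<bullet> v)) (at u within cball z r)"
        by (rule has_derivative_at_withinI[OF d1]) (use u r in auto)
      show "onorm (\<lambda>v. g u \<bullet> v) \<le> G"
      proof (rule onorm_bound)
        fix v
        have "norm (g u \<bullet> v) \<le> norm (g u) * norm v" using Cauchy_Schwarz_ineq2[of "g u" v] by simp
        also have "\<dots> \<le> G * norm v" by (intro mult_right_mono G u) auto
        finally show "norm (g u \<bullet> v) \<le> G * norm v" .
      qed (use G in simp)
    qed
    then show ?thesis by simp
  qed
  \<comment> \<open>Points of the closure are approached from \<open>D\<close>, where
    \<open>\<phi>\<close> is positive.\<close>
  have clos: "0 \<le> \<phi> y" if y: "y \<in> cball z r" "y \<in> closure D" for y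
  proof (rule ccontr)
    assume neg: "\<not> 0 \<le> \<phi> y"
    have yU: "y \<in> U" using y r by auto
    have "isCont \<phi> y" using d1[OF yU] has_derivative_continuous by blast
    then have "\<exists>d>0. \<forall>u. dist u y < d \<longrightarrow> dist (\<phi> u) (\<phi> y) < - \<phi> y"
      using neg unfolding continuous_at_eps_delta by (simp add: not_le)
    then obtain d where d: "0 < d" "\<And>u. dist u y < d \<Longrightarrow> dist (\<phi> u) (\<phi> y) < - \<phi> y" by blast
    obtain d' where d': "0 < d'" "ball y d' \<subseteq> U" using U(1) yU open_contains_ball by blast
    obtain u where u: "u \<in> D" "dist u y < min d d'" using closure_approachable[THEN iffD1, OF y(2), rule_format, of "min d d'"] d(1) d'(1) by auto
    then have "u \<in> D \<inter> U" using d' by (auto simp: dist_commute subset_eq)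
    then have "0 < \<phi> u" using DU by auto
    moreover have "dist (\<phi> u) (\<phi> y) < - \<phi> y" using u by (intro d) auto
    ultimately show False by (simp add: dist_real_def)
  qed
  have fr: "\<phi> y = 0" if y: "y \<in> cball z r" "y \<in> frontier D" for y
  proof -
    have "y \<notin> D" "y \<in> closure D" using y(2) D by (auto simp: frontier_def interior_open)
    moreover have "y \<in> U" using y r by auto
    ultimately have "\<not> 0 < \<phi> y" using DU by auto
    then show ?thesis using clos[OF y(1) \<open>y \<in> closure D\<close>] by simp
  qed
  show ?thesis
  proof (rule that[of r C G "norm (g z) / 2" g \<phi>])
    show "norm (g y) \<le> G \<and> norm (g z) / 2 \<le> norm (g y)" if "y \<in> cball z r" for y
      using G(2)[OF that] gb[OF that] by blast
    show "0 < norm (g z) / 2" using gz by simp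
  qed (fact r(1) C G(1) cg taylor philip clos fr)+
qed

text \<open>
  The concave function \<open>p - \<mu> p\<^sup>2\<close> of the boundary defining function is nonnegative near the
  boundary inside the domain; for large \<open>\<mu>\<close> its second order part is negative.
\<close>

lemma barrier_inequality:
  fixes g \<delta> \<beta> j :: "'a::real_inner"
  assumes taylor: "\<bar>p - g \<bullet> \<delta>\<bar> \<le> C * (norm \<delta>)\<^sup>2" and low: "- \<kappa> \<le> p" and \<kappa>: "0 \<le> \<kappa>"
    and g: "norm g \<le> G" and \<rho>: "norm \<delta> \<le> \<rho>" and small: "G * \<rho> + C * \<rho>\<^sup>2 \<le> 1 / \<mu>" "\<mu> * C * \<rho>\<^sup>2 \<le> 1"
    and \<mu>: "0 < \<mu>" and C: "0 \<le> C" and K: "0 \<le> K" and \<delta>: "\<delta> = \<beta> + j" and \<beta>: "norm \<beta> \<le> K * d" and d: "0 \<le> d" "d \<le> h" "h \<le> 1"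
  shows "- (\<kappa> + \<mu> * \<kappa>\<^sup>2) \<le> g \<bullet> j + 4 * C * (norm j)\<^sup>2 - \<mu> / 4 * (g \<bullet> j)\<^sup>2 + (G * K + 4 * C * K\<^sup>2 + \<mu> / 2 * (G\<^sup>2 * K\<^sup>2 * h)) * d"
proof -
  \<comment> \<open>\<open>u\<close>, \<open>v\<close> and \<open>a\<close> are the components along
    \<open>g\<close> of the displacement, its martingale part and its drift part.\<close>
  define u where "u = g \<bullet> \<delta>"
  define v where "v = g \<bullet> j"
  define a where "a = g \<bullet> \<beta>"
  define N where "N = norm \<delta>"
  have G: "0 \<le> G" using order_trans[OF norm_ge_zero g] .
  have N: "0 \<le> N" "N \<le> \<rho>" using \<rho> by (auto simp: N_def)
  have uva: "u = v + a" by (simp add: u_def v_def a_def \<delta> inner_add_right)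
  have ab: "\<bar>a\<bar> \<le> G * K * d"
  proof -
    have "\<bar>a\<bar> \<le> norm g * norm \<beta>" unfolding a_def by (rule Cauchy_Schwarz_ineq2)
    also have "\<dots> \<le> G * (K * d)" by (intro mult_mono g \<beta> G) auto
    finally show ?thesis by (simp add: mult.assoc)
  qed
  have ub: "\<bar>u\<bar> \<le> G * N"
  proof -
    have "\<bar>u\<bar> \<le> norm g * norm \<delta>" unfolding u_def by (rule Cauchy_Schwarz_ineq2)
    also have "\<dots> \<le> G * N" unfolding N_def by (intro mult_right_mono g) auto
    finally show ?thesis .
  qed
  have t: "\<bar>p - u\<bar> \<le> C * N\<^sup>2" using taylor by (simp add: u_def N_def)
  have N2: "N\<^sup>2 \<le> \<rho>\<^sup>2" using N by (intro power_mono) auto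
  have "p \<le> u + C * N\<^sup>2" using t by simp
  also have "\<dots> \<le> G * \<rho> + C * \<rho>\<^sup>2"
  proof -
    have "G * N \<le> G * \<rho>" "C * N\<^sup>2 \<le> C * \<rho>\<^sup>2" using N N2 G C by (auto intro: mult_left_mono)
    then show ?thesis using ub by linarith
  qed
  finally have p1: "p \<le> 1 / \<mu>" using small by simp
  \<comment> \<open>On \<open>{0..1 / \<mu>}\<close> the parabola
    \<open>p - \<mu> * p\<^sup>2\<close> is nonnegative; for negative \<open>p\<close> the bound by
    \<open>\<kappa>\<close> is used.\<close>
  have low2: "- (\<kappa> + \<mu> * \<kappa>\<^sup>2) \<le> p - \<mu> * p\<^sup>2"
  proof (cases "0 \<le> p")
    case True
    have "\<mu> * p \<le> 1" using p1 \<mu> by (simp add: field_simps)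
    then have "0 \<le> p * (1 - \<mu> * p)" using True by (intro mult_nonneg_nonneg) auto
    also have "\<dots> = p - \<mu> * p\<^sup>2" by (simp add: power2_eq_square algebra_simps)
    finally have "0 \<le> p - \<mu> * p\<^sup>2" .
    moreover have "0 \<le> \<kappa> + \<mu> * \<kappa>\<^sup>2" using \<kappa> \<mu> by simp
    ultimately show ?thesis by linarith
  next
    case False
    then have "(- p)\<^sup>2 \<le> \<kappa>\<^sup>2" using low by (intro power_mono) auto
    then have "\<mu> * p\<^sup>2 \<le> \<mu> * \<kappa>\<^sup>2" using \<mu> by (intro mult_left_mono) auto
    then show ?thesis using low by linarith
  qed
  have "u\<^sup>2 \<le> 2 * p\<^sup>2 + 2 * (p - u)\<^sup>2"
    using zero_le_power2[of "2 * p - u"] by (simp add: power2_eq_square algebra_simps)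
  then have l1: "\<mu> / 2 * u\<^sup>2 \<le> \<mu> * p\<^sup>2 + \<mu> * (p - u)\<^sup>2"
    using mult_left_mono[of "u\<^sup>2" "2 * p\<^sup>2 + 2 * (p - u)\<^sup>2" "\<mu> / 2"] \<mu> by (simp add: algebra_simps)
  \<comment> \<open>The smallness of \<open>\<rho>\<close> reduces an error of fourth order in
    \<open>N\<close> to one of second order.\<close>
  have l2: "\<mu> * (p - u)\<^sup>2 \<le> C * N\<^sup>2"
  proof -
    have "\<bar>p - u\<bar>\<^sup>2 \<le> (C * N\<^sup>2)\<^sup>2" using t by (intro power_mono) auto
    then have "(p - u)\<^sup>2 \<le> (C * N\<^sup>2) * (C * N\<^sup>2)" by (simp add: power2_eq_square)
    also have "\<dots> \<le> (C * N\<^sup>2) * (C * \<rho>\<^sup>2)" using C N2 by (intro mult_left_mono) auto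
    finally have "\<mu> * (p - u)\<^sup>2 \<le> \<mu> * ((C * N\<^sup>2) * (C * \<rho>\<^sup>2))" using \<mu> by (intro mult_left_mono) auto
    also have "\<dots> = (\<mu> * C * \<rho>\<^sup>2) * (C * N\<^sup>2)" by (simp add: algebra_simps)
    also have "\<dots> \<le> 1 * (C * N\<^sup>2)" using small C by (intro mult_right_mono) auto
    finally show ?thesis by simp
  qed
  have dd: "d * d \<le> h * d" "d * d \<le> d" using d mult_right_mono[of d h d] mult_right_mono[of d 1 d] by auto
  have n1: "N\<^sup>2 \<le> 2 * (norm j)\<^sup>2 + 2 * K\<^sup>2 * d"
  proof -
    have "N \<le> norm \<beta> + norm j" unfolding N_def \<delta> by (rule norm_triangle_ineq)
    then have "N\<^sup>2 \<le> (norm \<beta> + norm j)\<^sup>2" using N by (intro power_mono) auto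
    also have "\<dots> \<le> 2 * (norm \<beta>)\<^sup>2 + 2 * (norm j)\<^sup>2"
      using zero_le_power2[of "norm \<beta> - norm j"] by (simp add: power2_eq_square algebra_simps)
    also have "(norm \<beta>)\<^sup>2 \<le> (K * d)\<^sup>2" using \<beta> by (intro power_mono) auto
    also have "(K * d)\<^sup>2 = K\<^sup>2 * (d * d)" by (simp add: power2_eq_square algebra_simps)
    also have "\<dots> \<le> K\<^sup>2 * d" using dd by (intro mult_left_mono) auto
    finally show ?thesis by (simp add: algebra_simps)
  qed
  have a2: "a\<^sup>2 \<le> G\<^sup>2 * K\<^sup>2 * h * d"
  proof -
    have "\<bar>a\<bar>\<^sup>2 \<le> (G * K * d)\<^sup>2" using ab by (intro power_mono) auto
    also have "\<dots> = G\<^sup>2 * K\<^sup>2 * (d * d)" by (simp add: power2_eq_square algebra_simps)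
    also have "\<dots> \<le> G\<^sup>2 * K\<^sup>2 * (h * d)" using dd by (intro mult_left_mono) auto
    finally show ?thesis by (simp add: algebra_simps)
  qed
  have "v\<^sup>2 \<le> 2 * u\<^sup>2 + 2 * a\<^sup>2"
    unfolding uva using zero_le_power2[of "v + 2 * a"] by (simp add: power2_eq_square algebra_simps)
  \<comment> \<open>Passing from the full component \<open>u\<close> to its martingale part
    \<open>v\<close> halves the coefficient, whence \<open>\<mu> / 4\<close>.\<close>
  then have l3: "\<mu> / 4 * v\<^sup>2 \<le> \<mu> / 2 * u\<^sup>2 + \<mu> / 2 * a\<^sup>2"
    using mult_left_mono[of "v\<^sup>2" "2 * u\<^sup>2 + 2 * a\<^sup>2" "\<mu> / 4"] \<mu> by (simp add: algebra_simps)
  have l4: "\<mu> / 2 * a\<^sup>2 \<le> \<mu> / 2 * (G\<^sup>2 * K\<^sup>2 * h * d)" using a2 \<mu> by (intro mult_left_mono) auto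
  have l5: "2 * C * N\<^sup>2 \<le> 2 * C * (2 * (norm j)\<^sup>2 + 2 * K\<^sup>2 * d)" using n1 C by (intro mult_left_mono) auto
  have "- (\<kappa> + \<mu> * \<kappa>\<^sup>2) \<le> u + 2 * C * N\<^sup>2 - \<mu> / 2 * u\<^sup>2"
    using low2 l1 l2 t by simp
  also have "\<dots> \<le> (v + G * K * d) + 2 * C * (2 * (norm j)\<^sup>2 + 2 * K\<^sup>2 * d) - (\<mu> / 4 * v\<^sup>2 - \<mu> / 2 * (G\<^sup>2 * K\<^sup>2 * h * d))"
    using l3 l4 l5 ab uva by linarith
  finally show ?thesis unfolding v_def[symmetric] by (simp add: algebra_simps)
qed

lemma continuous_ge_endpoint:
  fixes g :: "real \<Rightarrow> real"
  assumes c: "continuous_on {a..b} g" and ab: "a < b" and g: "\<And>r. a \<le> r \<Longrightarrow> r < b \<Longrightarrow> c \<le> g r"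
  shows "c \<le> g b"
proof -
  define x where "x n = b - (b - a) / real (Suc n)" for n
  have "(\<lambda>n. (b - a) / real (Suc n)) \<longlonglongrightarrow> 0" using LIMSEQ_Suc[OF lim_const_over_n[of "b - a"]] by simp
  then have "x \<longlonglongrightarrow> b - 0" unfolding x_def by (intro tendsto_intros)
  then have x: "x \<longlonglongrightarrow> b" by simp
  have xr: "a \<le> x n" "x n < b" for n
  proof -
    have "(b - a) / real (Suc n) \<le> (b - a) / 1" using ab by (intro divide_left_mono) auto
    then show "a \<le> x n" by (simp add: x_def)
    show "x n < b" using ab by (simp add: x_def)
  qed
  have "(\<lambda>n. g (x n)) \<longlonglongrightarrow> g b"
    by (rule continuous_on_tendsto_compose[OF c x]) (use ab xr in \<open>auto simp: less_imp_le\<close>)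
  then show ?thesis by (rule LIMSEQ_le_const) (use g[OF xr] in auto)
qed

lemma first_hit_geI:
  assumes c: "continuous_on {a..T} g" and "a \<le> T" "u \<le> T" and above: "\<And>t. a \<le> t \<Longrightarrow> t < u \<Longrightarrow> c < g t"
  shows "u \<le> first_hit g c a T"
proof (rule ccontr)
  assume n: "\<not> u \<le> first_hit g c a T"
  then have "first_hit g c a T < T" using assms(3) by simp
  then have "g (first_hit g c a T) \<le> c" by (rule first_hit_value[OF c assms(2)])
  moreover have "c < g (first_hit g c a T)" using n first_hit_bounds(1)[OF assms(2)] by (intro above) auto
  ultimately show False by simp
qed

text \<open>A connected path that meets \<open>D\<close> and its complement meets the
  frontier.\<close>

lemma path_stays:
  fixes p :: "real \<Rightarrow> 'b::real_normed_vector"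
  assumes c: "continuous_on {0..t} p" and p0: "p 0 \<in> D" and t: "0 \<le> t"
    and nf: "\<And>r. 0 \<le> r \<Longrightarrow> r \<le> t \<Longrightarrow> p r \<notin> frontier D"
  shows "p t \<in> D"
proof (rule ccontr)
  assume "p t \<notin> D"
  have "connected (p ` {0..t})" by (intro connected_continuous_image c) simp
  moreover have "p 0 \<in> p ` {0..t}" "p t \<in> p ` {0..t}" using t by (intro imageI; simp)+
  then have "p ` {0..t} \<inter> D \<noteq> {}" "p ` {0..t} - D \<noteq> {}" using p0 \<open>p t \<notin> D\<close> by blast+
  ultimately have "p ` {0..t} \<inter> frontier D \<noteq> {}" by (rule connected_Int_frontier)
  then show False using nf by auto
qed

lemma drift_bound:
  fixes f :: "real \<Rightarrow> 'b::euclidean_space"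
  assumes i: "set_integrable lborel {0..t} f" and st: "0 \<le> s" "s \<le> t" and K: "\<And>r. norm (f r) \<le> K"
  shows "norm ((LINT r:{0..t}|lborel. f r) - (LINT r:{0..s}|lborel. f r)) \<le> K * (t - s)"
proof -
  have i2: "set_integrable lborel {0..s} f" by (rule set_integrable_subset[OF i]) (use st in auto)
  have "(LINT r:{0..t}|lborel. f r) - (LINT r:{0..s}|lborel. f r) = (\<integral>r. indicator {0..t} r *\<^sub>R f r - indicator {0..s} r *\<^sub>R f r \<partial>lborel)"
    unfolding set_lebesgue_integral_def
    by (rule Bochner_Integration.integral_diff[symmetric]) (use i i2 in \<open>auto simp: set_integrable_def\<close>)
  also have "norm \<dots> \<le> (\<integral>r. norm (indicator {0..t} r *\<^sub>R f r - indicator {0..s} r *\<^sub>R f r) \<partial>lborel)"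
    by (rule integral_norm_bound)
  also have "\<dots> \<le> (\<integral>r. indicator {s..t} r * K \<partial>lborel)"
  proof (rule integral_mono)
    show "integrable lborel (\<lambda>r. norm (indicator {0..t} r *\<^sub>R f r - indicator {0..s} r *\<^sub>R f r))"
      using i i2 by (auto simp: set_integrable_def)
    show "integrable lborel (\<lambda>r. indicator {s..t} r * K)" using st by simp
    show "norm (indicator {0..t} r *\<^sub>R f r - indicator {0..s} r *\<^sub>R f r) \<le> indicator {s..t} r * K" for r
      using K[of r] st order_trans[OF norm_ge_zero K[of r]] by (auto simp: indicator_def)
  qed
  also have "\<dots> = K * (t - s)" using st by (simp add: mult.commute)
  finally show ?thesis .
qed

section \<open>The diffusion and the covariation of its martingale part\<close>

locale diffusion = brownian M B for M :: "'w measure" and B :: "real \<Rightarrow> 'w \<Rightarrow> real ^ 'd" +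
  fixes D :: "(real ^ 'd) set" and b :: "real ^ 'd \<Rightarrow> real ^ 'd" and \<sigma> :: "real ^ 'd \<Rightarrow> real ^ 'd ^ 'd"
    and K \<alpha> :: real and x :: "real ^ 'd" and X J :: "real \<Rightarrow> 'w \<Rightarrow> real ^ 'd"
  assumes D_open: "open D" and D_bounded: "bounded D" and D_C2: "C2_boundary D"
    and K_nonneg: "0 \<le> K" and \<alpha>_pos: "0 < \<alpha>"
    and b_bound: "norm (b y) \<le> K" and \<sigma>_bound: "norm (\<sigma> y) \<le> K"
    and elliptic: "\<alpha> * (v \<bullet> v) \<le> v \<bullet> ((\<sigma> y ** transpose (\<sigma> y)) *v v)"
    and x_in: "x \<in> D"
    and X_prog: "progressively_measurable (aug_filtration M B) X"
    and X_cont: "AE w in P. continuous_on {0..} (\<lambda>t. X t w)"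
    and J_ito: "ito_integral M B (\<lambda>r w. \<sigma> (X r w) $ i) (\<lambda>t w. J t w $ i)"
    and X_eq: "AE w in P. \<forall>t\<ge>0. set_integrable lborel {0..t} (\<lambda>r. b (X r w)) \<and>
      X t w = x + (LINT r:{0..t}|lborel. b (X r w)) + J t w"
begin

abbreviation "frontier_hit T w \<equiv> first_hit (\<lambda>t. infdist (X t w) (frontier D)) 0 0 T"

lemma frontier_nonempty: "frontier D \<noteq> {}"
  using D_bounded x_in frontier_not_empty[of D] by (metis empty_iff not_bounded_UNIV)

lemma X_adapted: "0 \<le> t \<Longrightarrow> X t \<in> borel_measurable (Ft t)"
  by (rule progressive_adapted[OF X_prog])

text \<open>The integral is known only through its approximations, so its vanishing at time 0 is
  read off from them on the interval \<open>{0..0}\<close>.\<close>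

lemma X_0: "AE w in P. X 0 w = x"
proof -
  have "AE w in P. \<forall>i. J 0 w $ i = 0"
  proof -
    have "AE w in P. J 0 w $ i = 0" for i
    proof -
      note Z2 = bounded_sq_integrable_integrand[of "\<lambda>r w. \<sigma> (X r w) $ i" K 0, OF order_trans[OF Finite_Cartesian_Product.norm_nth_le \<sigma>_bound]]
      have z: "(\<integral>\<^sup>+ w. ennreal ((J 0 w $ i)\<^sup>2) \<partial>P) \<le> ennreal (2 * (1/2) ^ n)" for n :: nat
      proof -
        obtain m s h where sp: "\<And>n :: nat. simple_process M B (m n) (s n) (h n)"
          and q: "\<And>n. (\<integral>\<^sup>+ x. ennreal ((norm (simple_val (m n) (s n) (h n) (fst x) (snd x) - \<sigma> (X (fst x) (snd x)) $ i))\<^sup>2) \<partial>Q 0) \<le> ennreal ((1/2) ^ n)"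
          and c: "\<And>n t. 0 \<le> t \<Longrightarrow> t \<le> 0 \<Longrightarrow> (\<integral>\<^sup>+ w. ennreal ((simple_int B (m n) (s n) (h n) t w - J t w $ i)\<^sup>2) \<partial>P) \<le> ennreal (2 * (1/2) ^ n)"
          by (rule ito_integral_L2_approx[OF J_ito order_refl Z2]) blast
        show ?thesis using c[of 0 n] by (simp add: simple_int_0[OF sp])
      qed
      have "(\<lambda>n. ennreal (2 * (1/2) ^ n)) \<longlonglongrightarrow> ennreal 0" by (intro tendsto_ennrealI geometric_null)
      then have "(\<integral>\<^sup>+ w. ennreal ((J 0 w $ i)\<^sup>2) \<partial>P) \<le> ennreal 0" by (rule LIMSEQ_le_const) (use z in auto)
      then have "(\<integral>\<^sup>+ w. ennreal ((J 0 w $ i)\<^sup>2) \<partial>P) = 0" by simp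
      moreover have "(\<lambda>w. J 0 w $ i) \<in> borel_measurable P"
        by (rule measurable_F[OF ito_integral_adapted[OF J_ito order_refl]])
      ultimately have "AE w in P. ennreal ((J 0 w $ i)\<^sup>2) = 0" by (subst (asm) nn_integral_0_iff_AE) measurable
      then show ?thesis by eventually_elim (simp add: ennreal_eq_0_iff)
    qed
    then show ?thesis by (simp add: AE_finite_all[of UNIV, simplified])
  qed
  with X_eq show ?thesis
  proof eventually_elim
    case (elim w)
    have "J 0 w = 0" using elim(2) by (simp add: vec_eq_iff)
    moreover have "(LINT r:{0..0}|lborel. b (X r w)) = 0"
      unfolding set_lebesgue_integral_def
    proof (rule integral_eq_zero_AE)
      show "AE r in lborel. indicator {0..0} r *\<^sub>R b (X r w) = 0"
        using AE_lborel_singleton[of "0::real"] by eventually_elim (auto simp: indicator_def)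
    qed
    ultimately show ?case using elim(1) by auto
  qed
qed

lemma X_cont_on: "AE w in P. continuous_on {0..T} (\<lambda>t. X t w)"
  using X_cont by eventually_elim (rule continuous_on_subset, auto)

text \<open>\<open>f\<close> is the identity for approaching a set and the negation for moving away
  from it.\<close>

lemma infdist_X_stop:
  fixes f :: "real \<Rightarrow> real"
  assumes "0 \<le> T" and f: "continuous_on UNIV f"
  shows "stop (\<lambda>w. first_hit (\<lambda>t. f (infdist (X t w) A)) c 0 T)"
proof (rule first_hit_stop[OF order_refl assms(1)])
  show "(\<lambda>w. f (infdist (X t w) A)) \<in> borel_measurable (Ft t)" if "0 \<le> t" for t
  proof (rule measurable_compose[OF X_adapted[OF that]])
    have "continuous_on UNIV (\<lambda>y. infdist y A)" by (intro continuous_intros)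
    then show "(\<lambda>y. f (infdist y A)) \<in> borel_measurable borel"
      by (intro borel_measurable_continuous_onI continuous_on_compose2[OF f]) auto
  qed
  show "AE w in P. continuous_on {0..T} (\<lambda>t. f (infdist (X t w) A))"
    using X_cont_on[of T] by eventually_elim (intro continuous_on_compose2[OF f] continuous_intros, auto)
qed

lemma frontier_hit_stop: "0 \<le> T \<Longrightarrow> stop (frontier_hit T)"
  using infdist_X_stop[of T "\<lambda>u. u" "frontier D" 0] by simp

lemma frontier_hit_in:
  assumes c: "continuous_on {0..T} (\<lambda>t. X t w)" and T: "0 \<le> T" and lt: "frontier_hit T w < T"
  shows "X (frontier_hit T w) w \<in> frontier D"
proof -
  have "infdist (X (frontier_hit T w) w) (frontier D) \<le> 0"
    by (rule first_hit_value[OF _ T lt]) (intro continuous_intros c)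
  then have "infdist (X (frontier_hit T w) w) (frontier D) = 0" using infdist_nonneg[of _ "frontier D"] by (simp add: antisym)
  then show ?thesis using in_closed_iff_infdist_zero[OF frontier_closed frontier_nonempty] by blast
qed

lemma before_frontier_hit:
  assumes c: "continuous_on {0..T} (\<lambda>t. X t w)" and X0: "X 0 w = x" and T: "0 \<le> T" and t: "0 \<le> t" "t < frontier_hit T w"
  shows "X t w \<in> D"
proof (rule path_stays[of t "\<lambda>t. X t w"])
  have tT: "t < T" using t first_hit_bounds(2)[OF T, of "\<lambda>t. infdist (X t w) (frontier D)" 0] by linarith
  show "continuous_on {0..t} (\<lambda>t. X t w)" by (rule continuous_on_subset[OF c]) (use tT in auto)
  fix r assume r: "0 \<le> r" "r \<le> t"
  then have "0 < infdist (X r w) (frontier D)"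
    using first_hit_above[of 0 r "\<lambda>t. infdist (X t w) (frontier D)" 0 T] t T by auto
  then show "X r w \<notin> frontier D" using infdist_zero by force
qed (use X0 x_in t in auto)

lemma \<sigma>_row_bound: "norm (\<sigma> y $ i) \<le> K"
  by (rule order_trans[OF Finite_Cartesian_Product.norm_nth_le \<sigma>_bound])

lemma \<sigma>_row_prog: "progressively_measurable (aug_filtration M B) (\<lambda>r w. \<sigma> (X r w) $ i)"
  using J_ito[of i] by (simp add: ito_integral_def)

abbreviation "Jc i \<equiv> (\<lambda>t w. J t w $ i)"
abbreviation "cov i k \<equiv> covariation (\<lambda>r w. \<sigma> (X r w) $ i) (\<lambda>r w. \<sigma> (X r w) $ k)"

lemma J_mart: "0 \<le> T \<Longrightarrow> mart T (Jc i)"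
  by (rule ito_integral_mart[OF J_ito _ bounded_sq_integrable_integrand[of _ K, OF \<sigma>_row_bound]])

lemma J_product_mart: "0 \<le> T \<Longrightarrow> mart T (\<lambda>t w. Jc i t w * Jc k t w - cov i k t w)"
  by (rule ito_product_mart[OF J_ito J_ito \<sigma>_row_bound \<sigma>_row_bound])

lemma Jc_cont: "AE w in P. continuous_on {0..} (\<lambda>t. Jc i t w)"
  using J_ito[of i] by (simp add: ito_integral_def AE_completion_iff)

text \<open>The trace of the covariation matrix is the time integral of the squared Euclidean norm
  of the matrix \<open>\<sigma>\<close>.\<close>

lemma cov_trace:
  assumes w: "w \<in> space M" and st: "0 \<le> s" "s \<le> t" "t \<le> T"
  shows "(\<Sum>i\<in>UNIV. cov i i t w - cov i i s w) \<le> K\<^sup>2 * (t - s)"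
proof -
  note ci = covariation_increment[OF \<sigma>_row_prog \<sigma>_row_prog \<sigma>_row_bound \<sigma>_row_bound w st]
  have "(\<Sum>i\<in>UNIV. cov i i t w - cov i i s w) = (\<integral>r. (\<Sum>i\<in>UNIV. indicator {s<..t} r * (\<sigma> (X r w) $ i \<bullet> \<sigma> (X r w) $ i)) \<partial>time_measure T)"
    by (subst Bochner_Integration.integral_sum) (simp_all add: ci)
  also have "\<dots> \<le> (\<integral>r. indicator {s<..t} r * K\<^sup>2 \<partial>time_measure T)"
  proof (rule integral_mono)
    show "integrable (time_measure T) (\<lambda>r. indicator {s<..t} r * K\<^sup>2)"
      by (rule time_integrable_bounded[of _ _ "K\<^sup>2"]) (auto intro!: borel_measurable_time_measure simp: indicator_def)
    show "integrable (time_measure T) (\<lambda>r. \<Sum>i\<in>UNIV. indicator {s<..t} r * (\<sigma> (X r w) $ i \<bullet> \<sigma> (X r w) $ i))"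
      by (intro Bochner_Integration.integrable_sum ci)
    fix r
    have "(\<Sum>i\<in>UNIV. \<sigma> (X r w) $ i \<bullet> \<sigma> (X r w) $ i) = (norm (\<sigma> (X r w)))\<^sup>2"
      by (simp add: norm_vec_def[of "\<sigma> (X r w)"] L2_set_def sum_nonneg power2_norm_eq_inner)
    also have "\<dots> \<le> K\<^sup>2" by (intro power_mono \<sigma>_bound) auto
    finally show "(\<Sum>i\<in>UNIV. indicator {s<..t} r * (\<sigma> (X r w) $ i \<bullet> \<sigma> (X r w) $ i)) \<le> indicator {s<..t} r * K\<^sup>2"
      unfolding sum_distrib_left[symmetric] by (intro mult_left_mono) auto
  qed
  also have "\<dots> = K\<^sup>2 * (t - s)" by (rule time_integral_Ioc[OF st])
  finally show ?thesis .
qed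

text \<open>The quadratic form of the covariation increments is the time integral of the form of
  \<open>\<sigma> y ** transpose (\<sigma> y)\<close>, which ellipticity bounds below.\<close>

lemma cov_elliptic:
  assumes w: "w \<in> space M" and st: "0 \<le> s" "s \<le> t" "t \<le> T"
  shows "\<alpha> * (v \<bullet> v) * (t - s) \<le> (\<Sum>i\<in>UNIV. \<Sum>k\<in>UNIV. (v $ i * v $ k) * (cov i k t w - cov i k s w))"
proof -
  note ci = covariation_increment[OF \<sigma>_row_prog \<sigma>_row_prog \<sigma>_row_bound \<sigma>_row_bound w st]
  have quad: "(\<Sum>i\<in>UNIV. \<Sum>k\<in>UNIV. (v $ i * v $ k) * (\<sigma> y $ i \<bullet> \<sigma> y $ k)) = v \<bullet> ((\<sigma> y ** transpose (\<sigma> y)) *v v)" for y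
    by (simp add: inner_vec_def[of v] matrix_vector_mult_def matrix_matrix_mult_def transpose_def
        inner_vec_def[of "\<sigma> y $ _"] sum_distrib_left sum_distrib_right mult_ac)
  have "\<alpha> * (v \<bullet> v) * (t - s) = (\<integral>r. indicator {s<..t} r * (\<alpha> * (v \<bullet> v)) \<partial>time_measure T)"
    by (rule time_integral_Ioc[OF st, symmetric])
  also have "\<dots> \<le> (\<integral>r. (\<Sum>i\<in>UNIV. \<Sum>k\<in>UNIV. (v $ i * v $ k) * (indicator {s<..t} r * (\<sigma> (X r w) $ i \<bullet> \<sigma> (X r w) $ k))) \<partial>time_measure T)"
  proof (rule integral_mono)
    show "integrable (time_measure T) (\<lambda>r. indicator {s<..t} r * (\<alpha> * (v \<bullet> v)))"
      by (rule time_integrable_bounded[of _ _ "\<bar>\<alpha> * (v \<bullet> v)\<bar>"]) (auto intro!: borel_measurable_time_measure simp: indicator_def)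
    show "integrable (time_measure T) (\<lambda>r. \<Sum>i\<in>UNIV. \<Sum>k\<in>UNIV. (v $ i * v $ k) * (indicator {s<..t} r * (\<sigma> (X r w) $ i \<bullet> \<sigma> (X r w) $ k)))"
      by (intro Bochner_Integration.integrable_sum integrable_mult_right ci)
    fix r
    have "(\<Sum>i\<in>UNIV. \<Sum>k\<in>UNIV. (v $ i * v $ k) * (indicator {s<..t} r * (\<sigma> (X r w) $ i \<bullet> \<sigma> (X r w) $ k)))
        = indicator {s<..t} r * (\<Sum>i\<in>UNIV. \<Sum>k\<in>UNIV. (v $ i * v $ k) * (\<sigma> (X r w) $ i \<bullet> \<sigma> (X r w) $ k))"
      by (simp add: sum_distrib_left mult_ac)
    then show "indicator {s<..t} r * (\<alpha> * (v \<bullet> v)) \<le> (\<Sum>i\<in>UNIV. \<Sum>k\<in>UNIV. (v $ i * v $ k) * (indicator {s<..t} r * (\<sigma> (X r w) $ i \<bullet> \<sigma> (X r w) $ k)))"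
      unfolding quad using elliptic[of v "X r w"] by (auto simp: indicator_def)
  qed
  also have "\<dots> = (\<Sum>i\<in>UNIV. \<Sum>k\<in>UNIV. (v $ i * v $ k) * (cov i k t w - cov i k s w))"
    by (simp only: Bochner_Integration.integral_sum Bochner_Integration.integrable_sum integrable_mult_right ci
        integral_mult_right_zero)
  finally show ?thesis .
qed

lemma stopped_cov_measurable:
  assumes s: "stop s" and T: "0 \<le> T" and bd: "\<And>w. w \<in> space P \<Longrightarrow> s w \<le> T"
  shows "(\<lambda>w. cov i k (s w) w) \<in> borel_measurable P"
proof -
  have "(\<lambda>w. cov i k (min T (s w)) w) \<in> borel_measurable (Ft T)"
  proof (rule stopped_measurable[OF s T])
    show "cov i k r \<in> borel_measurable (Ft r)" if "0 \<le> r" for r by (rule covariation_adapted[OF \<sigma>_row_prog \<sigma>_row_prog that])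
    show "AE w in P. continuous_on {0..T} (\<lambda>r. cov i k r w)"
      by (rule AE_I2) (use covariation_continuous[OF \<sigma>_row_prog \<sigma>_row_prog \<sigma>_row_bound \<sigma>_row_bound _ T] in simp)
  qed
  then have "(\<lambda>w. cov i k (min T (s w)) w) \<in> borel_measurable P" by (rule measurable_F)
  then show ?thesis by (rule measurable_cong[THEN iffD1, rotated]) (use bd in \<open>simp add: min_absorb2\<close>)
qed

lemma cov_increment_bound:
  assumes w: "w \<in> space M" and st: "0 \<le> s" "s \<le> t" "t \<le> T"
  shows "\<bar>cov i k t w - cov i k s w\<bar> \<le> K\<^sup>2 * (t - s)"
proof -
  note ci = covariation_increment[OF \<sigma>_row_prog \<sigma>_row_prog \<sigma>_row_bound \<sigma>_row_bound w st]
  have "\<bar>cov i k t w - cov i k s w\<bar> \<le> (\<integral>r. \<bar>indicator {s<..t} r * (\<sigma> (X r w) $ i \<bullet> \<sigma> (X r w) $ k)\<bar> \<partial>time_measure T)"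
    unfolding ci(1) by (rule integral_abs_bound)
  also have "\<dots> \<le> (\<integral>r. indicator {s<..t} r * K\<^sup>2 \<partial>time_measure T)"
  proof (rule integral_mono[OF integrable_abs[OF ci(2)]])
    show "integrable (time_measure T) (\<lambda>r. indicator {s<..t} r * K\<^sup>2)"
      by (rule time_integrable_bounded[of _ _ "K\<^sup>2"]) (auto intro!: borel_measurable_time_measure simp: indicator_def)
    fix r
    have "\<bar>\<sigma> (X r w) $ i \<bullet> \<sigma> (X r w) $ k\<bar> \<le> K\<^sup>2" by (rule ci(4))
    then show "\<bar>indicator {s<..t} r * (\<sigma> (X r w) $ i \<bullet> \<sigma> (X r w) $ k)\<bar> \<le> indicator {s<..t} r * K\<^sup>2"
      by (auto simp: indicator_def)
  qed
  also have "\<dots> = K\<^sup>2 * (t - s)" by (rule time_integral_Ioc[OF st])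
  finally show ?thesis .
qed

text \<open>The isometry between two stopping times with a weight known at the first. The value of
  \<open>J\<close> at \<open>s\<close> enters the cross terms and must be bounded where the weight
  does not vanish.\<close>

lemma stopped_second_moment:
  assumes T: "0 \<le> T" and s: "stop s" and s': "stop s'"
    and le: "\<And>w. w \<in> space P \<Longrightarrow> s w \<le> s' w" and bd: "\<And>w. w \<in> space P \<Longrightarrow> s' w \<le> T"
    and V: "V \<in> borel_measurable (stopped_algebra s)" and Vb: "\<And>w. w \<in> space P \<Longrightarrow> \<bar>V w\<bar> \<le> C"
    and JS: "AE w in P. V w \<noteq> 0 \<longrightarrow> norm (J (s w) w) \<le> C'" and C': "0 \<le> C'"
  shows "integrable P (\<lambda>w. V w * (Jc i (s' w) w - Jc i (s w) w) * (Jc k (s' w) w - Jc k (s w) w))"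
    "integrable P (\<lambda>w. V w * (cov i k (s' w) w - cov i k (s w) w))"
    "expectation (\<lambda>w. V w * (Jc i (s' w) w - Jc i (s w) w) * (Jc k (s' w) w - Jc k (s w) w))
      = expectation (\<lambda>w. V w * (cov i k (s' w) w - cov i k (s w) w))"
proof -
  have bds: "s w \<le> T" if "w \<in> space P" for w using le[OF that] bd[OF that] by simp
  \<comment> \<open>The value of \<open>J\<close> at \<open>s\<close>, clamped so as to be part of a
    bounded weight; where \<open>V\<close> is nonzero the clamp almost surely changes
    nothing.\<close>
  define jS where "jS i w = max (- C') (min C' (Jc i (s w) w))" for i w
  have jSb: "\<bar>jS i w\<bar> \<le> C'" for i w using C' by (auto simp: jS_def)
  have jSm: "jS i \<in> borel_measurable (stopped_algebra s)" for i
  proof -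
    have "(\<lambda>w. Jc i (s w) w) \<in> borel_measurable (stopped_algebra s)"
      by (rule stopped_algebra_measurable[OF s T _ _ Jc_cont]) (use bds ito_integral_adapted[OF J_ito] in auto)
    then show ?thesis unfolding jS_def[abs_def] by measurable
  qed
  have sub: "subalgebra P (stopped_algebra s)"
    using stopped_algebra_le[OF s T bds] sets_stopped_algebra(2)[OF s] by (auto simp: subalgebra_def)
  have Vm: "V \<in> borel_measurable P" by (rule measurable_from_subalg[OF sub V])
  have C: "w \<in> space P \<Longrightarrow> 0 \<le> C" for w using Vb[of w] by (meson abs_ge_zero order_trans)
  have VjS: "(\<lambda>w. V w * jS i w) \<in> borel_measurable (stopped_algebra s)" "\<And>w. w \<in> space P \<Longrightarrow> \<bar>V w * jS i w\<bar> \<le> C * C'" for i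
    using V jSm C Vb jSb by (auto simp: abs_mult intro!: mult_mono)
  define N where "N t w = Jc i t w * Jc k t w - cov i k t w" for t w
  have N: "mart T N" unfolding N_def[abs_def] by (rule J_product_mart[OF T])
  note w1 = weighted_optional_stopping[OF N T s s' le bd V Vb]
  note w2 = weighted_optional_stopping[OF J_mart[OF T] T s s' le bd VjS]
  have ic: "integrable P (\<lambda>w. V w * (cov i k (s' w) w - cov i k (s w) w))"
  proof (rule integrable_const_bound[of _ "C * (K\<^sup>2 * T)"])
    show "AE w in P. norm (V w * (cov i k (s' w) w - cov i k (s w) w)) \<le> C * (K\<^sup>2 * T)"
    proof (rule AE_I2)
      fix w assume w: "w \<in> space P"
      have "\<bar>cov i k (s' w) w - cov i k (s w) w\<bar> \<le> K\<^sup>2 * (s' w - s w)"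
        by (rule cov_increment_bound) (use w stopD(1)[OF s w] le[OF w] bd[OF w] in auto)
      also have "\<dots> \<le> K\<^sup>2 * T" using stopD(1)[OF s w] bd[OF w] by (intro mult_left_mono) auto
      finally show "norm (V w * (cov i k (s' w) w - cov i k (s w) w)) \<le> C * (K\<^sup>2 * T)"
        unfolding real_norm_def abs_mult using Vb[OF w] C[OF w] by (intro mult_mono) auto
    qed
    show "(\<lambda>w. V w * (cov i k (s' w) w - cov i k (s w) w)) \<in> borel_measurable P"
      using Vm stopped_cov_measurable[OF s' T bd] stopped_cov_measurable[OF s T bds] by (intro borel_measurable_times borel_measurable_diff) auto
  qed
  then show "integrable P (\<lambda>w. V w * (cov i k (s' w) w - cov i k (s w) w))" .
  \<comment> \<open>The product of increments, rewritten through increments of \<open>N\<close>, of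
    the covariation and of single components, each with a bounded weight known at
    \<open>s\<close>.\<close>
  let ?R = "\<lambda>w. V w * (N (s' w) w - N (s w) w) + V w * (cov i k (s' w) w - cov i k (s w) w)
      - (V w * jS i w) * (Jc k (s' w) w - Jc k (s w) w) - (V w * jS k w) * (Jc i (s' w) w - Jc i (s w) w)"
  have eq: "AE w in P. ?R w = V w * (Jc i (s' w) w - Jc i (s w) w) * (Jc k (s' w) w - Jc k (s w) w)"
    using JS
  proof eventually_elim
    case (elim w)
    have "V w * jS l w = V w * Jc l (s w) w" for l
    proof (cases "V w = 0")
      case False
      then have "\<bar>Jc l (s w) w\<bar> \<le> C'" using elim by (meson component_le_norm_cart order_trans)
      then show ?thesis by (auto simp: jS_def)
    qed simp
    then show ?case by (simp only:) (simp add: N_def algebra_simps)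
  qed
  have iR: "integrable P ?R" by (intro Bochner_Integration.integrable_diff Bochner_Integration.integrable_add w1 w2 ic)
  have mL: "(\<lambda>w. V w * (Jc i (s' w) w - Jc i (s w) w) * (Jc k (s' w) w - Jc k (s w) w)) \<in> borel_measurable P"
    by (rule measurable_P_AE[OF borel_measurable_integrable[OF iR]]) (use eq in \<open>auto elim!: eventually_mono\<close>)
  show "integrable P (\<lambda>w. V w * (Jc i (s' w) w - Jc i (s w) w) * (Jc k (s' w) w - Jc k (s w) w))"
    by (rule integrable_cong_AE[THEN iffD1, OF _ mL eq iR]) (use iR in auto)
  have "expectation (\<lambda>w. V w * (Jc i (s' w) w - Jc i (s w) w) * (Jc k (s' w) w - Jc k (s w) w)) = expectation ?R"
    by (rule integral_cong_AE[symmetric, OF _ mL eq]) (use iR in auto)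
  also have "\<dots> = expectation (\<lambda>w. V w * (cov i k (s' w) w - cov i k (s w) w))"
    using w1 w2 ic by simp
  finally show "expectation (\<lambda>w. V w * (Jc i (s' w) w - Jc i (s w) w) * (Jc k (s' w) w - Jc k (s w) w))
      = expectation (\<lambda>w. V w * (cov i k (s' w) w - cov i k (s w) w))" .
qed

text \<open>
  Let \<open>S\<close> be the first hitting time of the boundary and \<open>\<theta>\<close> the first time after \<open>S\<close> at which
  \<open>X\<close> is at distance \<open>\<epsilon>\<close> from the closed domain, at distance \<open>\<rho>\<close> from \<open>X\<^sub>S\<close>, or \<open>h\<close> time units have
  passed. A second order expansion of the boundary defining function between \<open>S\<close> and \<open>\<theta>\<close> bounds
  the mean of \<open>\<theta> - S\<close> by a quantity that vanishes with \<open>\<epsilon>\<close>.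
\<close>

lemma exit_estimate:
  fixes T :: real
  assumes T: "0 < T" and z: "z \<in> frontier D"
    and r: "0 < r" and C: "0 < C" and G: "0 < G" and m: "0 < m"
    and gc: "continuous_on (cball z r) g"
    and gb: "\<And>y. y \<in> cball z r \<Longrightarrow> norm (g y) \<le> G \<and> m \<le> norm (g y)"
    and tay: "\<And>y y'. y \<in> cball z r \<Longrightarrow> y' \<in> cball z r \<Longrightarrow> \<bar>\<phi> y' - \<phi> y - g y \<bullet> (y' - y)\<bar> \<le> C * (norm (y' - y))\<^sup>2"
    and lip: "\<And>y y'. y \<in> cball z r \<Longrightarrow> y' \<in> cball z r \<Longrightarrow> \<bar>\<phi> y' - \<phi> y\<bar> \<le> G * norm (y' - y)"
    and cl: "\<And>y. y \<in> cball z r \<Longrightarrow> y \<in> closure D \<Longrightarrow> 0 \<le> \<phi> y"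
    and fr: "\<And>y. y \<in> cball z r \<Longrightarrow> y \<in> frontier D \<Longrightarrow> \<phi> y = (0::real)"
    and \<rho>: "0 < \<rho>" "\<rho> \<le> r/4" and h: "0 < h" "h \<le> 1" and \<mu>: "0 < \<mu>"
    and small: "G * \<rho> + C * \<rho>\<^sup>2 \<le> 1 / \<mu>" "\<mu> * C * \<rho>\<^sup>2 \<le> 1"
    and coef: "G * K + 8 * C * K\<^sup>2 + \<mu> / 2 * (G\<^sup>2 * K\<^sup>2 * h) - \<mu> / 4 * (\<alpha> * m\<^sup>2) \<le> - 1"
    and \<epsilon>: "0 < \<epsilon>" "\<epsilon> \<le> r/4"
  defines "S \<equiv> \<lambda>w. frontier_hit T w"
  defines "\<theta> \<equiv> \<lambda>w. max (S w) (min (min (first_hit (\<lambda>t. - infdist (X t w) (closure D)) (- \<epsilon>) 0 T)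
      (first_hit (\<lambda>t. - norm (X t w - X (min t (S w)) w)) (- \<rho>) 0 T)) (S w + h))"
  shows "integrable P (\<lambda>w. indicator {w\<in>space P. S w < T \<and> X (S w) w \<in> cball z (r/2)} w * (\<theta> w - S w))"
    "expectation (\<lambda>w. indicator {w\<in>space P. S w < T \<and> X (S w) w \<in> cball z (r/2)} w * (\<theta> w - S w))
      \<le> G * \<epsilon> + \<mu> * (G * \<epsilon>)\<^sup>2"
proof -
  have T0: "0 \<le> T" using T by simp
  have S: "stop S" unfolding S_def by (rule frontier_hit_stop[OF T0])
  have Sb: "0 \<le> S w" "S w \<le> T" for w unfolding S_def using first_hit_bounds[OF T0] by auto
  have XS: "(\<lambda>w. X (min t (S w)) w) \<in> borel_measurable (Ft t)" if "0 \<le> t" for t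
    by (rule progressive_stopped[OF X_prog S that])
  define \<theta>1 where "\<theta>1 w = first_hit (\<lambda>t. - infdist (X t w) (closure D)) (- \<epsilon>) 0 T" for w
  define \<theta>2 where "\<theta>2 w = first_hit (\<lambda>t. - norm (X t w - X (min t (S w)) w)) (- \<rho>) 0 T" for w
  \<comment> \<open>The searches in \<open>\<theta>1\<close> and \<open>\<theta>2\<close> start at
    time 0, which makes them stopping times. Up to \<open>S\<close> the displacement in
    \<open>\<theta>2\<close> is zero, and the outer \<open>max\<close> keeps \<open>\<theta>\<close>
    at or after \<open>S\<close> on every path.\<close>
  have \<theta>_eq: "\<theta> w = max (S w) (min (min (\<theta>1 w) (\<theta>2 w)) (S w + h))" for w
    by (simp add: \<theta>_def \<theta>1_def \<theta>2_def)
  have c2: "continuous_on {0..T} (\<lambda>t. - norm (X t w - X (min t (S w)) w))" if "continuous_on {0..T} (\<lambda>t. X t w)" for w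
  proof -
    have "continuous_on {0..T} (\<lambda>t. X (min t (S w)) w)"
      by (rule continuous_on_compose2[OF that]) (use Sb[of w] in \<open>auto intro!: continuous_intros\<close>)
    then show ?thesis by (intro continuous_intros that)
  qed
  have st1: "stop \<theta>1" unfolding \<theta>1_def[abs_def]
    by (rule infdist_X_stop[OF T0, of "\<lambda>u. - u"]) (intro continuous_intros)
  have st2: "stop \<theta>2" unfolding \<theta>2_def[abs_def]
  proof (rule first_hit_stop[OF order_refl T0])
    show "(\<lambda>w. - norm (X t w - X (min t (S w)) w)) \<in> borel_measurable (Ft t)" if "0 \<le> t" for t
      using X_adapted[OF that] XS[OF that] by measurable
    show "AE w in P. continuous_on {0..T} (\<lambda>t. - norm (X t w - X (min t (S w)) w))"
      using X_cont_on[of T] by eventually_elim (rule c2)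
  qed
  have \<theta>: "stop \<theta>" unfolding \<theta>_eq[abs_def] by (intro stop_max stop_min stop_add S st1 st2) (use h in simp)
  have \<theta>b: "S w \<le> \<theta> w" "\<theta> w \<le> T" "\<theta> w \<le> S w + h" for w
    using first_hit_bounds(2)[OF T0] Sb[of w] h unfolding \<theta>_eq \<theta>1_def by (auto simp: min_le_iff_disj)
  define A where "A = {w\<in>space P. S w < T \<and> X (S w) w \<in> cball z (r/2)}"
  have XSm: "(\<lambda>w. X (S w) w) \<in> borel_measurable (stopped_algebra S)"
    by (rule stopped_algebra_measurable[OF S T0 Sb(2) X_adapted X_cont])
  have sp: "space (stopped_algebra S) = space P" by (rule sets_stopped_algebra(2)[OF S])
  have A: "A \<in> sets (stopped_algebra S)"
  proof -
    have "pre S {w\<in>space P. S w < T}" unfolding pre_def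
    proof (intro conjI allI impI)
      fix t :: real assume t: "0 \<le> t"
      show "{w\<in>space P. S w < T} \<inter> {w\<in>space P. S w \<le> t} \<in> sets (Ft t)"
      proof (cases "T \<le> t")
        case True
        have "{w\<in>space P. S w < T} \<in> sets (Ft t)" using stop_lt[OF S T0] F_mono[OF True] by auto
        then show ?thesis using stopD(2)[OF S t] by (rule sets.Int)
      next
        case False
        then have "{w\<in>space P. S w < T} \<inter> {w\<in>space P. S w \<le> t} = {w\<in>space P. S w \<le> t}" by auto
        then show ?thesis using stopD(2)[OF S t] by simp
      qed
    qed auto
    then have "{w\<in>space P. S w < T} \<in> sets (stopped_algebra S)" using sets_stopped_algebra(1)[OF S] by simp
    moreover have "(\<lambda>w. X (S w) w) -` cball z (r/2) \<inter> space (stopped_algebra S) \<in> sets (stopped_algebra S)"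
      by (rule measurable_sets[OF XSm]) simp
    moreover have "A = {w\<in>space P. S w < T} \<inter> ((\<lambda>w. X (S w) w) -` cball z (r/2) \<inter> space (stopped_algebra S))"
      unfolding A_def sp by auto
    ultimately show ?thesis by (simp only: sets.Int)
  qed
  have AP: "A \<in> sets P" using A stopped_algebra_le[OF S T0 Sb(2)] by blast
  \<comment> \<open>The gradient is continuous on the ball only; extending it by zero gives a Borel
    function.\<close>
  define gh where "gh y = indicator (cball z r) y *\<^sub>R g y" for y
  have ghm: "gh \<in> borel_measurable borel"
    unfolding gh_def[abs_def] by (rule borel_measurable_continuous_on_indicator[OF _ gc]) simp
  have ghb: "norm (gh y) \<le> G" for y using gb[of y] G by (auto simp: gh_def indicator_def)
  \<comment> \<open>The gradient frozen at the boundary point that is hit, hence known at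
    \<open>S\<close>.\<close>
  define v where "v w = indicator A w *\<^sub>R gh (X (S w) w)" for w
  have vm: "v \<in> borel_measurable (stopped_algebra S)"
    unfolding v_def[abs_def] by (intro borel_measurable_scaleR borel_measurable_indicator A measurable_compose[OF XSm ghm])
  have vb: "norm (v w) \<le> G" for w using ghb G by (auto simp: v_def indicator_def)
  have vi: "(\<lambda>w. v w $ i) \<in> borel_measurable (stopped_algebra S)" for i by (rule measurable_compose[OF vm]) measurable
  have vib: "\<bar>v w $ i\<bar> \<le> G" for w i using component_le_norm_cart[of "v w" i] vb[of w] by simp
  define a where "a w = (indicator A w :: real)" for w
  have am: "a \<in> borel_measurable (stopped_algebra S)" unfolding a_def[abs_def] by (intro borel_measurable_indicator A)
  have ab: "\<bar>a w\<bar> \<le> 1" "0 \<le> a w" for w by (auto simp: a_def indicator_def)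
  define d where "d w = \<theta> w - S w" for w
  have db: "0 \<le> d w" "d w \<le> h" for w using \<theta>b[of w] by (auto simp: d_def)
  have dm: "d \<in> borel_measurable P" unfolding d_def[abs_def] using stop_measurable[OF \<theta>] stop_measurable[OF S] by measurable
  have amP: "a \<in> borel_measurable P" unfolding a_def[abs_def] using AP by (intro borel_measurable_indicator)
  have id: "integrable P (\<lambda>w. a w * d w)"
  proof (rule integrable_const_bound[of _ h])
    show "AE w in P. norm (a w * d w) \<le> h" using db h by (auto simp: a_def indicator_def)
    show "(\<lambda>w. a w * d w) \<in> borel_measurable P" using amP dm by measurable
  qed
  define j where "j w = J (\<theta> w) w - J (S w) w" for w
  have ji: "j w $ i = Jc i (\<theta> w) w - Jc i (S w) w" for w i by (simp add: j_def)
  \<comment> \<open>On \<open>A\<close> the point \<open>X (S w) w\<close> is within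
    \<open>r\<close> of \<open>z\<close>, and the drift up to \<open>S\<close> is at most
    \<open>K * T\<close>; this bounds the martingale part at \<open>S\<close>.\<close>
  define CJ where "CJ = norm z + r + norm x + K * T"
  have CJ: "0 \<le> CJ" unfolding CJ_def using r K_nonneg T by simp
  have good: "AE w in P. w \<in> space P \<and> X 0 w = x \<and> continuous_on {0..T} (\<lambda>t. X t w) \<and>
     (\<forall>t\<ge>0. set_integrable lborel {0..t} (\<lambda>r. b (X r w)) \<and> X t w = x + (LINT r:{0..t}|lborel. b (X r w)) + J t w)"
    using X_0 X_cont_on[of T] X_eq AE_space by eventually_elim auto
  have JS: "AE w in P. w \<in> A \<longrightarrow> norm (J (S w) w) \<le> CJ"
    using good
  proof eventually_elim
    case (elim w)
    show ?case
    proof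
      assume "w \<in> A"
      then have XSz: "norm (X (S w) w) \<le> norm z + r"
        using r norm_triangle_sub[of "X (S w) w" z] by (auto simp: A_def dist_norm norm_minus_commute)
      have "(LINT r:{0..0}|lborel. b (X r w)) = 0"
        unfolding set_lebesgue_integral_def
      proof (rule integral_eq_zero_AE)
        show "AE r in lborel. indicator {0..0} r *\<^sub>R b (X r w) = 0"
          using AE_lborel_singleton[of "0::real"] by eventually_elim (auto simp: indicator_def)
      qed
      then have "norm (LINT r:{0..S w}|lborel. b (X r w)) \<le> K * (S w - 0)"
        using drift_bound[of "S w" "\<lambda>r. b (X r w)" 0 K] elim Sb[of w] b_bound by auto
      also have "\<dots> \<le> K * T" using Sb[of w] K_nonneg by (intro mult_left_mono) auto
      finally have I: "norm (LINT r:{0..S w}|lborel. b (X r w)) \<le> K * T" .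
      have "J (S w) w = X (S w) w - x - (LINT r:{0..S w}|lborel. b (X r w))"
        using elim Sb(1)[of w] by simp
      then have "norm (J (S w) w) \<le> norm (X (S w) w) + norm x + norm (LINT r:{0..S w}|lborel. b (X r w))"
        using norm_triangle_ineq4[of "X (S w) w - x" "LINT r:{0..S w}|lborel. b (X r w)"] norm_triangle_ineq4[of "X (S w) w" x] by simp
      then show "norm (J (S w) w) \<le> CJ" using XSz I by (simp add: CJ_def)
    qed
  qed
  have aV: "w \<in> A" if "a w \<noteq> 0" for w using that by (auto simp: a_def indicator_def split: if_splits)
  have vV: "w \<in> A" if "v w $ i * v w $ k \<noteq> 0" for w i k using that by (auto simp: v_def indicator_def split: if_splits)
  have JSa: "AE w in P. a w \<noteq> 0 \<longrightarrow> norm (J (S w) w) \<le> CJ" using JS by eventually_elim (use aV in blast)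
  have JSv: "AE w in P. v w $ i * v w $ k \<noteq> 0 \<longrightarrow> norm (J (S w) w) \<le> CJ" for i k using JS by eventually_elim (use vV in blast)
  note wo = weighted_optional_stopping[OF J_mart[OF T0] T0 S \<theta> \<theta>b(1) \<theta>b(2) vi vib]
  note sa = stopped_second_moment[OF T0 S \<theta> \<theta>b(1) \<theta>b(2) am ab(1) JSa CJ]
  have vvm: "(\<lambda>w. v w $ i * v w $ k) \<in> borel_measurable (stopped_algebra S)" for i k using vi by (intro borel_measurable_times)
  have vvb: "\<bar>v w $ i * v w $ k\<bar> \<le> G * G" for w i k unfolding abs_mult using vib G by (intro mult_mono) auto
  note sv = stopped_second_moment[OF T0 S \<theta> \<theta>b(1) \<theta>b(2) vvm vvb JSv CJ]
  have E1: "integrable P (\<lambda>w. v w \<bullet> j w)" "expectation (\<lambda>w. v w \<bullet> j w) = 0"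
  proof -
    have e: "v w \<bullet> j w = (\<Sum>i\<in>UNIV. v w $ i * (Jc i (\<theta> w) w - Jc i (S w) w))" for w
      by (simp add: inner_vec_def ji)
    show "integrable P (\<lambda>w. v w \<bullet> j w)" unfolding e by (intro Bochner_Integration.integrable_sum wo(1))
    show "expectation (\<lambda>w. v w \<bullet> j w) = 0" unfolding e
      by (subst Bochner_Integration.integral_sum[OF wo(1)]) (rule sum.neutral, use wo(2) in blast)
  qed
  have E2: "integrable P (\<lambda>w. a w * (norm (j w))\<^sup>2)" "expectation (\<lambda>w. a w * (norm (j w))\<^sup>2) \<le> K\<^sup>2 * expectation (\<lambda>w. a w * d w)"
  proof -
    have e: "a w * (norm (j w))\<^sup>2 = (\<Sum>i\<in>UNIV. a w * (Jc i (\<theta> w) w - Jc i (S w) w) * (Jc i (\<theta> w) w - Jc i (S w) w))" for w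
    proof -
      have "(norm (j w))\<^sup>2 = (\<Sum>i\<in>UNIV. (j w $ i)\<^sup>2)" by (simp add: norm_vec_def L2_set_def sum_nonneg)
      then show ?thesis by (simp add: ji sum_distrib_left power2_eq_square mult.assoc)
    qed
    show "integrable P (\<lambda>w. a w * (norm (j w))\<^sup>2)" unfolding e by (intro Bochner_Integration.integrable_sum sa(1))
    have "expectation (\<lambda>w. a w * (norm (j w))\<^sup>2) = (\<Sum>i\<in>UNIV. expectation (\<lambda>w. a w * (cov i i (\<theta> w) w - cov i i (S w) w)))"
      unfolding e by (subst Bochner_Integration.integral_sum[OF sa(1)]) (simp only: sa(3))
    also have "\<dots> = expectation (\<lambda>w. \<Sum>i\<in>UNIV. a w * (cov i i (\<theta> w) w - cov i i (S w) w))"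
      by (rule Bochner_Integration.integral_sum[symmetric]) (rule sa(2))
    also have "\<dots> \<le> expectation (\<lambda>w. K\<^sup>2 * (a w * d w))"
    proof (rule integral_mono)
      show "integrable P (\<lambda>w. \<Sum>i\<in>UNIV. a w * (cov i i (\<theta> w) w - cov i i (S w) w))" by (intro Bochner_Integration.integrable_sum sa(2))
      show "integrable P (\<lambda>w. K\<^sup>2 * (a w * d w))" by (intro integrable_mult_right id)
      fix w assume "w \<in> space P"
      then have "(\<Sum>i\<in>UNIV. cov i i (\<theta> w) w - cov i i (S w) w) \<le> K\<^sup>2 * d w"
        unfolding d_def by (intro cov_trace[OF _ Sb(1) \<theta>b(1,2)]) simp
      then have "a w * (\<Sum>i\<in>UNIV. cov i i (\<theta> w) w - cov i i (S w) w) \<le> a w * (K\<^sup>2 * d w)" using ab by (intro mult_left_mono)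
      then show "(\<Sum>i\<in>UNIV. a w * (cov i i (\<theta> w) w - cov i i (S w) w)) \<le> K\<^sup>2 * (a w * d w)"
        by (simp add: sum_distrib_left mult_ac)
    qed
    also have "\<dots> = K\<^sup>2 * expectation (\<lambda>w. a w * d w)" by simp
    finally show "expectation (\<lambda>w. a w * (norm (j w))\<^sup>2) \<le> K\<^sup>2 * expectation (\<lambda>w. a w * d w)" .
  qed
  \<comment> \<open>Ellipticity and the lower bound \<open>m\<close> of the gradient give the term
    that outweighs all others once \<open>\<mu>\<close> is large.\<close>
  have E3: "integrable P (\<lambda>w. (v w \<bullet> j w)\<^sup>2)" "\<alpha> * m\<^sup>2 * expectation (\<lambda>w. a w * d w) \<le> expectation (\<lambda>w. (v w \<bullet> j w)\<^sup>2)"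
  proof -
    have e: "(v w \<bullet> j w)\<^sup>2 = (\<Sum>i\<in>UNIV. \<Sum>k\<in>UNIV. v w $ i * v w $ k * (Jc i (\<theta> w) w - Jc i (S w) w) * (Jc k (\<theta> w) w - Jc k (S w) w))" for w
      by (simp add: inner_vec_def ji power2_eq_square sum_product mult_ac)
    show "integrable P (\<lambda>w. (v w \<bullet> j w)\<^sup>2)" unfolding e by (intro Bochner_Integration.integrable_sum sv(1))
    have "\<alpha> * m\<^sup>2 * expectation (\<lambda>w. a w * d w) = expectation (\<lambda>w. \<alpha> * m\<^sup>2 * (a w * d w))" by simp
    also have "\<dots> \<le> expectation (\<lambda>w. \<Sum>i\<in>UNIV. \<Sum>k\<in>UNIV. v w $ i * v w $ k * (cov i k (\<theta> w) w - cov i k (S w) w))"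
    proof (rule integral_mono)
      show "integrable P (\<lambda>w. \<alpha> * m\<^sup>2 * (a w * d w))" by (intro integrable_mult_right id)
      show "integrable P (\<lambda>w. \<Sum>i\<in>UNIV. \<Sum>k\<in>UNIV. v w $ i * v w $ k * (cov i k (\<theta> w) w - cov i k (S w) w))"
        by (intro Bochner_Integration.integrable_sum sv(2))
      fix w assume w: "w \<in> space P"
      have "\<alpha> * m\<^sup>2 * (a w * d w) \<le> \<alpha> * (v w \<bullet> v w) * (\<theta> w - S w)"
      proof (cases "w \<in> A")
        case True
        then have "X (S w) w \<in> cball z r" using r by (auto simp: A_def)
        then have "m \<le> norm (v w)" using gb True by (auto simp: v_def gh_def)
        then have "m\<^sup>2 \<le> v w \<bullet> v w" unfolding power2_norm_eq_inner[symmetric] using m by (intro power_mono) auto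
        then have "\<alpha> * m\<^sup>2 * d w \<le> \<alpha> * (v w \<bullet> v w) * d w" using \<alpha>_pos db by (intro mult_right_mono mult_left_mono) auto
        then show ?thesis using True by (simp add: a_def d_def)
      next
        case False
        then show ?thesis by (simp add: a_def v_def)
      qed
      also have "\<dots> \<le> (\<Sum>i\<in>UNIV. \<Sum>k\<in>UNIV. v w $ i * v w $ k * (cov i k (\<theta> w) w - cov i k (S w) w))"
        by (rule cov_elliptic[OF _ Sb(1) \<theta>b(1,2)]) (use w in simp)
      finally show "\<alpha> * m\<^sup>2 * (a w * d w) \<le> (\<Sum>i\<in>UNIV. \<Sum>k\<in>UNIV. v w $ i * v w $ k * (cov i k (\<theta> w) w - cov i k (S w) w))" .
    qed
    also have "\<dots> = (\<Sum>i\<in>UNIV. \<Sum>k\<in>UNIV. expectation (\<lambda>w. v w $ i * v w $ k * (cov i k (\<theta> w) w - cov i k (S w) w)))"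
      by (simp only: Bochner_Integration.integral_sum Bochner_Integration.integrable_sum sv(2))
    also have "\<dots> = expectation (\<lambda>w. (v w \<bullet> j w)\<^sup>2)"
      unfolding e by (simp only: Bochner_Integration.integral_sum Bochner_Integration.integrable_sum sv(1) sv(3))
    finally show "\<alpha> * m\<^sup>2 * expectation (\<lambda>w. a w * d w) \<le> expectation (\<lambda>w. (v w \<bullet> j w)\<^sup>2)" .
  qed
  \<comment> \<open>At \<open>\<theta>\<close> the path is within \<open>\<epsilon>\<close> of the
    closed domain, where \<open>\<phi>\<close> is nonnegative; by its Lipschitz bound
    \<open>\<phi>\<close> is then at least \<open>- \<kappa>\<close>.\<close>
  define \<kappa> where "\<kappa> = G * \<epsilon>"
  have \<kappa>: "0 \<le> \<kappa>" using G \<epsilon> by (simp add: \<kappa>_def)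
  define c where "c = G * K + 4 * C * K\<^sup>2 + \<mu> / 2 * (G\<^sup>2 * K\<^sup>2 * h)"
  \<comment> \<open>On \<open>A\<close> this is \<open>barrier_inequality\<close>; off
    \<open>A\<close> both sides vanish.\<close>
  have pt: "AE w in P. a w * (- (\<kappa> + \<mu> * \<kappa>\<^sup>2)) \<le> v w \<bullet> j w + 4 * C * (a w * (norm (j w))\<^sup>2) - \<mu> / 4 * (v w \<bullet> j w)\<^sup>2 + c * (a w * d w)"
    using good
  proof eventually_elim
    case (elim w)
    then have w: "w \<in> space P" and X0: "X 0 w = x" and cX: "continuous_on {0..T} (\<lambda>t. X t w)"
      and eq: "\<And>t. 0 \<le> t \<Longrightarrow> set_integrable lborel {0..t} (\<lambda>r. b (X r w)) \<and> X t w = x + (LINT r:{0..t}|lborel. b (X r w)) + J t w" by blast+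
    show ?case
    proof (cases "w \<in> A")
      case False
      then show ?thesis by (simp add: a_def v_def)
    next
      case True
      then have lt: "frontier_hit T w < T" and XSz: "X (S w) w \<in> cball z (r/2)" by (auto simp: A_def S_def)
      have XSf: "X (S w) w \<in> frontier D" unfolding S_def by (rule frontier_hit_in[OF cX T0 lt])
      have XSr: "X (S w) w \<in> cball z r" using XSz r by auto
      let ?y = "X (S w) w" and ?y' = "X (\<theta> w) w"
      \<comment> \<open>Strictly before \<open>\<theta>\<close> neither bound is violated, and
        continuity extends this to \<open>\<theta>\<close> itself.\<close>
      have ends: "norm (?y' - ?y) \<le> \<rho> \<and> infdist ?y' (closure D) \<le> \<epsilon>"
      proof (cases "S w = \<theta> w")
        case True
        have "?y \<in> closure D" using XSf by (simp add: frontier_def)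
        then have "infdist ?y (closure D) = 0" by (rule infdist_zero)
        then show ?thesis using True[symmetric] \<rho> \<epsilon> by simp
      next
        case False
        then have lt': "S w < \<theta> w" using \<theta>b(1)[of w] by simp
        then have \<theta>e: "\<theta> w \<le> \<theta>1 w" "\<theta> w \<le> \<theta>2 w" unfolding \<theta>_eq by (auto simp: max_def split: if_splits)
        have sub: "{S w..\<theta> w} \<subseteq> {0..T}" using Sb(1)[of w] \<theta>b(2)[of w] by auto
        have "- \<rho> \<le> - norm (X (\<theta> w) w - X (min (\<theta> w) (S w)) w)"
        proof (rule continuous_ge_endpoint[OF continuous_on_subset[OF c2[OF cX] sub] lt'])
          fix u assume u: "S w \<le> u" "u < \<theta> w"
          have "- \<rho> < - norm (X u w - X (min u (S w)) w)"
            by (rule first_hit_above[of 0 u "\<lambda>t. - norm (X t w - X (min t (S w)) w)" "- \<rho>" T])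
              (use u Sb(1)[of w] \<theta>e T0 in \<open>auto simp: \<theta>2_def\<close>)
          then show "- \<rho> \<le> - norm (X u w - X (min u (S w)) w)" by simp
        qed
        moreover have "- \<epsilon> \<le> - infdist (X (\<theta> w) w) (closure D)"
        proof (rule continuous_ge_endpoint[OF _ lt'])
          show "continuous_on {S w..\<theta> w} (\<lambda>t. - infdist (X t w) (closure D))"
            by (intro continuous_intros continuous_on_subset[OF cX sub])
          fix u assume u: "S w \<le> u" "u < \<theta> w"
          have "- \<epsilon> < - infdist (X u w) (closure D)"
            by (rule first_hit_above[of 0 u "\<lambda>t. - infdist (X t w) (closure D)" "- \<epsilon>" T])
              (use u Sb(1)[of w] \<theta>e T0 in \<open>auto simp: \<theta>1_def\<close>)
          then show "- \<epsilon> \<le> - infdist (X u w) (closure D)" by simp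
        qed
        ultimately show ?thesis using lt' by (simp add: min_absorb2)
      qed
      \<comment> \<open>\<open>r / 2\<close> for the point that is hit and \<open>r / 4\<close> for
        the displacement; the last \<open>r / 4\<close> is kept for the nearest point of the
        closure.\<close>
      have y'z: "dist z ?y' \<le> 3 * r / 4"
      proof -
        have "dist z ?y' \<le> dist z ?y + dist ?y ?y'" by (rule dist_triangle)
        also have "\<dots> \<le> r/2 + r/4" using XSz ends \<rho> by (intro add_mono) (auto simp: dist_norm norm_minus_commute)
        finally show ?thesis by simp
      qed
      have y'r: "?y' \<in> cball z r" using y'z r by auto
      have low: "- \<kappa> \<le> \<phi> ?y'"
      proof -
        have "closure D \<noteq> {}" using x_in closure_subset by blast
        then obtain y'' where y'': "y'' \<in> closure D" "infdist ?y' (closure D) = dist ?y' y''"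
          using infdist_attains_inf[of "closure D"] by auto
        have "dist z y'' \<le> dist z ?y' + dist ?y' y''" by (rule dist_triangle)
        also have "\<dots> \<le> 3 * r / 4 + r / 4" using y'z y''(2) ends \<epsilon> by (intro add_mono) auto
        finally have y''r: "y'' \<in> cball z r" by simp
        have "\<bar>\<phi> ?y' - \<phi> y''\<bar> \<le> G * norm (?y' - y'')" by (rule lip[OF y''r y'r])
        also have "\<dots> \<le> G * \<epsilon>" using y''(2) ends G by (intro mult_left_mono) (auto simp: dist_norm)
        finally show ?thesis using cl[OF y''r y''(1)] by (simp add: \<kappa>_def)
      qed
      have vw: "v w = g ?y" using True XSr by (simp add: v_def gh_def)
      define \<beta> where "\<beta> = (LINT r:{0..\<theta> w}|lborel. b (X r w)) - (LINT r:{0..S w}|lborel. b (X r w))"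
      have \<theta>0: "0 \<le> \<theta> w" using Sb(1)[of w] \<theta>b(1)[of w] by simp
      have \<delta>: "?y' - ?y = \<beta> + j w" using eq[OF \<theta>0] eq[OF Sb(1)] by (simp add: \<beta>_def j_def algebra_simps)
      have \<beta>: "norm \<beta> \<le> K * d w" unfolding \<beta>_def d_def
        by (rule drift_bound[OF conjunct1[OF eq[OF \<theta>0]] Sb(1) \<theta>b(1) b_bound])
      have t: "\<bar>\<phi> ?y' - v w \<bullet> (?y' - ?y)\<bar> \<le> C * (norm (?y' - ?y))\<^sup>2"
        using tay[OF XSr y'r] fr[OF XSr XSf] by (simp add: vw)
      have "- (\<kappa> + \<mu> * \<kappa>\<^sup>2) \<le> v w \<bullet> j w + 4 * C * (norm (j w))\<^sup>2 - \<mu> / 4 * (v w \<bullet> j w)\<^sup>2 + (G * K + 4 * C * K\<^sup>2 + \<mu> / 2 * (G\<^sup>2 * K\<^sup>2 * h)) * d w"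
        by (rule barrier_inequality[OF t low \<kappa> vb conjunct1[OF ends] small \<mu> less_imp_le[OF C] K_nonneg \<delta> \<beta> db h(2)])
      then show ?thesis using True by (simp add: a_def c_def)
    qed
  qed
  have iR: "integrable P (\<lambda>w. v w \<bullet> j w + 4 * C * (a w * (norm (j w))\<^sup>2) - \<mu> / 4 * (v w \<bullet> j w)\<^sup>2 + c * (a w * d w))"
    by (intro Bochner_Integration.integrable_add Bochner_Integration.integrable_diff integrable_mult_right E1 E2 E3 id)
  have iL: "integrable P (\<lambda>w. a w * (- (\<kappa> + \<mu> * \<kappa>\<^sup>2)))"
    by (intro integrable_mult_left) (rule integrable_const_bound[of _ 1], use ab amP in auto)
  have "- (\<kappa> + \<mu> * \<kappa>\<^sup>2) \<le> expectation (\<lambda>w. a w * (- (\<kappa> + \<mu> * \<kappa>\<^sup>2)))"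
  proof -
    have "0 \<le> \<kappa> + \<mu> * \<kappa>\<^sup>2" using \<kappa> \<mu> by simp
    then have "- (\<kappa> + \<mu> * \<kappa>\<^sup>2) \<le> a w * (- (\<kappa> + \<mu> * \<kappa>\<^sup>2))" for w by (auto simp: a_def indicator_def)
    then have e1: "expectation (\<lambda>w. - (\<kappa> + \<mu> * \<kappa>\<^sup>2)) \<le> expectation (\<lambda>w. a w * (- (\<kappa> + \<mu> * \<kappa>\<^sup>2)))"
      by (intro integral_mono iL) auto
    have e2: "expectation (\<lambda>w. - (\<kappa> + \<mu> * \<kappa>\<^sup>2)) = - (\<kappa> + \<mu> * \<kappa>\<^sup>2)"
      using prob_space by (simp only: lebesgue_integral_const real_scaleR_def mult_1_left)
    show ?thesis using e1 unfolding e2 .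
  qed
  also have "\<dots> \<le> expectation (\<lambda>w. v w \<bullet> j w + 4 * C * (a w * (norm (j w))\<^sup>2) - \<mu> / 4 * (v w \<bullet> j w)\<^sup>2 + c * (a w * d w))"
    by (rule integral_mono_AE[OF iL iR pt])
  also have "\<dots> = expectation (\<lambda>w. v w \<bullet> j w) + 4 * C * expectation (\<lambda>w. a w * (norm (j w))\<^sup>2) - \<mu> / 4 * expectation (\<lambda>w. (v w \<bullet> j w)\<^sup>2) + c * expectation (\<lambda>w. a w * d w)"
    by (simp only: Bochner_Integration.integral_add Bochner_Integration.integral_diff Bochner_Integration.integrable_add Bochner_Integration.integrable_diff
        integrable_mult_right integral_mult_right_zero E1(1) E2(1) E3(1) id)
  \<comment> \<open>The second moment of \<open>j\<close> contributes another
    \<open>4 * C * K\<^sup>2\<close>, whence the 8 in \<open>coef\<close>.\<close>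
  also have "\<dots> \<le> 0 + 4 * C * (K\<^sup>2 * expectation (\<lambda>w. a w * d w)) - \<mu> / 4 * (\<alpha> * m\<^sup>2 * expectation (\<lambda>w. a w * d w)) + c * expectation (\<lambda>w. a w * d w)"
    using E1(2) E2(2) E3(2) C \<mu> by (intro add_mono[OF _ order_refl] add_mono diff_mono mult_left_mono) auto
  also have "\<dots> = (G * K + 8 * C * K\<^sup>2 + \<mu> / 2 * (G\<^sup>2 * K\<^sup>2 * h) - \<mu> / 4 * (\<alpha> * m\<^sup>2)) * expectation (\<lambda>w. a w * d w)"
    by (simp add: c_def algebra_simps)
  also have "\<dots> \<le> - 1 * expectation (\<lambda>w. a w * d w)"
  proof (rule mult_right_mono[OF coef])
    have "0 \<le> a w * d w" for w using ab(2)[of w] db(1)[of w] by simp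
    then show "0 \<le> expectation (\<lambda>w. a w * d w)" by (intro integral_nonneg_AE) simp
  qed
  finally have fin: "expectation (\<lambda>w. a w * d w) \<le> \<kappa> + \<mu> * \<kappa>\<^sup>2" by simp
  show "integrable P (\<lambda>w. indicator {w\<in>space P. S w < T \<and> X (S w) w \<in> cball z (r/2)} w * (\<theta> w - S w))"
    using id by (simp only: a_def d_def A_def)
  show "expectation (\<lambda>w. indicator {w\<in>space P. S w < T \<and> X (S w) w \<in> cball z (r/2)} w * (\<theta> w - S w)) \<le> G * \<epsilon> + \<mu> * (G * \<epsilon>)\<^sup>2"
    using fin by (simp only: a_def d_def A_def \<kappa>_def)
qed

end

section \<open>Capped and extended hitting times\<close>

text \<open>Connects extended hitting times with the capped ones, for which measurability has been
  shown.\<close>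

lemma tmin_hitting_time:
  assumes T: "0 \<le> T"
  shows "tmin T (hitting_time {y. f y \<le> c} X w) = first_hit (\<lambda>t. f (X t w)) c 0 T"
proof (rule antisym)
  let ?h = "hitting_time {y. f y \<le> c} X w" and ?f = "first_hit (\<lambda>t. f (X t w)) c 0 T"
  have f: "0 \<le> ?f" "?f \<le> T" using first_hit_bounds[OF T] by auto
  have "ennreal ?f \<le> min (ennreal T) ?h"
  proof (rule min.boundedI)
    show "ennreal ?f \<le> ennreal T" using f by (intro ennreal_leI)
    show "ennreal ?f \<le> ?h" unfolding hitting_time_def
    proof (rule INF_greatest)
      fix t assume t: "t \<in> {t. 0 \<le> t \<and> X t w \<in> {y. f y \<le> c}}"
      have "?f \<le> t"
      proof (cases "t \<le> T")
        case True
        then show ?thesis using t first_hit_le[of 0 t T "\<lambda>t. f (X t w)" c] by auto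
      qed (use f in simp)
      then show "ennreal ?f \<le> ennreal t" by (rule ennreal_leI)
    qed
  qed
  then have "enn2real (ennreal ?f) \<le> tmin T ?h"
    unfolding tmin_def by (rule enn2real_mono) (simp add: min_less_iff_disj)
  then show "?f \<le> tmin T ?h" using f by simp
  show "tmin T ?h \<le> ?f" unfolding first_hit_def
  proof (rule cInf_greatest)
    fix e assume e: "e \<in> {t \<in> {0..T}. f (X t w) \<le> c} \<union> {T}"
    have "min (ennreal T) ?h \<le> ennreal e"
    proof (cases "e = T")
      case False
      then have "?h \<le> ennreal e" unfolding hitting_time_def using e by (intro INF_lower) auto
      then show ?thesis by (simp add: min.coboundedI2)
    qed simp
    then have "tmin T ?h \<le> enn2real (ennreal e)" unfolding tmin_def by (rule enn2real_mono) simp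
    then show "tmin T ?h \<le> e" using e T by auto
  qed auto
qed

text \<open>\<open>g\<close> stands for the distance to the boundary along one path and
  \<open>s\<close> for its first zero. Every positive level is reached before \<open>s\<close>, and
  small levels only after any given earlier time, by compactness.\<close>

lemma near_time_path:
  fixes g :: "real \<Rightarrow> real"
  assumes c: "continuous_on {0..} g" and s: "0 < s" and gs: "g s = 0" and pos: "\<And>t. 0 \<le> t \<Longrightarrow> t < s \<Longrightarrow> 0 < g t"
  shows "0 < \<eta> \<Longrightarrow> \<exists>u. (INF t\<in>{t. 0 \<le> t \<and> g t \<le> \<eta>}. ennreal t) = ennreal u \<and> 0 \<le> u \<and> u < s"
    and "0 \<le> t \<Longrightarrow> t < s \<Longrightarrow> \<exists>k0::nat. \<forall>k\<ge>k0. ennreal t \<le> (INF t\<in>{t. 0 \<le> t \<and> g t \<le> 1 / real (Suc k)}. ennreal t)"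
proof -
  assume \<eta>: "0 < \<eta>"
  let ?I = "INF t\<in>{t. 0 \<le> t \<and> g t \<le> \<eta>}. ennreal t"
  have "(g \<longlongrightarrow> g s) (at s within {0..})" using c s by (auto simp: continuous_on_def)
  then have "eventually (\<lambda>t. g t < \<eta>) (at s within {0..})" using gs \<eta> by (intro order_tendstoD(2)) auto
  then obtain d where d: "0 < d" "\<And>t. t \<in> {0..} \<Longrightarrow> t \<noteq> s \<Longrightarrow> dist t s < d \<Longrightarrow> g t < \<eta>"
    unfolding eventually_at by auto
  define t where "t = max 0 (s - d/2)"
  have t: "0 \<le> t" "t < s" "dist t s < d" using s d by (auto simp: t_def dist_real_def)
  then have "g t \<le> \<eta>" using d(2)[of t] by auto
  then have "?I \<le> ennreal t" using t by (intro INF_lower) auto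
  also have "ennreal t < ennreal s" using t by (intro ennreal_lessI) auto
  finally have "?I < ennreal s" .
  then have "?I < \<top>" by (rule order_less_trans) simp
  then have e: "ennreal (enn2real ?I) = ?I" by (rule ennreal_enn2real)
  then have "ennreal (enn2real ?I) < ennreal s" using \<open>?I < ennreal s\<close> by (simp only: e)
  then have "enn2real ?I < s" unfolding ennreal_less_iff[OF enn2real_nonneg] .
  then show "\<exists>u. ?I = ennreal u \<and> 0 \<le> u \<and> u < s" using e[symmetric] enn2real_nonneg[of ?I] by (intro exI[of _ "enn2real ?I"] conjI)
next
  assume t: "0 \<le> t" "t < s"
  have "continuous_on {0..t} g" by (rule continuous_on_subset[OF c]) auto
  then obtain m where m: "m \<in> {0..t}" "\<And>r. r \<in> {0..t} \<Longrightarrow> g m \<le> g r"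
    using continuous_attains_inf[of "{0..t}" g] t by auto
  have "0 < g m" using m t by (intro pos) auto
  then obtain k0 :: nat where k0: "1 / real (Suc k0) < g m" using nat_approx_posE by blast
  have "ennreal t \<le> (INF t\<in>{t. 0 \<le> t \<and> g t \<le> 1 / real (Suc k)}. ennreal t)" if "k \<ge> k0" for k
  proof (rule INF_greatest)
    fix r assume r: "r \<in> {t. 0 \<le> t \<and> g t \<le> 1 / real (Suc k)}"
    have "1 / real (Suc k) \<le> 1 / real (Suc k0)" using that by (intro divide_left_mono) auto
    then have "g r < g m" using r k0 by auto
    then have "\<not> r \<le> t" using m(2)[of r] r by auto
    then show "ennreal t \<le> ennreal r" by (intro ennreal_leI) simp
  qed
  then show "\<exists>k0::nat. \<forall>k\<ge>k0. ennreal t \<le> (INF t\<in>{t. 0 \<le> t \<and> g t \<le> 1 / real (Suc k)}. ennreal t)" by blast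
qed

section \<open>Immediate exit once the boundary is hit\<close>

context diffusion
begin

text \<open>A path that stayed in the closed domain after the hit would give
  \<open>exit_estimate\<close> a waiting time with a positive lower bound common to all
  \<open>\<epsilon>\<close>, whereas its mean vanishes with \<open>\<epsilon>\<close>.\<close>

lemma exit_immediately_local:
  assumes z: "z \<in> frontier D"
  shows "\<exists>r>0. \<forall>T>0. AE w in P. frontier_hit T w < T \<and> X (frontier_hit T w) w \<in> cball z r \<longrightarrow>
    (\<forall>\<eta>>0. \<exists>t. frontier_hit T w \<le> t \<and> t \<le> frontier_hit T w + \<eta> \<and> X t w \<notin> closure D)"
proof -
  obtain r C G m \<phi> g where r: "0 < r" and C: "0 < C" and G: "0 < G" and m: "0 < m"
    and gc: "continuous_on (cball z r) g"
    and gb: "\<And>y. y \<in> cball z r \<Longrightarrow> norm (g y) \<le> G \<and> m \<le> norm (g y)"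
    and tay: "\<And>y y'. y \<in> cball z r \<Longrightarrow> y' \<in> cball z r \<Longrightarrow> \<bar>\<phi> y' - \<phi> y - g y \<bullet> (y' - y)\<bar> \<le> C * (norm (y' - y))\<^sup>2"
    and lip: "\<And>y y'. y \<in> cball z r \<Longrightarrow> y' \<in> cball z r \<Longrightarrow> \<bar>\<phi> y' - \<phi> y\<bar> \<le> G * norm (y' - y)"
    and cl: "\<And>y. y \<in> cball z r \<Longrightarrow> y \<in> closure D \<Longrightarrow> 0 \<le> \<phi> y"
    and fr: "\<And>y. y \<in> cball z r \<Longrightarrow> y \<in> frontier D \<Longrightarrow> \<phi> y = (0::real)"
    by (rule C2_boundary_local[OF D_C2 D_open z]) blast
  \<comment> \<open>With \<open>L = G * K + 8 * C * K\<^sup>2 + 1\<close>, the ellipticity term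
    equals \<open>2 * L\<close>. The choice of \<open>h\<close> makes the term containing
    \<open>h\<close> at most \<open>L\<close>, so the sum in \<open>coef\<close> is at most
    \<open>(L - 1) + L - 2 * L = - 1\<close>.\<close>
  define \<mu> where "\<mu> = 8 * (G * K + 8 * C * K\<^sup>2 + 1) / (\<alpha> * m\<^sup>2)"
  have am: "0 < \<alpha> * m\<^sup>2" using \<alpha>_pos m by simp
  have GK: "0 < G * K + 8 * C * K\<^sup>2 + 1" using G C K_nonneg by (intro add_nonneg_pos add_nonneg_nonneg) auto
  have \<mu>: "0 < \<mu>" using am GK by (simp add: \<mu>_def)
  define h where "h = min 1 (\<alpha> * m\<^sup>2 / (4 * (G\<^sup>2 * K\<^sup>2 + 1)))"
  have h: "0 < h" "h \<le> 1" using am by (auto simp: h_def add_nonneg_pos)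
  have hK: "G\<^sup>2 * K\<^sup>2 * h \<le> \<alpha> * m\<^sup>2 / 4"
  proof -
    have p: "0 < G\<^sup>2 * K\<^sup>2 + 1" by (simp add: add_nonneg_pos)
    have "G\<^sup>2 * K\<^sup>2 * h \<le> (G\<^sup>2 * K\<^sup>2 + 1) * (\<alpha> * m\<^sup>2 / (4 * (G\<^sup>2 * K\<^sup>2 + 1)))"
      using h by (intro mult_mono) (auto simp: h_def)
    also have "\<dots> = \<alpha> * m\<^sup>2 / 4" using p by (simp add: field_simps)
    finally show ?thesis .
  qed
  have coef: "G * K + 8 * C * K\<^sup>2 + \<mu> / 2 * (G\<^sup>2 * K\<^sup>2 * h) - \<mu> / 4 * (\<alpha> * m\<^sup>2) \<le> - 1"
  proof -
    have "\<mu> / 2 * (G\<^sup>2 * K\<^sup>2 * h) \<le> \<mu> / 2 * (\<alpha> * m\<^sup>2 / 4)" using hK \<mu> by (intro mult_left_mono) auto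
    moreover have "\<mu> * (\<alpha> * m\<^sup>2) = 8 * (G * K + 8 * C * K\<^sup>2 + 1)" unfolding \<mu>_def by (rule nonzero_eq_divide_eq[THEN iffD1, OF _ refl]) (use am in linarith)
    moreover have "\<mu> / 2 * (\<alpha> * m\<^sup>2 / 4) = \<mu> * (\<alpha> * m\<^sup>2) / 8" "\<mu> / 4 * (\<alpha> * m\<^sup>2) = \<mu> * (\<alpha> * m\<^sup>2) / 4" by simp_all
    ultimately show ?thesis by argo
  qed
  \<comment> \<open>\<open>\<rho> \<le> 1\<close> bounds the square by \<open>\<rho>\<close>; the
    last two entries then give the two inequalities of \<open>small\<close>.\<close>
  define \<rho> where "\<rho> = min (min (r/4) 1) (min (1 / (\<mu> * (G + C))) (1 / (\<mu> * C)))"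
  have \<rho>: "0 < \<rho>" "\<rho> \<le> r/4" "\<rho> \<le> 1" using r \<mu> G C by (auto simp: \<rho>_def)
  have \<rho>2: "\<rho>\<^sup>2 \<le> \<rho>" using \<rho> by (simp add: power2_eq_square mult_left_le)
  have small: "G * \<rho> + C * \<rho>\<^sup>2 \<le> 1 / \<mu>" "\<mu> * C * \<rho>\<^sup>2 \<le> 1"
  proof -
    have "G * \<rho> + C * \<rho>\<^sup>2 \<le> (G + C) * \<rho>" using \<rho>2 C by (simp add: algebra_simps)
    also have "\<dots> \<le> (G + C) * (1 / (\<mu> * (G + C)))" using G C by (intro mult_left_mono) (auto simp: \<rho>_def)
    also have "\<dots> = 1 / \<mu>" using G C by simp
    finally show "G * \<rho> + C * \<rho>\<^sup>2 \<le> 1 / \<mu>" .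
    have "\<mu> * C * \<rho>\<^sup>2 \<le> (\<mu> * C) * (1 / (\<mu> * C))" using \<rho>2 \<mu> C by (intro mult_left_mono) (auto simp: \<rho>_def)
    also have "\<dots> = 1" using \<mu> C by simp
    finally show "\<mu> * C * \<rho>\<^sup>2 \<le> 1" .
  qed
  show ?thesis
  proof (intro exI[of _ "r/2"] conjI allI impI)
    show "0 < r/2" using r by simp
    fix T :: real assume T: "0 < T"
    have T0: "0 \<le> T" using T by simp
    define S where "S w = frontier_hit T w" for w
    define \<epsilon> where "\<epsilon> n = r / 4 / real (Suc n)" for n
    have \<epsilon>: "0 < \<epsilon> n" "\<epsilon> n \<le> r/4" for n
    proof -
      show "0 < \<epsilon> n" using r by (simp add: \<epsilon>_def)
      have "r / 4 / real (Suc n) \<le> r / 4 / 1" using r by (intro divide_left_mono) auto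
      then show "\<epsilon> n \<le> r/4" by (simp add: \<epsilon>_def)
    qed
    define \<theta>1 where "\<theta>1 n w = first_hit (\<lambda>t. - infdist (X t w) (closure D)) (- \<epsilon> n) 0 T" for n w
    define \<theta>2 where "\<theta>2 w = first_hit (\<lambda>t. - norm (X t w - X (min t (S w)) w)) (- \<rho>) 0 T" for w
    define A where "A = {w\<in>space P. S w < T \<and> X (S w) w \<in> cball z (r/2)}"
    define f where "f n w = indicator A w * (max (S w) (min (min (\<theta>1 n w) (\<theta>2 w)) (S w + h)) - S w)" for n w
    have est: "integrable P (f n)" "expectation (f n) \<le> G * \<epsilon> n + \<mu> * (G * \<epsilon> n)\<^sup>2" for n
      using exit_estimate[OF T z r C G m gc gb tay lip cl fr \<rho>(1,2) h \<mu> small coef \<epsilon>[of n]]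
      unfolding f_def[abs_def] A_def S_def \<theta>1_def \<theta>2_def by blast+
    have fnn: "0 \<le> f n w" for n w by (auto simp: f_def indicator_def)
    have \<epsilon>0: "\<epsilon> \<longlonglongrightarrow> 0" unfolding \<epsilon>_def using LIMSEQ_Suc[OF lim_const_over_n[of "r/4"]] by simp
    have "(\<lambda>n. G * \<epsilon> n + \<mu> * (G * \<epsilon> n)\<^sup>2) \<longlonglongrightarrow> G * 0 + \<mu> * (G * 0)\<^sup>2" by (intro tendsto_intros \<epsilon>0)
    then have lim0: "(\<lambda>n. ennreal (G * \<epsilon> n + \<mu> * (G * \<epsilon> n)\<^sup>2)) \<longlonglongrightarrow> ennreal 0" by (intro tendsto_ennrealI) simp
    have [measurable]: "f n \<in> borel_measurable P" for n using est(1) by (rule borel_measurable_integrable)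
    have "(\<integral>\<^sup>+ w. liminf (\<lambda>n. ennreal (f n w)) \<partial>P) \<le> liminf (\<lambda>n. \<integral>\<^sup>+ w. ennreal (f n w) \<partial>P)"
      by (rule nn_integral_liminf) measurable
    also have "\<dots> \<le> liminf (\<lambda>n. ennreal (G * \<epsilon> n + \<mu> * (G * \<epsilon> n)\<^sup>2))"
    proof (rule Liminf_mono, rule always_eventually, rule allI)
      fix n
      have "(\<integral>\<^sup>+ w. ennreal (f n w) \<partial>P) = ennreal (expectation (f n))"
        by (rule nn_integral_eq_integral[OF est(1)]) (simp add: fnn)
      also have "\<dots> \<le> ennreal (G * \<epsilon> n + \<mu> * (G * \<epsilon> n)\<^sup>2)" by (rule ennreal_leI[OF est(2)])
      finally show "(\<integral>\<^sup>+ w. ennreal (f n w) \<partial>P) \<le> ennreal (G * \<epsilon> n + \<mu> * (G * \<epsilon> n)\<^sup>2)" .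
    qed
    also have "\<dots> = 0" using lim_imp_Liminf[OF _ lim0] by simp
    finally have "(\<integral>\<^sup>+ w. liminf (\<lambda>n. ennreal (f n w)) \<partial>P) = 0" by simp
    then have ae: "AE w in P. liminf (\<lambda>n. ennreal (f n w)) = 0"
      by (subst (asm) nn_integral_0_iff_AE) measurable
    show "AE w in P. frontier_hit T w < T \<and> X (frontier_hit T w) w \<in> cball z (r/2) \<longrightarrow>
       (\<forall>\<eta>>0. \<exists>t. frontier_hit T w \<le> t \<and> t \<le> frontier_hit T w + \<eta> \<and> X t w \<notin> closure D)"
      using ae X_0 X_cont_on[of T] AE_space
    proof eventually_elim
      case (elim w)
      show ?case
      proof (intro impI allI, rule ccontr)
        fix \<eta> :: real
        assume a: "frontier_hit T w < T \<and> X (frontier_hit T w) w \<in> cball z (r/2)" and \<eta>: "0 < \<eta>"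
          and n: "\<not> (\<exists>t. frontier_hit T w \<le> t \<and> t \<le> frontier_hit T w + \<eta> \<and> X t w \<notin> closure D)"
        have wA: "w \<in> A" and ST: "S w < T" using a elim by (auto simp: A_def S_def)
        have S0: "0 \<le> S w" unfolding S_def using first_hit_bounds(1)[OF T0] .
        have stay: "X t w \<in> closure D" if "0 \<le> t" "t \<le> S w + \<eta>" for t
        proof (cases "t < S w")
          case True
          then have "X t w \<in> D" using before_frontier_hit[OF elim(3,2) T0 that(1)] by (simp add: S_def)
          then show ?thesis using closure_subset by blast
        next
          case False
          then show ?thesis using n that by (auto simp: S_def)
        qed
        have "((\<lambda>t. X t w) \<longlongrightarrow> X (S w) w) (at (S w) within {0..T})"
          using elim(3) S0 ST by (auto simp: continuous_on_def)
        then have "eventually (\<lambda>t. dist (X t w) (X (S w) w) < \<rho>) (at (S w) within {0..T})" using \<rho>(1) by (rule tendstoD)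
        then obtain d where d: "0 < d" "\<And>t. t \<in> {0..T} \<Longrightarrow> t \<noteq> S w \<Longrightarrow> dist t (S w) < d \<Longrightarrow> dist (X t w) (X (S w) w) < \<rho>"
          unfolding eventually_at by auto
        \<comment> \<open>A time after the hit before which neither the distance
          \<open>\<rho>\<close>, nor the horizon \<open>T\<close>, nor the supposed stay of length
          \<open>\<eta>\<close> is exhausted.\<close>
        define u where "u = S w + min (min \<eta> d) (T - S w)"
        have u: "S w < u" "u \<le> T" "u \<le> S w + \<eta>" "u \<le> S w + d" using \<eta> d ST by (auto simp: u_def)
        have 1: "u \<le> \<theta>1 n w" for n
          unfolding \<theta>1_def
        proof (rule first_hit_geI[OF _ T0 u(2)])
          show "continuous_on {0..T} (\<lambda>t. - infdist (X t w) (closure D))" by (intro continuous_intros elim(3))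
          fix t assume t: "0 \<le> t" "t < u"
          have "X t w \<in> closure D" using t u by (intro stay) auto
          then show "- \<epsilon> n < - infdist (X t w) (closure D)" using \<epsilon>[of n] by (simp add: infdist_zero)
        qed
        have 2: "u \<le> \<theta>2 w"
          unfolding \<theta>2_def
        proof (rule first_hit_geI[OF _ T0 u(2)])
          have "continuous_on {0..T} (\<lambda>t. X (min t (S w)) w)"
            by (rule continuous_on_compose2[OF elim(3)]) (use S0 ST in \<open>auto intro!: continuous_intros\<close>)
          then show "continuous_on {0..T} (\<lambda>t. - norm (X t w - X (min t (S w)) w))" by (intro continuous_intros elim(3))
          fix t assume t: "0 \<le> t" "t < u"
          show "- \<rho> < - norm (X t w - X (min t (S w)) w)"
          proof (cases "t \<le> S w")
            case True
            then show ?thesis using \<rho> by (simp add: min_absorb1)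
          next
            case False
            then have "dist (X t w) (X (S w) w) < \<rho>" using t u by (intro d(2)) (auto simp: dist_real_def)
            then show ?thesis using False by (simp add: min_absorb2 dist_norm)
          qed
        qed
        define c0 where "c0 = min (u - S w) h"
        have c0: "0 < c0" using u h by (simp add: c0_def)
        have "c0 \<le> f n w" for n
        proof -
          have "S w + c0 \<le> min (min (\<theta>1 n w) (\<theta>2 w)) (S w + h)" using 1[of n] 2 by (auto simp: c0_def)
          then have "c0 \<le> max (S w) (min (min (\<theta>1 n w) (\<theta>2 w)) (S w + h)) - S w" by linarith
          then show ?thesis using wA by (simp add: f_def)
        qed
        then have "ennreal c0 \<le> liminf (\<lambda>n. ennreal (f n w))"
          by (intro Liminf_bounded always_eventually allI ennreal_leI)
        then show False using elim(1) c0 by simp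
      qed
    qed
  qed
qed

text \<open>The frontier is compact, so finitely many local statements cover it; integer horizons
  keep the exceptional set null.\<close>

lemma exit_immediately:
  "AE w in P. \<forall>n::nat. frontier_hit (real (Suc n)) w < real (Suc n) \<longrightarrow>
    (\<forall>\<eta>>0. \<exists>t. frontier_hit (real (Suc n)) w \<le> t \<and> t \<le> frontier_hit (real (Suc n)) w + \<eta> \<and> X t w \<notin> closure D)"
proof -
  obtain r where r: "\<And>z. z \<in> frontier D \<Longrightarrow> 0 < r z"
    and ex: "\<And>z T. z \<in> frontier D \<Longrightarrow> 0 < T \<Longrightarrow> AE w in P. frontier_hit T w < T \<and> X (frontier_hit T w) w \<in> cball z (r z) \<longrightarrow>
    (\<forall>\<eta>>0. \<exists>t. frontier_hit T w \<le> t \<and> t \<le> frontier_hit T w + \<eta> \<and> X t w \<notin> closure D)"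
    using bchoice[of "frontier D" "\<lambda>z r. 0 < r \<and> (\<forall>T>0. AE w in P. frontier_hit T w < T \<and> X (frontier_hit T w) w \<in> cball z r \<longrightarrow>
    (\<forall>\<eta>>0. \<exists>t. frontier_hit T w \<le> t \<and> t \<le> frontier_hit T w + \<eta> \<and> X t w \<notin> closure D))"] exit_immediately_local by blast
  have "compact (frontier D)" using D_bounded by (rule compact_frontier_bounded)
  then obtain Z where Z: "Z \<subseteq> frontier D" "finite Z" "frontier D \<subseteq> (\<Union>z\<in>Z. ball z (r z))"
    by (rule compactE_image[of "frontier D" "frontier D" "\<lambda>z. ball z (r z)"]) (use r in force)+
  have "AE w in P. \<forall>z\<in>Z. \<forall>n::nat. frontier_hit (real (Suc n)) w < real (Suc n) \<and> X (frontier_hit (real (Suc n)) w) w \<in> cball z (r z) \<longrightarrow>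
    (\<forall>\<eta>>0. \<exists>t. frontier_hit (real (Suc n)) w \<le> t \<and> t \<le> frontier_hit (real (Suc n)) w + \<eta> \<and> X t w \<notin> closure D)"
    using Z(1) by (intro AE_finite_allI[OF Z(2)] AE_all_countable[THEN iffD2] allI ex) auto
  moreover have "AE w in P. \<forall>n::nat. continuous_on {0..real (Suc n)} (\<lambda>t. X t w)"
    by (intro AE_all_countable[THEN iffD2] allI X_cont_on)
  ultimately show ?thesis
  proof eventually_elim
    case (elim w)
    show ?case
    proof (rule allI, rule impI)
      fix n :: nat assume lt: "frontier_hit (real (Suc n)) w < real (Suc n)"
      have "X (frontier_hit (real (Suc n)) w) w \<in> frontier D"
        by (rule frontier_hit_in[OF elim(2)[rule_format] _ lt]) simp
      then obtain z where "z \<in> Z" "X (frontier_hit (real (Suc n)) w) w \<in> cball z (r z)" using Z(3) by (auto simp: less_imp_le subset_eq)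
      then show "\<forall>\<eta>>0. \<exists>t. frontier_hit (real (Suc n)) w \<le> t \<and> t \<le> frontier_hit (real (Suc n)) w + \<eta> \<and> X t w \<notin> closure D"
        using elim(1) lt by blast
    qed
  qed
qed

text \<open>The finite exponential moment rules out paths that never meet the boundary. For the
  others the exit time is the first hit: the path lies in \<open>D\<close> before it and leaves the
  closure immediately after it.\<close>

lemma exit_time_frontier:
  assumes \<beta>: "0 < \<beta>" and fin: "(\<integral>\<^sup>+ w. exp_time \<beta> (exit_time D X w) \<partial>P) < \<infinity>"
  shows "AE w in P. continuous_on {0..} (\<lambda>t. X t w) \<and> (\<exists>s>0. exit_time D X w = ennreal s \<and> X s w \<in> frontier D \<and> (\<forall>t. 0 \<le> t \<and> t < s \<longrightarrow> X t w \<in> D))"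
proof -
  \<comment> \<open>A hitting time equal to its cap for every integer cap means that the boundary is
    never met.\<close>
  define N where "N = {w\<in>space P. \<forall>n::nat. frontier_hit (real (Suc n)) w = real (Suc n)}"
  have Nm: "N \<in> sets P"
  proof -
    have [measurable]: "(\<lambda>w. frontier_hit (real (Suc n)) w) \<in> borel_measurable P" for n
      by (rule stop_measurable[OF frontier_hit_stop]) simp
    show ?thesis unfolding N_def by measurable
  qed
  have NAE: "AE w in P. w \<in> N \<longrightarrow> exit_time D X w = \<top>"
    using X_0 X_cont AE_space
  proof eventually_elim
    case (elim w)
    show ?case
    proof
      assume N: "w \<in> N"
      have "X t w \<in> closure D" if "0 \<le> t" for t
      proof -
        obtain n :: nat where n: "t < real (Suc n)" using reals_Archimedean2[of t] by (metis less_trans lessI of_nat_less_iff)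
        have "X t w \<in> D"
          by (rule before_frontier_hit[of "real (Suc n)"])
            (use continuous_on_subset[OF elim(2), of "{0..real (Suc n)}"] elim(1) that n N in \<open>auto simp: N_def\<close>)
        then show ?thesis using closure_subset by blast
      qed
      then have "{t. 0 \<le> t \<and> X t w \<in> - closure D} = {}" by auto
      then show "exit_time D X w = \<top>" unfolding exit_time_def hitting_time_def by simp
    qed
  qed
  have "(\<integral>\<^sup>+ w. \<top> * indicator N w \<partial>P) \<le> (\<integral>\<^sup>+ w. exp_time \<beta> (exit_time D X w) \<partial>P)"
    by (rule nn_integral_mono_AE, use NAE in eventually_elim) (auto simp: indicator_def exp_time_def)
  then have "\<top> * emeasure P N < \<top>" using fin Nm by (simp add: nn_integral_cmult_indicator le_less_trans del: emeasure_completion)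
  then have "emeasure P N = 0" by (metis ennreal_top_mult less_irrefl)
  then have "AE w in P. w \<notin> N" using Nm by (intro AE_not_in null_setsI)
  then show ?thesis using X_0 X_cont exit_immediately AE_space
  proof eventually_elim
    case (elim w)
    have cT: "continuous_on {0..T} (\<lambda>t. X t w)" for T by (rule continuous_on_subset[OF elim(3)]) auto
    obtain n :: nat where n: "frontier_hit (real (Suc n)) w \<noteq> real (Suc n)" using elim(1,5) by (auto simp: N_def)
    define s where "s = frontier_hit (real (Suc n)) w"
    have T: "0 \<le> real (Suc n)" by simp
    have lt: "frontier_hit (real (Suc n)) w < real (Suc n)" using n first_hit_bounds(2)[OF T] by (metis order_le_imp_less_or_eq)
    have Xs: "X s w \<in> frontier D" unfolding s_def by (rule frontier_hit_in[OF cT T lt])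
    have s0: "0 \<le> s" unfolding s_def by (rule first_hit_bounds(1)[OF T])
    have "s \<noteq> 0"
    proof
      assume "s = 0"
      then have "x \<in> frontier D" using Xs elim(2) by simp
      then show False using x_in D_open by (simp add: frontier_def interior_open)
    qed
    then have s: "0 < s" using s0 by simp
    have before: "X t w \<in> D" if "0 \<le> t" "t < s" for t
      using before_frontier_hit[OF cT elim(2) T that(1)] that(2) by (simp add: s_def)
    have "exit_time D X w = ennreal s"
    proof (rule antisym)
      show "ennreal s \<le> exit_time D X w" unfolding exit_time_def hitting_time_def
      proof (rule INF_greatest)
        fix t assume t: "t \<in> {t. 0 \<le> t \<and> X t w \<in> - closure D}"
        then have "\<not> t < s" using before[of t] closure_subset by blast
        then show "ennreal s \<le> ennreal t" by (intro ennreal_leI) simp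
      qed
      show "exit_time D X w \<le> ennreal s"
      proof (rule ennreal_le_epsilon)
        fix e :: real assume e: "0 < e"
        obtain t where t: "s \<le> t" "t \<le> s + e" "X t w \<notin> closure D" using elim(4)[rule_format, OF lt e] by (auto simp: s_def)
        have "exit_time D X w \<le> ennreal t" unfolding exit_time_def hitting_time_def
          using t s0 by (intro INF_lower) auto
        also have "\<dots> \<le> ennreal (s + e)" using t by (intro ennreal_leI)
        also have "\<dots> = ennreal s + ennreal e" using s0 e by (simp add: ennreal_plus)
        finally show "exit_time D X w \<le> ennreal s + ennreal e" .
      qed
    qed
    then show ?case using s Xs before elim(3) by blast
  qed
qed

end

subsection \<open>The comparison with the singular solution\<close>

text \<open>The means of \<open>Y\<close> vanish, so Fatou's lemma makes the lower limit of
  \<open>X\<close> zero. No limit of \<open>X\<close> is available on all paths; the conclusion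
  therefore speaks of those on which it is eventually constant.\<close>

lemma (in prob_space) eventually_constant_zero:
  fixes X Y :: "nat \<Rightarrow> 'a \<Rightarrow> real"
  assumes iX: "\<And>k. integrable M (X k)" and X0: "\<And>k w. 0 \<le> X k w"
    and Ym: "\<And>k. Y k \<in> borel_measurable M" and Y2: "\<And>k. (\<integral>\<^sup>+ w. ennreal ((Y k w)\<^sup>2) \<partial>M) \<le> ennreal C" and C: "0 \<le> C"
    and le: "\<And>k. k0 \<le> k \<Longrightarrow> expectation (X k) \<le> expectation (Y k)"
    and lim: "AE w in M. (\<lambda>k. Y k w) \<longlonglongrightarrow> 0"
  shows "AE w in M. \<forall>c. eventually (\<lambda>k. X k w = c) sequentially \<longrightarrow> c = 0"
proof -
  note sq = nn_sq_integrable[OF Ym Y2 C]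
  have iY: "integrable M (Y k)" for k
  proof (rule Bochner_Integration.integrable_bound[of M "\<lambda>w. 1 + (Y k w)\<^sup>2"])
    have "\<bar>y\<bar> \<le> 1 + y\<^sup>2" for y :: real
      using zero_le_power2[of "\<bar>y\<bar> - 1"] zero_le_power2[of y] by (simp add: power2_diff)
    moreover have "0 \<le> 1 + y\<^sup>2" for y :: real using zero_le_power2[of y] by linarith
    ultimately show "AE w in M. norm (Y k w) \<le> norm (1 + (Y k w)\<^sup>2)" by (intro AE_I2) (simp add: abs_of_nonneg)
  qed (use sq(1)[of k] Ym in auto)
  \<comment> \<open>Second moments bounded by \<open>C\<close> give tails of order
    \<open>C / (n + 1)\<close>, hence uniform integrability.\<close>
  have "(\<lambda>k. expectation (Y k)) \<longlonglongrightarrow> expectation (\<lambda>w. 0)"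
  proof (rule uniformly_integrable_limit(2)[OF iY _ lim, of "\<lambda>n. real (Suc n)" "\<lambda>n. C / real (Suc n)"])
    show "expectation (\<lambda>w. indicator {w. real (Suc n) < \<bar>Y k w\<bar>} w * \<bar>Y k w\<bar>) \<le> C / real (Suc n)" for n k
    proof -
      have "expectation (\<lambda>w. indicator {w. real (Suc n) < \<bar>Y k w\<bar>} w * \<bar>Y k w\<bar>) \<le> expectation (\<lambda>w. (Y k w)\<^sup>2 / real (Suc n))"
      proof (rule integral_mono)
        show "integrable M (\<lambda>w. indicator {w. real (Suc n) < \<bar>Y k w\<bar>} w * \<bar>Y k w\<bar>)"
        proof (rule Bochner_Integration.integrable_bound[OF integrable_abs[OF iY[of k]]])
          have "(\<lambda>w. indicator {w. real (Suc n) < \<bar>Y k w\<bar>} w * \<bar>Y k w\<bar>) = (\<lambda>w. if real (Suc n) < \<bar>Y k w\<bar> then \<bar>Y k w\<bar> else 0)"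
            by (auto simp: indicator_def)
          then show "(\<lambda>w. indicator {w. real (Suc n) < \<bar>Y k w\<bar>} w * \<bar>Y k w\<bar>) \<in> borel_measurable M"
            using Ym[of k] by simp
        qed (auto simp: indicator_def)
        show "integrable M (\<lambda>w. (Y k w)\<^sup>2 / real (Suc n))" using sq(1) by simp
        fix w assume "w \<in> space M"
        have "\<bar>y\<bar> \<le> y\<^sup>2 / real (Suc n)" if "real (Suc n) < \<bar>y\<bar>" for y
        proof -
          have "\<bar>y\<bar> * real (Suc n) \<le> \<bar>y\<bar> * \<bar>y\<bar>" using that by (intro mult_left_mono) auto
          then show ?thesis by (simp add: pos_le_divide_eq power2_eq_square)
        qed
        then show "indicator {w. real (Suc n) < \<bar>Y k w\<bar>} w * \<bar>Y k w\<bar> \<le> (Y k w)\<^sup>2 / real (Suc n)"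
          by (auto simp: indicator_def)
      qed
      also have "\<dots> \<le> C / real (Suc n)" using sq(2)[of k] by (simp add: divide_right_mono)
      finally show ?thesis .
    qed
    show "(\<lambda>n. C / real (Suc n)) \<longlonglongrightarrow> 0" using LIMSEQ_Suc[OF lim_const_over_n[of C]] by simp
  qed auto
  then have "(\<lambda>k. ennreal (expectation (Y k))) \<longlonglongrightarrow> ennreal 0" by (intro tendsto_ennrealI) simp
  then have l0: "liminf (\<lambda>k. ennreal (expectation (Y k))) = 0" using lim_imp_Liminf[OF sequentially_bot] by auto
  have Xm: "X k \<in> borel_measurable M" for k using iX by (rule borel_measurable_integrable)
  have "(\<integral>\<^sup>+ w. liminf (\<lambda>k. ennreal (X k w)) \<partial>M) \<le> liminf (\<lambda>k. \<integral>\<^sup>+ w. ennreal (X k w) \<partial>M)"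
    using Xm by (intro nn_integral_liminf) measurable
  also have "\<dots> \<le> liminf (\<lambda>k. ennreal (expectation (Y k)))"
  proof (rule Liminf_mono, rule eventually_sequentiallyI)
    fix k assume k: "k0 \<le> k"
    have "(\<integral>\<^sup>+ w. ennreal (X k w) \<partial>M) = ennreal (expectation (X k))"
      by (rule nn_integral_eq_integral[OF iX]) (simp add: X0)
    also have "\<dots> \<le> ennreal (expectation (Y k))" by (rule ennreal_leI[OF le[OF k]])
    finally show "(\<integral>\<^sup>+ w. ennreal (X k w) \<partial>M) \<le> ennreal (expectation (Y k))" .
  qed
  finally have "(\<integral>\<^sup>+ w. liminf (\<lambda>k. ennreal (X k w)) \<partial>M) = 0" unfolding l0 by simp
  then have "AE w in M. liminf (\<lambda>k. ennreal (X k w)) = 0"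
    using Xm by (subst (asm) nn_integral_0_iff_AE) measurable
  then show ?thesis
  proof eventually_elim
    case (elim w)
    show ?case
    proof (intro allI impI)
      fix c assume c: "eventually (\<lambda>k. X k w = c) sequentially"
      then have "eventually (\<lambda>k. ennreal (X k w) = ennreal c) sequentially" by eventually_elim simp
      then have "liminf (\<lambda>k. ennreal (X k w)) = liminf (\<lambda>k::nat. ennreal c)" by (rule Liminf_eq)
      then have "ennreal c = 0" using elim by (simp add: Liminf_const)
      moreover have "0 \<le> c" using c X0 eventually_happens[OF c] by auto
      ultimately show "c = 0" by (simp add: ennreal_eq_0_iff)
    qed
  qed
qed

lemma continuous_nonneg_rational:
  fixes g :: "real \<Rightarrow> real"
  assumes c: "continuous_on {0..S} g" and t: "0 \<le> t" "t < S" and q: "\<And>r. r \<in> \<rat> \<Longrightarrow> 0 \<le> r \<Longrightarrow> r < S \<Longrightarrow> 0 \<le> g r"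
  shows "0 \<le> g t"
proof (rule ccontr)
  assume n: "\<not> 0 \<le> g t"
  have "(g \<longlongrightarrow> g t) (at t within {0..S})" using c t by (auto simp: continuous_on_def)
  then have "eventually (\<lambda>r. g r < 0) (at t within {0..S})" using n by (intro order_tendstoD(2)) auto
  then obtain d where d: "0 < d" "\<And>r. r \<in> {0..S} \<Longrightarrow> r \<noteq> t \<Longrightarrow> dist r t < d \<Longrightarrow> g r < 0"
    unfolding eventually_at by auto
  obtain r where r: "r \<in> \<rat>" "t < r" "r < min (t + d) S" using Rats_dense_in_real[of t "min (t + d) S"] d t by auto
  then have "g r < 0" using t by (intro d(2)) (auto simp: dist_real_def)
  then show False using q[of r] r t by auto
qed

section \<open>Comparison up to times near the boundary\<close>

context diffusion
begin

definition near_stop :: "nat \<Rightarrow> 'w \<Rightarrow> real" where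
  "near_stop k w = tmin (real (Suc k)) (near_time D X (1 / real (Suc k)) w)"

lemma near_stop_eq: "near_stop k w = first_hit (\<lambda>t. infdist (X t w) (frontier D)) (1 / real (Suc k)) 0 (real (Suc k))"
  unfolding near_stop_def near_time_def by (rule tmin_hitting_time) simp

lemma near_stop_bounds: "0 \<le> near_stop k w" "near_stop k w \<le> real (Suc k)"
  unfolding near_stop_eq using first_hit_bounds[of 0 "real (Suc k)"] by auto

lemma near_stop_stop: "stop (near_stop k)"
  using infdist_X_stop[of "real (Suc k)" "\<lambda>u. u" "frontier D" "1 / real (Suc k)"]
  unfolding near_stop_eq[abs_def] by simp

text \<open>The common ground of truncated and singular solutions. The martingale may depend on
  \<open>k\<close>, since an integral up to \<open>\<tau>\<close> need not be a martingale in the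
  singular case.\<close>

definition local_solution :: "(real \<Rightarrow> real) \<Rightarrow> (real \<Rightarrow> 'w \<Rightarrow> real) \<Rightarrow> bool" where
  "local_solution f Y \<longleftrightarrow> progressively_measurable (aug_filtration M B) Y \<and>
     (\<forall>k. (\<integral>\<^sup>+ w. (SUP t\<in>{0..near_stop k w}. ennreal ((Y t w)\<^sup>2)) \<partial>P) < \<infinity> \<and>
        (\<exists>N. mart (real (Suc k)) N \<and> (AE w in P. backward_path f (near_stop k w) (\<lambda>t. Y t w) (\<lambda>t. N t w))))"

lemma local_solution_measurable:
  assumes Y: "local_solution f Y" and t: "0 \<le> t"
  shows "(\<lambda>w. Y (min t (near_stop k w)) w) \<in> borel_measurable (Ft t)"
  using Y t by (intro progressive_stopped near_stop_stop) (auto simp: local_solution_def)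

lemma local_solution_integrable:
  assumes Y: "local_solution f Y" and t: "0 \<le> t"
  shows "integrable P (\<lambda>w. Y (min t (near_stop k w)) w)"
proof (rule sq_integrable_imp_integrable)
  let ?I = "\<integral>\<^sup>+ w. (SUP t\<in>{0..near_stop k w}. ennreal ((Y t w)\<^sup>2)) \<partial>P"
  show m: "(\<lambda>w. Y (min t (near_stop k w)) w) \<in> borel_measurable P"
    by (rule measurable_F[OF local_solution_measurable[OF Y t]])
  have "?I < \<top>" using Y by (auto simp: local_solution_def)
  then obtain c where c: "?I = ennreal c" "0 \<le> c" by (cases ?I) auto
  have "(\<integral>\<^sup>+ w. ennreal ((Y (min t (near_stop k w)) w)\<^sup>2) \<partial>P) \<le> ?I"
    by (intro nn_integral_mono SUP_upper) (use t near_stop_bounds in auto)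
  then show "integrable P (\<lambda>w. (Y (min t (near_stop k w)) w)\<^sup>2)"
    using c by (intro nn_sq_integrable(1)[OF m, of c]) auto
qed

lemma local_solution_continuous:
  assumes Y: "local_solution f Y"
  shows "AE w in P. \<forall>k. continuous_on {0..near_stop k w} (\<lambda>t. Y t w)"
  unfolding AE_all_countable
proof
  fix k
  obtain N where N: "mart (real (Suc k)) N" "AE w in P. backward_path f (near_stop k w) (\<lambda>t. Y t w) (\<lambda>t. N t w)"
    using Y by (auto simp: local_solution_def)
  have "AE w in P. continuous_on {0..real (Suc k)} (\<lambda>t. N t w)" by (rule martD(4)[OF N(1), of 0]) auto
  with N(2) show "AE w in P. continuous_on {0..near_stop k w} (\<lambda>t. Y t w)"
  proof eventually_elim
    case (elim w)
    have "continuous_on {0..near_stop k w} (\<lambda>t. N t w)"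
      by (rule continuous_on_subset[OF elim(2)]) (use near_stop_bounds(2)[of k w] in auto)
    then show ?case by (rule backward_path_continuous[OF elim(1)])
  qed
qed

text \<open>Once \<open>near_stop k\<close> has passed a fixed time \<open>a\<close>, the positive
  part of the difference at the stopped time no longer depends on \<open>k\<close>, while its mean
  is bounded by one that vanishes. Rational times and continuity give all times outside one null
  set. \<open>S\<close> is meant to be the exit time.\<close>

lemma local_solution_comparison:
  assumes f: "mono f" and U: "local_solution f U" and V: "local_solution f V" and C: "0 \<le> C"
    and bd: "\<And>k. (\<integral>\<^sup>+ w. ennreal ((max 0 (U (near_stop k w) w - V (near_stop k w) w))\<^sup>2) \<partial>P) \<le> ennreal C"
    and lim: "AE w in P. (\<lambda>k. max 0 (U (near_stop k w) w - V (near_stop k w) w)) \<longlonglongrightarrow> 0"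
  shows "AE w in P. \<forall>S t. (\<forall>r<S. eventually (\<lambda>k. r < near_stop k w) sequentially) \<longrightarrow> 0 \<le> t \<longrightarrow> t < S \<longrightarrow> U t w \<le> V t w"
proof -
  have fixed: "AE w in P. eventually (\<lambda>k. a < near_stop k w) sequentially \<longrightarrow> U a w \<le> V a w" if a: "0 \<le> a" for a
  proof -
    define Xk where "Xk k w = max 0 (U (min a (near_stop k w)) w - V (min a (near_stop k w)) w)" for k w
    define Yk where "Yk k w = max 0 (U (near_stop k w) w - V (near_stop k w) w)" for k w
    have m: "min (real (Suc k)) (near_stop k w) = near_stop k w" for k w
      by (rule min_absorb2[OF near_stop_bounds(2)])
    have iX: "integrable P (Xk k)" for k
      unfolding Xk_def[abs_def]
      by (intro Bochner_Integration.integrable_max Bochner_Integration.integrable_diff local_solution_integrable[OF U a] local_solution_integrable[OF V a]) simp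
    have Ym: "Yk k \<in> borel_measurable P" for k
    proof -
      have [measurable]: "(\<lambda>w. U (near_stop k w) w) \<in> borel_measurable P" "(\<lambda>w. V (near_stop k w) w) \<in> borel_measurable P"
        using measurable_F[OF local_solution_measurable[OF U, of "real (Suc k)" k]]
          measurable_F[OF local_solution_measurable[OF V, of "real (Suc k)" k]] by (simp_all only: m of_nat_0_le_iff)
      show ?thesis unfolding Yk_def[abs_def] by measurable
    qed
    \<comment> \<open>From this index on the horizon \<open>k + 1\<close> covers
      \<open>a\<close>.\<close>
    have le: "expectation (Xk k) \<le> expectation (Yk k)" if k: "nat \<lceil>a\<rceil> \<le> k" for k
    proof -
      have T: "a \<le> real (Suc k)" using k by linarith
      obtain NU where NU: "mart (real (Suc k)) NU" "AE w in P. backward_path f (near_stop k w) (\<lambda>t. U t w) (\<lambda>t. NU t w)"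
        using U by (auto simp: local_solution_def)
      obtain NV where NV: "mart (real (Suc k)) NV" "AE w in P. backward_path f (near_stop k w) (\<lambda>t. V t w) (\<lambda>t. NV t w)"
        using V by (auto simp: local_solution_def)
      have "expectation (\<lambda>w. max 0 (U (min a (near_stop k w)) w - V (min a (near_stop k w)) w))
        \<le> expectation (\<lambda>w. max 0 (U (min (real (Suc k)) (near_stop k w)) w - V (min (real (Suc k)) (near_stop k w)) w))"
        by (rule comparison_step[OF a T near_stop_stop near_stop_bounds(2) f NU(1) NV(1) local_solution_measurable[OF U] local_solution_measurable[OF V]
            local_solution_integrable[OF U] local_solution_integrable[OF V] NU(2) NV(2)])
      then show ?thesis unfolding m Xk_def Yk_def .
    qed
    have "AE w in P. \<forall>c. eventually (\<lambda>k. Xk k w = c) sequentially \<longrightarrow> c = 0"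
      by (rule eventually_constant_zero[OF iX _ Ym _ C le])
        (use bd lim in \<open>simp_all only: Xk_def[abs_def] Yk_def[abs_def] max.cobounded1\<close>)
    then show ?thesis
    proof eventually_elim
      case (elim w)
      show ?case
      proof
        assume "eventually (\<lambda>k. a < near_stop k w) sequentially"
        then have "eventually (\<lambda>k. Xk k w = max 0 (U a w - V a w)) sequentially"
          by eventually_elim (simp add: Xk_def min_absorb1)
        then have "max 0 (U a w - V a w) = 0" using elim by blast
        then show "U a w \<le> V a w" by (simp add: max_def split: if_splits)
      qed
    qed
  qed
  have "AE w in P. \<forall>a\<in>\<rat> \<inter> {0..}. eventually (\<lambda>k. a < near_stop k w) sequentially \<longrightarrow> U a w \<le> V a w"
    by (intro AE_ball_countable' fixed countable_Int1 countable_rat) auto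
  then show ?thesis using local_solution_continuous[OF U] local_solution_continuous[OF V]
  proof eventually_elim
    case (elim w)
    show ?case
    proof (intro allI impI)
      fix S t :: real assume ev: "\<forall>r<S. eventually (\<lambda>k. r < near_stop k w) sequentially" and t: "0 \<le> t" "t < S"
      \<comment> \<open>Continuity is known up to each \<open>near_stop k\<close> only, so an
        interval ending before \<open>S\<close> is used.\<close>
      obtain u where u: "t < u" "u < S" using dense[OF t(2)] by blast
      obtain k where k: "u < near_stop k w" using ev u eventually_happens[of _ sequentially] by force
      have "continuous_on {0..u} (\<lambda>t. V t w - U t w)"
        by (rule continuous_on_subset[of "{0..near_stop k w}"]) (use elim k in \<open>auto intro!: continuous_on_diff\<close>)
      then have "0 \<le> V t w - U t w"
        by (rule continuous_nonneg_rational[OF _ t(1) u(1)]) (use elim(1) ev u in auto)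
      then show "U t w \<le> V t w" by simp
    qed
  qed
qed

end

section \<open>From extended to real time\<close>

lemma tmin_ennreal: "0 \<le> t \<Longrightarrow> 0 \<le> u \<Longrightarrow> tmin t (ennreal u) = min t u"
  unfolding tmin_def by (cases "t \<le> u") (auto simp: min_def ennreal_le_iff)

lemma le_tmin:
  assumes "0 \<le> r" "r \<le> t" "ennreal r \<le> S" shows "r \<le> tmin t S"
proof -
  have "ennreal r \<le> min (ennreal t) S" using assms by (auto intro: ennreal_leI)
  then have "enn2real (ennreal r) \<le> tmin t S" unfolding tmin_def by (rule enn2real_mono) (simp add: min_less_iff_disj)
  then show ?thesis using assms(1) by simp
qed

lemma tmin_absorb: "0 \<le> r \<Longrightarrow> ennreal r \<le> S \<Longrightarrow> tmin r S = r"
  unfolding tmin_def by (simp add: min_absorb1)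

lemma tmin_bounds:
  assumes "0 \<le> t" shows "0 \<le> tmin t S" "tmin t S \<le> t" "ennreal (tmin t S) \<le> S"
proof -
  show "0 \<le> tmin t S" unfolding tmin_def by simp
  have e: "ennreal (tmin t S) = min (ennreal t) S" unfolding tmin_def by (intro ennreal_enn2real) (simp add: min_less_iff_disj)
  then show "ennreal (tmin t S) \<le> S" by simp
  have "ennreal (tmin t S) \<le> ennreal t" unfolding e by simp
  then show "tmin t S \<le> t" using assms by (simp add: ennreal_le_iff)
qed

lemma bsde_path_backward:
  assumes p: "bsde_path q S y i" and u: "ennreal c \<le> S"
  shows "backward_path (\<lambda>z. z * \<bar>z\<bar> powr q) c y (\<lambda>t. i (tmin t S))"
  unfolding backward_path_def
proof (intro allI impI)
  fix a t :: real assume a: "0 \<le> a \<and> a \<le> t \<and> t \<le> c"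
  have "ennreal r \<le> S" if "r \<le> c" for r using order_trans[OF ennreal_leI[OF that] u] .
  then have eq: "tmin a S = a" "tmin t S = t" using a by (auto intro!: tmin_absorb)
  have "set_integrable lborel {tmin a S..tmin t S} (\<lambda>r. y r * \<bar>y r\<bar> powr q) \<and>
      y (tmin a S) = y (tmin t S) - (LINT r:{tmin a S..tmin t S}|lborel. y r * \<bar>y r\<bar> powr q) - (i (tmin t S) - i (tmin a S))"
    using p a unfolding bsde_path_def by blast
  then show "set_integrable lborel {a..t} (\<lambda>r. y r * \<bar>y r\<bar> powr q) \<and>
      y a = y t - (LINT r:{a..t}|lborel. y r * \<bar>y r\<bar> powr q) - (i (tmin t S) - i (tmin a S))"
    by (simp only: eq)
qed

lemma mono_mult_abs_powr:
  assumes "0 < q" shows "mono (\<lambda>z :: real. z * \<bar>z\<bar> powr q)"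
proof (rule monoI)
  fix y z :: real assume yz: "y \<le> z"
  consider "0 \<le> y" | "y \<le> 0" "0 \<le> z" | "z \<le> 0" using yz by linarith
  then show "y * \<bar>y\<bar> powr q \<le> z * \<bar>z\<bar> powr q"
  proof cases
    case 1
    then show ?thesis using yz assms by (intro mult_mono powr_mono2) auto
  next
    case 2
    then have "y * \<bar>y\<bar> powr q \<le> 0" "0 \<le> z * \<bar>z\<bar> powr q" by (auto intro: mult_nonpos_nonneg)
    then show ?thesis by simp
  next
    case 3
    then have "(- z) * \<bar>- z\<bar> powr q \<le> (- y) * \<bar>- y\<bar> powr q" using yz assms by (intro mult_mono powr_mono2) auto
    then show ?thesis by simp
  qed
qed

section \<open>Truncated solutions up to the exit time\<close>

locale exit_problem = diffusion M B D b \<sigma> K \<alpha> x X J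
  for M :: "'w measure" and B :: "real \<Rightarrow> 'w \<Rightarrow> real ^ 'd" and D b \<sigma> K \<alpha> x X J +
  fixes \<beta> :: real
  assumes \<beta>_pos: "0 < \<beta>" and exit_moment: "(\<integral>\<^sup>+ w. exp_time \<beta> (exit_time D X w) \<partial>P) < \<infinity>"
begin

abbreviation "\<tau> \<equiv> exit_time D X"

text \<open>The pathwise facts about \<open>near_stop\<close> on one event. It approaches the exit
  time strictly from below, as the left limit in the terminal condition requires.\<close>

lemma near_stop_exit:
  "AE w in P. \<exists>s>0. \<tau> w = ennreal s \<and> (\<forall>k. near_stop k w < s \<and> ennreal (near_stop k w) \<le> near_time D X (1 / real (Suc k)) w) \<and>
     (\<forall>r<s. eventually (\<lambda>k. r < near_stop k w) sequentially) \<and> (\<lambda>k. near_stop k w) \<longlonglongrightarrow> s"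
  using exit_time_frontier[OF \<beta>_pos exit_moment]
proof eventually_elim
  case (elim w)
  define g where "g t = infdist (X t w) (frontier D)" for t
  obtain s where s: "0 < s" "\<tau> w = ennreal s" "X s w \<in> frontier D" "\<And>t. 0 \<le> t \<Longrightarrow> t < s \<Longrightarrow> X t w \<in> D"
    using elim by blast
  have cg: "continuous_on {0..} g" unfolding g_def using elim by (intro continuous_intros) auto
  have gs: "g s = 0" using s(3) by (simp add: g_def)
  have gp: "0 < g t" if "0 \<le> t" "t < s" for t
  proof -
    have "X t w \<notin> frontier D" using s(4)[OF that] D_open by (simp add: frontier_def interior_open)
    then have "g t \<noteq> 0" unfolding g_def using in_closed_iff_infdist_zero[OF frontier_closed frontier_nonempty] by blast
    then show ?thesis using infdist_nonneg[of "X t w" "frontier D"] by (simp add: g_def)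
  qed
  have nt: "near_time D X \<eta> w = (INF t\<in>{t. 0 \<le> t \<and> g t \<le> \<eta>}. ennreal t)" for \<eta>
    by (simp add: near_time_def hitting_time_def g_def)
  have A: "near_stop k w < s \<and> ennreal (near_stop k w) \<le> near_time D X (1 / real (Suc k)) w" for k
  proof -
    have "0 < 1 / real (Suc k)" by simp
    from near_time_path(1)[OF cg s(1) gs gp this, folded nt]
    obtain u where u: "near_time D X (1 / real (Suc k)) w = ennreal u" "0 \<le> u" "u < s" by auto
    then have "near_stop k w = min (real (Suc k)) u" unfolding near_stop_def u(1) by (intro tmin_ennreal) auto
    then show ?thesis using u by (auto intro!: ennreal_leI)
  qed
  have Bt: "eventually (\<lambda>k. r < near_stop k w) sequentially" if "r < s" for r
  proof -
    have "max 0 r < s" using that s(1) by simp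
    then obtain u where u: "max 0 r < u" "u < s" using dense by blast
    then have "0 \<le> u" by simp
    from near_time_path(2)[OF cg s(1) gs gp this u(2), folded nt]
    obtain k0 where k0: "\<And>k. k0 \<le> k \<Longrightarrow> ennreal u \<le> near_time D X (1 / real (Suc k)) w" by auto
    show ?thesis
    proof (rule eventually_sequentiallyI)
      fix k assume k: "max k0 (nat \<lceil>u\<rceil>) \<le> k"
      then have "u \<le> real (Suc k)" by linarith
      then have "u \<le> near_stop k w" unfolding near_stop_def using k k0[of k] \<open>0 \<le> u\<close> by (intro le_tmin) auto
      then show "r < near_stop k w" using u by simp
    qed
  qed
  have "(\<lambda>k. near_stop k w) \<longlonglongrightarrow> s"
  proof (rule order_tendstoI)
    show "eventually (\<lambda>k. a < near_stop k w) sequentially" if "a < s" for a by (rule Bt[OF that])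
    show "eventually (\<lambda>k. near_stop k w < a) sequentially" if "s < a" for a
      using A that by (intro always_eventually allI) (blast intro: less_trans)
  qed
  then show ?case using s A Bt by blast
qed

text \<open>The weight \<open>exp (\<beta> * t)\<close> is at least one, so the weighted bound makes
  \<open>Z\<close>, cut off after \<open>\<tau>\<close>, square integrable and its integral a
  martingale.\<close>

lemma truncated_path:
  assumes tr: "truncated_solution M B q \<beta> \<tau> \<xi> n Y Z"
  obtains N where "\<And>T. 0 \<le> T \<Longrightarrow> mart T N"
    and "AE w in P. bsde_path q (\<tau> w) (\<lambda>t. Y t w) (\<lambda>t. N t w) \<and> continuous_on {0..} (\<lambda>t. N t w)"
proof -
  obtain I where I: "stopped_ito_integral M B \<tau> Z I" "AE w in M. bsde_path q (\<tau> w) (\<lambda>t. Y t w) (\<lambda>t. I t w)"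
    using tr unfolding truncated_solution_def by blast
  \<comment> \<open>\<open>N\<close> is the integral of the cut-off integrand; the equation sees
    times up to \<open>\<tau>\<close> only, so \<open>I\<close> may be replaced by it.\<close>
  define N where "N t w = I (tmin t (\<tau> w)) w" for t w
  have ito: "ito_integral M B (\<lambda>r w. if ennreal r \<le> \<tau> w then Z r w else 0) N"
    using I(1) unfolding stopped_ito_integral_def N_def[abs_def] .
  have "mart T N" if T: "0 \<le> T" for T
  proof (rule ito_integral_mart[OF ito T])
    have "(\<integral>\<^sup>+ w. \<integral>\<^sup>+ r. ennreal ((norm (if ennreal r \<le> \<tau> w then Z r w else 0))\<^sup>2) \<partial>time_measure T \<partial>P)
      \<le> (\<integral>\<^sup>+ w. (SUP t\<in>{t. 0 \<le> t \<and> ennreal t \<le> \<tau> w}. ennreal (exp (\<beta> * t) * \<bar>Y t w\<bar>\<^sup>2))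
        + (\<integral>\<^sup>+ t\<in>{t. 0 \<le> t \<and> ennreal t \<le> \<tau> w}.
             ennreal (exp (\<beta> * t) * (\<bar>Y t w\<bar>\<^sup>2 + (norm (Z t w))\<^sup>2)) \<partial>lborel) \<partial>P)"
    proof (intro nn_integral_mono)
      fix w
      have "(\<integral>\<^sup>+ r. ennreal ((norm (if ennreal r \<le> \<tau> w then Z r w else 0))\<^sup>2) \<partial>time_measure T)
        \<le> (\<integral>\<^sup>+ t\<in>{t. 0 \<le> t \<and> ennreal t \<le> \<tau> w}. ennreal (exp (\<beta> * t) * (\<bar>Y t w\<bar>\<^sup>2 + (norm (Z t w))\<^sup>2)) \<partial>lborel)"
        unfolding nn_integral_time_measure
      proof (rule nn_integral_mono)
        fix r
        have "(norm (Z r w))\<^sup>2 \<le> exp (\<beta> * r) * (\<bar>Y r w\<bar>\<^sup>2 + (norm (Z r w))\<^sup>2)" if "0 \<le> r"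
        proof -
          have "1 * (norm (Z r w))\<^sup>2 \<le> exp (\<beta> * r) * (\<bar>Y r w\<bar>\<^sup>2 + (norm (Z r w))\<^sup>2)"
            using \<beta>_pos that by (intro mult_mono) auto
          then show ?thesis by simp
        qed
        then show "ennreal ((norm (if ennreal r \<le> \<tau> w then Z r w else 0))\<^sup>2) * indicator {0..T} r
          \<le> ennreal (exp (\<beta> * r) * (\<bar>Y r w\<bar>\<^sup>2 + (norm (Z r w))\<^sup>2)) * indicator {t. 0 \<le> t \<and> ennreal t \<le> \<tau> w} r"
          by (auto simp: indicator_def intro!: ennreal_leI)
      qed
      then show "(\<integral>\<^sup>+ r. ennreal ((norm (if ennreal r \<le> \<tau> w then Z r w else 0))\<^sup>2) \<partial>time_measure T)
        \<le> (SUP t\<in>{t. 0 \<le> t \<and> ennreal t \<le> \<tau> w}. ennreal (exp (\<beta> * t) * \<bar>Y t w\<bar>\<^sup>2))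
        + (\<integral>\<^sup>+ t\<in>{t. 0 \<le> t \<and> ennreal t \<le> \<tau> w}.
             ennreal (exp (\<beta> * t) * (\<bar>Y t w\<bar>\<^sup>2 + (norm (Z t w))\<^sup>2)) \<partial>lborel)"
        by (rule add_increasing[OF zero_le])
    qed
    also have "\<dots> < \<infinity>" using tr unfolding truncated_solution_def nn_integral_completion by blast
    finally show "sq_integrable_integrand T (\<lambda>r w. if ennreal r \<le> \<tau> w then Z r w else 0)" .
  qed
  moreover have "AE w in P. bsde_path q (\<tau> w) (\<lambda>t. Y t w) (\<lambda>t. N t w) \<and> continuous_on {0..} (\<lambda>t. N t w)"
  proof -
    have "AE w in M. continuous_on {0..} (\<lambda>t. N t w)" using ito unfolding ito_integral_def by blast
    with I(2) have "AE w in M. bsde_path q (\<tau> w) (\<lambda>t. Y t w) (\<lambda>t. N t w) \<and> continuous_on {0..} (\<lambda>t. N t w)"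
    proof eventually_elim
      case (elim w)
      have "tmin (tmin t (\<tau> w)) (\<tau> w) = tmin t (\<tau> w)" if "0 \<le> t" for t
        by (rule tmin_absorb[OF tmin_bounds(1)[OF that] tmin_bounds(3)[OF that]])
      then show ?case using elim unfolding bsde_path_def N_def by force
    qed
    then show ?thesis unfolding AE_completion_iff .
  qed
  ultimately show thesis by (rule that)
qed

text \<open>One constant serves all \<open>k\<close>, as the passage to the limit in the comparison
  demands.\<close>

lemma truncated_sq_bound:
  assumes tr: "truncated_solution M B q \<beta> \<tau> \<xi> n Y Z"
  obtains C where "0 \<le> C" and "\<And>k. (\<integral>\<^sup>+ w. (SUP t\<in>{0..near_stop k w}. ennreal ((Y t w)\<^sup>2)) \<partial>P) \<le> ennreal C"
proof -
  let ?I = "\<integral>\<^sup>+ w. (SUP t\<in>{t. 0 \<le> t \<and> ennreal t \<le> \<tau> w}. ennreal (exp (\<beta> * t) * \<bar>Y t w\<bar>\<^sup>2))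
        + (\<integral>\<^sup>+ t\<in>{t. 0 \<le> t \<and> ennreal t \<le> \<tau> w}.
             ennreal (exp (\<beta> * t) * (\<bar>Y t w\<bar>\<^sup>2 + (norm (Z t w))\<^sup>2)) \<partial>lborel) \<partial>P"
  have "?I < \<top>" using tr unfolding truncated_solution_def nn_integral_completion by simp
  then obtain C where C: "?I = ennreal C" "0 \<le> C" by (cases ?I) auto
  have "(\<integral>\<^sup>+ w. (SUP t\<in>{0..near_stop k w}. ennreal ((Y t w)\<^sup>2)) \<partial>P) \<le> ?I" for k
  proof (rule nn_integral_mono_AE, use near_stop_exit in eventually_elim)
    case (elim w)
    then obtain s where s: "0 < s" "\<tau> w = ennreal s" "near_stop k w < s" by auto
    have "(SUP t\<in>{0..near_stop k w}. ennreal ((Y t w)\<^sup>2)) \<le> (SUP t\<in>{t. 0 \<le> t \<and> ennreal t \<le> \<tau> w}. ennreal (exp (\<beta> * t) * \<bar>Y t w\<bar>\<^sup>2))"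
    proof (rule SUP_least)
      fix t assume t: "t \<in> {0..near_stop k w}"
      have "1 * (Y t w)\<^sup>2 \<le> exp (\<beta> * t) * (Y t w)\<^sup>2" using t \<beta>_pos by (intro mult_right_mono) auto
      then have "ennreal ((Y t w)\<^sup>2) \<le> ennreal (exp (\<beta> * t) * \<bar>Y t w\<bar>\<^sup>2)" by (intro ennreal_leI) simp
      also have "\<dots> \<le> (SUP t\<in>{t. 0 \<le> t \<and> ennreal t \<le> \<tau> w}. ennreal (exp (\<beta> * t) * \<bar>Y t w\<bar>\<^sup>2))"
        by (rule SUP_upper) (use t s in \<open>auto intro!: ennreal_leI\<close>)
      finally show "ennreal ((Y t w)\<^sup>2) \<le> (SUP t\<in>{t. 0 \<le> t \<and> ennreal t \<le> \<tau> w}. ennreal (exp (\<beta> * t) * \<bar>Y t w\<bar>\<^sup>2))" .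
    qed
    then show ?case by (rule add_increasing2[OF zero_le])
  qed
  then show thesis using C by (intro that[of C]) auto
qed

lemma truncated_local_solution:
  assumes tr: "truncated_solution M B q \<beta> \<tau> \<xi> n Y Z"
  shows "local_solution (\<lambda>z. z * \<bar>z\<bar> powr q) Y"
proof -
  obtain N where N: "\<And>T. 0 \<le> T \<Longrightarrow> mart T N"
    "AE w in P. bsde_path q (\<tau> w) (\<lambda>t. Y t w) (\<lambda>t. N t w) \<and> continuous_on {0..} (\<lambda>t. N t w)"
    using truncated_path[OF tr] by blast
  obtain C where C: "\<And>k. (\<integral>\<^sup>+ w. (SUP t\<in>{0..near_stop k w}. ennreal ((Y t w)\<^sup>2)) \<partial>P) \<le> ennreal C"
    using truncated_sq_bound[OF tr] by blast
  have "AE w in P. backward_path (\<lambda>z. z * \<bar>z\<bar> powr q) (near_stop k w) (\<lambda>t. Y t w) (\<lambda>t. N t w)" for k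
    using N(2) near_stop_exit
  proof eventually_elim
    case (elim w)
    then obtain s where s: "0 < s" "\<tau> w = ennreal s" "near_stop k w < s" by auto
    then have le: "ennreal (near_stop k w) \<le> \<tau> w" by (auto intro!: ennreal_leI)
    have eq: "tmin t (\<tau> w) = t" if "0 \<le> t" "t \<le> near_stop k w" for t
      using that s by (simp add: tmin_ennreal)
    show ?case using bsde_path_backward[OF conjunct1[OF elim(1)] le] eq
      unfolding backward_path_def by auto
  qed
  moreover have "(\<integral>\<^sup>+ w. (SUP t\<in>{0..near_stop k w}. ennreal ((Y t w)\<^sup>2)) \<partial>P) < \<infinity>" for k
    by (rule le_less_trans[OF C]) simp
  moreover have "mart (real (Suc k)) N" for k by (rule N(1)) simp
  moreover have "progressively_measurable (aug_filtration M B) Y" using tr unfolding truncated_solution_def by blast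
  ultimately show ?thesis unfolding local_solution_def by blast
qed

text \<open>The truncated equation holds up to and including \<open>\<tau>\<close>, so the path is
  continuous there and tends to its terminal value.\<close>

lemma truncated_terminal:
  assumes tr: "truncated_solution M B q \<beta> \<tau> \<xi> n Y Z"
  shows "AE w in P. \<exists>c. (\<lambda>k. Y (near_stop k w) w) \<longlonglongrightarrow> c \<and> ereal c = min (\<xi> w) (ereal (real n))"
proof -
  obtain N where N: "AE w in P. bsde_path q (\<tau> w) (\<lambda>t. Y t w) (\<lambda>t. N t w) \<and> continuous_on {0..} (\<lambda>t. N t w)"
    using truncated_path[OF tr] by blast
  have "AE w in P. \<forall>t\<ge>0. \<tau> w \<le> ennreal t \<longrightarrow> ereal (Y t w) = min (\<xi> w) (ereal (real n)) \<and> Z t w = 0"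
    using tr unfolding truncated_solution_def AE_completion_iff by blast
  with N near_stop_exit show ?thesis
  proof eventually_elim
    case (elim w)
    then obtain s where s: "0 < s" "\<tau> w = ennreal s" "\<And>k. near_stop k w < s" "(\<lambda>k. near_stop k w) \<longlonglongrightarrow> s" by blast
    have eq: "tmin t (\<tau> w) = t" if "0 \<le> t" "t \<le> s" for t
      using that s by (simp add: tmin_ennreal)
    have "backward_path (\<lambda>z. z * \<bar>z\<bar> powr q) s (\<lambda>t. Y t w) (\<lambda>t. N (tmin t (\<tau> w)) w)"
      by (rule bsde_path_backward) (use elim(1) s in auto)
    moreover have "continuous_on {0..s} (\<lambda>t. N (tmin t (\<tau> w)) w)"
    proof (rule continuous_on_eq)
      show "continuous_on {0..s} (\<lambda>t. N t w)" by (rule continuous_on_subset[of "{0..}"]) (use elim(1) in auto)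
    qed (use eq in auto)
    ultimately have "continuous_on {0..s} (\<lambda>t. Y t w)" by (rule backward_path_continuous)
    then have "(\<lambda>k. Y (near_stop k w) w) \<longlonglongrightarrow> Y s w"
      by (rule continuous_on_tendsto_compose[OF _ s(4)]) (use s near_stop_bounds(1) in \<open>auto simp: less_imp_le\<close>)
    moreover have "ereal (Y s w) = min (\<xi> w) (ereal (real n))" using elim(3) s by auto
    ultimately show ?case by blast
  qed
qed

end

text \<open>\<open>\<xi>\<close> may be infinite while every \<open>v k\<close> is finite; a lower
  bound of \<open>v\<close> slightly below the finite number \<open>c\<close> covers both
  cases.\<close>

lemma tendsto_excess_zero:
  fixes u :: "nat \<Rightarrow> real" and v :: "nat \<Rightarrow> ereal"
  assumes u: "u \<longlonglongrightarrow> c" and v: "v \<longlonglongrightarrow> \<xi>" and le: "ereal c \<le> \<xi>" and fin: "\<And>k. \<bar>v k\<bar> \<noteq> \<infinity>"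
  shows "(\<lambda>k. max 0 (u k - real_of_ereal (v k))) \<longlonglongrightarrow> 0"
proof (rule order_tendstoI)
  fix a :: real assume a: "0 < a"
  have "ereal (c - a/2) < ereal c" using a by simp
  then have "ereal (c - a/2) < \<xi>" using le by (rule less_le_trans)
  then have "eventually (\<lambda>k. ereal (c - a/2) < v k) sequentially" by (rule order_tendstoD(1)[OF v])
  moreover have "eventually (\<lambda>k. u k < c + a/2) sequentially" using a by (intro order_tendstoD(2)[OF u]) simp
  ultimately show "eventually (\<lambda>k. max 0 (u k - real_of_ereal (v k)) < a) sequentially"
  proof eventually_elim
    case (elim k)
    obtain r where r: "v k = ereal r" using fin[of k] by (cases "v k") auto
    then have "c - a/2 < r" using elim(1) by simp
    then have "u k - r < a" using elim(2) by (simp add: field_simps)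
    then show ?case using a r by simp
  qed
qed (auto intro: always_eventually)

lemma singular_solutionD:
  assumes "singular_solution M B q \<tau>' \<tau> \<xi> Y Z"
  shows "progressively_measurable (aug_filtration M B) Y"
    and "\<forall>\<eta>>0. \<forall>T\<ge>0.
        (\<integral>\<^sup>+ w. (SUP t\<in>{0..T}. e2ennreal (\<bar>Y (tmin t (\<tau>' \<eta> w)) w\<bar>\<^sup>2))
           + (\<integral>\<^sup>+ r\<in>{0..tmin T (\<tau>' \<eta> w)}. ennreal ((norm (Z r w))\<^sup>2) \<partial>lborel) \<partial>M) < \<infinity>"
    and "\<exists>I. (\<forall>\<eta>>0. stopped_ito_integral M B (\<tau>' \<eta>) Z I) \<and>
        (AE w in M. \<forall>\<eta>>0. (\<forall>t\<ge>0. \<bar>Y (tmin t (\<tau>' \<eta> w)) w\<bar> \<noteq> \<infinity>) \<and>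
           bsde_path q (\<tau>' \<eta> w) (\<lambda>t. real_of_ereal (Y t w)) (\<lambda>t. I t w))"
    and "AE w in M. \<forall>t\<ge>0. \<tau> w \<le> ennreal t \<longrightarrow> Y t w = \<xi> w \<and> Z t w = 0"
    and "AE w in M. ((\<lambda>t. Y t w) \<longlongrightarrow> \<xi> w) (at (enn2real (\<tau> w)) within {0..<enn2real (\<tau> w)})"
  using assms unfolding singular_solution_def by - (elim conjE, assumption)+

context exit_problem
begin

lemma near_stop_measurable:
  assumes "local_solution f Y" shows "(\<lambda>w. Y (near_stop k w) w) \<in> borel_measurable P"
  using measurable_F[OF local_solution_measurable[OF assms, of "real (Suc k)" k]]
  by (simp only: min_absorb2[OF near_stop_bounds(2)] of_nat_0_le_iff)

lemma truncated_near_bound: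
  assumes tr: "truncated_solution M B q \<beta> \<tau> \<xi> n Y Z"
  obtains C where "0 \<le> C" and "\<And>k. (\<integral>\<^sup>+ w. ennreal ((Y (near_stop k w) w)\<^sup>2) \<partial>P) \<le> ennreal C"
proof -
  obtain C where C: "0 \<le> C" "\<And>k. (\<integral>\<^sup>+ w. (SUP t\<in>{0..near_stop k w}. ennreal ((Y t w)\<^sup>2)) \<partial>P) \<le> ennreal C"
    using truncated_sq_bound[OF tr] by blast
  have "(\<integral>\<^sup>+ w. ennreal ((Y (near_stop k w) w)\<^sup>2) \<partial>P) \<le> ennreal C" for k
    by (rule order_trans[OF nn_integral_mono C(2)[of k]], rule SUP_upper) (simp add: near_stop_bounds(1))
  then show thesis using C(1) by (rule that[rotated])
qed

text \<open>Both solutions have mean-square bounds uniform in \<open>k\<close>, and their terminal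
  values are ordered.\<close>

lemma truncated_mono:
  assumes q: "0 < q" and n: "n \<le> m"
    and U: "truncated_solution M B q \<beta> \<tau> \<xi> n U ZU" and V: "truncated_solution M B q \<beta> \<tau> \<xi> m V ZV"
  shows "AE w in P. \<forall>t\<ge>0. U t w \<le> V t w"
proof -
  note lU = truncated_local_solution[OF U] and lV = truncated_local_solution[OF V]
  obtain C where C: "0 \<le> C" "\<And>k. (\<integral>\<^sup>+ w. ennreal ((U (near_stop k w) w)\<^sup>2) \<partial>P) \<le> ennreal C"
    by (rule truncated_near_bound[OF U]) blast
  obtain C' where C': "0 \<le> C'" "\<And>k. (\<integral>\<^sup>+ w. ennreal ((V (near_stop k w) w)\<^sup>2) \<partial>P) \<le> ennreal C'"
    by (rule truncated_near_bound[OF V]) blast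
  have bd: "(\<integral>\<^sup>+ w. ennreal ((max 0 (U (near_stop k w) w - V (near_stop k w) w))\<^sup>2) \<partial>P) \<le> ennreal (2 * C + 2 * C')" for k
  proof -
    have "(\<integral>\<^sup>+ w. ennreal ((max 0 (U (near_stop k w) w - V (near_stop k w) w))\<^sup>2) \<partial>P)
      \<le> (\<integral>\<^sup>+ w. ennreal ((U (near_stop k w) w - V (near_stop k w) w)\<^sup>2) \<partial>P)"
      by (intro nn_integral_mono ennreal_leI) (simp add: max_def)
    also have "\<dots> \<le> 2 * (\<integral>\<^sup>+ w. ennreal ((U (near_stop k w) w)\<^sup>2) \<partial>P) + 2 * (\<integral>\<^sup>+ w. ennreal ((V (near_stop k w) w)\<^sup>2) \<partial>P)"
      by (rule nn_sq_diff_le[OF near_stop_measurable[OF lU] near_stop_measurable[OF lV]])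
    also have "\<dots> \<le> 2 * ennreal C + 2 * ennreal C'" by (intro add_mono mult_left_mono C(2) C'(2)) auto
    also have "\<dots> = ennreal (2 * C + 2 * C')" using C(1) C'(1) by (simp add: ennreal_mult ennreal_plus)
    finally show ?thesis .
  qed
  have lim: "AE w in P. (\<lambda>k. max 0 (U (near_stop k w) w - V (near_stop k w) w)) \<longlonglongrightarrow> 0"
    using truncated_terminal[OF U] truncated_terminal[OF V]
  proof eventually_elim
    case (elim w)
    then obtain c c' where c: "(\<lambda>k. U (near_stop k w) w) \<longlonglongrightarrow> c" "ereal c = min (\<xi> w) (ereal (real n))"
      and c': "(\<lambda>k. V (near_stop k w) w) \<longlonglongrightarrow> c'" "ereal c' = min (\<xi> w) (ereal (real m))" by blast
    have "ereal c \<le> ereal c'" unfolding c c' using n by (intro min.mono) auto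
    then show ?case
      using tendsto_excess_zero[OF c(1) tendsto_ereal[OF c'(1)]] by simp
  qed
  have C0: "0 \<le> 2 * C + 2 * C'" using C(1) C'(1) by simp
  have after: "AE w in P. \<forall>t\<ge>0. \<tau> w \<le> ennreal t \<longrightarrow> ereal (U t w) \<le> ereal (V t w)"
  proof -
    have "AE w in M. \<forall>t\<ge>0. \<tau> w \<le> ennreal t \<longrightarrow> ereal (U t w) = min (\<xi> w) (ereal (real n)) \<and> ZU t w = 0"
      "AE w in M. \<forall>t\<ge>0. \<tau> w \<le> ennreal t \<longrightarrow> ereal (V t w) = min (\<xi> w) (ereal (real m)) \<and> ZV t w = 0"
      using U V unfolding truncated_solution_def by blast+
    then have "AE w in M. \<forall>t\<ge>0. \<tau> w \<le> ennreal t \<longrightarrow> ereal (U t w) \<le> ereal (V t w)"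
    proof eventually_elim
      case (elim w)
      have "min (\<xi> w) (ereal (real n)) \<le> min (\<xi> w) (ereal (real m))" using n by (intro min.mono) auto
      then show ?case using elim by simp
    qed
    then show ?thesis unfolding AE_completion_iff .
  qed
  show ?thesis
    using local_solution_comparison[OF mono_mult_abs_powr[OF q] lU lV C0 bd lim] after near_stop_exit
  proof eventually_elim
    case (elim w)
    obtain s where s: "0 < s" "\<tau> w = ennreal s" "\<forall>r<s. eventually (\<lambda>k. r < near_stop k w) sequentially" using elim(3) by blast
    show ?case
    proof (intro allI impI)
      fix t :: real assume t: "0 \<le> t"
      show "U t w \<le> V t w"
      proof (cases "t < s")
        case True
        then show ?thesis using elim(1) s(3) t by blast
      next
        case False
        then have "\<tau> w \<le> ennreal t" unfolding s(2) by (intro ennreal_leI) simp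
        then have "ereal (U t w) \<le> ereal (V t w)" using elim(2) t by blast
        then show ?thesis by simp
      qed
    qed
  qed
qed

text \<open>\<open>real_of_ereal\<close> is faithful on finite values only; this provides them
  before the exit.\<close>

lemma singular_finite:
  assumes sing: "singular_solution M B q (near_time D X) \<tau> \<xi> Y Z"
  shows "AE w in P. \<forall>k. \<forall>t\<in>{0..near_stop k w}. \<bar>Y t w\<bar> \<noteq> \<infinity>"
proof -
  have "AE w in P. \<forall>\<eta>>0. \<forall>t\<ge>0. \<bar>Y (tmin t (near_time D X \<eta> w)) w\<bar> \<noteq> \<infinity>"
  proof -
    obtain I where "AE w in M. \<forall>\<eta>>0. (\<forall>t\<ge>0. \<bar>Y (tmin t (near_time D X \<eta> w)) w\<bar> \<noteq> \<infinity>) \<and>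
           bsde_path q (near_time D X \<eta> w) (\<lambda>t. real_of_ereal (Y t w)) (\<lambda>t. I t w)"
      using singular_solutionD(3)[OF sing] by (elim exE conjE)
    then have "AE w in M. \<forall>\<eta>>0. \<forall>t\<ge>0. \<bar>Y (tmin t (near_time D X \<eta> w)) w\<bar> \<noteq> \<infinity>"
      by eventually_elim simp
    then show ?thesis unfolding AE_completion_iff .
  qed
  with near_stop_exit show ?thesis
  proof eventually_elim
    case (elim w)
    then have le: "ennreal (near_stop k w) \<le> near_time D X (1 / real (Suc k)) w" for k by blast
    show ?case
    proof (intro allI ballI)
      fix k t assume t: "t \<in> {0..near_stop k w}"
      then have t0: "0 \<le> t" and "ennreal t \<le> ennreal (near_stop k w)" by (auto intro: ennreal_leI)
      then have eq: "tmin t (near_time D X (1 / real (Suc k)) w) = t"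
        by (intro tmin_absorb[OF t0] order_trans[OF _ le])
      have "0 < 1 / real (Suc k)" by simp
      from elim(2)[rule_format, OF this t0] show "\<bar>Y t w\<bar> \<noteq> \<infinity>" unfolding eq .
    qed
  qed
qed

text \<open>Condition (D1) at level \<open>1 / (k + 1)\<close> and horizon \<open>k + 1\<close>
  makes the stopped integral a martingale on this horizon.\<close>

lemma singular_local_solution:
  assumes sing: "singular_solution M B q (near_time D X) \<tau> \<xi> Y Z"
  shows "local_solution (\<lambda>z. z * \<bar>z\<bar> powr q) (\<lambda>t w. real_of_ereal (Y t w))"
  unfolding local_solution_def
proof (intro conjI allI)
  show "progressively_measurable (aug_filtration M B) (\<lambda>t w. real_of_ereal (Y t w))"
    unfolding progressively_measurable_def
  proof (intro allI impI)
    fix t :: real assume "0 \<le> t"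
    with singular_solutionD(1)[OF sing]
    have "(\<lambda>(r, w). Y r w) \<in> borel_measurable (restrict_space borel {0..t} \<Otimes>\<^sub>M aug_filtration M B (ennreal t))"
      unfolding progressively_measurable_def by blast
    from borel_measurable_real_of_ereal[OF this]
    show "(\<lambda>(r, w). real_of_ereal (Y r w)) \<in> borel_measurable (restrict_space borel {0..t} \<Otimes>\<^sub>M aug_filtration M B (ennreal t))"
      by (simp only: case_prod_unfold)
  qed
  fix k
  let ?s = "near_time D X (1 / real (Suc k))" and ?T = "real (Suc k)"
  have \<eta>: "0 < 1 / real (Suc k)" by simp
  have le: "ennreal (near_stop k w) \<le> ?s w" for w unfolding near_stop_def by (rule tmin_bounds(3)) simp
  have absorb: "tmin t (?s w) = t" if "0 \<le> t" "t \<le> near_stop k w" for t w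
    by (rule tmin_absorb[OF that(1) order_trans[OF ennreal_leI[OF that(2)] le]])
  obtain I where I: "stopped_ito_integral M B ?s Z I"
    "AE w in M. bsde_path q (?s w) (\<lambda>t. real_of_ereal (Y t w)) (\<lambda>t. I t w)"
  proof -
    obtain I where 1: "\<forall>\<eta>>0. stopped_ito_integral M B (near_time D X \<eta>) Z I"
      and 2: "AE w in M. \<forall>\<eta>>0. (\<forall>t\<ge>0. \<bar>Y (tmin t (near_time D X \<eta> w)) w\<bar> \<noteq> \<infinity>) \<and>
           bsde_path q (near_time D X \<eta> w) (\<lambda>t. real_of_ereal (Y t w)) (\<lambda>t. I t w)"
      using singular_solutionD(3)[OF sing] by (elim exE conjE)
    have "AE w in M. bsde_path q (?s w) (\<lambda>t. real_of_ereal (Y t w)) (\<lambda>t. I t w)"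
      using 2 by eventually_elim (use \<eta> in blast)
    with 1 \<eta> show thesis by (intro that) auto
  qed
  have "(\<integral>\<^sup>+ w. (SUP t\<in>{0..?T}. e2ennreal (\<bar>Y (tmin t (?s w)) w\<bar>\<^sup>2))
           + (\<integral>\<^sup>+ r\<in>{0..tmin ?T (?s w)}. ennreal ((norm (Z r w))\<^sup>2) \<partial>lborel) \<partial>M) < \<infinity>"
  proof -
    have "0 \<le> ?T" by simp
    from singular_solutionD(2)[OF sing, rule_format, OF \<eta> this] show ?thesis .
  qed
  then have fin: "(\<integral>\<^sup>+ w. (SUP t\<in>{0..?T}. e2ennreal (\<bar>Y (tmin t (?s w)) w\<bar>\<^sup>2))
           + (\<integral>\<^sup>+ r\<in>{0..tmin ?T (?s w)}. ennreal ((norm (Z r w))\<^sup>2) \<partial>lborel) \<partial>P) < \<infinity>"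
    unfolding nn_integral_completion .
  show "(\<integral>\<^sup>+ w. (SUP t\<in>{0..near_stop k w}. ennreal ((real_of_ereal (Y t w))\<^sup>2)) \<partial>P) < \<infinity>"
  proof (rule le_less_trans[OF nn_integral_mono_AE fin], use singular_finite[OF sing] in eventually_elim)
    case (elim w)
    have "(SUP t\<in>{0..near_stop k w}. ennreal ((real_of_ereal (Y t w))\<^sup>2)) \<le> (SUP t\<in>{0..?T}. e2ennreal (\<bar>Y (tmin t (?s w)) w\<bar>\<^sup>2))"
    proof (rule SUP_mono)
      fix t assume t: "t \<in> {0..near_stop k w}"
      have "\<bar>Y t w\<bar> \<noteq> \<infinity>" by (rule elim[rule_format, OF t])
      then obtain y where "Y t w = ereal y" by (cases "Y t w") auto
      then have "ennreal ((real_of_ereal (Y t w))\<^sup>2) \<le> e2ennreal (\<bar>Y (tmin t (?s w)) w\<bar>\<^sup>2)"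
        using absorb[of t w] t by (simp add: e2ennreal_ereal)
      moreover have "t \<in> {0..?T}" using t near_stop_bounds(2)[of k w] by auto
      ultimately show "\<exists>m\<in>{0..?T}. ennreal ((real_of_ereal (Y t w))\<^sup>2) \<le> e2ennreal (\<bar>Y (tmin m (?s w)) w\<bar>\<^sup>2)" by blast
    qed
    then show ?case by (rule add_increasing2[OF zero_le])
  qed
  define N where "N t w = I (tmin t (?s w)) w" for t w
  have ito: "ito_integral M B (\<lambda>r w. if ennreal r \<le> ?s w then Z r w else 0) N"
    using I(1) unfolding stopped_ito_integral_def N_def[abs_def] .
  have "mart ?T N"
  proof (rule ito_integral_mart[OF ito])
    show "sq_integrable_integrand ?T (\<lambda>r w. if ennreal r \<le> ?s w then Z r w else 0)"
    proof (rule le_less_trans[OF _ fin], rule nn_integral_mono, rule add_increasing[OF zero_le])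
      fix w
      show "(\<integral>\<^sup>+ r. ennreal ((norm (if ennreal r \<le> ?s w then Z r w else 0))\<^sup>2) \<partial>time_measure ?T)
        \<le> (\<integral>\<^sup>+ r\<in>{0..tmin ?T (?s w)}. ennreal ((norm (Z r w))\<^sup>2) \<partial>lborel)"
        unfolding nn_integral_time_measure
      proof (rule nn_integral_mono)
        fix r
        show "ennreal ((norm (if ennreal r \<le> ?s w then Z r w else 0))\<^sup>2) * indicator {0..?T} r
          \<le> ennreal ((norm (Z r w))\<^sup>2) * indicator {0..tmin ?T (?s w)} r"
        proof (cases "0 \<le> r \<and> r \<le> ?T \<and> ennreal r \<le> ?s w")
          case True
          then have "r \<in> {0..tmin ?T (?s w)}" "r \<in> {0..?T}" using le_tmin[of r ?T "?s w"] by simp_all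
          then show ?thesis using True by (simp only: indicator_simps if_True)
        next
          case False
          then have "r \<notin> {0..?T} \<or> \<not> ennreal r \<le> ?s w" by simp
          then show ?thesis by (elim disjE) simp_all
        qed
      qed
    qed
  qed simp
  moreover have "AE w in P. backward_path (\<lambda>z. z * \<bar>z\<bar> powr q) (near_stop k w) (\<lambda>t. real_of_ereal (Y t w)) (\<lambda>t. N t w)"
    unfolding AE_completion_iff using I(2)
  proof eventually_elim
    case (elim w)
    show ?case unfolding N_def by (rule bsde_path_backward[OF elim le])
  qed
  ultimately show "\<exists>N. mart ?T N \<and>
      (AE w in P. backward_path (\<lambda>z. z * \<bar>z\<bar> powr q) (near_stop k w) (\<lambda>t. real_of_ereal (Y t w)) (\<lambda>t. N t w))" by blast
qed

text \<open>(D1) gives no bound of \<open>Y\<close> uniform in \<open>k\<close>. Its nonnegativity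
  serves instead: the positive part of the difference is at most the absolute value of
  \<open>U\<close>.\<close>

lemma truncated_le_singular:
  assumes q: "0 < q" and U: "truncated_solution M B q \<beta> \<tau> \<xi> n U ZU"
    and sing: "singular_solution M B q (near_time D X) \<tau> \<xi> Y Z" and nonneg: "AE w in P. \<forall>t\<ge>0. 0 \<le> Y t w"
  shows "AE w in P. \<forall>t\<ge>0. ereal (U t w) \<le> Y t w"
proof -
  note lU = truncated_local_solution[OF U] and lY = singular_local_solution[OF sing]
  obtain C where C: "0 \<le> C" "\<And>k. (\<integral>\<^sup>+ w. ennreal ((U (near_stop k w) w)\<^sup>2) \<partial>P) \<le> ennreal C"
    by (rule truncated_near_bound[OF U]) blast
  have bd: "(\<integral>\<^sup>+ w. ennreal ((max 0 (U (near_stop k w) w - real_of_ereal (Y (near_stop k w) w)))\<^sup>2) \<partial>P) \<le> ennreal C" for k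
  proof (rule order_trans[OF nn_integral_mono_AE C(2)[of k]], use nonneg in eventually_elim)
    case (elim w)
    then have "0 \<le> real_of_ereal (Y (near_stop k w) w)" using near_stop_bounds(1) by (intro real_of_ereal_pos) blast
    then have "max 0 (U (near_stop k w) w - real_of_ereal (Y (near_stop k w) w)) \<le> \<bar>U (near_stop k w) w\<bar>" by linarith
    then have "(max 0 (U (near_stop k w) w - real_of_ereal (Y (near_stop k w) w)))\<^sup>2 \<le> \<bar>U (near_stop k w) w\<bar>\<^sup>2"
      by (intro power_mono) auto
    then show ?case by (intro ennreal_leI) simp
  qed
  have "AE w in P. ((\<lambda>t. Y t w) \<longlongrightarrow> \<xi> w) (at (enn2real (\<tau> w)) within {0..<enn2real (\<tau> w)})"
    unfolding AE_completion_iff by (rule singular_solutionD(5)[OF sing])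
  then have lim: "AE w in P. (\<lambda>k. max 0 (U (near_stop k w) w - real_of_ereal (Y (near_stop k w) w))) \<longlonglongrightarrow> 0"
    using truncated_terminal[OF U] near_stop_exit singular_finite[OF sing]
  proof eventually_elim
    case (elim w)
    obtain c where c: "(\<lambda>k. U (near_stop k w) w) \<longlonglongrightarrow> c" "ereal c = min (\<xi> w) (ereal (real n))" using elim(2) by blast
    obtain s where s: "0 < s" "\<tau> w = ennreal s" "\<And>k. near_stop k w < s" "(\<lambda>k. near_stop k w) \<longlonglongrightarrow> s" using elim(3) by blast
    \<comment> \<open>The terminal limit is taken within \<open>{0..<s}\<close>, so the
      approximating times must stay strictly below \<open>s\<close>.\<close>
    have fl: "filterlim (\<lambda>k. near_stop k w) (at s within {0..<s}) sequentially"
      unfolding filterlim_at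
    proof (intro conjI always_eventually allI s(4))
      show "near_stop k w \<in> {0..<s}" "near_stop k w \<noteq> s" for k
        using s(3)[of k] near_stop_bounds(1)[of k w] by auto
    qed
    have es: "enn2real (\<tau> w) = s" using s by simp
    have "((\<lambda>t. Y t w) \<longlongrightarrow> \<xi> w) (at s within {0..<s})" using elim(1) unfolding es .
    then have "(\<lambda>k. Y (near_stop k w) w) \<longlonglongrightarrow> \<xi> w" by (rule filterlim_compose[OF _ fl])
    then show ?case
    proof (rule tendsto_excess_zero[OF c(1)])
      show "ereal c \<le> \<xi> w" unfolding c(2) by (rule min.cobounded1)
      have "near_stop k w \<in> {0..near_stop k w}" for k using near_stop_bounds(1)[of k w] by simp
      from elim(4)[rule_format, OF this] show "\<bar>Y (near_stop k w) w\<bar> \<noteq> \<infinity>" for k .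
    qed
  qed
  have "AE w in M. \<forall>t\<ge>0. \<tau> w \<le> ennreal t \<longrightarrow> ereal (U t w) = min (\<xi> w) (ereal (real n)) \<and> ZU t w = 0"
    using U unfolding truncated_solution_def by blast
  with singular_solutionD(4)[OF sing] have "AE w in M. \<forall>t\<ge>0. \<tau> w \<le> ennreal t \<longrightarrow> ereal (U t w) \<le> Y t w"
    by eventually_elim simp
  then have after: "AE w in P. \<forall>t\<ge>0. \<tau> w \<le> ennreal t \<longrightarrow> ereal (U t w) \<le> Y t w" unfolding AE_completion_iff .
  show ?thesis
    using local_solution_comparison[OF mono_mult_abs_powr[OF q] lU lY C(1) bd lim] after near_stop_exit singular_finite[OF sing]
  proof eventually_elim
    case (elim w)
    obtain s where s: "0 < s" "\<tau> w = ennreal s" "\<forall>r<s. eventually (\<lambda>k. r < near_stop k w) sequentially" using elim(3) by blast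
    show ?case
    proof (intro allI impI)
      fix t :: real assume t: "0 \<le> t"
      show "ereal (U t w) \<le> Y t w"
      proof (cases "t < s")
        case True
        then obtain k where "t < near_stop k w" using s(3) eventually_happens[of "\<lambda>k. t < near_stop k w" sequentially] by auto
        then have "t \<in> {0..near_stop k w}" using t by simp
        from elim(4)[rule_format, OF this] have "\<bar>Y t w\<bar> \<noteq> \<infinity>" .
        moreover have "U t w \<le> real_of_ereal (Y t w)" using elim(1) s(3) t True by blast
        ultimately show ?thesis by (cases "Y t w") auto
      next
        case False
        then have "\<tau> w \<le> ennreal t" unfolding s(2) by (intro ennreal_leI) simp
        then show ?thesis using elim(2) t by blast
      qed
    qed
  qed
qed

text \<open>The equations are given for \<open>n \<ge> 1\<close>, hence the shift by one;
  \<open>lim\<close> is then the supremum of an increasing sequence.\<close>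

lemma minimal_candidate_le:
  assumes q: "0 < q" and tr: "\<And>n. 1 \<le> n \<Longrightarrow> truncated_solution M B q \<beta> \<tau> \<xi> n (Yn n) (Zn n)"
    and sing: "singular_solution M B q (near_time D X) \<tau> \<xi> Y Z" and nonneg: "AE w in P. \<forall>t\<ge>0. 0 \<le> Y t w"
  shows "AE w in P. \<forall>t\<ge>0. minimal_candidate Yn t w \<le> Y t w"
proof -
  have "AE w in P. \<forall>n. \<forall>t\<ge>0. Yn (Suc n) t w \<le> Yn (Suc (Suc n)) t w"
    unfolding AE_all_countable by (intro allI truncated_mono[OF q _ tr tr]) auto
  moreover have "AE w in P. \<forall>n. \<forall>t\<ge>0. ereal (Yn (Suc n) t w) \<le> Y t w"
    unfolding AE_all_countable by (intro allI truncated_le_singular[OF q tr sing nonneg]) auto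
  ultimately show ?thesis
  proof eventually_elim
    case (elim w)
    show ?case
    proof (intro allI impI)
      fix t :: real assume t: "0 \<le> t"
      have "incseq (\<lambda>n. ereal (Yn (Suc n) t w))" using elim(1) t by (intro incseq_SucI) simp
      then have "(\<lambda>n. ereal (Yn (Suc n) t w)) \<longlonglongrightarrow> (SUP n. ereal (Yn (Suc n) t w))" by (rule LIMSEQ_SUP)
      then have "(\<lambda>n. ereal (Yn n t w)) \<longlonglongrightarrow> (SUP n. ereal (Yn (Suc n) t w))" by (rule LIMSEQ_imp_Suc)
      then have "minimal_candidate Yn t w = (SUP n. ereal (Yn (Suc n) t w))" unfolding minimal_candidate_def by (rule limI)
      also have "\<dots> \<le> Y t w" using elim(2) t by (intro SUP_least) blast
      finally show "minimal_candidate Yn t w \<le> Y t w" .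
    qed
  qed
qed

end

theorem theorem7:
  fixes M :: "'w measure"
    and B :: "real \<Rightarrow> 'w \<Rightarrow> real ^ 'd"
    and D :: "(real ^ 'd) set"
    and b :: "real ^ 'd \<Rightarrow> real ^ 'd"
    and \<sigma> :: "real ^ 'd \<Rightarrow> real ^ 'd ^ 'd"
    and X :: "real ^ 'd \<Rightarrow> real \<Rightarrow> 'w \<Rightarrow> real ^ 'd"
    and \<xi> :: "'w \<Rightarrow> ereal"
    and \<tau> :: "'w \<Rightarrow> ennreal"
    and q K \<alpha> \<beta> :: real
    and x :: "real ^ 'd"
    and Yn :: "nat \<Rightarrow> real \<Rightarrow> 'w \<Rightarrow> real"
    and Zn :: "nat \<Rightarrow> real \<Rightarrow> 'w \<Rightarrow> real ^ 'd"
    and Ybar :: "real \<Rightarrow> 'w \<Rightarrow> ereal"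
    and Zbar :: "real \<Rightarrow> 'w \<Rightarrow> real ^ 'd"
  assumes "prob_space M" and "brownian_motion M B"
    and "q > 0"
    and "open D" and "bounded D" and "C2_boundary D"
    and "b \<in> borel_measurable borel" and "\<sigma> \<in> borel_measurable borel"
    and "K \<ge> 0" and "\<alpha> > 0"
    and "\<And>y z. norm (\<sigma> y - \<sigma> z) \<le> K * norm (y - z)"
    and "\<And>y. norm (b y) + norm (\<sigma> y) \<le> K"
    and "\<And>y v. v \<bullet> ((\<sigma> y ** transpose (\<sigma> y)) *v v) \<ge> \<alpha> * (v \<bullet> v)"
    and "\<And>z. strong_solution M B b \<sigma> z (X z)"
    and "\<beta> > 0"
    and "(SUP z\<in>closure D. \<integral>\<^sup>+ w. exp_time \<beta> (exit_time D (X z) w) \<partial>M) < \<infinity>"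
    and "x \<in> D"
    and "\<tau> = exit_time D (X x)"
    and "\<xi> \<in> borel_measurable (filtration.pre_sigma (space M) (aug_filtration M B) \<tau>)"
    and "\<And>w. w \<in> space M \<Longrightarrow> 0 \<le> \<xi> w"
    and "emeasure (completion M) {w \<in> space M. \<xi> w = \<infinity>} > 0"
    and "\<And>n. n \<ge> 1 \<Longrightarrow> truncated_solution M B q \<beta> \<tau> \<xi> n (Yn n) (Zn n)"
    and "singular_solution M B q (near_time D (X x)) \<tau> \<xi> Ybar Zbar"
    and "AE w in M. \<forall>t\<ge>0. 0 \<le> Ybar t w"
  shows "AE w in M. \<forall>t\<ge>0. minimal_candidate Yn t w \<le> Ybar t w"
proof -
  have br: "brownian M B" using assms(1,2) by (simp add: brownian_def)
  obtain J where J: "\<And>i. ito_integral M B (\<lambda>r w. \<sigma> (X x r w) $ i) (\<lambda>t w. J t w $ i)"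
    "AE w in M. \<forall>t\<ge>0. set_integrable lborel {0..t} (\<lambda>r. b (X x r w)) \<and>
           X x t w = x + (LINT r:{0..t}|lborel. b (X x r w)) + J t w"
    using assms(14)[of x] unfolding strong_solution_def by blast
  have Xx: "progressively_measurable (aug_filtration M B) (X x)" "AE w in M. continuous_on {0..} (\<lambda>t. X x t w)"
    using assms(14)[of x] unfolding strong_solution_def by blast+
  interpret br: brownian M B by (rule br)
  have bound: "norm (b y) \<le> K" "norm (\<sigma> y) \<le> K" for y
    using assms(12)[of y] norm_ge_zero[of "b y"] norm_ge_zero[of "\<sigma> y"] by linarith+
  have "x \<in> closure D" using assms(17) closure_subset by blast
  then have "(\<integral>\<^sup>+ w. exp_time \<beta> (exit_time D (X x) w) \<partial>M) \<le> (SUP z\<in>closure D. \<integral>\<^sup>+ w. exp_time \<beta> (exit_time D (X z) w) \<partial>M)"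
    by (rule SUP_upper)
  then have moment: "(\<integral>\<^sup>+ w. exp_time \<beta> (exit_time D (X x) w) \<partial>completion M) < \<infinity>"
    using assms(16) unfolding nn_integral_completion by (rule le_less_trans)
  interpret exit_problem M B D b \<sigma> K \<alpha> x "X x" J \<beta>
    by unfold_locales
      (use assms(4-6,9,10,13,15,17) bound Xx J moment in \<open>simp_all add: AE_completion_iff\<close>)
  have "AE w in completion M. \<forall>t\<ge>0. minimal_candidate Yn t w \<le> Ybar t w"
    by (rule minimal_candidate_le[OF assms(3)])
      (use assms(22-24) in \<open>simp_all add: assms(18) AE_completion_iff\<close>)
  then show ?thesis unfolding AE_completion_iff .
qed

end
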